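(* Let $\eta:\mathbb R\to(0,\infty)$ be a fixed, smooth, strictly increasing, uniformly Lipschitz and bijective function, and assume that $\rho_0=\eta\circ w_0$ for some $w_0\in C^\beta([0,1]^d)$, $\beta>0$. Consider data $D^{(n)}\sim P^{(n)}_{\rho_0}$, with $Z$ a stationary random field with values in $[0,1]^d$. Let the prior $\Pi$ be the law of $\rho_W:=\eta\circ W$, with $W$ the hierarchical Gaussian wavelet expansion $$W(z):=\sum_{l=1}^{L}\sum_{k=1}^{2^{ld}}g_{lk}\psi_{lk}(z),\quad z\in[0,1]^d,\qquad g_{lk}\overset{\mathrm{iid}}{\sim}N(0,1),$$ $$L\sim\Pi_L,\qquad \Pi_L(L=l)\propto e^{-C_L2^{ld}l},\qquad C_L>0.$$ Set $\epsilon_n=n^{-\beta/(2\beta+d)}\log n$. Then, for all sufficiently large $M>0$, as $n\to\infty$, $$E^{(n)}_{\rho_0}\left[\Pi\left(\rho:\ \frac1n\|\lambda^{(n)}_\rho-\lambda^{(n)}_{\rho_0}\|_{L^1(\mathcal W_n)}>M\epsilon_n\,\Big|\,D^{(n)}\right)\right]\to0.$$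
   Context: Observation model. Let $D,d\in\mathbb N$ and $\mathcal Z=[0,1]^d$. $Z=(Z(x),\,x\in\mathbb R^D)$ is a jointly measurable $\mathcal Z$-valued random field, stationary with invariant distribution $\nu$. $(\mathcal W_n)_{n\ge1}$ are nonempty compact sets with $\mathcal W_n\subseteq\mathcal W_{n+1}\subset\mathbb R^D$ and, by convention, $\mathrm{vol}(\mathcal W_n)=n$. $Z^{(n)}:=(Z(x),\,x\in\mathcal W_n)$. For measurable bounded $\rho:\mathcal Z\to[0,\infty)$ let $\lambda_\rho^{(n)}(x):=\rho(Z(x))$, $x\in\mathcal W_n$. $P^{(n)}_\rho$ (with expectation $E^{(n)}_\rho$) is the joint law of $D^{(n)}=(N^{(n)},Z^{(n)})$, where conditionally on $Z^{(n)}$, $N^{(n)}$ is an inhomogeneous Poisson point process on $\mathcal W_n$ with intensity $\lambda^{(n)}_\rho$. Likelihood: $L_n(\rho)=\exp\{\int_{\mathcal W_n}\log(\rho(Z(x)))\,dN^{(n)}(x)-\int_{\mathcal W_n}\rho(Z(x))\,dx\}$ (up to a factor not depending on $\rho$); the posterior is $\Pi(A|D^{(n)})=\int_AL_n\,d\Pi/\int L_n\,d\Pi$. $(\psi_{lk},\ l\ge1,\ k=1,\dots,2^{ld})$ is an orthonormal tensor product wavelet basis of $L^2([0,1]^d)$, formed by $S$-regular (with $S\in\mathbb N$ sufficiently large) compactly supported and boundary-corrected Daubechies wavelets. $C^\beta$ denotes the usual Hölder space. *)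

theory Defs
  imports "HOL-Probability.Probability"
begin

section \<open>Hoelder spaces on the unit cube\<close>

(* The cube [0,1]^d is cbox 0 1 in real^'d. Derivatives are taken within the closed cube, where
   they are unique; f' i is the i-th partial derivative. *)
primrec holder_smooth :: "nat \<Rightarrow> real \<Rightarrow> (real^'d \<Rightarrow> real) \<Rightarrow> bool" where
  "holder_smooth 0 s f \<longleftrightarrow>
     continuous_on (cbox 0 1) f \<and>
     (\<exists>B. \<forall>x\<in>cbox 0 1. \<forall>y\<in>cbox 0 1. \<bar>f x - f y\<bar> \<le> B * norm (x - y) powr s)"
| "holder_smooth (Suc m) s f \<longleftrightarrow>
     (\<exists>f' :: 'd \<Rightarrow> real^'d \<Rightarrow> real.
        (\<forall>x\<in>cbox 0 1. (f has_derivative (\<lambda>v. \<Sum>i\<in>UNIV. v $ i * f' i x)) (at x within cbox 0 1)) \<and>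
        (\<forall>i. holder_smooth m s (f' i)))"

(* For integer b this is the classical space of b times continuously differentiable functions. *)
definition holder_space :: "real \<Rightarrow> (real^'d \<Rightarrow> real) set" where
  "holder_space b = {f. holder_smooth (nat \<lfloor>b\<rfloor>) (b - of_int \<lfloor>b\<rfloor>) f}"


section \<open>Boundary-corrected Daubechies wavelets\<close>

definition C_times :: "nat \<Rightarrow> (real \<Rightarrow> real) \<Rightarrow> bool" where
  "C_times S f \<longleftrightarrow>
     (\<forall>k<S. \<forall>x. (deriv ^^ k) f differentiable at x) \<and> continuous_on UNIV ((deriv ^^ S) f)"

(* A compactly supported Daubechies scaling function phi with N vanishing moments, in the
   normalisation of Cohen, Daubechies and Vial: the filter h lives on {1-N..N}. Every spectral
   factor (extremal phase, least asymmetric, ...) is admitted. *)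
definition daubechies_scaling :: "nat \<Rightarrow> (int \<Rightarrow> real) \<Rightarrow> (real \<Rightarrow> real) \<Rightarrow> bool" where
  "daubechies_scaling N h \<phi> \<longleftrightarrow>
     N \<ge> 1 \<and>
     (\<forall>n. n \<notin> {1 - int N..int N} \<longrightarrow> h n = 0) \<and>
     (\<Sum>n\<in>{1 - int N..int N}. h n) = sqrt 2 \<and>
     (\<forall>k. (\<Sum>n\<in>{1 - int N..int N}. h n * h (n + 2 * k)) = (if k = 0 then 1 else 0)) \<and>
     (\<forall>p<N. (\<Sum>n\<in>{1 - int N..int N}. (-1) powi n * of_int n ^ p * h n) = 0) \<and>
     continuous_on UNIV \<phi> \<and>
     (\<forall>x. \<phi> x \<noteq> 0 \<longrightarrow> x \<in> {1 - real N..real N}) \<and>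
     (LINT x|lborel. \<phi> x) = 1 \<and>
     (\<forall>x. \<phi> x = sqrt 2 * (\<Sum>n\<in>{1 - int N..int N}. h n * \<phi> (2 * x - of_int n))) \<and>
     (\<forall>m :: int. (LINT x|lborel. \<phi> x * \<phi> (x - of_int m)) = (if m = 0 then 1 else 0))"

definition daubechies_wavelet :: "nat \<Rightarrow> (int \<Rightarrow> real) \<Rightarrow> (real \<Rightarrow> real) \<Rightarrow> real \<Rightarrow> real" where
  "daubechies_wavelet N h \<phi> x =
     sqrt 2 * (\<Sum>n\<in>{1 - int N..int N}. (-1) powi n * h (1 - n) * \<phi> (2 * x - of_int n))"

definition halfline_orthonormal :: "nat \<Rightarrow> (nat \<Rightarrow> real \<Rightarrow> real) \<Rightarrow> bool" where
  "halfline_orthonormal N f \<longleftrightarrow>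
     (\<forall>i<N. \<forall>k<N. (LINT x:{0..}|lborel. f i x * f k x) = (if i = k then 1 else 0))"

(* Boundary functions of Cohen, Daubechies and Vial on the half-line [0,oo).
   phiE 0, ..., phiE (N-1) orthonormalise the polynomial combinations
     sum_{n=k}^{2N-2} (n choose k) phi(x + n - N + 1),  k < N,
   of translates of phi; together with phi(. - m), m >= N, they span the restricted scaling space V_0.
   psiE 0, ..., psiE (N-1) complete psi(. - m), m >= N, to the orthogonal complement of V_0 in V_1.
   (Elements of that complement orthogonal to all psi(. - m), m >= N, have no component along
   phi(2 . - m) for m > 3N-2, whence the finite range below.)
   Both families are determined up to an orthogonal N x N matrix. *)
definition cdv_boundary ::
  "nat \<Rightarrow> (real \<Rightarrow> real) \<Rightarrow> (real \<Rightarrow> real) \<Rightarrow> (nat \<Rightarrow> real \<Rightarrow> real) \<Rightarrow> (nat \<Rightarrow> real \<Rightarrow> real) \<Rightarrow> bool"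
where
  "cdv_boundary N \<phi> \<psi> \<phi>E \<psi>E \<longleftrightarrow>
     (\<forall>i<N. \<exists>a :: nat \<Rightarrow> real. \<forall>x\<ge>0. \<phi>E i x =
        (\<Sum>k<N. a k * (\<Sum>n = k..2 * N - 2. real (n choose k) * \<phi> (x + real n - real N + 1)))) \<and>
     halfline_orthonormal N \<phi>E \<and>
     (\<forall>i<N. \<exists>a b :: nat \<Rightarrow> real. \<forall>x\<ge>0. \<psi>E i x =
        (\<Sum>k<N. a k * \<phi>E k (2 * x)) + (\<Sum>m = N..3 * N - 2. b m * \<phi> (2 * x - real m))) \<and>
     halfline_orthonormal N \<psi>E \<and>
     (\<forall>i<N. \<forall>k<N. (LINT x:{0..}|lborel. \<psi>E i x * \<phi>E k x) = 0) \<and>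
     (\<forall>i<N. \<forall>m\<ge>N. (LINT x:{0..}|lborel. \<psi>E i x * \<phi> (x - real m)) = 0 \<and>
                   (LINT x:{0..}|lborel. \<psi>E i x * \<psi> (x - real m)) = 0)"

(* Level-j function number k < 2^j on [0,1]: N boundary functions at each end, interior translates
   otherwise. The right boundary functions live on the half-line in the variable 1 - x. *)
definition interval_fun ::
  "nat \<Rightarrow> (real \<Rightarrow> real) \<Rightarrow> (nat \<Rightarrow> real \<Rightarrow> real) \<Rightarrow> (nat \<Rightarrow> real \<Rightarrow> real) \<Rightarrow> nat \<Rightarrow> nat \<Rightarrow> real \<Rightarrow> real"
where
  "interval_fun N f fL fR j k x = sqrt (2 ^ j) *
     (if k < N then fL k (2 ^ j * x)
      else if k < 2 ^ j - N then f (2 ^ j * x - real k)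
      else fR (2 ^ j - 1 - k) (2 ^ j * (1 - x)))"

(* Tensor product wavelets on the cube are indexed by (j, e, k): level, type and location.
   e i says whether coordinate i carries a wavelet or a scaling function; the pure scaling type
   occurs at the coarsest level J only. *)
definition tensor_index :: "nat \<Rightarrow> (nat \<times> ('d \<Rightarrow> bool) \<times> ('d \<Rightarrow> nat)) set" where
  "tensor_index J = {(j, e, k). J \<le> j \<and> (j = J \<or> (\<exists>i. e i)) \<and> (\<forall>i. k i < 2 ^ j)}"

(* smallest j such that the function belongs to the tensor product scaling space V_j *)
fun tensor_resolution :: "nat \<times> ('d \<Rightarrow> bool) \<times> ('d \<Rightarrow> nat) \<Rightarrow> nat" where
  "tensor_resolution (j, e, k) = (if \<exists>i. e i then Suc j else j)"

fun tensor_fun ::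
  "(nat \<Rightarrow> nat \<Rightarrow> real \<Rightarrow> real) \<Rightarrow> (nat \<Rightarrow> nat \<Rightarrow> real \<Rightarrow> real)
     \<Rightarrow> nat \<times> ('d::finite \<Rightarrow> bool) \<times> ('d \<Rightarrow> nat) \<Rightarrow> real^'d \<Rightarrow> real" where
  "tensor_fun scal wav (j, e, k) z = (\<Prod>i\<in>UNIV. (if e i then wav else scal) j (k i) (z $ i))"

definition level_index :: "nat \<Rightarrow> (nat \<times> nat) set" where
  "level_index d = {(l, k). 1 \<le> l \<and> k \<in> {1..2 ^ (l * d)}}"

definition cube_orthonormal_basis :: "(nat \<Rightarrow> nat \<Rightarrow> real^'d \<Rightarrow> real) \<Rightarrow> bool" where
  "cube_orthonormal_basis \<psi> \<longleftrightarrow>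
     (\<forall>(l, k)\<in>level_index CARD('d).
        set_borel_measurable lborel (cbox 0 1) (\<psi> l k) \<and>
        set_integrable lborel (cbox 0 1) (\<lambda>z. (\<psi> l k z)\<^sup>2)) \<and>
     (\<forall>(l, k)\<in>level_index CARD('d). \<forall>(l', k')\<in>level_index CARD('d).
        (LINT z:cbox 0 1|lborel. \<psi> l k z * \<psi> l' k' z) = (if (l, k) = (l', k') then 1 else 0)) \<and>
     (\<forall>f. set_borel_measurable lborel (cbox 0 1) f \<longrightarrow>
          set_integrable lborel (cbox 0 1) (\<lambda>z. (f z)\<^sup>2) \<longrightarrow>
        (\<forall>\<epsilon>>0. \<exists>I c. finite I \<and> I \<subseteq> level_index CARD('d) \<and>
           (LINT z:cbox 0 1|lborel. (f z - (\<Sum>(l, k)\<in>I. c l k * \<psi> l k z))\<^sup>2) < \<epsilon>))"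

(* S-regular: S times continuously differentiable with (at least) S vanishing moments.
   The numbering (l, k), 1 <= k <= 2^(l d), enumerates the tensor product basis by nondecreasing
   resolution (at a given level there are really (2^d - 1) 2^(j d) wavelets); it satisfies
   V_l <= span {psi l' k | l' <= l} <= V_(l+1) for l >= J.
   Values of psi l k outside the cube are irrelevant and left unspecified. *)
definition daubechies_tensor_basis :: "nat \<Rightarrow> (nat \<Rightarrow> nat \<Rightarrow> real^'d \<Rightarrow> real) \<Rightarrow> bool" where
  "daubechies_tensor_basis S \<psi> \<longleftrightarrow>
     cube_orthonormal_basis \<psi> \<and>
     (\<exists>N h \<phi> \<phi>L \<psi>L \<phi>R \<psi>R J \<iota>.
        let w = daubechies_wavelet N h \<phi> in
        daubechies_scaling N h \<phi> \<and> S \<le> N \<and> C_times S \<phi> \<and>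
        cdv_boundary N \<phi> w \<phi>L \<psi>L \<and>
        cdv_boundary N (\<lambda>x. \<phi> (1 - x)) (\<lambda>x. w (1 - x)) \<phi>R \<psi>R \<and>
        2 * N \<le> 2 ^ J \<and>
        bij_betw \<iota> (level_index CARD('d)) (tensor_index J) \<and>
        (\<forall>p\<in>level_index CARD('d). \<forall>q\<in>level_index CARD('d).
           fst p < fst q \<longrightarrow> tensor_resolution (\<iota> p) \<le> tensor_resolution (\<iota> q)) \<and>
        (\<forall>(l, k)\<in>level_index CARD('d). \<forall>z\<in>cbox 0 1.
           \<psi> l k z = tensor_fun (interval_fun N \<phi> \<phi>L \<phi>R) (interval_fun N w \<psi>L \<psi>R) (\<iota> (l, k)) z))"


section \<open>Observation model\<close>

(* Z \<omega> x is the covariate at location x; the sample space M carries the (jointly measurable) field. *)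
definition stationary_field ::
  "'w measure \<Rightarrow> ('w \<Rightarrow> real^'D \<Rightarrow> real^'d) \<Rightarrow> (real^'d) measure \<Rightarrow> bool" where
  "stationary_field M Z \<nu> \<longleftrightarrow>
     prob_space M \<and>
     (\<lambda>(\<omega>, x). Z \<omega> x) \<in> borel_measurable (M \<Otimes>\<^sub>M borel) \<and>
     (\<forall>\<omega>\<in>space M. \<forall>x. Z \<omega> x \<in> cbox 0 1) \<and>
     (\<forall>I v. finite I \<longrightarrow>
        distr M (Pi\<^sub>M I (\<lambda>_. borel)) (\<lambda>\<omega>. \<lambda>x\<in>I. Z \<omega> (x + v)) =
        distr M (Pi\<^sub>M I (\<lambda>_. borel)) (\<lambda>\<omega>. \<lambda>x\<in>I. Z \<omega> x)) \<and>
     (\<forall>x. distr M borel (\<lambda>\<omega>. Z \<omega> x) = \<nu>)"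

definition observation_windows :: "(nat \<Rightarrow> (real^'D) set) \<Rightarrow> bool" where
  "observation_windows W \<longleftrightarrow>
     (\<forall>n\<ge>1. W n \<noteq> {} \<and> compact (W n) \<and> W n \<subseteq> W (Suc n) \<and> measure lborel (W n) = real n)"

(* Realisations of a finite point process are finite multisets of points. *)
definition point_count :: "'a set \<Rightarrow> 'a multiset \<Rightarrow> nat" where
  "point_count B N = size (filter_mset (\<lambda>x. x \<in> B) N)"

definition point_configs :: "'a::topological_space multiset measure" where
  "point_configs = sigma UNIV {{N. point_count B N = k} | B k. B \<in> sets borel}"

(* Q is the law of a Poisson point process on A with intensity function lam. *)
definition poisson_process ::
  "'a::euclidean_space set \<Rightarrow> ('a \<Rightarrow> real) \<Rightarrow> 'a multiset measure \<Rightarrow> bool" where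
  "poisson_process A lam Q \<longleftrightarrow>
     prob_space Q \<and> sets Q = sets point_configs \<and>
     (\<forall>B\<in>sets borel. \<forall>k. let m = (LINT x:A \<inter> B|lborel. lam x) in
        measure Q {N. point_count B N = k} = m ^ k / fact k * exp (- m)) \<and>
     (\<forall>r (B :: nat \<Rightarrow> 'a set). (\<forall>i<r. B i \<in> sets borel) \<longrightarrow> disjoint_family_on B {..<r} \<longrightarrow>
        prob_space.indep_vars Q (\<lambda>_. count_space UNIV) (\<lambda>i. point_count (B i)) {..<r})"

definition intensity :: "('z \<Rightarrow> real) \<Rightarrow> ('x \<Rightarrow> 'z) \<Rightarrow> 'x \<Rightarrow> real" where
  "intensity \<rho> z x = \<rho> (z x)"

(* P is the joint law of the data (N, Z): Z has its given law, and conditionally on Z the points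
   are a Poisson process on A with intensity rho(Z(x)). The field is recorded through the sample
   point \<omega>, which determines the path Z \<omega>; K is the conditional law of N. *)
definition data_law ::
  "'w measure \<Rightarrow> ('w \<Rightarrow> real^'D \<Rightarrow> real^'d) \<Rightarrow> (real^'D) set \<Rightarrow> (real^'d \<Rightarrow> real)
     \<Rightarrow> ((real^'D) multiset \<times> 'w) measure \<Rightarrow> bool" where
  "data_law M Z A \<rho> P \<longleftrightarrow>
     (\<exists>K \<in> measurable M (prob_algebra point_configs).
        (\<forall>\<omega>\<in>space M. poisson_process A (intensity \<rho> (Z \<omega>)) (K \<omega>)) \<and>
        P = bind M (\<lambda>\<omega>. distr (K \<omega>) (point_configs \<Otimes>\<^sub>M M) (\<lambda>N. (N, \<omega>))))"

(* Only used for strictly positive rho, so that ln is the genuine logarithm. *)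
definition likelihood ::
  "(real^'D) set \<Rightarrow> (real^'D) multiset \<Rightarrow> (real^'D \<Rightarrow> real^'d) \<Rightarrow> (real^'d \<Rightarrow> real) \<Rightarrow> real" where
  "likelihood A N z \<rho> = exp ((\<Sum>x\<in>#N. ln (\<rho> (z x))) - (LINT x:A|lborel. \<rho> (z x)))"

definition posterior ::
  "(real^'d \<Rightarrow> real) measure \<Rightarrow> (real^'D) set \<Rightarrow> (real^'D) multiset \<Rightarrow> (real^'D \<Rightarrow> real^'d)
     \<Rightarrow> (real^'d \<Rightarrow> real) set \<Rightarrow> real" where
  "posterior Q A N z E =
     (LINT \<rho>:E|Q. likelihood A N z \<rho>) / (LINT \<rho>|Q. likelihood A N z \<rho>)"


section \<open>Hierarchical Gaussian wavelet prior\<close>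

definition link_function :: "(real \<Rightarrow> real) \<Rightarrow> bool" where
  "link_function \<eta> \<longleftrightarrow>
     (\<forall>k x. (deriv ^^ k) \<eta> differentiable at x) \<and>
     strict_mono \<eta> \<and> (\<exists>B. B-lipschitz_on UNIV \<eta>) \<and> bij_betw \<eta> UNIV {0<..}"

definition level_weight :: "nat \<Rightarrow> real \<Rightarrow> nat \<Rightarrow> real" where
  "level_weight d C l = (if l \<ge> 1 then exp (- C * 2 ^ (l * d) * real l) else 0)"

definition level_prior :: "nat \<Rightarrow> real \<Rightarrow> nat measure" where
  "level_prior d C =
     density (count_space UNIV) (\<lambda>l. ennreal (level_weight d C l / (\<Sum>l'. level_weight d C l')))"

(* joint law of the truncation level L and the i.i.d. N(0,1) coefficients, L independent of g *)
definition prior_params :: "nat \<Rightarrow> real \<Rightarrow> (nat \<times> (nat \<times> nat \<Rightarrow> real)) measure" where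
  "prior_params d C =
     level_prior d C \<Otimes>\<^sub>M Pi\<^sub>M UNIV (\<lambda>_. density lborel (\<lambda>t. ennreal (std_normal_density t)))"

fun wavelet_series ::
  "(nat \<Rightarrow> nat \<Rightarrow> real^'d \<Rightarrow> real) \<Rightarrow> nat \<times> (nat \<times> nat \<Rightarrow> real) \<Rightarrow> real^'d \<Rightarrow> real" where
  "wavelet_series \<psi> (L, g) z = (\<Sum>l = 1..L. \<Sum>k = 1..2 ^ (l * CARD('d)). g (l, k) * \<psi> l k z)"

(* The law of f under M on the largest sigma-algebra making f measurable; it extends the law of f
   on any sigma-algebra for which f is measurable. *)
definition full_law :: "'p measure \<Rightarrow> ('p \<Rightarrow> 'q) \<Rightarrow> 'q measure" where
  "full_law M f = distr M (sigma UNIV {E. f -` E \<inter> space M \<in> sets M}) f"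

definition wavelet_prior ::
  "(real \<Rightarrow> real) \<Rightarrow> real \<Rightarrow> (nat \<Rightarrow> nat \<Rightarrow> real^'d \<Rightarrow> real) \<Rightarrow> (real^'d \<Rightarrow> real) measure" where
  "wavelet_prior \<eta> C \<psi> = full_law (prior_params CARD('d) C) (\<lambda>p. \<eta> \<circ> wavelet_series \<psi> p)"

lemma sets_full_law: "sets (full_law M f) = {E. f -` E \<inter> space M \<in> sets M}"
proof -
  have "sigma_algebra UNIV {E. f -` E \<inter> space M \<in> sets M}"
    unfolding sigma_algebra_iff2
  proof (intro conjI ballI allI impI)
    fix E assume "E \<in> {E. f -` E \<inter> space M \<in> sets M}"
    moreover have "f -` (UNIV - E) \<inter> space M = space M - (f -` E \<inter> space M)" by auto
    ultimately show "UNIV - E \<in> {E. f -` E \<inter> space M \<in> sets M}" by auto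
  next
    fix E :: "nat \<Rightarrow> _" assume *: "range E \<subseteq> {E. f -` E \<inter> space M \<in> sets M}"
    have "(\<Union>i. f -` E i \<inter> space M) \<in> sets M"
      using * by (intro sets.countable_UN) auto
    moreover have "f -` (\<Union>i. E i) \<inter> space M = (\<Union>i. f -` E i \<inter> space M)" by auto
    ultimately show "(\<Union>i. E i) \<in> {E. f -` E \<inter> space M \<in> sets M}"
      by (simp only: mem_Collect_eq)
  qed auto
  then show ?thesis
    by (simp add: full_law_def sigma_algebra.sigma_sets_eq)
qed

end

theory Submission
  imports Defs "HOL-Computational_Algebra.Polynomial" "HOL-Real_Asymp.Real_Asymp"
begin

text \<open>
If two intensities are far apart in \<open>L\<^sup>1\<close>, then the integral of their difference over one of the two sets where
one exceeds the other is at least half of the distance. Letting one of the two intensities range over a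
finite net of a sieve, the part of the sieve far from the truth is separated from it by the numbers of
points in finitely many sets, and these obey Chernoff bounds under every intensity, in place of
abstract tests. The numerator of the posterior is thus small except outside the sieve, where the prior
mass is exponentially small; the denominator is bounded below through the prior mass of a supremum norm
ball around the truth. Every bound is uniform in the path of the covariates.

The mass of the ball comes from the approximation of \<open>w\<^sub>0\<close> at level \<open>l\<close> with error of order
\<open>2 powr (- \<beta> * l)\<close> and bounded coefficients. The vanishing moments of the filter let the translates of the scaling
function reproduce polynomials, also at the boundary, so that the wavelets are orthogonal to polynomials
and the wavelet coefficients of a Hoelder function decay; the partial sums then converge uniformly, and
their limit is the function because the basis is complete.
\<close>

section \<open>Polynomial reproduction by a refinable function\<close>

text \<open>The separation of intensities has to work conditionally on the path, along which
  intensities that differ on the cube may coincide; hence counts in subsets of the window, which see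
  the \<open>L^1\<close> distance along the path itself. Every likelihood is divided by its value at
  the truth. A single inequality for exponential moments of sums over Poisson points then controls
  the mean of this ratio, of its inverse, and of its product with an exponential of a count.

  The logarithm in the rate has this origin. With \<open>X = n powr (d / (2 * \<beta> + d))\<close>,
  the level prior leaves mass \<open>exp (- c * n * \<epsilon>\<^sup>2)\<close> beyond level
  \<open>L\<close> once \<open>2 ^ (L * d)\<close> is of order \<open>X * ln n\<close>, and each of
  these coefficients costs a further \<open>ln n\<close> in the net: together
  \<open>X * (ln n)\<^sup>2 = n * \<epsilon>\<^sup>2\<close>. The ball around the truth costs only
  order \<open>X * ln n\<close>.

  A scale \<open>j\<close> has \<open>(2 ^ d - 1) * 2 ^ (j * d)\<close> wavelets, a level
  \<open>l\<close> of the numbering \<open>2 ^ (l * d)\<close> indices. Estimates are therefore made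
  by scale and moved to the numbering by counting.\<close>

definition translate_sum :: "nat \<Rightarrow> (real \<Rightarrow> real) \<Rightarrow> (int \<Rightarrow> real) \<Rightarrow> real \<Rightarrow> real" where
  "translate_sum N \<phi> f x = (\<Sum>n\<in>{\<lfloor>x\<rfloor> - int N..\<lfloor>x\<rfloor> + int N}. f n * \<phi> (x - of_int n))"

text \<open>A sum over all integers is meant. By the support of \<phi> only finitely many terms
  differ from 0, so the window of the definition can be exchanged for any finite set that catches
  these.\<close>

lemma translate_sum_eq:
  assumes supp: "\<And>y. \<phi> y \<noteq> 0 \<Longrightarrow> y \<in> {1 - real N..real N}"
    and F: "finite F" "\<And>n. \<phi> (x - of_int n) \<noteq> 0 \<Longrightarrow> n \<in> F"
  shows "translate_sum N \<phi> f x = (\<Sum>n\<in>F. f n * \<phi> (x - of_int n))"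
proof -
  let ?I = "{\<lfloor>x\<rfloor> - int N..\<lfloor>x\<rfloor> + int N}"
  have I: "n \<in> ?I" if "\<phi> (x - of_int n) \<noteq> 0" for n
  proof -
    have "real_of_int n \<ge> x - real N" "real_of_int n \<le> x + real N - 1"
      using supp[OF that] by auto
    then show ?thesis
      by (auto; linarith)
  qed
  have "translate_sum N \<phi> f x = (\<Sum>n\<in>?I \<union> F. f n * \<phi> (x - of_int n))"
    unfolding translate_sum_def using I F by (intro sum.mono_neutral_left) auto
  also have "\<dots> = (\<Sum>n\<in>F. f n * \<phi> (x - of_int n))"
    using I F by (intro sum.mono_neutral_right) auto
  finally show ?thesis .
qed

lemma translate_sum_lincomb:
  "translate_sum N \<phi> (\<lambda>n. \<Sum>i\<in>A. c i * f i n) x = (\<Sum>i\<in>A. c i * translate_sum N \<phi> (f i) x)"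
  unfolding translate_sum_def sum_distrib_left sum_distrib_right
  by (subst sum.swap) (simp add: mult.assoc)

text \<open>Each translate is refined and the terms are regrouped by the new position
  \<open>m = 2 * n + k\<close>. For given \<open>m\<close> and \<open>k\<close> a source
  \<open>n\<close> exists only if \<open>m - k\<close> is even, whence the parity condition.\<close>

lemma translate_sum_refine:
  assumes supp: "\<And>y. \<phi> y \<noteq> 0 \<Longrightarrow> y \<in> {1 - real N..real N}"
    and ref: "\<And>x. \<phi> x = sqrt 2 * (\<Sum>n\<in>{1 - int N..int N}. h n * \<phi> (2 * x - of_int n))"
  shows "translate_sum N \<phi> f x =
    translate_sum N \<phi> (\<lambda>m. sqrt 2 * (\<Sum>k | k \<in> {1 - int N..int N} \<and> even (m - k). f ((m - k) div 2) * h k)) (2 * x)"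
proof -
  define F where "F = {\<lfloor>x\<rfloor> - int N..\<lfloor>x\<rfloor> + int N}"
  define K where "K = {1 - int N..int N}"
  define g where "g = (\<lambda>(n::int, k::int). 2 * n + k)"
  define T where "T = (\<lambda>(n::int, k::int). sqrt 2 * f n * h k * \<phi> (2 * x - of_int (2 * n + k)))"
  define G where "G = g ` (F \<times> K) \<union> {\<lfloor>2*x\<rfloor> - int N..\<lfloor>2*x\<rfloor> + int N}"
  have fin: "finite F" "finite K" "finite G" by (auto simp: F_def K_def G_def)
  have "translate_sum N \<phi> f x = (\<Sum>n\<in>F. \<Sum>k\<in>K. T (n, k))"
    unfolding translate_sum_def F_def T_def K_def
    by (subst ref) (simp add: sum_distrib_left mult_ac algebra_simps)
  also have "\<dots> = sum T (F \<times> K)" by (simp add: sum.cartesian_product)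
  also have "\<dots> = (\<Sum>m\<in>G. \<Sum>p\<in>{p \<in> F \<times> K. g p = m}. T p)"
    using fin by (subst sum.group) (auto simp: G_def)
  also have "\<dots> = (\<Sum>m\<in>G. sqrt 2 * (\<Sum>k | k \<in> K \<and> even (m - k). f ((m - k) div 2) * h k) * \<phi> (2 * x - of_int m))"
  proof (rule sum.cong[OF refl])
    fix m assume "m \<in> G"
    show "(\<Sum>p\<in>{p \<in> F \<times> K. g p = m}. T p) =
      sqrt 2 * (\<Sum>k | k \<in> K \<and> even (m - k). f ((m - k) div 2) * h k) * \<phi> (2 * x - of_int m)"
    proof (cases "\<phi> (2 * x - of_int m) = 0")
      case True
      then show ?thesis by (auto simp: T_def g_def intro!: sum.neutral)
    next
      case False
      from supp[OF this] have b: "of_int m \<ge> 2 * x - real N" "of_int m \<le> 2 * x + real N - 1" by auto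
      \<comment> \<open>No source is lost to the window: if \<open>m\<close> is seen at
        \<open>2 * x\<close>, each \<open>n = (m - k) div 2\<close> lies within \<open>N\<close> of
        \<open>x\<close>.\<close>
      have inF: "(m - k) div 2 \<in> F" if "k \<in> K" "even (m - k)" for k
      proof -
        define q where "q = (m - k) div 2"
        have "m - k = 2 * q" using that by (simp add: q_def)
        then have m: "of_int m = 2 * real_of_int q + of_int k" by linarith
        have k: "real_of_int k \<ge> 1 - real N" "real_of_int k \<le> real N" proof -
            have "1 - int N \<le> k" "k \<le> int N" using that(1) by (auto simp: K_def)
            then show "real_of_int k \<ge> 1 - real N" "real_of_int k \<le> real N" by linarith+
          qed
        from m k b have "real_of_int q \<ge> x - real N" "real_of_int q \<le> x + real N" by linarith+
        then show ?thesis unfolding q_def[symmetric] F_def by (auto; linarith)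
      qed
      have "(\<Sum>p\<in>{p \<in> F \<times> K. g p = m}. T p) =
        (\<Sum>k | k \<in> K \<and> even (m - k). sqrt 2 * f ((m - k) div 2) * h k * \<phi> (2 * x - of_int m))"
        using inF by (intro sum.reindex_bij_witness[of _ "\<lambda>k. ((m - k) div 2, k)" snd])
          (auto simp: g_def T_def)
      then show ?thesis by (simp add: sum_distrib_left sum_distrib_right mult_ac)
    qed
  qed
  also have "\<dots> = translate_sum N \<phi> (\<lambda>m. sqrt 2 * (\<Sum>k | k \<in> K \<and> even (m - k). f ((m - k) div 2) * h k)) (2 * x)"
  proof (rule translate_sum_eq[OF supp, symmetric])
    show "n \<in> G" if "\<phi> (2 * x - real_of_int n) \<noteq> 0" for n
    proof -
      have "real_of_int n \<ge> 2 * x - real N" "real_of_int n \<le> 2 * x + real N - 1"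
        using supp[OF that] by auto
      then have "n \<in> {\<lfloor>2*x\<rfloor> - int N..\<lfloor>2*x\<rfloor> + int N}" by (auto; linarith)
      then show ?thesis by (simp add: G_def)
    qed
  qed (use fin in auto)
  finally show ?thesis by (simp add: K_def)
qed

lemma abs_power_diff_le:
  fixes a b c :: real
  assumes "\<bar>a\<bar> \<le> c" "\<bar>b\<bar> \<le> c" "1 \<le> c"
  shows "\<bar>a ^ p - b ^ p\<bar> \<le> real p * c ^ p * \<bar>a - b\<bar>"
proof (induction p)
  case (Suc p)
  have "a ^ Suc p - b ^ Suc p = a * (a ^ p - b ^ p) + (a - b) * b ^ p" by (simp add: algebra_simps)
  then have "\<bar>a ^ Suc p - b ^ Suc p\<bar> \<le> \<bar>a\<bar> * \<bar>a ^ p - b ^ p\<bar> + \<bar>a - b\<bar> * \<bar>b\<bar> ^ p"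
    by (metis abs_mult abs_triangle_ineq power_abs)
  also have "\<dots> \<le> c * (real p * c ^ p * \<bar>a - b\<bar>) + \<bar>a - b\<bar> * c ^ p"
    using assms Suc by (intro add_mono mult_mono power_mono) auto
  also have "\<dots> \<le> c * (real p * c ^ p * \<bar>a - b\<bar>) + \<bar>a - b\<bar> * c ^ Suc p"
    using assms by (intro add_left_mono mult_left_mono power_increasing) auto
  also have "\<dots> = real (Suc p) * c ^ Suc p * \<bar>a - b\<bar>" by (simp add: algebra_simps)
  finally show ?case .
qed simp

lemma compact_support_bounded:
  fixes \<phi> :: "real \<Rightarrow> real"
  assumes "continuous_on UNIV \<phi>" "\<And>y. \<phi> y \<noteq> 0 \<Longrightarrow> y \<in> {a..b}"
  obtains B where "B > 0" "\<And>y. \<bar>\<phi> y\<bar> \<le> B"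
proof -
  have "compact (\<phi> ` {a..b})"
    by (intro compact_continuous_image continuous_on_subset[OF assms(1)]) auto
  then obtain B where "\<forall>y\<in>{a..b}. norm (\<phi> y) \<le> B"
    by (auto simp: bounded_iff dest!: compact_imp_bounded)
  then have "\<bar>\<phi> y\<bar> \<le> max B 1" for y
    using assms(2)[of y] by (cases "\<phi> y = 0") (auto simp: le_max_iff_disj)
  with that[of "max B 1"] show ?thesis by auto
qed

section \<open>Moments of the filter and polynomial sums of translates\<close>

context
  fixes N :: nat and h :: "int \<Rightarrow> real" and \<phi> :: "real \<Rightarrow> real"
  assumes sc: "daubechies_scaling N h \<phi>"
begin

lemma scaling_support: "\<phi> y \<noteq> 0 \<Longrightarrow> y \<in> {1 - real N..real N}"
  using sc unfolding daubechies_scaling_def by blast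

lemma scaling_order: "N \<ge> 1"
  using sc unfolding daubechies_scaling_def by blast

lemma scaling_continuous: "continuous_on A \<phi>"
  using sc unfolding daubechies_scaling_def by (blast intro: continuous_on_subset)

lemma scaling_isCont: "isCont \<phi> x"
  using scaling_continuous[of UNIV] by (simp add: continuous_on_eq_continuous_at)

lemma scaling_refine: "\<phi> x = sqrt 2 * (\<Sum>n\<in>{1 - int N..int N}. h n * \<phi> (2 * x - of_int n))"
  using sc unfolding daubechies_scaling_def by blast

text \<open>The alternating moments vanish, so the even and the odd positions contribute the same
  amount, half of the full moment each; hence the independence of \<open>m\<close>.\<close>

lemma filter_parity_moments:
  assumes "q < N"
  shows "(\<Sum>k | k \<in> {1 - int N..int N} \<and> even (m - k). of_int k ^ q * h k) =
    (\<Sum>k\<in>{1 - int N..int N}. of_int k ^ q * h k) / 2"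
proof -
  let ?K = "{1 - int N..int N}" and ?t = "\<lambda>k. of_int k ^ q * h k"
  have alt: "(\<Sum>n\<in>?K. (-1) powi n * of_int n ^ q * h n) = 0"
    using sc assms unfolding daubechies_scaling_def by blast
  have split: "sum u ?K = (\<Sum>k | k \<in> ?K \<and> even k. u k) + (\<Sum>k | k \<in> ?K \<and> odd k. u k)" for u :: "int \<Rightarrow> real"
  proof -
    have "finite {k. k \<in> ?K \<and> Q k}" for Q by (rule finite_subset[of _ ?K]) auto
    then show ?thesis by (subst sum.union_disjoint[symmetric]) (auto intro: sum.cong)
  qed
  have "(\<Sum>k | k \<in> ?K \<and> even k. ?t k) - (\<Sum>k | k \<in> ?K \<and> odd k. ?t k) =
      (\<Sum>k | k \<in> ?K \<and> even k. (-1) powi k * of_int k ^ q * h k) + (\<Sum>k | k \<in> ?K \<and> odd k. (-1) powi k * of_int k ^ q * h k)"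
    by (simp add: power_int_minus_left sum_negf[symmetric] mult_ac del: sum_negf)
  also have "\<dots> = 0" using alt split by metis
  finally have eq: "(\<Sum>k | k \<in> ?K \<and> even k. ?t k) = (\<Sum>k | k \<in> ?K \<and> odd k. ?t k)" by simp
  show ?thesis
    using eq split[of ?t] by (cases "even m") (auto simp: algebra_simps cong: conj_cong)
qed

text \<open>Binomial expansion of \<open>((m - k) / 2) ^ p\<close>: the inner sums over
  \<open>k\<close> do not depend on \<open>m\<close>, so refinement turns the coefficients
  \<open>n ^ p\<close> into a polynomial in \<open>m\<close> with leading coefficient
  \<open>1 / 2 ^ p\<close>.\<close>

lemma translate_sum_power_refine:
  assumes p: "p < N"
  obtains a :: "nat \<Rightarrow> real" where
    "\<And>x. translate_sum N \<phi> (\<lambda>n. of_int n ^ p) x =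
      (translate_sum N \<phi> (\<lambda>n. of_int n ^ p) (2 * x) +
       (\<Sum>q\<in>{1..p}. a q * translate_sum N \<phi> (\<lambda>n. of_int n ^ (p - q)) (2 * x))) / 2 ^ p"
proof -
  let ?K = "{1 - int N..int N}"
  define \<mu> where "\<mu> q = (\<Sum>k\<in>?K. of_int k ^ q * h k)" for q
  define a where "a q = sqrt 2 / 2 * real (p choose q) * (-1) ^ q * \<mu> q" for q
  have \<mu>0: "\<mu> 0 = sqrt 2" proof -
    have "(\<Sum>n\<in>?K. h n) = sqrt 2" using sc unfolding daubechies_scaling_def by blast
    then show ?thesis by (simp add: \<mu>_def)
  qed
  \<comment> \<open>The normalisation of the filter makes this exactly 1, so the top term reproduces
    itself up to the factor \<open>2 ^ p\<close>.\<close>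
  have a0: "a 0 = 1" by (simp add: a_def \<mu>0 flip: power2_eq_square)
  have g: "sqrt 2 * (\<Sum>k | k \<in> ?K \<and> even (m - k). of_int ((m - k) div 2) ^ p * h k) =
     (\<Sum>q\<in>{0..p}. (a q / 2 ^ p) * of_int m ^ (p - q))" for m
  proof -
    have "(\<Sum>k | k \<in> ?K \<and> even (m - k). of_int ((m - k) div 2) ^ p * h k) =
       (\<Sum>k | k \<in> ?K \<and> even (m - k). (\<Sum>q\<le>p. real (p choose q) * (- of_int k) ^ q * of_int m ^ (p - q)) / 2 ^ p * h k)"
    proof (rule sum.cong[OF refl])
      fix k assume k: "k \<in> {k. k \<in> ?K \<and> even (m - k)}"
      have "real_of_int ((m - k) div 2) = (- of_int k + of_int m) / 2"
        using k by (auto simp: real_of_int_div)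
      then show "of_int ((m - k) div 2) ^ p * h k =
        (\<Sum>q\<le>p. real (p choose q) * (- of_int k) ^ q * of_int m ^ (p - q)) / 2 ^ p * h k"
        by (simp only: power_divide binomial_ring)
    qed
    also have "\<dots> = (\<Sum>q\<le>p. real (p choose q) * (-1) ^ q * of_int m ^ (p - q) / 2 ^ p *
        (\<Sum>k | k \<in> ?K \<and> even (m - k). of_int k ^ q * h k))"
      unfolding sum_divide_distrib sum_distrib_right sum_distrib_left
      by (subst sum.swap) (simp add: power_minus[of "real_of_int _"] mult_ac)
    also have "\<dots> = (\<Sum>q\<le>p. real (p choose q) * (-1) ^ q * of_int m ^ (p - q) / 2 ^ p * (\<mu> q / 2))"
      by (rule sum.cong[OF refl], subst filter_parity_moments) (use p in \<open>simp_all add: \<mu>_def\<close>)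
    finally show ?thesis
      by (simp add: a_def sum_distrib_left atLeast0AtMost mult_ac)
  qed
  have "translate_sum N \<phi> (\<lambda>n. of_int n ^ p) x =
      (translate_sum N \<phi> (\<lambda>n. of_int n ^ p) (2 * x) +
       (\<Sum>q\<in>{1..p}. a q * translate_sum N \<phi> (\<lambda>n. of_int n ^ (p - q)) (2 * x))) / 2 ^ p" for x
  proof -
    have "translate_sum N \<phi> (\<lambda>n. of_int n ^ p) x =
      (\<Sum>q\<in>{0..p}. a q / 2 ^ p * translate_sum N \<phi> (\<lambda>n. of_int n ^ (p - q)) (2 * x))"
      by (subst translate_sum_refine[where h=h, OF scaling_support scaling_refine])
         (simp_all only: g translate_sum_lincomb simp_thms)
    also have "{0..p} = insert 0 {1..p}" by auto
    finally show ?thesis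
      by (simp add: a0 add_divide_distrib sum_divide_distrib)
  qed
  then show ?thesis by (rule that)
qed

text \<open>The sum is invariant under doubling of the argument, hence constant by continuity at 0;
  the constant is found by folding the integral of \<phi> onto the unit interval.\<close>

lemma partition_of_unity: "translate_sum N \<phi> (\<lambda>n. 1) x = 1"
proof -
  let ?M = "translate_sum N \<phi> (\<lambda>n. 1)"
  have N: "0 < N" using scaling_order by simp
  obtain a :: "nat \<Rightarrow> real" where a: "\<And>x. translate_sum N \<phi> (\<lambda>n. of_int n ^ 0) x =
      (translate_sum N \<phi> (\<lambda>n. of_int n ^ 0) (2 * x) +
       (\<Sum>q\<in>{1..0}. a q * translate_sum N \<phi> (\<lambda>n. of_int n ^ (0 - q)) (2 * x))) / 2 ^ 0"
    using translate_sum_power_refine[OF N] by blast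
  then have dbl: "?M x = ?M (2 * x)" for x by simp
  have pw: "?M x = ?M (x / 2 ^ k)" for x k
  proof (induction k)
    case (Suc k) then show ?case using dbl[of "x / 2 ^ Suc k"] by simp
  qed simp
  \<comment> \<open>A fixed index set serves all \<open>y\<close> near 0, so the limit can be taken
    term by term.\<close>
  have near: "?M y = (\<Sum>n\<in>{- int N - 1..int N + 1}. \<phi> (y - of_int n))" if "\<bar>y\<bar> \<le> 1" for y
  proof -
    have "n \<in> {- int N - 1..int N + 1}" if nz: "\<phi> (y - real_of_int n) \<noteq> 0" for n
    proof -
      have "real_of_int n \<ge> y - real N" "real_of_int n \<le> y + real N - 1"
        using scaling_support[OF nz] by auto
      with \<open>\<bar>y\<bar> \<le> 1\<close> have "real_of_int n \<ge> - 1 - real N" "real_of_int n \<le> 1 + real N" by linarith+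
      then show ?thesis by (auto; linarith)
    qed
    then show ?thesis by (subst translate_sum_eq[OF scaling_support]) auto
  qed
  have const: "?M x = ?M 0" for x
  proof -
    have lim: "(\<lambda>k. x / 2 ^ k) \<longlonglongrightarrow> 0"
      using tendsto_mult_right_zero[OF LIMSEQ_realpow_zero[of "1/2 :: real"], of x]
      by (simp add: power_divide)
    have ev: "\<forall>\<^sub>F k in sequentially. \<bar>x / 2 ^ k\<bar> \<le> 1"
      using order_tendstoD(2)[OF tendsto_rabs_zero[OF lim], of 1] by (auto elim: eventually_mono)
    have "(\<lambda>k. \<Sum>n\<in>{- int N - 1..int N + 1}. \<phi> (x / 2 ^ k - of_int n)) \<longlonglongrightarrow>
       (\<Sum>n\<in>{- int N - 1..int N + 1}. \<phi> (0 - of_int n))"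
      by (intro tendsto_sum isCont_tendsto_compose[OF scaling_isCont] tendsto_diff lim tendsto_const)
    then have "(\<lambda>k. ?M (x / 2 ^ k)) \<longlonglongrightarrow> ?M 0"
      by (subst near, simp, rule Lim_transform_eventually) (use ev near in \<open>auto elim!: eventually_mono\<close>)
    then show ?thesis using pw[of x] by (simp add: LIMSEQ_const_iff)
  qed
  have intble: "integrable lborel \<phi>"
  proof -
    have "set_integrable lborel {1 - real N..real N} \<phi>"
      unfolding set_integrable_def by (intro borel_integrable_compact scaling_continuous) auto
    moreover have "(\<lambda>y. indicator {1 - real N..real N} y *\<^sub>R \<phi> y) = \<phi>"
      using scaling_support by (fastforce simp: indicator_def)
    ultimately show ?thesis by (simp add: set_integrable_def)
  qed
  have [measurable]: "\<phi> \<in> borel_measurable borel"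
    by (rule borel_measurable_continuous_onI) (rule scaling_continuous)
  let ?K = "{- int N - 2..int N + 2}"
  \<comment> \<open>The line is cut into unit intervals. The range \<open>?K\<close> covers the
    support with a margin, so that the same finite sum serves for the cut and, after translation,
    for the folded sum.\<close>
  have ind: "\<phi> y = (\<Sum>n\<in>?K. indicator {0..<1} (y - of_int n) * \<phi> y)" for y
  proof (cases "\<phi> y = 0")
    case False
    from scaling_support[OF this] have "\<lfloor>y\<rfloor> \<in> ?K" by (auto; linarith)
    moreover have "indicator {0..<1} (y - of_int n) = (if n = \<lfloor>y\<rfloor> then 1 else 0 :: real)" for n
    proof -
      have "y - of_int n \<in> {0..<1} \<longleftrightarrow> n = \<lfloor>y\<rfloor>"
        by (simp add: eq_commute[of n] floor_eq_iff) linarith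
      then show ?thesis by (simp only: indicator_def of_bool_def)
    qed
    ultimately show ?thesis by (simp only: if_distrib[of "\<lambda>c. c * _"] mult_1 mult_zero_left) simp
  qed simp
  have i1: "integrable lborel (\<lambda>y. indicator {0..<1} (y - of_int n) * \<phi> y)" for n
    by (rule Bochner_Integration.integrable_bound[OF intble]) (auto simp: indicator_def)
  have shift: "(LINT y|lborel. indicator {0..<1} (y - of_int n) * \<phi> y) =
     (LINT y|lborel. indicator {0..<1} y * \<phi> (y + of_int n))" for n
    by (subst lborel_integral_real_affine[where c=1 and t="of_int n"]) (auto simp: add.commute)
  have i2: "integrable lborel (\<lambda>y. indicator {0..<1} y * \<phi> (y + of_int n))" for n
    using lborel_integrable_real_affine[OF i1, of 1 n "of_int n"] by (simp add: add.commute)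
  have "(LINT y|lborel. \<phi> y) = (LINT y|lborel. (\<Sum>n\<in>?K. indicator {0..<1} (y - of_int n) * \<phi> y))"
    by (subst ind) simp
  also have "\<dots> = (\<Sum>n\<in>?K. LINT y|lborel. indicator {0..<1} y * \<phi> (y + of_int n))"
    by (subst Bochner_Integration.integral_sum) (auto simp: i1 shift)
  also have "\<dots> = (LINT y|lborel. (\<Sum>n\<in>?K. indicator {0..<1} y * \<phi> (y + of_int n)))"
    by (subst Bochner_Integration.integral_sum) (auto simp: i2)
  also have "\<dots> = (LINT y|lborel. indicator {0..<1::real} y * ?M 0)"
  proof (intro Bochner_Integration.integral_cong refl)
    fix y :: real
    show "(\<Sum>n\<in>?K. indicator {0..<1} y * \<phi> (y + of_int n)) = indicator {0..<1} y * ?M 0"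
    proof (cases "y \<in> {0..<1}")
      case True
      have "n \<in> ?K" if "\<phi> (y - real_of_int n) \<noteq> 0" for n
        using scaling_support[OF that] True by (auto; linarith)
      then have "?M y = (\<Sum>n\<in>?K. \<phi> (y - of_int n))"
        by (subst translate_sum_eq[OF scaling_support]) auto
      also have "\<dots> = (\<Sum>n\<in>?K. \<phi> (y + of_int n))"
        by (rule sum.reindex_bij_witness[of _ uminus uminus]) auto
      finally show ?thesis using True const[of y] by simp
    qed simp
  qed
  also have "\<dots> = ?M 0" by simp
  moreover have "(LINT y|lborel. \<phi> y) = 1" using sc unfolding daubechies_scaling_def by blast
  ultimately have "?M 0 = 1" by simp
  then show ?thesis by (simp only: const[of x])
qed

text \<open>The lower order terms are found by solving the self-similarity relation among
  polynomials. The rest \<open>H\<close> satisfies \<open>H x = H (2 ^ k * x) / 2 ^ (k * p)\<close>,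
  and for large \<open>k\<close> only \<open>x ^ p\<close> survives, since each \<open>n\<close>
  that counts at \<open>2 ^ k * x\<close> is within \<open>N\<close> of it.\<close>

lemma translate_sum_power:
  assumes "p < N"
  shows "\<exists>P. (\<forall>i\<ge>p. coeff P i = 0) \<and> (\<forall>x. translate_sum N \<phi> (\<lambda>n. of_int n ^ p) x = x ^ p + poly P x)"
  using assms
proof (induction p rule: less_induct)
  case (less p)
  let ?M = "\<lambda>p. translate_sum N \<phi> (\<lambda>n. of_int n ^ p)"
  show ?case
  proof (cases "p = 0")
    case True
    with partition_of_unity show ?thesis by (intro exI[of _ 0]) auto
  next
    case False
    obtain a where a: "\<And>x. ?M p x = (?M p (2 * x) + (\<Sum>q\<in>{1..p}. a q * ?M (p - q) (2 * x))) / 2 ^ p"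
      using translate_sum_power_refine[OF less.prems] by blast
    have "\<forall>r\<in>{..<p}. \<exists>P. (\<forall>i\<ge>r. coeff P i = 0) \<and> (\<forall>x. ?M r x = x ^ r + poly P x)"
      using less by auto
    then obtain Q where Q: "\<And>r. r < p \<Longrightarrow> (\<forall>i\<ge>r. coeff (Q r) i = 0) \<and> (\<forall>x. ?M r x = x ^ r + poly (Q r) x)"
      unfolding bchoice_iff by auto
    define R where "R = (\<Sum>q\<in>{1..p}. smult (a q) (monom 1 (p - q) + Q (p - q)))"
    have R: "(\<Sum>q\<in>{1..p}. a q * ?M (p - q) y) = poly R y" for y
      using Q unfolding R_def poly_sum by (intro sum.cong) (auto simp: poly_monom)
    have Rc: "coeff R i = 0" if "i \<ge> p" for i
      using Q that unfolding R_def coeff_sum by (intro sum.neutral) auto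
    \<comment> \<open>Comparison of the coefficients of degree \<open>i\<close> gives
      \<open>c i * (2 ^ p - 2 ^ i) = coeff R i * 2 ^ i\<close>, solvable because
      \<open>i < p\<close>.\<close>
    define c where "c i = coeff R i * 2 ^ i / (2 ^ p - 2 ^ i)" for i
    define P where "P = (\<Sum>i<p. monom (c i) i)"
    have poly_R: "poly R y = (\<Sum>i<p. coeff R i * y ^ i)" for y
    proof -
      have "poly R y = poly (\<Sum>i<p. monom (coeff R i) i) y"
        using Rc by (intro arg_cong[where f="\<lambda>p. poly p y"] poly_eqI) (auto simp: coeff_sum coeff_monom)
      then show ?thesis by (simp add: poly_sum poly_monom)
    qed
    have poly_P: "poly P y = (\<Sum>i<p. c i * y ^ i)" for y by (simp add: P_def poly_sum poly_monom)
    have cP: "poly P x * 2 ^ p = poly P (2 * x) + poly R (2 * x)" for x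
    proof -
      have "c i * x ^ i * 2 ^ p = c i * (2 * x) ^ i + coeff R i * (2 * x) ^ i" if "i < p" for i
      proof -
        have "(2::real) ^ i \<noteq> 2 ^ p" using that by simp
        then have "c i * (2 ^ p - 2 ^ i) = coeff R i * 2 ^ i" by (simp add: c_def)
        then have "c i * 2 ^ p = c i * 2 ^ i + coeff R i * 2 ^ i" by (simp add: algebra_simps)
        then have "x ^ i * (c i * 2 ^ p) = x ^ i * (c i * 2 ^ i + coeff R i * 2 ^ i)" by simp
        then show ?thesis by (simp add: power_mult_distrib algebra_simps)
      qed
      then show ?thesis by (simp add: poly_R poly_P sum_distrib_right flip: sum.distrib)
    qed
    define H where "H x = ?M p x - poly P x" for x
    have Hdbl: "H x = H (2 * x) / 2 ^ p" for x
      using a[of x] cP[of x] unfolding H_def R by (simp add: field_simps)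
    have Hk: "H x = H (2 ^ k * x) / 2 ^ (k * p)" for x k
    proof (induction k)
      case (Suc k)
      then show ?case using Hdbl[of "2 ^ k * x"] by (simp add: power_add mult_ac)
    qed simp
    have "H x = x ^ p" for x
    proof -
      obtain B where B: "B > 0" "\<And>y. \<bar>\<phi> y\<bar> \<le> B"
        using compact_support_bounded[OF scaling_continuous scaling_support] by blast
      have N: "1 \<le> real N" using scaling_order by simp
      have bound: "\<bar>?M p (2 ^ k * x) / 2 ^ (k * p) - x ^ p\<bar> \<le>
        (real (2 * N + 1) * (real p * (\<bar>x\<bar> + real N) ^ p * real N * B)) * (1 / 2) ^ k" for k
      proof -
        let ?y = "2 ^ k * x"
        let ?I = "{\<lfloor>?y\<rfloor> - int N..\<lfloor>?y\<rfloor> + int N}"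
        \<comment> \<open>The partition of unity brings \<open>x ^ p\<close> under the same sum, so
          that each term compares \<open>n / 2 ^ k\<close> with \<open>x\<close>.\<close>
        have "?M p ?y / 2 ^ (k * p) - x ^ p = ?M p ?y / 2 ^ (k * p) - x ^ p * translate_sum N \<phi> (\<lambda>n. 1) ?y"
          by (simp add: partition_of_unity)
        also have "\<dots> = (\<Sum>n\<in>?I. ((of_int n / 2 ^ k) ^ p - x ^ p) * \<phi> (?y - of_int n))"
          unfolding translate_sum_def sum_divide_distrib sum_distrib_left
          by (simp add: algebra_simps power_divide power_mult flip: sum_subtractf)
        also have "\<bar>\<dots>\<bar> \<le> (\<Sum>n\<in>?I. real p * (\<bar>x\<bar> + real N) ^ p * real N * B * (1/2) ^ k)"
        proof (rule order_trans[OF sum_abs sum_mono])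
          fix n
          show "\<bar>((of_int n / 2 ^ k) ^ p - x ^ p) * \<phi> (?y - of_int n)\<bar> \<le>
            real p * (\<bar>x\<bar> + real N) ^ p * real N * B * (1/2) ^ k"
          proof (cases "\<phi> (?y - of_int n) = 0")
            case True then show ?thesis using B by simp
          next
            case False
            from scaling_support[OF False] N have "\<bar>?y - of_int n\<bar> \<le> real N" by auto
            then have "\<bar>?y - of_int n\<bar> / 2 ^ k \<le> real N / 2 ^ k" by (simp add: divide_right_mono)
            moreover have "of_int n / 2 ^ k - x = (of_int n - ?y) / 2 ^ k" by (simp add: field_simps)
            then have "\<bar>of_int n / 2 ^ k - x\<bar> = \<bar>?y - of_int n\<bar> / 2 ^ k"
              by (simp add: abs_minus_commute)
            ultimately have d: "\<bar>of_int n / 2 ^ k - x\<bar> \<le> real N * (1/2) ^ k" by (simp add: power_divide)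
            also have "\<dots> \<le> real N * 1" by (intro mult_left_mono power_le_one) auto
            finally have "\<bar>of_int n / 2 ^ k - x\<bar> \<le> real N" by simp
            then have "\<bar>of_int n / 2 ^ k\<bar> \<le> \<bar>x\<bar> + real N" by linarith
            then have "\<bar>(of_int n / 2 ^ k) ^ p - x ^ p\<bar> \<le> real p * (\<bar>x\<bar> + real N) ^ p * \<bar>of_int n / 2 ^ k - x\<bar>"
              using N by (intro abs_power_diff_le) auto
            also have "\<dots> \<le> real p * (\<bar>x\<bar> + real N) ^ p * (real N * (1/2) ^ k)"
              by (intro mult_left_mono d) auto
            finally have "\<bar>(of_int n / 2 ^ k) ^ p - x ^ p\<bar> * \<bar>\<phi> (?y - of_int n)\<bar> \<le>
              (real p * (\<bar>x\<bar> + real N) ^ p * (real N * (1/2) ^ k)) * B"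
              using B by (intro mult_mono) auto
            then show ?thesis by (simp add: abs_mult mult_ac)
          qed
        qed
        also have "\<dots> = (real (2 * N + 1) * (real p * (\<bar>x\<bar> + real N) ^ p * real N * B)) * (1 / 2) ^ k"
          by (simp add: nat_add_distrib)
        finally show ?thesis .
      qed
      have half: "(\<lambda>k. (1/2 :: real) ^ k) \<longlonglongrightarrow> 0" by (rule LIMSEQ_realpow_zero) auto
      have "(\<lambda>k. ?M p (2 ^ k * x) / 2 ^ (k * p) - x ^ p) \<longlonglongrightarrow> 0"
        by (rule Lim_null_comparison[OF _ tendsto_mult_right_zero[OF half]])
           (use bound in \<open>auto intro!: always_eventually\<close>)
      \<comment> \<open>A term of degree \<open>i < p\<close> is damped by
        \<open>2 ^ (p - i)\<close> at each doubling.\<close>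
      moreover have "(\<lambda>k. poly P (2 ^ k * x) / 2 ^ (k * p)) \<longlonglongrightarrow> (\<Sum>i<p. c i * x ^ i * 0)"
      proof -
        have "poly P (2 ^ k * x) / 2 ^ (k * p) = (\<Sum>i<p. c i * x ^ i * (1 / 2 ^ (p - i)) ^ k)" for k
          unfolding poly_P sum_divide_distrib
        proof (rule sum.cong[OF refl])
          fix i assume "i \<in> {..<p}"
          then have "p = i + (p - i)" by simp
          then have "(2::real) ^ (k * p) = 2 ^ (k * i) * 2 ^ (k * (p - i))"
            by (metis distrib_left power_add)
          then show "c i * (2 ^ k * x) ^ i / 2 ^ (k * p) = c i * x ^ i * (1 / 2 ^ (p - i)) ^ k"
            by (simp add: power_mult_distrib power_divide mult.commute[of k] flip: power_mult)
        qed
        then show ?thesis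
          by (simp only:) (intro tendsto_sum tendsto_mult tendsto_const LIMSEQ_realpow_zero, auto)
      qed
      ultimately have "(\<lambda>k. (?M p (2 ^ k * x) / 2 ^ (k * p) - x ^ p) - poly P (2 ^ k * x) / 2 ^ (k * p)) \<longlonglongrightarrow> 0 - (\<Sum>i<p. c i * x ^ i * 0)"
        by (rule tendsto_diff)
      moreover have "(?M p (2 ^ k * x) / 2 ^ (k * p) - x ^ p) - poly P (2 ^ k * x) / 2 ^ (k * p) = H x - x ^ p" for k
        by (subst Hk[of x k]) (simp add: H_def diff_divide_distrib)
      ultimately show ?thesis by (simp add: LIMSEQ_const_iff)
    qed
    then have "?M p x = x ^ p + poly P x" for x unfolding H_def by (metis diff_add_cancel)
    moreover have "\<forall>i\<ge>p. coeff P i = 0" by (simp add: P_def coeff_sum coeff_monom)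
    ultimately show ?thesis by blast
  qed
qed

text \<open>Triangular inversion: the sums with coefficients \<open>n ^ m\<close> are monic of
  degree \<open>m\<close>, so leading terms can be removed one at a time.\<close>

lemma polynomial_reproduction:
  assumes "degree r < N"
  shows "\<exists>q. degree q < N \<and> (\<forall>x. poly r x = translate_sum N \<phi> (\<lambda>n. poly q (of_int n)) x)"
proof -
  \<comment> \<open>Vanishing of all coefficients from \<open>m\<close> on replaces a bound on the
    degree, so that \<open>m = 0\<close> means the zero polynomial and starts the induction.\<close>
  have "\<exists>q. (\<forall>i\<ge>m. coeff q i = 0) \<and> (\<forall>x. poly r x = translate_sum N \<phi> (\<lambda>n. poly q (of_int n)) x)"
    if "\<forall>i\<ge>m. coeff r i = 0" "m \<le> N" for m and r :: "real poly"
    using that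
  proof (induction m arbitrary: r)
    case 0
    then have "r = 0" by (simp add: poly_eq_iff)
    then show ?case by (intro exI[of _ 0]) (simp add: translate_sum_def)
  next
    case (Suc m)
    from translate_sum_power[of m] Suc.prems obtain P where
      P: "\<forall>i\<ge>m. coeff P i = 0" "\<And>x. translate_sum N \<phi> (\<lambda>n. of_int n ^ m) x = x ^ m + poly P x" by auto
    let ?c = "coeff r m"
    define r' where "r' = r - smult ?c (monom 1 m + P)"
    have "\<forall>i\<ge>m. coeff r' i = 0"
    proof (intro allI impI)
      fix i assume "m \<le> i"
      then show "coeff r' i = 0"
        using Suc.prems P by (cases "i = m") (auto simp: r'_def)
    qed
    with Suc.IH[of r'] Suc.prems obtain q where
      q: "\<forall>i\<ge>m. coeff q i = 0" "\<And>x. poly r' x = translate_sum N \<phi> (\<lambda>n. poly q (of_int n)) x" by auto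
    have "poly r x = translate_sum N \<phi> (\<lambda>n. poly (q + smult ?c (monom 1 m)) (of_int n)) x" for x
    proof -
      have "poly r x = poly r' x + ?c * (x ^ m + poly P x)" by (simp add: r'_def poly_monom)
      also have "\<dots> = translate_sum N \<phi> (\<lambda>n. poly q (of_int n)) x + ?c * translate_sum N \<phi> (\<lambda>n. of_int n ^ m) x"
        by (simp add: q P)
      finally show ?thesis
        by (simp add: translate_sum_def poly_monom sum_distrib_left algebra_simps flip: sum.distrib)
    qed
    moreover have "\<forall>i\<ge>Suc m. coeff (q + smult ?c (monom 1 m)) i = 0" using q by simp
    ultimately show ?case by blast
  qed
  moreover have "\<forall>i\<ge>N. coeff r i = 0" using assms by (auto intro: coeff_eq_0)
  ultimately obtain q where q: "\<forall>i\<ge>N. coeff q i = 0"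
    "\<forall>x. poly r x = translate_sum N \<phi> (\<lambda>n. poly q (of_int n)) x"
    by blast
  moreover have "degree q < N"
    using q(1) assms by (cases "q = 0") (auto simp: not_le[symmetric])
  ultimately show ?thesis by blast
qed

end

section \<open>Vanishing moments at the boundary\<close>

text \<open>Elimination of one equation with pivot \<open>a i0 k\<close>. It serves to show that the
  matrix expressing the boundary scaling functions by edge functions is invertible.\<close>

lemma homogeneous_system_nontrivial:
  fixes a :: "'i \<Rightarrow> 'k \<Rightarrow> real"
  assumes "finite K" "finite I" "card K < card I"
  shows "\<exists>c. (\<exists>i\<in>I. c i \<noteq> 0) \<and> (\<forall>k\<in>K. (\<Sum>i\<in>I. c i * a i k) = 0)"
  using assms
proof (induction K arbitrary: I a rule: finite_induct)
  case empty
  then have "I \<noteq> {}" by auto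
  then show ?case by (intro exI[of _ "\<lambda>_. 1"]) auto
next
  case (insert k K)
  show ?case
  proof (cases "\<forall>i\<in>I. a i k = 0")
    case True
    with insert.IH[of I a] insert.prems insert.hyps show ?thesis by auto
  next
    case False
    then obtain i0 where i0: "i0 \<in> I" "a i0 k \<noteq> 0" by auto
    define a' where "a' i k' = a i k' - a i k / a i0 k * a i0 k'" for i k'
    obtain c where c: "\<exists>i\<in>I - {i0}. c i \<noteq> 0" "\<forall>k\<in>K. (\<Sum>i\<in>I - {i0}. c i * a' i k) = 0"
    proof -
      have "card K < card (I - {i0})" using insert.prems insert.hyps i0 by simp
      with insert.IH[of "I - {i0}" a'] insert.prems show ?thesis using that by blast
    qed
    define s where "s = (\<Sum>i\<in>I - {i0}. c i * (a i k / a i0 k))"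
    define c' where "c' = c(i0 := - s)"
    have sum_c': "(\<Sum>i\<in>I. c' i * a i k') = (\<Sum>i\<in>I - {i0}. c i * a i k') - s * a i0 k'" for k'
      using i0 insert.prems by (subst sum.remove[of _ i0]) (auto simp: c'_def intro!: sum.cong)
    have "(\<Sum>i\<in>I. c' i * a i k') = 0" if "k' \<in> insert k K" for k'
    proof (cases "k' = k")
      case True
      have "s * a i0 k = (\<Sum>i\<in>I - {i0}. c i * a i k)"
        using i0 by (simp add: s_def sum_distrib_right)
      then show ?thesis using sum_c'[of k] True by simp
    next
      case False
      then have "(\<Sum>i\<in>I - {i0}. c i * a' i k') = 0" using that c by auto
      then show ?thesis
        unfolding sum_c' by (simp add: a'_def s_def right_diff_distrib sum_subtractf sum_distrib_right mult.assoc)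
    qed
    moreover have "\<exists>i\<in>I. c' i \<noteq> 0" using c by (auto simp: c'_def)
    ultimately show ?thesis by blast
  qed
qed

text \<open>Horner recursion with \<open>n * (n choose k) = Suc k * (n choose Suc k) + k * (n choose
  k)\<close>. Binomial coefficients are the weights in the edge functions.\<close>

lemma polynomial_binomial_basis:
  fixes s :: "real poly"
  assumes "degree s < m"
  shows "\<exists>b. \<forall>n::nat. poly s (real n) = (\<Sum>k<m. b k * real (n choose k))"
  using assms
proof (induction m arbitrary: s)
  case (Suc m)
  show ?case
  proof (cases "degree s = 0")
    case True
    then obtain a where "s = [:a:]" by (auto elim: degree_eq_zeroE)
    then show ?thesis
      by (intro exI[of _ "\<lambda>k. if k = 0 then a else 0"])
         (simp add: if_distrib[of "\<lambda>x. x * _"] cong: if_cong)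
  next
    case False
    obtain a p where s: "s = pCons a p" by (cases s)
    with False Suc.prems have "degree p < m" by (auto split: if_splits)
    with Suc.IH obtain b where b: "\<And>n::nat. poly p (real n) = (\<Sum>k<m. b k * real (n choose k))" by blast
    define b' where "b' k = (if k = 0 then a else b (k - 1) * real k) + (if k < m then b k * real k else 0)" for k
    have "poly s (real n) = (\<Sum>k<Suc m. b' k * real (n choose k))" for n
    proof -
      have step: "real n * real (n choose k) = real (Suc k) * real (n choose Suc k) + real k * real (n choose k)" for k
      proof -
        have "Suc k * (n choose Suc k) + k * (n choose k) = n * (n choose k)"
        proof -
          have "Suc k * (n choose Suc k) = (n - k) * (n choose k)"
            by (simp only: binomial_absorption binomial_absorb_comp)
          then show ?thesis by (cases "k \<le> n") (simp_all add: diff_mult_distrib binomial_eq_0 add.commute)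
        qed
        then show ?thesis by (metis of_nat_add of_nat_mult)
      qed
      have "poly s (real n) = a + (\<Sum>k<m. b k * (real n * real (n choose k)))"
        by (simp add: s b sum_distrib_left mult_ac)
      also have "\<dots> = a + (\<Sum>k<m. b k * real (Suc k) * real (n choose Suc k)) + (\<Sum>k<m. b k * real k * real (n choose k))"
        by (simp only: step) (simp add: algebra_simps sum.distrib)
      also have "a + (\<Sum>k<m. b k * real (Suc k) * real (n choose Suc k)) =
          (\<Sum>k<Suc m. (if k = 0 then a else b (k - 1) * real k) * real (n choose k))"
        by (subst sum.lessThan_Suc_shift) simp
      also have "(\<Sum>k<m. b k * real k * real (n choose k)) =
          (\<Sum>k<Suc m. (if k < m then b k * real k else 0) * real (n choose k))" by simp
      finally show ?thesis by (simp only: b'_def distrib_right sum.distrib)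
    qed
    then show ?thesis by blast
  qed
qed simp

text \<open>Boundary functions are specified for \<open>x >= 0\<close> only, so continuity and
  support are asked for there and nothing is said about negative arguments.\<close>

definition half_supported :: "real \<Rightarrow> (real \<Rightarrow> real) \<Rightarrow> bool" where
  "half_supported R f \<longleftrightarrow> continuous_on {0..} f \<and> (\<forall>x\<ge>0. f x \<noteq> 0 \<longrightarrow> x \<le> R)"

lemma half_supported_mult:
  "half_supported R f \<Longrightarrow> continuous_on {0..} g \<Longrightarrow> half_supported R (\<lambda>x. f x * g x)"
  by (auto simp: half_supported_def intro: continuous_intros)

lemma half_supported_set_integrable:
  assumes "half_supported R f" shows "set_integrable lborel {0..} f"
proof -
  have "set_integrable lborel {0..R} f"
    unfolding set_integrable_def
    using assms by (intro borel_integrable_compact) (auto simp: half_supported_def elim: continuous_on_subset)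
  moreover have "(\<lambda>x. indicator {0..R} x *\<^sub>R f x) = (\<lambda>x. indicator {0..} x *\<^sub>R f x)"
    using assms by (fastforce simp: half_supported_def indicator_def)
  ultimately show ?thesis by (simp add: set_integrable_def)
qed

lemma half_supported_bounded:
  assumes "half_supported R f"
  obtains B where "B > 0" "\<And>x. x \<ge> 0 \<Longrightarrow> \<bar>f x\<bar> \<le> B"
proof -
  have "compact (f ` {0..R})"
    using assms by (intro compact_continuous_image) (auto simp: half_supported_def elim: continuous_on_subset)
  then obtain B where B: "\<forall>y\<in>{0..R}. \<bar>f y\<bar> \<le> B"
    by (auto simp: bounded_iff dest!: compact_imp_bounded)
  then have "\<bar>f x\<bar> \<le> max B 1" if "x \<ge> 0" for x
    using assms that by (cases "f x = 0") (auto simp: le_max_iff_disj half_supported_def)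
  with that[of "max B 1"] show ?thesis by auto
qed

lemma half_supported_sum:
  "(\<And>i. i \<in> A \<Longrightarrow> half_supported R (f i)) \<Longrightarrow> half_supported R (\<lambda>x. \<Sum>i\<in>A. c i * f i x)"
  unfolding half_supported_def
  by (intro conjI continuous_intros allI impI) (auto elim!: sum.not_neutral_contains_not_neutral)

lemma half_supported_add:
  "half_supported R f \<Longrightarrow> half_supported R g \<Longrightarrow> half_supported R (\<lambda>x. f x + g x)"
  unfolding half_supported_def by (auto intro!: continuous_intros)

lemma half_supported_cong:
  "(\<And>x. x \<ge> 0 \<Longrightarrow> f x = g x) \<Longrightarrow> half_supported R f = half_supported R g"
  unfolding half_supported_def by (intro arg_cong2[where f="(\<and>)"] continuous_on_cong) auto

lemma set_integral_sum:
  fixes f :: "'i \<Rightarrow> 'a \<Rightarrow> real"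
  assumes "\<And>i. i \<in> I \<Longrightarrow> set_integrable M A (f i)"
  shows "(LINT x:A|M. (\<Sum>i\<in>I. c i * f i x)) = (\<Sum>i\<in>I. c i * (LINT x:A|M. f i x))"
proof -
  have "(LINT x:A|M. (\<Sum>i\<in>I. c i * f i x)) = (LINT x|M. (\<Sum>i\<in>I. c i * (indicator A x *\<^sub>R f i x)))"
    unfolding set_lebesgue_integral_def by (simp add: sum_distrib_left mult_ac)
  also have "\<dots> = (\<Sum>i\<in>I. c i * (LINT x:A|M. f i x))"
    using assms unfolding set_lebesgue_integral_def set_integrable_def
    by (subst Bochner_Integration.integral_sum) auto
  finally show ?thesis .
qed

text \<open>The closed support interval admits its endpoint, but continuity from the right forces
  the value 0 there. This removes one translate at the edge.\<close>

lemma support_endpoint_zero: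
  fixes \<phi> :: "real \<Rightarrow> real"
  assumes "continuous_on UNIV \<phi>" "\<And>y. \<phi> y \<noteq> 0 \<Longrightarrow> y \<le> b"
  shows "\<phi> b = 0"
proof (rule ccontr)
  assume "\<phi> b \<noteq> 0"
  have "isCont \<phi> b" using assms(1) by (simp add: continuous_on_eq_continuous_at)
  then have "(\<phi> \<longlongrightarrow> \<phi> b) (at_right b)" by (simp add: isCont_def filterlim_at_split)
  moreover have "(\<phi> \<longlongrightarrow> 0) (at_right b)"
    using assms(2) by (intro tendsto_eventually) (auto simp: eventually_at_right_field not_le[symmetric] intro!: exI[of _ "b+1"])
  ultimately have "\<phi> b = 0" by (rule tendsto_unique[rotated]) simp
  with \<open>\<phi> b \<noteq> 0\<close> show False ..
qed

section \<open>Boundary functions on the half-line\<close>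

context
  fixes N :: nat and \<phi> \<psi> :: "real \<Rightarrow> real" and \<phi>E \<psi>E :: "nat \<Rightarrow> real \<Rightarrow> real"
  assumes bd: "cdv_boundary N \<phi> \<psi> \<phi>E \<psi>E"
    and cont: "continuous_on UNIV \<phi>"
    and supp: "\<And>y. \<phi> y \<noteq> 0 \<Longrightarrow> y \<in> {1 - real N..real N}"
    and N: "N \<ge> 1"
begin

lemma half_supported_translate:
  "real N + a \<le> R \<Longrightarrow> half_supported R (\<lambda>x. \<phi> (x - a))"
  unfolding half_supported_def
proof (intro conjI allI impI)
  show "continuous_on {0..} (\<lambda>x. \<phi> (x - a))"
    by (intro continuous_on_compose2[OF cont] continuous_intros) auto
  show "x \<le> R" if "real N + a \<le> R" "\<phi> (x - a) \<noteq> 0" for x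
    using supp[OF that(2)] that(1) by simp
qed

lemma boundary_scaling_combination:
  "\<exists>a. \<forall>i<N. \<forall>x\<ge>0. \<phi>E i x =
        (\<Sum>k<N. a i k * (\<Sum>n = k..2 * N - 2. real (n choose k) * \<phi> (x + real n - real N + 1)))"
proof -
  have "\<forall>i<N. \<exists>a. \<forall>x\<ge>0. \<phi>E i x =
        (\<Sum>k<N. a k * (\<Sum>n = k..2 * N - 2. real (n choose k) * \<phi> (x + real n - real N + 1)))"
    using bd unfolding cdv_boundary_def by (elim conjE)
  then have "\<forall>i. \<exists>a. i < N \<longrightarrow> (\<forall>x\<ge>0. \<phi>E i x =
        (\<Sum>k<N. a k * (\<Sum>n = k..2 * N - 2. real (n choose k) * \<phi> (x + real n - real N + 1))))"
    by simp
  then show ?thesis by (rule choice)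
qed

text \<open>The translate with \<open>n = 0\<close> reaches farthest to the right, up to
  \<open>N + (N - 1)\<close>.\<close>

lemma half_supported_edge:
  "half_supported (2 * real N - 1) (\<lambda>x. \<Sum>n = k..2 * N - 2. real (n choose k) * \<phi> (x + real n - real N + 1))"
proof (rule half_supported_sum)
  fix n assume "n \<in> {k..2 * N - 2}"
  have "half_supported (2 * real N - 1) (\<lambda>x. \<phi> (x - (real N - real n - 1)))"
    by (rule half_supported_translate) simp
  then show "half_supported (2 * real N - 1) (\<lambda>x. \<phi> (x + real n - real N + 1))"
    by (simp add: algebra_simps)
qed

lemma half_supported_boundary_scaling: "i < N \<Longrightarrow> half_supported (2 * real N - 1) (\<phi>E i)"
proof -
  assume i: "i < N"
  from boundary_scaling_combination obtain a where a: "\<forall>i<N. \<forall>x\<ge>0. \<phi>E i x =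
        (\<Sum>k<N. a i k * (\<Sum>n = k..2 * N - 2. real (n choose k) * \<phi> (x + real n - real N + 1)))" ..
  show ?thesis
    by (subst half_supported_cong[OF a[rule_format, OF i]]) (auto intro!: half_supported_sum half_supported_edge)
qed

text \<open>The farthest translate at double frequency, \<open>m = 3 * N - 2\<close>, ends at
  \<open>(N + 3 * N - 2) / 2 = 2 * N - 1\<close>.\<close>

lemma half_supported_boundary_wavelet: "i < N \<Longrightarrow> half_supported (2 * real N - 1) (\<psi>E i)"
proof -
  assume i: "i < N"
  then obtain a b :: "nat \<Rightarrow> real" where ab: "\<And>x. x \<ge> 0 \<Longrightarrow> \<psi>E i x =
        (\<Sum>k<N. a k * \<phi>E k (2 * x)) + (\<Sum>m = N..3 * N - 2. b m * \<phi> (2 * x - real m))"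
    using bd unfolding cdv_boundary_def by blast
  have "half_supported (2 * real N - 1) (\<lambda>x. \<phi>E k (2 * x))" if "k < N" for k
    using half_supported_boundary_scaling[OF that] unfolding half_supported_def
  proof (intro conjI allI impI)
    assume *: "continuous_on {0..} (\<phi>E k) \<and> (\<forall>x\<ge>0. \<phi>E k x \<noteq> 0 \<longrightarrow> x \<le> 2 * real N - 1)"
    show "continuous_on {0..} (\<lambda>x. \<phi>E k (2 * x))"
      using * by (auto intro!: continuous_on_compose2[of "{0..}" "\<phi>E k"] continuous_intros)
    show "x \<le> 2 * real N - 1" if "x \<ge> 0" "\<phi>E k (2 * x) \<noteq> 0" for x
      using *[THEN conjunct2, rule_format, of "2 * x"] that by simp
  qed
  moreover have "half_supported (2 * real N - 1) (\<lambda>x. \<phi> (2 * x - real m))" if "m \<in> {N..3 * N - 2}" for m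
  proof -
    have "real m \<le> 3 * real N - 2" using that N by auto
    show ?thesis
      unfolding half_supported_def
    proof (intro conjI allI impI)
      show "continuous_on {0..} (\<lambda>x. \<phi> (2 * x - real m))"
        by (intro continuous_on_compose2[OF cont] continuous_intros) auto
      show "x \<le> 2 * real N - 1" if "\<phi> (2 * x - real m) \<noteq> 0" for x
        using supp[OF that] \<open>real m \<le> 3 * real N - 2\<close> by simp
    qed
  qed
  ultimately show ?thesis
    by (subst half_supported_cong[where g="\<lambda>x. (\<Sum>k<N. a k * \<phi>E k (2 * x)) + (\<Sum>m = N..3 * N - 2. b m * \<phi> (2 * x - real m))"])
       (auto simp: ab intro!: half_supported_add half_supported_sum)
qed

text \<open>By construction \<open>\<psi>E i\<close> is orthogonal to the \<open>N\<close>
  orthonormal functions, not directly to the edge functions they combine. The square matrix of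
  combinations must be invertible: a vanishing combination of its rows would make the orthonormal
  functions linearly dependent.\<close>

lemma boundary_wavelet_orthogonal_edge:
  assumes i: "i < N" and k: "k < N"
  shows "(LINT x:{0..}|lborel. \<psi>E i x * (\<Sum>n = k..2 * N - 2. real (n choose k) * \<phi> (x + real n - real N + 1))) = 0"
proof -
  let ?u = "\<lambda>k x. \<Sum>n = k..2 * N - 2. real (n choose k) * \<phi> (x + real n - real N + 1)"
  define y where "y k = (LINT x:{0..}|lborel. \<psi>E i x * ?u k x)" for k
  from boundary_scaling_combination obtain a where a: "\<forall>i<N. \<forall>x\<ge>0. \<phi>E i x = (\<Sum>k<N. a i k * ?u k x)" ..
  have cu: "continuous_on {0..} (?u k)" and cE: "j < N \<Longrightarrow> continuous_on {0..} (\<phi>E j)" for k j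
    using half_supported_edge half_supported_boundary_scaling by (auto simp: half_supported_def)
  have ay: "(\<Sum>k<N. a j k * y k) = 0" if "j < N" for j
  proof -
    have "(LINT x:{0..}|lborel. \<psi>E i x * \<phi>E j x) = 0"
      using bd i that unfolding cdv_boundary_def by blast
    also have "(LINT x:{0..}|lborel. \<psi>E i x * \<phi>E j x) = (LINT x:{0..}|lborel. (\<Sum>k<N. a j k * (\<psi>E i x * ?u k x)))"
      using a that by (intro set_lebesgue_integral_cong) (auto simp: sum_distrib_left mult_ac)
    also have "\<dots> = (\<Sum>k<N. a j k * y k)"
      unfolding y_def
      by (intro set_integral_sum half_supported_set_integrable[OF half_supported_mult[OF half_supported_boundary_wavelet[OF i]]] cu)
    finally show ?thesis by simp
  qed
  have "y k = 0"
  proof (rule ccontr)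
    assume yk: "y k \<noteq> 0"
    \<comment> \<open>\<open>N\<close> unknowns and \<open>N - 1\<close> equations give a
      combination of the rows that vanishes off column \<open>k\<close>. Since \<open>y k\<close> is
      assumed nonzero, it vanishes in column \<open>k\<close> as well.\<close>
    have "card ({..<N} - {k}) < card {..<N}" using k by simp
    then obtain c where c: "\<exists>j\<in>{..<N}. c j \<noteq> 0" "\<forall>m\<in>{..<N} - {k}. (\<Sum>j<N. c j * a j m) = 0"
      using homogeneous_system_nontrivial[of "{..<N} - {k}" "{..<N}" a] by auto
    have "(\<Sum>m<N. (\<Sum>j<N. c j * a j m) * y m) = (\<Sum>j<N. c j * (\<Sum>m<N. a j m * y m))"
      unfolding sum_distrib_left sum_distrib_right by (subst sum.swap) (simp add: mult_ac)
    also have "\<dots> = 0" using ay by simp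
    also have "(\<Sum>m<N. (\<Sum>j<N. c j * a j m) * y m) = (\<Sum>j<N. c j * a j k) * y k"
      using c(2) k by (subst sum.remove[of _ k]) auto
    finally have col: "(\<Sum>j<N. c j * a j m) = 0" if "m < N" for m
      using c(2) yk that by (cases "m = k") auto
    have zero: "(\<Sum>j<N. c j * \<phi>E j x) = 0" if "x \<ge> 0" for x
    proof -
      have "(\<Sum>j<N. c j * \<phi>E j x) = (\<Sum>j<N. c j * (\<Sum>m<N. a j m * ?u m x))" using a that by simp
      also have "\<dots> = (\<Sum>m<N. (\<Sum>j<N. c j * a j m) * ?u m x)"
        unfolding sum_distrib_left[of "c _"] sum_distrib_right by (subst sum.swap) (simp add: mult_ac)
      also have "\<dots> = 0" using col by simp
      finally show ?thesis .
    qed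
    have "c l = 0" if l: "l < N" for l
    proof -
      have "0 = (LINT x:{0..}|lborel. (\<Sum>j<N. c j * \<phi>E j x) * \<phi>E l x)"
        using zero by (subst set_lebesgue_integral_cong[where g="\<lambda>_. 0"]) auto
      also have "\<dots> = (LINT x:{0..}|lborel. (\<Sum>j<N. c j * (\<phi>E j x * \<phi>E l x)))"
        by (simp add: sum_distrib_right mult.assoc)
      also have "\<dots> = (\<Sum>j<N. c j * (LINT x:{0..}|lborel. \<phi>E j x * \<phi>E l x))"
        by (intro set_integral_sum half_supported_set_integrable[OF half_supported_mult[OF half_supported_boundary_scaling cE]])
           (use l in auto)
      also have "\<dots> = (\<Sum>j<N. if j = l then c j else 0)"
        using bd l by (intro sum.cong) (auto simp: cdv_boundary_def halfline_orthonormal_def)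
      also have "\<dots> = c l" using l by simp
      finally show ?thesis by simp
    qed
    with c(1) show False by auto
  qed
  then show ?thesis by (simp add: y_def)
qed

text \<open>On the support of \<open>\<psi>E i\<close> the polynomial is a sum of translates of
  \<phi>. Those with \<open>n < N\<close> combine, by their polynomial weights, into edge functions;
  the others are interior translates; \<open>\<psi>E i\<close> is orthogonal to both kinds.\<close>

lemma boundary_wavelet_moment:
  assumes i: "i < N" and rep: "degree q < N" "\<And>x. poly r x = translate_sum N \<phi> (\<lambda>n. poly q (of_int n)) x"
  shows "(LINT x:{0..}|lborel. poly r x * \<psi>E i x) = 0"
proof -
  let ?u = "\<lambda>k x. \<Sum>n = k..2 * N - 2. real (n choose k) * \<phi> (x + real n - real N + 1)"
  \<comment> \<open>With \<open>n = N - 1 - j\<close> the translates that meet the boundary are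
    numbered by \<open>j\<close> from 0 to \<open>2 * N - 2\<close>, as in the edge functions;
    \<open>s\<close> is \<open>q\<close> in the variable \<open>j\<close>.\<close>
  define s where "s = pcompose q [:real N - 1, -1:]"
  have "degree s < N" using rep(1) by (simp add: s_def degree_pcompose)
  with polynomial_binomial_basis obtain b where b: "\<And>n::nat. poly s (real n) = (\<Sum>k<N. b k * real (n choose k))"
    by blast
  have expand: "poly r x * \<psi>E i x = (\<Sum>k<N. b k * (\<psi>E i x * ?u k x)) + (\<Sum>m\<in>{N..3*N}. poly q (real m) * (\<psi>E i x * \<phi> (x - real m)))"
    if x: "x \<in> {0..}" for x
  proof (cases "\<psi>E i x = 0")
    case False
    then have x2: "x \<le> 2 * real N - 1" using half_supported_boundary_wavelet[OF i] x by (auto simp: half_supported_def)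
    have "poly r x = (\<Sum>n\<in>{1 - int N..3 * int N}. poly q (of_int n) * \<phi> (x - of_int n))"
      unfolding rep(2)
    proof (rule translate_sum_eq[OF supp])
      fix n :: int assume nz: "\<phi> (x - real_of_int n) \<noteq> 0"
      from supp[OF nz] have r: "real_of_int n \<ge> x - real N" "real_of_int n \<le> x + real N - 1" by auto
      \<comment> \<open>The translate \<open>n = - N\<close> meets the half-line at
        \<open>x = 0\<close> only, with the endpoint of its support.\<close>
      have "\<phi> (real N) = 0" using supp by (intro support_endpoint_zero cont) auto
      then have "n \<noteq> - int N \<or> x \<noteq> 0" using nz by auto
      with r x x2 show "n \<in> {1 - int N..3 * int N}"
        by (cases "n = - int N") (auto; linarith)+
    qed auto
    also have "{1 - int N..3 * int N} = {1 - int N..int N - 1} \<union> {int N..3 * int N}" using N by auto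
    also have "(\<Sum>n\<in>\<dots>. poly q (of_int n) * \<phi> (x - of_int n)) =
       (\<Sum>n\<in>{1 - int N..int N - 1}. poly q (of_int n) * \<phi> (x - of_int n)) +
       (\<Sum>n\<in>{int N..3 * int N}. poly q (of_int n) * \<phi> (x - of_int n))"
      by (rule sum.union_disjoint) auto
    also have "(\<Sum>n\<in>{1 - int N..int N - 1}. poly q (of_int n) * \<phi> (x - of_int n)) =
        (\<Sum>n\<in>{0..2*N-2}. poly s (real n) * \<phi> (x + real n - real N + 1))"
      using N by (intro sum.reindex_bij_witness[of _ "\<lambda>n. int N - 1 - int n" "\<lambda>n. nat (int N - 1 - n)"])
        (auto simp: s_def poly_pcompose algebra_simps)
    also have "\<dots> = (\<Sum>k<N. b k * (\<Sum>n\<in>{0..2*N-2}. real (n choose k) * \<phi> (x + real n - real N + 1)))"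
      unfolding b sum_distrib_left sum_distrib_right by (subst sum.swap) (simp add: mult_ac)
    also have "\<dots> = (\<Sum>k<N. b k * ?u k x)"
      by (intro sum.cong refl arg_cong2[where f="(*)"] sum.mono_neutral_right) (auto simp: binomial_eq_0)
    also have "(\<Sum>n\<in>{int N..3 * int N}. poly q (of_int n) * \<phi> (x - of_int n)) =
        (\<Sum>m\<in>{N..3*N}. poly q (real m) * \<phi> (x - real m))"
      by (intro sum.reindex_bij_witness[of _ int nat]) auto
    finally have "poly r x * \<psi>E i x = ((\<Sum>k<N. b k * ?u k x) + (\<Sum>m\<in>{N..3*N}. poly q (real m) * \<phi> (x - real m))) * \<psi>E i x"
      by (rule arg_cong)
    then show ?thesis
      unfolding distrib_right sum_distrib_right[of _ _ "\<psi>E i x"] by (simp only: mult_ac)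
  qed simp
  have cu: "continuous_on {0..} (?u k)" for k using half_supported_edge by (auto simp: half_supported_def)
  have cphi: "continuous_on {0..} (\<lambda>x. \<phi> (x - a))" for a
    by (intro continuous_on_compose2[OF cont] continuous_intros) auto
  note int1 = half_supported_set_integrable[OF half_supported_mult[OF half_supported_boundary_wavelet[OF i] cu]]
  note int2 = half_supported_set_integrable[OF half_supported_mult[OF half_supported_boundary_wavelet[OF i] cphi]]
  have "(LINT x:{0..}|lborel. poly r x * \<psi>E i x) = (LINT x:{0..}|lborel.
      (\<Sum>k<N. b k * (\<psi>E i x * ?u k x)) + (\<Sum>m\<in>{N..3*N}. poly q (real m) * (\<psi>E i x * \<phi> (x - real m))))"
    using expand by (intro set_lebesgue_integral_cong) auto
  also have "\<dots> = (LINT x:{0..}|lborel. (\<Sum>k<N. b k * (\<psi>E i x * ?u k x))) +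
      (LINT x:{0..}|lborel. (\<Sum>m\<in>{N..3*N}. poly q (real m) * (\<psi>E i x * \<phi> (x - real m))))"
    by (intro set_integral_add half_supported_set_integrable[OF half_supported_sum[OF half_supported_mult[OF half_supported_boundary_wavelet[OF i]]]] cu cphi)
  also have "\<dots> = (\<Sum>k<N. b k * (LINT x:{0..}|lborel. \<psi>E i x * ?u k x)) +
      (\<Sum>m\<in>{N..3*N}. poly q (real m) * (LINT x:{0..}|lborel. \<psi>E i x * \<phi> (x - real m)))"
    by (simp only: set_integral_sum[OF int1] set_integral_sum[OF int2])
  also have "\<dots> = 0"
    using bd i boundary_wavelet_orthogonal_edge[OF i] by (auto simp: cdv_boundary_def)
  finally show ?thesis .
qed

end

section \<open>Support and moments of the interior wavelet\<close>

context
  fixes N :: nat and h :: "int \<Rightarrow> real" and \<phi> :: "real \<Rightarrow> real"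
  assumes sc: "daubechies_scaling N h \<phi>"
begin

lemma wavelet_support: "daubechies_wavelet N h \<phi> y \<noteq> 0 \<Longrightarrow> y \<in> {1 - real N..real N}"
proof -
  assume "daubechies_wavelet N h \<phi> y \<noteq> 0"
  then obtain n where n: "n \<in> {1 - int N..int N}" "\<phi> (2 * y - of_int n) \<noteq> 0"
    unfolding daubechies_wavelet_def by (metis (no_types, lifting) mult_eq_0_iff sum.neutral)
  then have "1 - int N \<le> n" "n \<le> int N" by auto
  then have "1 - real N \<le> of_int n" "of_int n \<le> real N" by linarith+
  with scaling_support[OF sc n(2)] show ?thesis by auto
qed

lemma wavelet_continuous: "continuous_on A (daubechies_wavelet N h \<phi>)"
  unfolding daubechies_wavelet_def
  by (intro continuous_intros continuous_on_compose2[OF scaling_continuous[OF sc, of UNIV]]) auto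

lemma continuous_support_integrable:
  fixes f g :: "real \<Rightarrow> real"
  assumes "continuous_on UNIV f" "continuous_on UNIV g" "\<And>y. g y \<noteq> 0 \<Longrightarrow> y \<in> {a..b}"
  shows "integrable lborel (\<lambda>x. f x * g x)"
proof -
  have "set_integrable lborel {a..b} (\<lambda>x. f x * g x)"
    unfolding set_integrable_def using assms
    by (intro borel_integrable_compact continuous_intros) (auto elim: continuous_on_subset)
  moreover have "(\<lambda>x. indicator {a..b} x *\<^sub>R (f x * g x)) = (\<lambda>x. f x * g x)"
    using assms(3) by (fastforce simp: indicator_def)
  ultimately show ?thesis by (simp add: set_integrable_def)
qed

text \<open>The reversed filter \<open>h (1 - n)\<close> inherits the alternating moment conditions
  through the substitution of \<open>1 - n\<close> for \<open>n\<close>. After a change of variable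
  the moment is an integral of \<phi> against such a filter sum with a polynomial in
  \<open>n\<close>.\<close>

lemma wavelet_moment:
  assumes r: "degree r < N"
  shows "(LINT x|lborel. poly r x * daubechies_wavelet N h \<phi> x) = 0"
proof -
  let ?K = "{1 - int N..int N}"
  have alt: "(\<Sum>n\<in>?K. (-1) powi n * h (1 - n) * of_int n ^ q) = 0" if "q < N" for q
  proof -
    have "(\<Sum>n\<in>?K. (-1) powi n * h (1 - n) * of_int n ^ q) = (\<Sum>n\<in>?K. (-1) powi (1 - n) * h n * (1 - of_int n) ^ q)"
      by (rule sum.reindex_bij_witness[of _ "\<lambda>n. 1 - n" "\<lambda>n. 1 - n"]) auto
    also have "\<dots> = (\<Sum>n\<in>?K. \<Sum>i\<le>q. - real (q choose i) * (-1) ^ i * ((-1) powi n * of_int n ^ i * h n))"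
    proof (rule sum.cong[OF refl])
      fix n
      have "(1 - of_int n :: real) ^ q = (\<Sum>i\<le>q. real (q choose i) * (- of_int n) ^ i)"
        using binomial_ring[of "- of_int n :: real" 1 q] by simp
      moreover have "(-1::real) powi (1 - n) = - ((-1) powi n)" by (auto simp: power_int_minus_left)
      ultimately show "(-1) powi (1 - n) * h n * (1 - of_int n) ^ q =
          (\<Sum>i\<le>q. - real (q choose i) * (-1) ^ i * ((-1) powi n * of_int n ^ i * h n))"
        by (simp add: sum_distrib_left sum_negf power_minus[of "real_of_int _"] mult_ac)
    qed
    also have "\<dots> = (\<Sum>i\<le>q. - real (q choose i) * (-1) ^ i * (\<Sum>n\<in>?K. (-1) powi n * of_int n ^ i * h n))"
      unfolding sum_distrib_left by (rule sum.swap)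
    also have "\<dots> = 0"
    proof (rule sum.neutral, rule ballI)
      fix i assume "i \<in> {..q}"
      then have "(\<Sum>n\<in>?K. (-1) powi n * of_int n ^ i * h n) = 0"
        using sc that unfolding daubechies_scaling_def by (meson atMost_iff le_less_trans)
      then show "- real (q choose i) * (-1) ^ i * (\<Sum>n\<in>?K. (-1) powi n * of_int n ^ i * h n) = 0" by simp
    qed
    finally show ?thesis .
  qed
  have altp: "(\<Sum>n\<in>?K. (-1) powi n * h (1 - n) * poly s (of_int n)) = 0" if "degree s < N" for s :: "real poly"
  proof -
    have "(\<Sum>n\<in>?K. (-1) powi n * h (1 - n) * poly s (of_int n)) =
      (\<Sum>q\<le>degree s. coeff s q * (\<Sum>n\<in>?K. (-1) powi n * h (1 - n) * of_int n ^ q))"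
      unfolding poly_altdef sum_distrib_left by (subst sum.swap) (simp add: mult_ac)
    also have "\<dots> = 0" using alt that by (intro sum.neutral) auto
    finally show ?thesis .
  qed
  note [continuous_intros] = continuous_on_compose2[OF scaling_continuous[OF sc, of UNIV]]
  have cphi: "continuous_on UNIV (\<lambda>x. \<phi> (2 * x - of_int n))" for n by (intro continuous_intros) auto
  have int1: "integrable lborel (\<lambda>x. poly r x * \<phi> (2 * x - of_int n))" for n
    using scaling_support[OF sc]
    by (intro continuous_support_integrable[where a="(1 - real N + of_int n) / 2" and b="(real N + of_int n) / 2"] continuous_intros cphi)
       (fastforce simp: field_simps)+
  have int2: "integrable lborel (\<lambda>y. poly r ((y + of_int n) / 2) * \<phi> y)" for n
    using scaling_support[OF sc]
    by (intro continuous_support_integrable[where a="(1 - real N)" and b="real N"] continuous_intros scaling_continuous[OF sc]) auto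
  have subst: "(LINT x|lborel. poly r x * \<phi> (2 * x - of_int n)) = (LINT y|lborel. poly r ((y + of_int n) / 2) * \<phi> y) / 2" for n
    by (subst lborel_integral_real_affine[where c="1/2" and t="of_int n / 2"]) (auto simp: add_divide_distrib algebra_simps)
  have "(LINT x|lborel. poly r x * daubechies_wavelet N h \<phi> x) =
     (LINT x|lborel. (\<Sum>n\<in>?K. (sqrt 2 * ((-1) powi n * h (1 - n))) * (poly r x * \<phi> (2 * x - of_int n))))"
    unfolding daubechies_wavelet_def by (simp add: sum_distrib_left mult_ac)
  also have "\<dots> = (\<Sum>n\<in>?K. (sqrt 2 * ((-1) powi n * h (1 - n))) * (LINT y|lborel. poly r ((y + of_int n) / 2) * \<phi> y) / 2)"
    using int1 by (subst Bochner_Integration.integral_sum) (auto simp: subst)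
  also have "\<dots> = (LINT y|lborel. (\<Sum>n\<in>?K. (sqrt 2 * ((-1) powi n * h (1 - n)) / 2) * (poly r ((y + of_int n) / 2) * \<phi> y)))"
    using int2 by (subst Bochner_Integration.integral_sum) auto
  also have "\<dots> = (LINT y|(lborel::real measure). 0)"
  proof (intro Bochner_Integration.integral_cong refl)
    fix y :: real
    define s where "s = pcompose r [:y / 2, 1 / 2:]"
    have "degree s < N" using r by (simp add: s_def degree_pcompose)
    moreover have "poly r ((y + of_int n) / 2) = poly s (of_int n)" for n
      by (simp add: s_def poly_pcompose add_divide_distrib)
    ultimately have "(\<Sum>n\<in>?K. (-1) powi n * h (1 - n) * poly r ((y + of_int n) / 2)) = 0" using altp by simp
    then have "sqrt 2 / 2 * \<phi> y * (\<Sum>n\<in>?K. (-1) powi n * h (1 - n) * poly r ((y + of_int n) / 2)) = 0" by simp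
    then show "(\<Sum>n\<in>?K. (sqrt 2 * ((-1) powi n * h (1 - n)) / 2) * (poly r ((y + of_int n) / 2) * \<phi> y)) = 0"
      unfolding sum_distrib_left by (simp add: mult_ac)
  qed
  finally show ?thesis by simp
qed

end

text \<open>At the right end the boundary functions are built on \<phi> reflected about 1/2. The
  reflection maps the support interval to itself, so reproduction is carried over from \<phi>
  instead of being proved for another filter.\<close>

lemma reflected_reproduction:
  assumes supp: "\<And>y. \<phi> y \<noteq> 0 \<Longrightarrow> y \<in> {1 - real N..real N}"
    and rep: "\<And>r. degree r < N \<Longrightarrow> \<exists>q. degree q < N \<and> (\<forall>x. poly r x = translate_sum N \<phi> (\<lambda>n. poly q (of_int n)) x)"
    and r: "degree r < N"
  shows "\<exists>q. degree q < N \<and> (\<forall>x. poly r x = translate_sum N (\<lambda>x. \<phi> (1 - x)) (\<lambda>n. poly q (of_int n)) x)"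
proof -
  have "degree (pcompose r [:1, -1:]) < N" using r by (simp add: degree_pcompose)
  with rep obtain q where q: "degree q < N"
    "\<And>x. poly (pcompose r [:1, -1:]) x = translate_sum N \<phi> (\<lambda>n. poly q (of_int n)) x" by blast
  have "poly r x = translate_sum N (\<lambda>x. \<phi> (1 - x)) (\<lambda>n. poly (pcompose q [:0, -1:]) (of_int n)) x" for x
  proof -
    let ?W = "{\<lfloor>1 - x\<rfloor> - int N..\<lfloor>1 - x\<rfloor> + int N}"
    have supp': "\<phi> (1 - y) \<noteq> 0 \<Longrightarrow> y \<in> {1 - real N..real N}" for y using supp[of "1 - y"] by auto
    have "n \<in> uminus ` ?W" if nz: "\<phi> (1 - (x - real_of_int n)) \<noteq> 0" for n
    proof -
      have "real_of_int (- n) \<ge> (1 - x) - real N" "real_of_int (- n) \<le> (1 - x) + real N - 1"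
        using supp[OF nz] by auto
      then have "- n \<in> ?W" by (auto; linarith)
      then show ?thesis by (metis image_eqI minus_minus)
    qed
    then have "translate_sum N (\<lambda>x. \<phi> (1 - x)) (\<lambda>n. poly (pcompose q [:0, -1:]) (of_int n)) x =
      (\<Sum>n\<in>uminus ` ?W. poly (pcompose q [:0, -1:]) (of_int n) * \<phi> (1 - (x - of_int n)))"
      by (intro translate_sum_eq[OF supp']) auto
    also have "\<dots> = (\<Sum>n\<in>?W. poly q (of_int n) * \<phi> (1 - x - of_int n))"
      by (subst sum.reindex) (auto simp: poly_pcompose inj_on_def algebra_simps)
    also have "\<dots> = poly (pcompose r [:1, -1:]) (1 - x)"
      unfolding q(2) by (simp add: translate_sum_def)
    finally show ?thesis by (simp add: poly_pcompose)
  qed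
  moreover have "degree (pcompose q [:0, -1:]) < N" using q(1) by (simp add: degree_pcompose)
  ultimately show ?thesis by blast
qed

text \<open>Common ground of the scaling and the wavelet functions on the interval, so that size,
  support and continuity are treated once for both.\<close>

definition interval_family ::
  "nat \<Rightarrow> real \<Rightarrow> (real \<Rightarrow> real) \<Rightarrow> (nat \<Rightarrow> real \<Rightarrow> real) \<Rightarrow> (nat \<Rightarrow> real \<Rightarrow> real) \<Rightarrow> bool" where
  "interval_family N B f fL fR \<longleftrightarrow>
     N \<ge> 1 \<and> B > 0 \<and> continuous_on UNIV f \<and> (\<forall>y. f y \<noteq> 0 \<longrightarrow> y \<in> {1 - real N..real N}) \<and> (\<forall>y. \<bar>f y\<bar> \<le> B) \<and>
     (\<forall>g\<in>{fL, fR}. \<forall>k<N. half_supported (2 * real N - 1) (g k) \<and> (\<forall>x\<ge>0. \<bar>g k x\<bar> \<le> B))"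

definition vanishing_moments ::
  "nat \<Rightarrow> (real \<Rightarrow> real) \<Rightarrow> (nat \<Rightarrow> real \<Rightarrow> real) \<Rightarrow> (nat \<Rightarrow> real \<Rightarrow> real) \<Rightarrow> bool" where
  "vanishing_moments N f fL fR \<longleftrightarrow> (\<forall>r :: real poly. degree r < N \<longrightarrow>
     (LINT x|lborel. poly r x * f x) = 0 \<and>
     (\<forall>g\<in>{fL, fR}. \<forall>k<N. (LINT x:{0..}|lborel. poly r x * g k x) = 0))"

lemma interval_family_exists_bound:
  assumes "N \<ge> 1" "continuous_on UNIV f" "\<And>y. f y \<noteq> 0 \<Longrightarrow> y \<in> {1 - real N..real N}"
    "\<And>k. k < N \<Longrightarrow> half_supported (2 * real N - 1) (fL k)"
    "\<And>k. k < N \<Longrightarrow> half_supported (2 * real N - 1) (fR k)"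
  shows "\<exists>B0. \<forall>B\<ge>B0. interval_family N B f fL fR"
proof -
  obtain B1 where B1: "B1 > 0" "\<And>y. \<bar>f y\<bar> \<le> B1"
    using compact_support_bounded[OF assms(2,3)] by blast
  have "\<exists>b. \<forall>k<N. \<forall>x\<ge>0. \<bar>g k x\<bar> \<le> b" if g: "\<And>k. k < N \<Longrightarrow> half_supported (2 * real N - 1) (g k)"
    for g :: "nat \<Rightarrow> real \<Rightarrow> real"
  proof -
    have "\<forall>k\<in>{..<N}. \<exists>b. \<forall>x\<ge>0. \<bar>g k x\<bar> \<le> b"
      using half_supported_bounded[OF g] by (metis lessThan_iff)
    then obtain b where b: "\<forall>k\<in>{..<N}. \<forall>x\<ge>0. \<bar>g k x\<bar> \<le> b k" by metis
    have "b k \<le> Max (b ` {..<N})" if "k < N" for k using that by (intro Max_ge) auto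
    with b show ?thesis by (meson lessThan_iff order_trans)
  qed
  from this[of fL, OF assms(4)] this[of fR, OF assms(5)] obtain bL bR where
    "\<forall>k<N. \<forall>x\<ge>0. \<bar>fL k x\<bar> \<le> bL" "\<forall>k<N. \<forall>x\<ge>0. \<bar>fR k x\<bar> \<le> bR" by blast
  then have "interval_family N B f fL fR" if "B \<ge> max B1 (max bL bR)" for B
    using assms B1 that unfolding interval_family_def by (fastforce intro: order_trans)
  then show ?thesis by blast
qed

lemma cdv_interval_families:
  assumes sc: "daubechies_scaling N h \<phi>" and w: "w = daubechies_wavelet N h \<phi>"
    and L: "cdv_boundary N \<phi> w \<phi>L \<psi>L"
    and R: "cdv_boundary N (\<lambda>x. \<phi> (1 - x)) (\<lambda>x. w (1 - x)) \<phi>R \<psi>R"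
  obtains B where "interval_family N B \<phi> \<phi>L \<phi>R" "interval_family N B w \<psi>L \<psi>R" "vanishing_moments N w \<psi>L \<psi>R"
proof -
  note cont = scaling_continuous[OF sc, of UNIV] and supp = scaling_support[OF sc] and N = scaling_order[OF sc]
  have cont': "continuous_on UNIV (\<lambda>x. \<phi> (1 - x))"
    by (intro continuous_on_compose2[OF cont] continuous_intros) auto
  have supp': "\<phi> (1 - y) \<noteq> 0 \<Longrightarrow> y \<in> {1 - real N..real N}" for y using supp[of "1 - y"] by auto
  note rep = polynomial_reproduction[OF sc]
  have momL: "(LINT x:{0..}|lborel. poly r x * \<psi>L k x) = 0" if d: "degree r < N" and k: "k < N" for r k
  proof -
    obtain q where "degree q < N" "\<forall>x. poly r x = translate_sum N \<phi> (\<lambda>n. poly q (of_int n)) x"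
      using rep[OF d] by (elim exE conjE) (rule that)
    then show ?thesis by (intro boundary_wavelet_moment[OF L cont supp N k, of q r]) simp_all
  qed
  have momR: "(LINT x:{0..}|lborel. poly r x * \<psi>R k x) = 0" if d: "degree r < N" and k: "k < N" for r k
  proof -
    obtain q where "degree q < N" "\<forall>x. poly r x = translate_sum N (\<lambda>x. \<phi> (1 - x)) (\<lambda>n. poly q (of_int n)) x"
    proof -
      have "\<exists>q. degree q < N \<and> (\<forall>x. poly r x = translate_sum N (\<lambda>x. \<phi> (1 - x)) (\<lambda>n. poly q (of_int n)) x)"
        by (rule reflected_reproduction) (erule supp | erule rep | rule d)+
      then show ?thesis by (elim exE conjE) (rule that)
    qed
    then show ?thesis by (intro boundary_wavelet_moment[OF R cont' supp' N k, of q r]) simp_all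
  qed
  have "vanishing_moments N w \<psi>L \<psi>R"
    using momL momR wavelet_moment[OF sc] by (auto simp: vanishing_moments_def w)
  moreover have "\<exists>B0. \<forall>B\<ge>B0. interval_family N B \<phi> \<phi>L \<phi>R"
    by (intro interval_family_exists_bound N cont supp half_supported_boundary_scaling[OF L cont supp N]
       half_supported_boundary_scaling[OF R cont' supp' N])
  moreover have "\<exists>B0. \<forall>B\<ge>B0. interval_family N B w \<psi>L \<psi>R"
    unfolding w
    by (intro interval_family_exists_bound N wavelet_continuous[OF sc] wavelet_support[OF sc]
       half_supported_boundary_wavelet[OF L cont supp N] half_supported_boundary_wavelet[OF R cont' supp' N])
  ultimately obtain B1 B2 where
    "\<forall>B\<ge>B1. interval_family N B \<phi> \<phi>L \<phi>R" "\<forall>B\<ge>B2. interval_family N B w \<psi>L \<psi>R" "vanishing_moments N w \<psi>L \<psi>R"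
    by (elim exE)
  then show ?thesis by (intro that[of "max B1 B2"]) auto
qed

section \<open>The functions of one level on the unit interval\<close>

context
  fixes N :: nat and B :: real and f fL fR and j :: nat
  assumes fam: "interval_family N B f fL fR" and j: "2 * N \<le> 2 ^ j"
begin

lemma interval_family_facts:
  "N \<ge> 1" "B > 0" "continuous_on UNIV f" "f y \<noteq> 0 \<Longrightarrow> y \<in> {1 - real N..real N}" "\<bar>f y\<bar> \<le> B"
  "k < N \<Longrightarrow> half_supported (2 * real N - 1) (fL k)" "k < N \<Longrightarrow> half_supported (2 * real N - 1) (fR k)"
  "k < N \<Longrightarrow> x \<ge> 0 \<Longrightarrow> \<bar>fL k x\<bar> \<le> B" "k < N \<Longrightarrow> x \<ge> 0 \<Longrightarrow> \<bar>fR k x\<bar> \<le> B"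
proof -
  note * = fam[unfolded interval_family_def]
  show "N \<ge> 1" using * by (elim conjE)
  show "B > 0" using * by (elim conjE)
  show "continuous_on UNIV f" using * by (elim conjE)
  show "f y \<noteq> 0 \<Longrightarrow> y \<in> {1 - real N..real N}" using * by (elim conjE allE impE)
  show "\<bar>f y\<bar> \<le> B" using * by (elim conjE allE)
  show "k < N \<Longrightarrow> half_supported (2 * real N - 1) (fL k)" using * by (meson insertCI)
  show "k < N \<Longrightarrow> half_supported (2 * real N - 1) (fR k)" using * by (meson insertCI)
  show "k < N \<Longrightarrow> x \<ge> 0 \<Longrightarrow> \<bar>fL k x\<bar> \<le> B" using * by (meson insertCI)
  show "k < N \<Longrightarrow> x \<ge> 0 \<Longrightarrow> \<bar>fR k x\<bar> \<le> B" using * by (meson insertCI)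
qed

lemma level_ge: "2 * real N \<le> 2 ^ j"
proof -
  have "real (2 * N) \<le> real (2 ^ j)" using j by (simp only: of_nat_le_iff)
  then show ?thesis by (simp only: of_nat_mult of_nat_power of_nat_numeral)
qed

lemma interval_fun_bound:
  assumes "k < 2 ^ j" "x \<in> {0..1}"
  shows "\<bar>interval_fun N f fL fR j k x\<bar> \<le> sqrt (2 ^ j) * B"
proof -
  have "2 ^ j - 1 - k < N" if "\<not> k < 2 ^ j - N" using that assms by linarith
  then show ?thesis
    using assms interval_family_facts unfolding interval_fun_def
    by (auto simp: abs_mult intro!: mult_left_mono)
qed

text \<open>The centre is taken inside the interval because a Taylor polynomial will be attached to
  it.\<close>

lemma interval_fun_support:
  assumes "k < 2 ^ j"
  obtains a where "a \<in> {0..1}" "\<And>x. x \<in> {0..1} \<Longrightarrow> interval_fun N f fL fR j k x \<noteq> 0 \<Longrightarrow> \<bar>x - a\<bar> \<le> 2 * real N / 2 ^ j"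
proof -
  consider "k < N" | "N \<le> k" "k < 2 ^ j - N" | "N \<le> k" "\<not> k < 2 ^ j - N" by linarith
  then show ?thesis
  proof cases
    case 1
    have "\<bar>x - 0\<bar> \<le> 2 * real N / 2 ^ j" if "x \<in> {0..1}" "interval_fun N f fL fR j k x \<noteq> 0" for x
    proof -
      have "fL k (2 ^ j * x) \<noteq> 0" using that 1 by (simp add: interval_fun_def)
      then have "2 ^ j * x \<le> 2 * real N - 1"
        using interval_family_facts(6)[OF 1] that by (auto simp: half_supported_def)
      then show ?thesis using that by (simp add: field_simps)
    qed
    then show ?thesis by (rule that[of 0, rotated]) auto
  next
    case 2
    have "\<bar>x - real k / 2 ^ j\<bar> \<le> 2 * real N / 2 ^ j" if "x \<in> {0..1}" "interval_fun N f fL fR j k x \<noteq> 0" for x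
    proof -
      have "f (2 ^ j * x - real k) \<noteq> 0" using that 2 by (simp add: interval_fun_def)
      then have "\<bar>2 ^ j * x - real k\<bar> \<le> 2 * real N"
        using interval_family_facts(4)[of "2 ^ j * x - real k"] interval_family_facts(1) by auto
      then have "\<bar>(2 ^ j * x - real k) / 2 ^ j\<bar> \<le> 2 * real N / 2 ^ j" by (simp add: divide_right_mono)
      then show ?thesis by (simp add: diff_divide_distrib)
    qed
    moreover have "real k / 2 ^ j \<in> {0..1}"
    proof -
      have "real k \<le> 2 ^ j" using assms by (metis less_imp_le of_nat_le_iff of_nat_numeral of_nat_power)
      then show ?thesis by simp
    qed
    ultimately show ?thesis using that by blast
  next
    case 3
    then have k: "2 ^ j - 1 - k < N" using assms by linarith
    have "\<bar>x - 1\<bar> \<le> 2 * real N / 2 ^ j" if "x \<in> {0..1}" "interval_fun N f fL fR j k x \<noteq> 0" for x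
    proof -
      have "fR (2 ^ j - 1 - k) (2 ^ j * (1 - x)) \<noteq> 0" using that 3 by (simp add: interval_fun_def)
      then have "2 ^ j * (1 - x) \<le> 2 * real N - 1"
        using interval_family_facts(7)[OF k] that by (auto simp: half_supported_def)
      then show ?thesis using that by (simp add: field_simps)
    qed
    then show ?thesis by (rule that[of 1, rotated]) auto
  qed
qed

text \<open>At a given point at most \<open>N\<close> functions from each end and
  \<open>2 * N + 1 <= 3 * N\<close> interior ones are nonzero, whatever the level.\<close>

lemma interval_fun_sum_bound:
  assumes x: "x \<in> {0..1}"
  shows "(\<Sum>k<2 ^ j. \<bar>interval_fun N f fL fR j k x\<bar>) \<le> sqrt (2 ^ j) * (5 * real N * B)"
proof -
  define y where "y = 2 ^ j * x"
  define T where "T = {..<N} \<union> {2 ^ j - N..<2 ^ j} \<union> {nat (\<lfloor>y\<rfloor> - int N)..nat (\<lfloor>y\<rfloor> + int N)}"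
  have y: "y \<ge> 0" using x by (simp add: y_def)
  have nz: "k \<in> T" if k: "k < 2 ^ j" "interval_fun N f fL fR j k x \<noteq> 0" for k
  proof (cases "k < N \<or> \<not> k < 2 ^ j - N")
    case True then show ?thesis using k by (auto simp: T_def)
  next
    case False
    then have "f (y - real k) \<noteq> 0" using k by (simp add: interval_fun_def y_def)
    from interval_family_facts(4)[OF this] have "real k \<ge> y - real N" "real k \<le> y + real N - 1" by auto
    then have "int k \<ge> \<lfloor>y\<rfloor> - int N" "int k \<le> \<lfloor>y\<rfloor> + int N" by linarith+
    then show ?thesis by (auto simp: T_def)
  qed
  have "card T \<le> card {..<N} + card {2 ^ j - N..<2 ^ j} + card {nat (\<lfloor>y\<rfloor> - int N)..nat (\<lfloor>y\<rfloor> + int N)}"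
    unfolding T_def by (intro order_trans[OF card_Un_le] add_right_mono card_Un_le)
  also have "\<dots> \<le> 5 * N" using interval_family_facts(1) by simp
  finally have cT: "card T \<le> 5 * N" .
  have "(\<Sum>k<2 ^ j. \<bar>interval_fun N f fL fR j k x\<bar>) = (\<Sum>k\<in>{..<2^j} \<inter> T. \<bar>interval_fun N f fL fR j k x\<bar>)"
    using nz by (intro sum.mono_neutral_right) auto
  also have "\<dots> \<le> (\<Sum>k\<in>{..<2^j} \<inter> T. sqrt (2 ^ j) * B)"
    using x by (intro sum_mono interval_fun_bound) auto
  also have "\<dots> = real (card ({..<2^j} \<inter> T)) * (sqrt (2 ^ j) * B)" by simp
  also have "\<dots> \<le> real (5 * N) * (sqrt (2 ^ j) * B)"
  proof (rule mult_right_mono)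
    have "card ({..<2^j} \<inter> T) \<le> card T" by (intro card_mono) (auto simp: T_def)
    with cT show "real (card ({..<2^j} \<inter> T)) \<le> real (5 * N)" by linarith
  qed (use interval_family_facts(2) in auto)
  finally show ?thesis by (simp add: mult_ac)
qed

lemma interval_fun_continuous:
  assumes "k < 2 ^ j"
  shows "continuous_on {0..1} (interval_fun N f fL fR j k)"
proof -
  consider "k < N" | "N \<le> k" "k < 2 ^ j - N" | "N \<le> k" "\<not> k < 2 ^ j - N" by linarith
  then show ?thesis
  proof cases
    case 1
    have "continuous_on {0..} (fL k)" using interval_family_facts(6)[OF 1] by (simp add: half_supported_def)
    then have "continuous_on {0..1} (\<lambda>x. fL k (2 ^ j * x))"
      by (rule continuous_on_compose2) (auto intro!: continuous_intros)
    with 1 show ?thesis by (simp add: interval_fun_def[abs_def] continuous_on_mult_left)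
  next
    case 2
    have "continuous_on {0..1} (\<lambda>x. f (2 ^ j * x - real k))"
      by (rule continuous_on_compose2[OF interval_family_facts(3)]) (auto intro!: continuous_intros)
    with 2 show ?thesis by (simp add: interval_fun_def[abs_def] continuous_on_mult_left)
  next
    case 3
    with assms have "2 ^ j - 1 - k < N" by linarith
    from interval_family_facts(7)[OF this] have "continuous_on {0..} (fR (2 ^ j - 1 - k))"
      by (simp add: half_supported_def)
    then have "continuous_on {0..1} (\<lambda>x. fR (2 ^ j - 1 - k) (2 ^ j * (1 - x)))"
      by (rule continuous_on_compose2) (auto intro!: continuous_intros)
    with 3 show ?thesis by (simp add: interval_fun_def[abs_def] continuous_on_mult_left)
  qed
qed

lemma interval_fun_L1:
  assumes k: "k < 2 ^ j"
  shows "(LINT x:{0..1}|lborel. \<bar>interval_fun N f fL fR j k x\<bar>) \<le> 4 * real N * B * sqrt (2 ^ j) / 2 ^ j"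
proof -
  obtain a where a: "\<And>x. x \<in> {0..1} \<Longrightarrow> interval_fun N f fL fR j k x \<noteq> 0 \<Longrightarrow> \<bar>x - a\<bar> \<le> 2 * real N / 2 ^ j"
    using interval_fun_support[OF k] by blast
  define \<delta> where "\<delta> = 2 * real N / 2 ^ j"
  have \<delta>: "\<delta> \<ge> 0" by (simp add: \<delta>_def)
  have "(LINT x:{0..1}|lborel. \<bar>interval_fun N f fL fR j k x\<bar>) \<le> (LINT x|lborel. indicator {a - \<delta>..a + \<delta>} x * (sqrt (2 ^ j) * B))"
    unfolding set_lebesgue_integral_def
  proof (rule integral_mono)
    show "integrable lborel (\<lambda>x. indicator {0..1} x *\<^sub>R \<bar>interval_fun N f fL fR j k x\<bar>)"
      by (intro borel_integrable_compact continuous_intros interval_fun_continuous k) auto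
    show "integrable lborel (\<lambda>x. indicator {a - \<delta>..a + \<delta>} x * (sqrt (2 ^ j) * B))"
      by (intro integrable_mult_left integrable_real_indicator) (auto simp: emeasure_lborel_Icc_eq)
    show "indicator {0..1} x *\<^sub>R \<bar>interval_fun N f fL fR j k x\<bar> \<le> indicator {a - \<delta>..a + \<delta>} x * (sqrt (2 ^ j) * B)" for x
      using a[of x] interval_fun_bound[OF k, of x] interval_family_facts(2)
      by (cases "interval_fun N f fL fR j k x = 0") (auto simp: indicator_def \<delta>_def abs_le_iff)
  qed
  also have "\<dots> = 2 * \<delta> * (sqrt (2 ^ j) * B)" using \<delta> by simp
  finally show ?thesis by (simp add: \<delta>_def mult_ac)
qed

text \<open>Rescaling by \<open>2 ^ j\<close>. Because \<open>2 * N <= 2 ^ j\<close> the supports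
  fit into the interval, so the cut at 0 and 1 loses nothing, and a moment on the line, or on the
  half-line for the boundary functions, results.\<close>

lemma interval_fun_moment:
  assumes k: "k < 2 ^ j" and van: "vanishing_moments N f fL fR" and r: "degree r < N"
  shows "(LINT x:{0..1}|lborel. poly r x * interval_fun N f fL fR j k x) = 0"
proof -
  define m :: real where "m = 2 ^ j"
  have m: "m > 0" "2 * real N \<le> m" using level_ge by (simp_all add: m_def)
  have affine: "(LINT x|lborel. g x) = (1 / m) * (LINT y|lborel. g (t + y / m))"
    "(LINT x|lborel. g x) = (1 / m) * (LINT y|lborel. g (t - y / m))" for g :: "real \<Rightarrow> real" and t
    using lborel_integral_real_affine[of "1 / m" g t] lborel_integral_real_affine[of "- 1 / m" g t] m by auto
  have comp: "degree (pcompose r [:t, s:]) < N" for t s using r by (auto simp: degree_pcompose intro: le_less_trans)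
  have van1: "(LINT x|lborel. poly (pcompose r p) x * f x) = 0"
     "l < N \<Longrightarrow> (LINT x:{0..}|lborel. poly (pcompose r p) x * fL l x) = 0"
     "l < N \<Longrightarrow> (LINT x:{0..}|lborel. poly (pcompose r p) x * fR l x) = 0" if "p = [:t, s:]" for p t s l
    using van comp[of t s] that unfolding vanishing_moments_def by auto
  consider "k < N" | "N \<le> k" "k < 2 ^ j - N" | "N \<le> k" "\<not> k < 2 ^ j - N" by linarith
  then show ?thesis
  proof cases
    case 1
    have "(LINT x:{0..1}|lborel. poly r x * interval_fun N f fL fR j k x) =
      (LINT x|lborel. indicator {0..1} x * (poly r x * (sqrt m * fL k (m * x))))"
      using 1 by (simp add: set_lebesgue_integral_def interval_fun_def m_def)
    also have "\<dots> = (1 / m) * (LINT y|lborel. indicator {0..1} (0 + y / m) * (poly r (0 + y / m) * (sqrt m * fL k (m * (0 + y / m)))))"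
      by (rule affine(1))
    also have "(LINT y|lborel. indicator {0..1} (0 + y / m) * (poly r (0 + y / m) * (sqrt m * fL k (m * (0 + y / m))))) =
        (LINT y|lborel. sqrt m * (indicator {0..} y *\<^sub>R (poly (pcompose r [:0, 1 / m:]) y * fL k y)))"
      using interval_family_facts(6)[OF 1] m
      by (intro Bochner_Integration.integral_cong refl) (auto simp: poly_pcompose half_supported_def indicator_def zero_le_divide_iff)
    also have "\<dots> = sqrt m * (LINT x:{0..}|lborel. poly (pcompose r [:0, 1 / m:]) x * fL k x)"
      by (simp add: set_lebesgue_integral_def)
    finally show ?thesis using van1(2)[OF refl 1] by simp
  next
    case 2
    have km: "real N \<le> real k" "real k \<le> m - real N"
    proof -
      have "k + N \<le> 2 ^ j" using 2 by linarith
      then have "real (k + N) \<le> m" unfolding m_def by (metis of_nat_le_iff of_nat_numeral of_nat_power)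
      then show "real k \<le> m - real N" by simp
    qed (use 2 in auto)
    have "(LINT x:{0..1}|lborel. poly r x * interval_fun N f fL fR j k x) =
      (LINT x|lborel. indicator {0..1} x * (poly r x * (sqrt m * f (m * x - real k))))"
      using 2 by (simp add: set_lebesgue_integral_def interval_fun_def m_def)
    also have "\<dots> = (1 / m) * (LINT y|lborel. indicator {0..1} (real k / m + y / m) * (poly r (real k / m + y / m) * (sqrt m * f (m * (real k / m + y / m) - real k))))"
      by (rule affine(1))
    also have "(LINT y|lborel. indicator {0..1} (real k / m + y / m) * (poly r (real k / m + y / m) * (sqrt m * f (m * (real k / m + y / m) - real k)))) =
        (LINT y|lborel. sqrt m * (poly (pcompose r [:real k / m, 1 / m:]) y * f y))"
    proof (intro Bochner_Integration.integral_cong refl)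
      fix y :: real
      have e: "m * (real k / m + y / m) - real k = y" using m by (simp add: field_simps)
      show "indicator {0..1} (real k / m + y / m) * (poly r (real k / m + y / m) * (sqrt m * f (m * (real k / m + y / m) - real k))) =
        sqrt m * (poly (pcompose r [:real k / m, 1 / m:]) y * f y)"
      proof (cases "f y = 0")
        case False
        from interval_family_facts(4)[OF this] have "0 \<le> real k + y" "real k + y \<le> m" using km by auto
        then have "real k / m + y / m \<in> {0..1}" using m by (simp add: add_divide_distrib[symmetric])
        then show ?thesis unfolding e by (simp add: poly_pcompose)
      qed (simp add: e)
    qed
    also have "\<dots> = sqrt m * (LINT x|lborel. poly (pcompose r [:real k / m, 1 / m:]) x * f x)" by simp
    finally show ?thesis using van1(1)[OF refl] by simp
  next
    case 3
    then have l: "2 ^ j - 1 - k < N" using k by linarith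
    have "(LINT x:{0..1}|lborel. poly r x * interval_fun N f fL fR j k x) =
      (LINT x|lborel. indicator {0..1} x * (poly r x * (sqrt m * fR (2 ^ j - 1 - k) (m * (1 - x)))))"
      using 3 by (simp add: set_lebesgue_integral_def interval_fun_def m_def)
    also have "\<dots> = (1 / m) * (LINT y|lborel. indicator {0..1} (1 - y / m) * (poly r (1 - y / m) * (sqrt m * fR (2 ^ j - 1 - k) (m * (1 - (1 - y / m))))))"
      by (rule affine(2))
    also have "(LINT y|lborel. indicator {0..1} (1 - y / m) * (poly r (1 - y / m) * (sqrt m * fR (2 ^ j - 1 - k) (m * (1 - (1 - y / m)))))) =
        (LINT y|lborel. sqrt m * (indicator {0..} y *\<^sub>R (poly (pcompose r [:1, - (1 / m):]) y * fR (2 ^ j - 1 - k) y)))"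
      using interval_family_facts(7)[OF l] m
      by (intro Bochner_Integration.integral_cong refl) (auto simp: poly_pcompose half_supported_def indicator_def zero_le_divide_iff)
    also have "\<dots> = sqrt m * (LINT x:{0..}|lborel. poly (pcompose r [:1, - (1 / m):]) x * fR (2 ^ j - 1 - k) x)"
      by (simp add: set_lebesgue_integral_def)
    finally show ?thesis using van1(3)[OF refl l] by simp
  qed
qed

end

section \<open>Hoelder functions on the cube\<close>

lemma prod_Basis_vec: "(\<Prod>b\<in>Basis. g b) = (\<Prod>i\<in>UNIV. g (axis i (1::real) :: real^'d))"
proof -
  have "(Basis :: (real^'d) set) = range (\<lambda>i. axis i 1)" by (auto simp: Basis_vec_def)
  moreover have "(\<Prod>i\<in>UNIV. g (axis i 1)) = prod g (range (\<lambda>i. axis i 1))"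
    by (subst prod.reindex) (auto simp: inj_on_def axis_eq_axis)
  ultimately show ?thesis by (simp only:)
qed

lemma measurable_vec_lambda_PiM [measurable]:
  "(\<lambda>f. \<chi> i. (f i :: real)) \<in> borel_measurable (Pi\<^sub>M (UNIV :: 'd::finite set) (\<lambda>_. borel))"
proof (subst borel_measurable_euclidean_space, rule ballI)
  fix b :: "real^'d" assume "b \<in> Basis"
  then obtain i where "b = axis i 1" by (auto simp: Basis_vec_def)
  then show "(\<lambda>f. (\<chi> i. f i) \<bullet> b) \<in> borel_measurable (Pi\<^sub>M (UNIV :: 'd::finite set) (\<lambda>_. borel))"
    by (simp flip: cart_eq_inner_axis) measurable
qed

text \<open>Lebesgue measure is determined by the volumes of boxes. As a product measure it allows a
  single coordinate to be integrated out.\<close>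

lemma lborel_vec_eq_PiM:
  "(lborel :: (real^'d) measure) = distr (Pi\<^sub>M UNIV (\<lambda>_. lborel)) borel (\<lambda>f. \<chi> i. f i)"
proof (rule lborel_eqI)
  interpret product_sigma_finite "\<lambda>_::'d. lborel :: real measure" ..
  fix l u :: "real^'d" assume lu: "\<And>b. b \<in> Basis \<Longrightarrow> l \<bullet> b \<le> u \<bullet> b"
  then have le: "l $ i \<le> u $ i" for i
    using lu[of "axis i 1"] by (simp add: cart_eq_inner_axis axis_in_Basis_iff)
  have meas: "(\<lambda>f. \<chi> i. f i) \<in> borel_measurable (Pi\<^sub>M (UNIV::'d set) (\<lambda>_. lborel :: real measure))"
    using measurable_vec_lambda_PiM by (simp cong: measurable_cong_sets sets_PiM_cong)
  have "emeasure (distr (Pi\<^sub>M UNIV (\<lambda>_. lborel)) borel (\<lambda>f. \<chi> i. f i)) (box l u) =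
     emeasure (Pi\<^sub>M UNIV (\<lambda>_. lborel)) (\<Pi>\<^sub>E i\<in>UNIV. {l $ i<..<u $ i})"
    by (subst emeasure_distr[OF meas]) (auto simp: mem_box_cart space_PiM PiE_def Pi_def intro!: arg_cong2[where f=emeasure])
  also have "\<dots> = (\<Prod>i\<in>UNIV. ennreal (u $ i - l $ i))"
    using le by (subst emeasure_PiM) auto
  also have "\<dots> = ennreal (\<Prod>b\<in>Basis. (u - l) \<bullet> b)"
    using le by (simp add: prod_Basis_vec prod_ennreal flip: cart_eq_inner_axis)
  finally show "emeasure (distr (Pi\<^sub>M UNIV (\<lambda>_. lborel)) borel (\<lambda>f. \<chi> i. f i)) (box l u) =
      ennreal (\<Prod>b\<in>Basis. (u - l) \<bullet> b)" .
qed simp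

definition coord_upd :: "real^'d \<Rightarrow> 'd \<Rightarrow> real \<Rightarrow> real^'d" where
  "coord_upd z i t = (\<chi> i'. if i' = i then t else z $ i')"

lemma coord_upd_in_cube: "z \<in> cbox 0 1 \<Longrightarrow> t \<in> {0..1} \<Longrightarrow> coord_upd z i t \<in> cbox 0 1"
  by (simp add: coord_upd_def mem_box_cart)

lemma coord_upd_diff: "coord_upd z i t - coord_upd z i a = axis i (t - a)"
  by (simp add: coord_upd_def vec_eq_iff axis_def)

lemma norm_axis_scaled: "norm (axis i t :: real^'d) = \<bar>t\<bar>"
proof -
  have "(axis i t :: real^'d) = t *\<^sub>R axis i 1" by (simp add: vec_eq_iff axis_def)
  then show ?thesis by simp
qed

text \<open>Coordinate \<open>i\<close> is integrated first with the others frozen: there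
  cancellation enters through \<open>A\<close>, whereas the remaining factors enter by their
  \<open>L^1\<close> norms. A tensor wavelet is only sure to have one coordinate with vanishing
  moments.\<close>

lemma cube_product_integral_bound:
  fixes f :: "real^'d \<Rightarrow> real" and F :: "'d \<Rightarrow> real \<Rightarrow> real"
  assumes f: "continuous_on (cbox 0 1) f" and F: "\<And>i. continuous_on {0..1} (F i)"
    and A: "\<And>z. z \<in> cbox 0 1 \<Longrightarrow> \<bar>LINT t:{0..1}|lborel. f (coord_upd z i t) * F i t\<bar> \<le> A"
    and b: "\<And>i'. i' \<noteq> i \<Longrightarrow> (LINT t:{0..1}|lborel. \<bar>F i' t\<bar>) \<le> b"
  shows "\<bar>LINT z:cbox 0 1|lborel. f z * (\<Prod>i\<in>UNIV. F i (z $ i))\<bar> \<le> A * b ^ (CARD('d) - 1)"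
proof -
  interpret product_sigma_finite "\<lambda>_::'d. lborel :: real measure" ..
  let ?P = "Pi\<^sub>M (UNIV::'d set) (\<lambda>_. lborel :: real measure)"
  let ?Q = "Pi\<^sub>M (UNIV - {i} :: 'd set) (\<lambda>_. lborel :: real measure)"
  define G where "G z = indicator (cbox 0 1) z *\<^sub>R (f z * (\<Prod>i\<in>UNIV. F i (z $ i)))" for z :: "real^'d"
  have A0: "A \<ge> 0" using A[of 0] by (force simp: mem_box_cart)
  have meas: "(\<lambda>f. \<chi> i. f i) \<in> measurable ?P borel"
    using measurable_vec_lambda_PiM by (simp cong: measurable_cong_sets sets_PiM_cong)
  have intG: "integrable lborel G"
    unfolding G_def
  proof (rule borel_integrable_compact)
    have "continuous_on (cbox 0 1) (\<lambda>z::real^'d. F i (z $ i))" for i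
      by (rule continuous_on_compose2[OF F]) (auto intro!: continuous_intros simp: mem_box_cart)
    then show "continuous_on (cbox 0 1) (\<lambda>z. f z * (\<Prod>i\<in>UNIV. F i (z $ i)))"
      by (intro continuous_intros f)
  qed simp
  have intG': "integrable ?P (\<lambda>x. G (\<chi> i. x i))"
    using intG by (subst (asm) lborel_vec_eq_PiM, subst (asm) integrable_distr_eq) (use meas intG in auto)
  have ins: "insert i (UNIV - {i}) = (UNIV :: 'd set)" by auto
  have "(LINT z:cbox 0 1|lborel. f z * (\<Prod>i\<in>UNIV. F i (z $ i))) = (LINT z|lborel. G z)"
    by (simp add: set_lebesgue_integral_def G_def)
  also have "\<dots> = (LINT x|?P. G (\<chi> i. x i))"
    using intG by (subst lborel_vec_eq_PiM, subst integral_distr) (use meas in auto)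
  also have "\<dots> = (LINT x|?Q. LINT y|lborel. G (\<chi> i'. (x(i := y)) i'))"
    using product_integral_insert[of "UNIV - {i}" i "\<lambda>x. G (\<chi> i. x i)"] intG' by (simp add: ins)
  finally have eq: "(LINT z:cbox 0 1|lborel. f z * (\<Prod>i\<in>UNIV. F i (z $ i))) =
     (LINT x|?Q. LINT y|lborel. G (\<chi> i'. (x(i := y)) i'))" .
  define H where "H x = (\<Prod>i'\<in>UNIV - {i}. indicator {0..1} (x i') *\<^sub>R \<bar>F i' (x i')\<bar>)" for x
  have intF: "integrable lborel (\<lambda>t. indicator {0..1} t *\<^sub>R \<bar>F i' t\<bar>)" for i'
    by (intro borel_integrable_compact continuous_intros F) auto
  have inner: "\<bar>LINT y|lborel. G (\<chi> i'. (x(i := y)) i')\<bar> \<le> A * H x" for x :: "'d \<Rightarrow> real"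
  proof (cases "\<forall>i'\<in>UNIV - {i}. x i' \<in> {0..1}")
    case True
    define z :: "real^'d" where "z = (\<chi> i'. if i' = i then 0 else x i')"
    have z: "z \<in> cbox 0 1" using True by (auto simp: z_def mem_box_cart)
    have upd: "(\<chi> i'. (x(i := y)) i') = coord_upd z i y" for y
      by (simp add: coord_upd_def z_def vec_eq_iff)
    have "G (coord_upd z i y) = (\<Prod>i'\<in>UNIV - {i}. F i' (x i')) * (indicator {0..1} y *\<^sub>R (f (coord_upd z i y) * F i y))" for y
    proof -
      have "(\<Prod>i'\<in>UNIV. F i' (coord_upd z i y $ i')) = F i y * (\<Prod>i'\<in>UNIV - {i}. F i' (coord_upd z i y $ i'))"
        by (subst prod.remove[of _ i]) (auto simp: coord_upd_def)
      also have "(\<Prod>i'\<in>UNIV - {i}. F i' (coord_upd z i y $ i')) = (\<Prod>i'\<in>UNIV - {i}. F i' (x i'))"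
        by (intro prod.cong) (auto simp: coord_upd_def z_def)
      finally have p: "(\<Prod>i'\<in>UNIV. F i' (coord_upd z i y $ i')) = F i y * (\<Prod>i'\<in>UNIV - {i}. F i' (x i'))" .
      have "coord_upd z i y \<in> cbox 0 1 \<longleftrightarrow> y \<in> {0..1}"
      proof
        assume "coord_upd z i y \<in> cbox 0 1"
        then have "0 \<le> coord_upd z i y $ i \<and> coord_upd z i y $ i \<le> 1" by (simp add: mem_box_cart)
        then show "y \<in> {0..1}" by (simp add: coord_upd_def)
      qed (rule coord_upd_in_cube[OF z])
      then have "indicator (cbox 0 1) (coord_upd z i y) = (indicator {0..1} y :: real)"
        by (simp add: indicator_def)
      then show ?thesis unfolding G_def p by simp
    qed
    then have "(LINT y|lborel. G (\<chi> i'. (x(i := y)) i')) =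
        (\<Prod>i'\<in>UNIV - {i}. F i' (x i')) * (LINT y:{0..1}|lborel. f (coord_upd z i y) * F i y)"
      unfolding upd set_lebesgue_integral_def by simp
    then have "\<bar>LINT y|lborel. G (\<chi> i'. (x(i := y)) i')\<bar> =
        (\<Prod>i'\<in>UNIV - {i}. \<bar>F i' (x i')\<bar>) * \<bar>LINT y:{0..1}|lborel. f (coord_upd z i y) * F i y\<bar>"
      by (simp add: abs_mult abs_prod)
    also have "\<dots> \<le> (\<Prod>i'\<in>UNIV - {i}. \<bar>F i' (x i')\<bar>) * A"
      by (intro mult_left_mono A z prod_nonneg) auto
    also have "(\<Prod>i'\<in>UNIV - {i}. \<bar>F i' (x i')\<bar>) = H x"
      unfolding H_def using True by (intro prod.cong) auto
    finally show ?thesis by (simp add: mult.commute)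
  next
    case False
    then obtain i' where i': "i' \<noteq> i" "x i' \<notin> {0..1}" by auto
    have "(\<chi> i'. (x(i := y)) i') \<notin> cbox 0 1" for y
      using i' by (auto simp: mem_box_cart intro!: exI[of _ i'])
    moreover have "H x \<ge> 0" by (simp add: H_def prod_nonneg)
    ultimately show ?thesis using A0 by (simp add: G_def)
  qed
  have intH: "integrable ?Q H" unfolding H_def by (intro product_integrable_prod intF) auto
  have "\<bar>LINT x|?Q. LINT y|lborel. G (\<chi> i'. (x(i := y)) i')\<bar> \<le> (LINT x|?Q. A * H x)"
  proof (cases "integrable ?Q (\<lambda>x. LINT y|lborel. G (\<chi> i'. (x(i := y)) i'))")
    case True
    have "\<bar>LINT x|?Q. LINT y|lborel. G (\<chi> i'. (x(i := y)) i')\<bar> \<le> (LINT x|?Q. \<bar>LINT y|lborel. G (\<chi> i'. (x(i := y)) i')\<bar>)"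
      by (rule integral_abs_bound)
    also have "\<dots> \<le> (LINT x|?Q. A * H x)"
      using True intH inner by (intro integral_mono) auto
    finally show ?thesis .
  next
    \<comment> \<open>The integral of a non-integrable function is 0 by convention, and the bound is
      nonnegative.\<close>
    case False
    have "0 \<le> (LINT x|?Q. A * H x)"
      using A0 by (intro Bochner_Integration.integral_nonneg mult_nonneg_nonneg) (auto simp: H_def prod_nonneg)
    with False show ?thesis by (simp add: not_integrable_integral_eq)
  qed
  also have "\<dots> = A * (\<Prod>i'\<in>UNIV - {i}. LINT t:{0..1}|lborel. \<bar>F i' t\<bar>)"
    unfolding H_def set_lebesgue_integral_def by (subst integral_mult_right_zero, subst product_integral_prod) (use intF in auto)
  also have "\<dots> \<le> A * (\<Prod>i'\<in>UNIV - {i}. b)"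
  proof (rule mult_left_mono[OF prod_mono A0])
    show "0 \<le> (LINT t:{0..1}|lborel. \<bar>F i' t\<bar>) \<and> (LINT t:{0..1}|lborel. \<bar>F i' t\<bar>) \<le> b" if "i' \<in> UNIV - {i}" for i'
      using b[of i'] that by (auto simp: set_lebesgue_integral_def intro!: Bochner_Integration.integral_nonneg)
  qed
  also have "\<dots> = A * b ^ (CARD('d) - 1)" by simp
  finally show ?thesis unfolding eq .
qed

section \<open>Taylor polynomials along coordinate lines\<close>

lemma polynomial_antiderivative:
  fixes Q :: "real poly" assumes "degree Q \<le> m"
  obtains P where "pderiv P = Q" "degree P \<le> Suc m"
proof
  let ?P = "\<Sum>k\<le>m. monom (coeff Q k / real (Suc k)) (Suc k)"
  show "pderiv ?P = Q"
    using assms by (auto simp: poly_eq_iff coeff_pderiv coeff_sum coeff_eq_0 not_le if_distrib[of "\<lambda>x. _ * x"] cong: if_cong)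
  show "degree ?P \<le> Suc m"
    by (intro degree_sum_le) (auto intro: order_trans[OF degree_monom_le])
qed

lemma holder_smooth_continuous: "holder_smooth m s f \<Longrightarrow> continuous_on (cbox 0 1) f"
  by (cases m) (auto intro: has_derivative_continuous_on)

text \<open>Polynomials in one coordinate are enough, because moments are used in one coordinate at
  a time. The polynomial of the partial derivative is integrated, its constant adjusted so that it
  meets \<open>f\<close> at \<open>a\<close>, and the error follows from the mean value bound.
  \<open>B\<close> is common to all lines and all \<open>a\<close>.\<close>

lemma holder_taylor:
  fixes f :: "real^'d \<Rightarrow> real"
  assumes "holder_smooth m s f" "s \<ge> 0"
  shows "\<exists>B\<ge>0. \<forall>z\<in>cbox 0 1. \<forall>a\<in>{0..1}. \<exists>P. degree P \<le> m \<and>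
    (\<forall>t\<in>{0..1}. \<bar>f (coord_upd z i t) - poly P t\<bar> \<le> B * \<bar>t - a\<bar> powr s * \<bar>t - a\<bar> ^ m)"
  using assms(1)
proof (induction m arbitrary: f)
  case 0
  then obtain B where B: "\<And>x y. x \<in> cbox 0 1 \<Longrightarrow> y \<in> cbox 0 1 \<Longrightarrow> \<bar>f x - f y\<bar> \<le> B * norm (x - y) powr s" by auto
  have "\<bar>f (coord_upd z i t) - f (coord_upd z i a)\<bar> \<le> \<bar>B\<bar> * \<bar>t - a\<bar> powr s"
    if "z \<in> cbox 0 1" "a \<in> {0..1}" "t \<in> {0..1}" for z a t
  proof -
    have "\<bar>f (coord_upd z i t) - f (coord_upd z i a)\<bar> \<le> B * norm (coord_upd z i t - coord_upd z i a) powr s"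
      using that by (intro B coord_upd_in_cube)
    also have "\<dots> = B * \<bar>t - a\<bar> powr s" by (simp add: coord_upd_diff norm_axis_scaled)
    also have "\<dots> \<le> \<bar>B\<bar> * \<bar>t - a\<bar> powr s" by (intro mult_right_mono) auto
    finally show ?thesis .
  qed
  then show ?case
    by (intro exI[of _ "\<bar>B\<bar>"] conjI ballI abs_ge_zero) (rule_tac x="[:f (coord_upd z i a):]" in exI, simp)
next
  case (Suc m)
  from Suc.prems obtain f' :: "'d \<Rightarrow> real^'d \<Rightarrow> real" where
    f': "\<And>x. x \<in> cbox 0 1 \<Longrightarrow> (f has_derivative (\<lambda>v. \<Sum>i\<in>UNIV. v $ i * f' i x)) (at x within cbox 0 1)"
    "\<And>i. holder_smooth m s (f' i)" by auto
  from Suc.IH[OF f'(2)[of i]] obtain B where B: "B \<ge> 0"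
    "\<And>z a. z \<in> cbox 0 1 \<Longrightarrow> a \<in> {0..1} \<Longrightarrow> \<exists>P. degree P \<le> m \<and>
      (\<forall>t\<in>{0..1}. \<bar>f' i (coord_upd z i t) - poly P t\<bar> \<le> B * \<bar>t - a\<bar> powr s * \<bar>t - a\<bar> ^ m)" by blast
  have "\<exists>P. degree P \<le> Suc m \<and>
    (\<forall>t\<in>{0..1}. \<bar>f (coord_upd z i t) - poly P t\<bar> \<le> B * \<bar>t - a\<bar> powr s * \<bar>t - a\<bar> ^ Suc m)"
    if z: "z \<in> cbox 0 1" and a: "a \<in> {0..1}" for z a
  proof -
    obtain Q where Q: "degree Q \<le> m" "\<And>t. t \<in> {0..1} \<Longrightarrow> \<bar>f' i (coord_upd z i t) - poly Q t\<bar> \<le> B * \<bar>t - a\<bar> powr s * \<bar>t - a\<bar> ^ m"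
      using B(2)[OF z a] by blast
    obtain R where R: "pderiv R = Q" "degree R \<le> Suc m" using polynomial_antiderivative[OF Q(1)] by blast
    define P where "P = R + [:f (coord_upd z i a) - poly R a:]"
    have dP: "degree P \<le> Suc m" unfolding P_def using R(2) by (intro degree_add_le) auto
    define D where "D t = f (coord_upd z i t) - poly P t" for t
    have Da: "D a = 0" by (simp add: D_def P_def)
    have der: "(D has_field_derivative (f' i (coord_upd z i t) - poly Q t)) (at t within {0..1})" if t: "t \<in> {0..1}" for t
    proof -
      have g: "((\<lambda>t. coord_upd z i t) has_derivative (\<lambda>v. axis i v)) (at t within {0..1})"
      proof -
        define z0 where "z0 = coord_upd z i 0"
        have e: "coord_upd z i = (\<lambda>t. z0 + t *\<^sub>R axis i 1)"
          by (simp add: z0_def coord_upd_def vec_eq_iff axis_def fun_eq_iff)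
        have a: "axis i = (\<lambda>v. v *\<^sub>R (axis i 1 :: real^'d))" by (simp add: vec_eq_iff axis_def fun_eq_iff)
        show ?thesis unfolding e by (subst (2) a) (auto intro!: derivative_eq_intros)
      qed
      have "((\<lambda>t. f (coord_upd z i t)) has_derivative (\<lambda>v. \<Sum>i'\<in>UNIV. axis i v $ i' * f' i' (coord_upd z i t))) (at t within {0..1})"
        using coord_upd_in_cube[OF z] t
        by (intro has_derivative_in_compose2[OF f'(1) _ _ g]) auto
      moreover have "(\<Sum>i'\<in>UNIV. axis i v $ i' * f' i' (coord_upd z i t)) = f' i (coord_upd z i t) * v" for v
        by (subst sum.remove[of _ i]) (auto simp: axis_def intro!: sum.neutral)
      ultimately have "((\<lambda>t. f (coord_upd z i t)) has_field_derivative f' i (coord_upd z i t)) (at t within {0..1})"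
        by (simp add: has_field_derivative_def)
      moreover have "((\<lambda>t. poly P t) has_field_derivative poly Q t) (at t within {0..1})"
        using poly_DERIV[of P t] by (auto simp: P_def R(1) pderiv_add pderiv_pCons intro: DERIV_subset)
      ultimately show ?thesis unfolding D_def by (rule DERIV_diff)
    qed
    have "\<bar>f (coord_upd z i t) - poly P t\<bar> \<le> B * \<bar>t - a\<bar> powr s * \<bar>t - a\<bar> ^ Suc m" if t: "t \<in> {0..1}" for t
    proof -
      have sub: "closed_segment a t \<subseteq> {0..1}" using a t by (auto simp: closed_segment_eq_real_ivl)
      have "norm (D t - D a) \<le> (B * \<bar>t - a\<bar> powr s * \<bar>t - a\<bar> ^ m) * norm (t - a)"
      proof (rule field_differentiable_bound[where S="closed_segment a t"])
        fix u assume u: "u \<in> closed_segment a t"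
        then have ua: "\<bar>u - a\<bar> \<le> \<bar>t - a\<bar>" by (auto simp: closed_segment_eq_real_ivl split: if_splits)
        show "(D has_field_derivative (f' i (coord_upd z i u) - poly Q u)) (at u within closed_segment a t)"
          using sub u by (intro DERIV_subset[OF der]) auto
        have "\<bar>f' i (coord_upd z i u) - poly Q u\<bar> \<le> B * \<bar>u - a\<bar> powr s * \<bar>u - a\<bar> ^ m"
          using sub u by (intro Q) auto
        also have "\<dots> \<le> B * \<bar>t - a\<bar> powr s * \<bar>t - a\<bar> ^ m"
          using ua B(1) assms(2) by (intro mult_mono powr_mono2 power_mono mult_nonneg_nonneg) auto
        finally show "norm (f' i (coord_upd z i u) - poly Q u) \<le> B * \<bar>t - a\<bar> powr s * \<bar>t - a\<bar> ^ m" by simp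
      qed auto
      then show ?thesis using Da by (simp add: D_def mult_ac)
    qed
    with dP show ?thesis by blast
  qed
  with B(1) show ?case by blast
qed

section \<open>Uniform approximation by tensor wavelets\<close>

abbreviation levels_upto :: "nat \<Rightarrow> nat \<Rightarrow> (nat \<times> nat) set" where
  "levels_upto d L \<equiv> {p \<in> level_index d. fst p \<le> L}"

lemma levels_upto_Sigma: "levels_upto d L = Sigma {1..L} (\<lambda>l. {1..2 ^ (l * d)})"
  by (auto simp: level_index_def)

lemma wavelet_series_sum:
  fixes \<psi> :: "nat \<Rightarrow> nat \<Rightarrow> real^'d \<Rightarrow> real"
  shows "wavelet_series \<psi> (L, c) z = (\<Sum>p\<in>levels_upto CARD('d) L. c p * \<psi> (fst p) (snd p) z)"
  unfolding levels_upto_Sigma by (simp add: sum.Sigma case_prod_unfold)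

lemma finite_levels_upto: "finite (levels_upto d L)"
  unfolding levels_upto_Sigma by auto

lemma card_levels_upto:
  assumes "d \<ge> 1" shows "card (levels_upto d l) < 2 ^ ((l + 1) * d)"
proof -
  have "(\<Sum>l'=1..l. 2 ^ (l' * d)) < (2::nat) ^ ((l + 1) * d)"
  proof (induction l)
    case (Suc l)
    have "(\<Sum>l'=1..Suc l. (2::nat) ^ (l' * d)) < 2 ^ (Suc l * d) + 2 ^ (Suc l * d)" using Suc by simp
    also have "\<dots> = 2 ^ (Suc l * d + 1)" by simp
    also have "\<dots> \<le> 2 ^ ((Suc l + 1) * d)" using assms by (intro power_increasing) auto
    finally show ?case .
  qed (use assms in simp)
  then show ?thesis unfolding levels_upto_Sigma by (subst card_SigmaI) auto
qed

lemma cube_set_integrable: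
  fixes g :: "real^'d \<Rightarrow> real"
  shows "continuous_on (cbox 0 1) g \<Longrightarrow> set_integrable lborel (cbox 0 1) g"
  unfolding set_integrable_def by (intro borel_integrable_compact) auto

lemma cube_integral_mono:
  fixes f g :: "real^'d \<Rightarrow> real"
  assumes "continuous_on (cbox 0 1) f" "continuous_on (cbox 0 1) g" "\<And>z. z \<in> cbox 0 1 \<Longrightarrow> f z \<le> g z"
  shows "(LINT z:cbox 0 1|lborel. f z) \<le> (LINT z:cbox 0 1|lborel. g z)"
  by (intro set_integral_mono cube_set_integrable assms) auto

lemma cube_integral_const: "(LINT z:(cbox 0 1 :: (real^'d) set)|lborel. c :: real) = c"
proof -
  have le: "\<forall>b\<in>Basis. (0 :: real^'d) \<bullet> b \<le> 1 \<bullet> b"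
    by (auto simp: Basis_vec_def simp flip: cart_eq_inner_axis)
  have "(\<Prod>b\<in>Basis. (1 - 0 :: real^'d) \<bullet> b) = 1"
    by (subst prod_Basis_vec) (simp flip: cart_eq_inner_axis)
  with le have "measure lborel (cbox 0 1 :: (real^'d) set) = 1"
    by (simp add: measure_lborel_cbox_eq)
  then show ?thesis by (simp add: set_lebesgue_integral_def)
qed

section \<open>Size and coefficients of the tensor wavelets\<close>

locale tensor_wavelets =
  fixes \<psi> :: "nat \<Rightarrow> nat \<Rightarrow> real^'d \<Rightarrow> real" and N J :: nat and B :: real
    and \<phi> w :: "real \<Rightarrow> real" and \<phi>L \<phi>R \<psi>L \<psi>R :: "nat \<Rightarrow> real \<Rightarrow> real"
    and \<iota> :: "nat \<times> nat \<Rightarrow> nat \<times> ('d \<Rightarrow> bool) \<times> ('d \<Rightarrow> nat)"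
  assumes ob: "cube_orthonormal_basis \<psi>"
    and fam_scal: "interval_family N B \<phi> \<phi>L \<phi>R"
    and fam_wav: "interval_family N B w \<psi>L \<psi>R"
    and van: "vanishing_moments N w \<psi>L \<psi>R"
    and J: "2 * N \<le> 2 ^ J"
    and bij: "bij_betw \<iota> (level_index CARD('d)) (tensor_index J)"
    and mono: "\<And>p q. p \<in> level_index CARD('d) \<Longrightarrow> q \<in> level_index CARD('d) \<Longrightarrow> fst p < fst q \<Longrightarrow>
       tensor_resolution (\<iota> p) \<le> tensor_resolution (\<iota> q)"
    and eq: "\<And>p z. p \<in> level_index CARD('d) \<Longrightarrow> z \<in> cbox 0 1 \<Longrightarrow>
       \<psi> (fst p) (snd p) z = tensor_fun (interval_fun N \<phi> \<phi>L \<phi>R) (interval_fun N w \<psi>L \<psi>R) (\<iota> p) z"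
begin

abbreviation "scal \<equiv> interval_fun N \<phi> \<phi>L \<phi>R"
abbreviation "wav \<equiv> interval_fun N w \<psi>L \<psi>R"
abbreviation "\<Psi> p \<equiv> \<psi> (fst p) (snd p)"

definition factor :: "bool \<Rightarrow> nat \<Rightarrow> nat \<Rightarrow> real \<Rightarrow> real" where
  "factor e = (if e then wav else scal)"

lemma tensor_fun_factor: "tensor_fun scal wav (j, e, k) z = (\<Prod>i\<in>UNIV. factor (e i) j (k i) (z $ i))"
  by (simp add: factor_def)

lemma pos: "N \<ge> 1" "B > 0" using interval_family_facts(1,2)[OF fam_scal J] by auto

lemma J_mono: "J \<le> j \<Longrightarrow> 2 * N \<le> 2 ^ j"
  using J by (meson one_le_numeral order_trans power_increasing)

lemma factor_facts:
  assumes "J \<le> j"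
  shows "k < 2 ^ j \<Longrightarrow> x \<in> {0..1} \<Longrightarrow> \<bar>factor e j k x\<bar> \<le> sqrt (2 ^ j) * B"
    "x \<in> {0..1} \<Longrightarrow> (\<Sum>k<2 ^ j. \<bar>factor e j k x\<bar>) \<le> sqrt (2 ^ j) * (5 * real N * B)"
    "k < 2 ^ j \<Longrightarrow> continuous_on {0..1} (factor e j k)"
    "k < 2 ^ j \<Longrightarrow> (LINT x:{0..1}|lborel. \<bar>factor e j k x\<bar>) \<le> 4 * real N * B * sqrt (2 ^ j) / 2 ^ j"
  using interval_fun_bound[OF fam_scal J_mono[OF assms]] interval_fun_bound[OF fam_wav J_mono[OF assms]]
    interval_fun_sum_bound[OF fam_scal J_mono[OF assms]] interval_fun_sum_bound[OF fam_wav J_mono[OF assms]]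
    interval_fun_continuous[OF fam_scal J_mono[OF assms]] interval_fun_continuous[OF fam_wav J_mono[OF assms]]
    interval_fun_L1[OF fam_scal J_mono[OF assms]] interval_fun_L1[OF fam_wav J_mono[OF assms]]
  unfolding factor_def by (cases e; simp)+

lemma cube_coord: "z \<in> cbox 0 1 \<Longrightarrow> (z :: real^'d) $ i \<in> {0..1}"
  by (simp add: mem_box_cart)

lemma tensor_bound:
  fixes e :: "'d \<Rightarrow> bool"
  assumes "(j, e, k) \<in> tensor_index J" "z \<in> cbox 0 1"
  shows "\<bar>tensor_fun scal wav (j, e, k) z\<bar> \<le> (sqrt (2 ^ j) * B) ^ CARD('d)"
proof -
  have "\<bar>tensor_fun scal wav (j, e, k) z\<bar> = (\<Prod>i\<in>UNIV. \<bar>factor (e i) j (k i) (z $ i)\<bar>)"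
    by (simp only: tensor_fun_factor abs_prod)
  also have "\<dots> \<le> (\<Prod>i\<in>(UNIV::'d set). sqrt (2 ^ j) * B)"
    using assms cube_coord[OF assms(2)] by (intro prod_mono conjI factor_facts(1)) (auto simp: tensor_index_def)
  finally show ?thesis by simp
qed

lemma tensor_continuous:
  fixes e :: "'d \<Rightarrow> bool"
  assumes "(j, e, k) \<in> tensor_index J"
  shows "continuous_on (cbox 0 1) (tensor_fun scal wav (j, e, k))"
proof -
  have "continuous_on (cbox 0 1) (\<lambda>z::real^'d. factor (e i) j (k i) (z $ i))" for i
    by (rule continuous_on_compose2[OF factor_facts(3)])
       (use assms cube_coord in \<open>auto intro!: continuous_intros simp: tensor_index_def\<close>)
  then have "continuous_on (cbox 0 1) (\<lambda>z::real^'d. \<Prod>i\<in>UNIV. factor (e i) j (k i) (z $ i))"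
    by (intro continuous_intros)
  then show ?thesis by (simp only: tensor_fun_factor[symmetric])
qed

lemma tensor_sum_bound:
  fixes e :: "'d \<Rightarrow> bool"
  assumes "J \<le> j" "z \<in> cbox 0 1"
  shows "(\<Sum>k | \<forall>i. k i < 2 ^ j. \<bar>tensor_fun scal wav (j, e, k) z\<bar>) \<le> (sqrt (2 ^ j) * (5 * real N * B)) ^ CARD('d)"
proof -
  have "{k. \<forall>i. k i < 2 ^ j} = PiE (UNIV :: 'd set) (\<lambda>_. {..<2 ^ j :: nat})" by (auto simp: PiE_def)
  then have "(\<Sum>k | \<forall>i. k i < 2 ^ j. \<bar>tensor_fun scal wav (j, e, k) z\<bar>) =
     (\<Sum>k\<in>PiE (UNIV :: 'd set) (\<lambda>_. {..<2 ^ j :: nat}). \<Prod>i\<in>UNIV. \<bar>factor (e i) j (k i) (z $ i)\<bar>)"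
    by (simp only: tensor_fun_factor abs_prod)
  also have "\<dots> = (\<Prod>i\<in>UNIV. \<Sum>k<2 ^ j. \<bar>factor (e i) j k (z $ i)\<bar>)"
    by (subst prod_sum_PiE) auto
  also have "\<dots> \<le> (\<Prod>i\<in>(UNIV::'d set). sqrt (2 ^ j) * (5 * real N * B))"
    using assms cube_coord[OF assms(2)] by (intro prod_mono conjI factor_facts(2) sum_nonneg) auto
  finally show ?thesis by simp
qed

lemma \<Psi>_tensor:
  assumes "p \<in> level_index CARD('d)"
  obtains j e k where "\<iota> p = (j, e, k)" "(j, e, k) \<in> tensor_index J"
    "\<And>z. z \<in> cbox 0 1 \<Longrightarrow> \<Psi> p z = tensor_fun scal wav (j, e, k) z"
proof -
  obtain j e k where "\<iota> p = (j, e, k)" by (metis prod_cases3)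
  moreover have "\<iota> p \<in> tensor_index J" using bij assms by (auto simp: bij_betw_def)
  ultimately show ?thesis using that[of j e k] eq[OF assms] by simp
qed

lemma \<Psi>_continuous: "p \<in> level_index CARD('d) \<Longrightarrow> continuous_on (cbox 0 1) (\<Psi> p)"
  by (erule \<Psi>_tensor) (use tensor_continuous in \<open>auto cong: continuous_on_cong simp del: tensor_fun.simps\<close>)

text \<open>The Taylor polynomial at the centre of the support has degree below \<open>N\<close> and
  is annihilated. What is left is its error on an interval of radius \<open>2 * N / 2 ^ j\<close>,
  times the \<open>L^1\<close> norm of the wavelet.\<close>

lemma factor_moment_bound:
  fixes h :: "real \<Rightarrow> real"
  assumes j: "J \<le> j" and k: "k < 2 ^ j" and h: "continuous_on {0..1} h" and H: "H \<ge> 0" and s: "s \<ge> 0"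
    and m: "m < N"
    and P: "\<And>a. a \<in> {0..1} \<Longrightarrow> \<exists>P. degree P \<le> m \<and> (\<forall>t\<in>{0..1}. \<bar>h t - poly P t\<bar> \<le> H * \<bar>t - a\<bar> powr s * \<bar>t - a\<bar> ^ m)"
  shows "\<bar>LINT t:{0..1}|lborel. h t * wav j k t\<bar> \<le>
    H * (2 * real N / 2 ^ j) powr s * (2 * real N / 2 ^ j) ^ m * (4 * real N * B * sqrt (2 ^ j) / 2 ^ j)"
proof -
  note jj = J_mono[OF j]
  define \<delta> where "\<delta> = 2 * real N / 2 ^ j"
  obtain a where a: "a \<in> {0..1}" "\<And>x. x \<in> {0..1} \<Longrightarrow> wav j k x \<noteq> 0 \<Longrightarrow> \<bar>x - a\<bar> \<le> \<delta>"
    using interval_fun_support[OF fam_wav jj k] unfolding \<delta>_def by blast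
  obtain P where P: "degree P \<le> m" "\<And>t. t \<in> {0..1} \<Longrightarrow> \<bar>h t - poly P t\<bar> \<le> H * \<bar>t - a\<bar> powr s * \<bar>t - a\<bar> ^ m"
    using P[OF a(1)] by blast
  note cw = interval_fun_continuous[OF fam_wav jj k]
  have integ: "set_integrable lborel {0..1} g" if "continuous_on {0..1} g" for g :: "real \<Rightarrow> real"
    using that unfolding set_integrable_def by (intro borel_integrable_compact) auto
  have 0: "(LINT t:{0..1}|lborel. poly P t * wav j k t) = 0"
    using P(1) m by (intro interval_fun_moment[OF fam_wav jj k van]) auto
  have sub: "(LINT t:{0..1}|lborel. h t * wav j k t) = (LINT t:{0..1}|lborel. h t * wav j k t - poly P t * wav j k t)"
    using 0 by (subst set_integral_diff) (auto intro!: integ continuous_intros h cw)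
  have "\<bar>LINT t:{0..1}|lborel. h t * wav j k t\<bar> \<le> (LINT t:{0..1}|lborel. \<bar>h t * wav j k t - poly P t * wav j k t\<bar>)"
    unfolding sub
    unfolding set_lebesgue_integral_def
    by (rule order_trans[OF integral_abs_bound]) (simp add: abs_mult)
  also have "\<dots> \<le> (LINT t:{0..1}|lborel. (H * \<delta> powr s * \<delta> ^ m) * \<bar>wav j k t\<bar>)"
  proof (rule set_integral_mono)
    have cp: "continuous_on {0..1} (\<lambda>t. poly P t)"
      by (intro continuous_at_imp_continuous_on ballI poly_isCont)
    show "set_integrable lborel {0..1} (\<lambda>t. \<bar>h t * wav j k t - poly P t * wav j k t\<bar>)"
      by (intro integ continuous_on_rabs continuous_on_diff continuous_on_mult h cw cp)
    show "set_integrable lborel {0..1} (\<lambda>t. (H * \<delta> powr s * \<delta> ^ m) * \<bar>wav j k t\<bar>)"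
      by (intro integ continuous_on_rabs continuous_on_mult continuous_on_const cw)
    fix t :: real assume t: "t \<in> {0..1}"
    show "\<bar>h t * wav j k t - poly P t * wav j k t\<bar> \<le> (H * \<delta> powr s * \<delta> ^ m) * \<bar>wav j k t\<bar>"
    proof (cases "wav j k t = 0")
      case False
      have "\<bar>h t - poly P t\<bar> \<le> H * \<bar>t - a\<bar> powr s * \<bar>t - a\<bar> ^ m" using P(2)[OF t] .
      also have "\<dots> \<le> H * \<delta> powr s * \<delta> ^ m"
        using a(2)[OF t False] H s by (intro mult_mono powr_mono2 power_mono mult_nonneg_nonneg) auto
      finally show ?thesis
        unfolding left_diff_distrib[symmetric] abs_mult by (intro mult_right_mono) auto
    qed simp
  qed
  also have "\<dots> = (H * \<delta> powr s * \<delta> ^ m) * (LINT t:{0..1}|lborel. \<bar>wav j k t\<bar>)" by simp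
  also have "\<dots> \<le> (H * \<delta> powr s * \<delta> ^ m) * (4 * real N * B * sqrt (2 ^ j) / 2 ^ j)"
    using H by (intro mult_left_mono interval_fun_L1[OF fam_wav jj k] mult_nonneg_nonneg) (auto simp: \<delta>_def)
  finally show ?thesis by (simp add: \<delta>_def)
qed

text \<open>Some coordinate carries a wavelet, and the cancellation is taken from this coordinate
  alone.\<close>

lemma tensor_coefficient_bound:
  fixes f :: "real^'d \<Rightarrow> real"
  assumes f: "holder_smooth m s f" and s: "s \<ge> 0" and m: "m < N"
  shows "\<exists>H\<ge>0. \<forall>j e k. (j, e, k) \<in> tensor_index J \<longrightarrow> (\<exists>i. e i) \<longrightarrow>
    \<bar>LINT z:cbox 0 1|lborel. f z * tensor_fun scal wav (j, e, k) z\<bar> \<le>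
      H * (2 * real N / 2 ^ j) powr s * (2 * real N / 2 ^ j) ^ m * (4 * real N * B * sqrt (2 ^ j) / 2 ^ j) ^ CARD('d)"
proof -
  have "\<forall>i. \<exists>H\<ge>0. \<forall>z\<in>cbox 0 1. \<forall>a\<in>{0..1}. \<exists>P. degree P \<le> m \<and>
    (\<forall>t\<in>{0..1}. \<bar>f (coord_upd z i t) - poly P t\<bar> \<le> H * \<bar>t - a\<bar> powr s * \<bar>t - a\<bar> ^ m)"
    using holder_taylor[OF f s] by blast
  then obtain Hi where Hi: "\<And>i. Hi i \<ge> 0" "\<And>i z a. z \<in> cbox 0 1 \<Longrightarrow> a \<in> {0..1} \<Longrightarrow> \<exists>P. degree P \<le> m \<and>
    (\<forall>t\<in>{0..1}. \<bar>f (coord_upd z i t) - poly P t\<bar> \<le> Hi i * \<bar>t - a\<bar> powr s * \<bar>t - a\<bar> ^ m)"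
    by metis
  \<comment> \<open>Which coordinate it is depends on the index, so the constants of all coordinates
    are added.\<close>
  define H where "H = (\<Sum>i\<in>UNIV. Hi i)"
  have H: "H \<ge> 0" "Hi i \<le> H" for i
    unfolding H_def using Hi(1) by (auto intro!: sum_nonneg member_le_sum)
  have "\<bar>LINT z:cbox 0 1|lborel. f z * tensor_fun scal wav (j, e, k) z\<bar> \<le>
      H * (2 * real N / 2 ^ j) powr s * (2 * real N / 2 ^ j) ^ m * (4 * real N * B * sqrt (2 ^ j) / 2 ^ j) ^ CARD('d)"
    if jek: "(j, e, k) \<in> tensor_index J" and i: "e i" for j e k i
  proof -
    from jek have j: "J \<le> j" and k: "\<And>i. k i < 2 ^ j" by (auto simp: tensor_index_def)
    let ?b = "4 * real N * B * sqrt (2 ^ j) / 2 ^ j"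
    let ?A = "H * (2 * real N / 2 ^ j) powr s * (2 * real N / 2 ^ j) ^ m * ?b"
    have "\<bar>LINT z:cbox 0 1|lborel. f z * (\<Prod>i\<in>UNIV. factor (e i) j (k i) (z $ i))\<bar> \<le> ?A * ?b ^ (CARD('d) - 1)"
    proof (rule cube_product_integral_bound[where i=i])
      show "continuous_on (cbox 0 1) f" by (rule holder_smooth_continuous[OF f])
      show "continuous_on {0..1} (factor (e i) j (k i))" for i by (rule factor_facts(3)[OF j k])
      show "(LINT t:{0..1}|lborel. \<bar>factor (e i') j (k i') t\<bar>) \<le> ?b" for i' by (rule factor_facts(4)[OF j k])
      fix z :: "real^'d" assume z: "z \<in> cbox 0 1"
      have "\<bar>LINT t:{0..1}|lborel. f (coord_upd z i t) * wav j (k i) t\<bar> \<le> ?A"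
      proof (rule factor_moment_bound[OF j k _ H(1) s m])
        have "continuous_on {0..1} (coord_upd z i)"
          unfolding coord_upd_def[abs_def]
        proof (rule continuous_on_vec_lambda)
          fix i'
          show "continuous_on {0..1} (\<lambda>t. if i' = i then t else z $ i')"
            by (cases "i' = i") (auto intro: continuous_intros)
        qed
        then show "continuous_on {0..1} (\<lambda>t. f (coord_upd z i t))"
          using coord_upd_in_cube[OF z] by (intro continuous_on_compose2[OF holder_smooth_continuous[OF f]]) auto
        fix a :: real assume "a \<in> {0..1}"
        from Hi(2)[OF z this, of i] obtain P where P: "degree P \<le> m"
          "\<And>t. t \<in> {0..1} \<Longrightarrow> \<bar>f (coord_upd z i t) - poly P t\<bar> \<le> Hi i * \<bar>t - a\<bar> powr s * \<bar>t - a\<bar> ^ m" by blast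
        have "\<bar>f (coord_upd z i t) - poly P t\<bar> \<le> H * \<bar>t - a\<bar> powr s * \<bar>t - a\<bar> ^ m" if t: "t \<in> {0..1}" for t
          by (rule order_trans[OF P(2)[OF t]]) (intro mult_right_mono H(2), simp_all)
        with P(1) show "\<exists>P. degree P \<le> m \<and> (\<forall>t\<in>{0..1}. \<bar>f (coord_upd z i t) - poly P t\<bar> \<le> H * \<bar>t - a\<bar> powr s * \<bar>t - a\<bar> ^ m)"
          by blast
      qed
      then show "\<bar>LINT t:{0..1}|lborel. f (coord_upd z i t) * factor (e i) j (k i) t\<bar> \<le> ?A"
        using i by (simp add: factor_def)
    qed
    moreover have "?b ^ CARD('d) = ?b * ?b ^ (CARD('d) - 1)" using power_eq_if[of ?b "CARD('d)"] by simp
    ultimately show ?thesis by (simp only: tensor_fun_factor mult.assoc)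
  qed
  with H(1) show ?thesis by blast
qed

text \<open>Truncation by the true scale of the wavelets. The numbering by \<open>l\<close> may put
  different scales on one level, so decay estimates cannot follow it directly.\<close>

definition level_set :: "nat \<Rightarrow> (nat \<times> nat) set" where
  "level_set m = {p \<in> level_index CARD('d). tensor_resolution (\<iota> p) \<le> m}"

text \<open>On each scale \<open>j <= m\<close> there are at most \<open>2 ^ d\<close> types and
  \<open>2 ^ (j * d)\<close> locations, summed geometrically. The strict inequality is what the
  counting below contradicts.\<close>

lemma finite_resolution:
  "finite {t \<in> tensor_index J :: (nat \<times> ('d \<Rightarrow> bool) \<times> ('d \<Rightarrow> nat)) set. tensor_resolution t \<le> m}"
  "card {t \<in> tensor_index J :: (nat \<times> ('d \<Rightarrow> bool) \<times> ('d \<Rightarrow> nat)) set. tensor_resolution t \<le> m} < 2 ^ ((m + 2) * CARD('d))"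
proof -
  let ?T = "{t \<in> tensor_index J :: (nat \<times> ('d \<Rightarrow> bool) \<times> ('d \<Rightarrow> nat)) set. tensor_resolution t \<le> m}"
  let ?K = "\<lambda>j. {k :: 'd \<Rightarrow> nat. \<forall>i. k i < 2 ^ j}"
  let ?U = "Sigma {..m} (\<lambda>j. (UNIV :: ('d \<Rightarrow> bool) set) \<times> ?K j)"
  have K: "?K j = PiE (UNIV :: 'd set) (\<lambda>_. {..<2 ^ j})" for j by (auto simp: PiE_def)
  have fK: "finite (?K j)" for j unfolding K by (intro finite_PiE) auto
  have cK: "card (?K j) = (2 ^ CARD('d)) ^ j" for j
    unfolding K by (simp add: card_PiE mult.commute flip: power_mult)
  have sub: "?T \<subseteq> ?U" by (auto simp: tensor_index_def split: if_splits)
  have fU: "finite ?U" using fK by (intro finite_SigmaI finite_cartesian_product) auto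
  then show "finite ?T" using sub by (rule finite_subset[rotated])
  have geo: "(\<Sum>j\<le>m. x ^ j) < x ^ Suc m" if "x \<ge> 2" for x m :: nat
  proof (induction m)
    case (Suc m)
    have "(\<Sum>j\<le>Suc m. x ^ j) < x ^ Suc m + x ^ Suc m" using Suc by simp
    also have "\<dots> \<le> x ^ Suc (Suc m)" using mult_le_mono1[OF that, of "x ^ Suc m"] by (simp only: mult_2 power_Suc)
    finally show ?case .
  qed (use that in simp)
  have "card ?T \<le> card ?U" using sub fU by (rule card_mono[rotated])
  also have "\<dots> = (\<Sum>j\<le>m. 2 ^ CARD('d) * (2 ^ CARD('d)) ^ j)"
    using fK by (subst card_SigmaI) (auto simp: card_cartesian_product cK card_fun card_UNIV_bool)
  also have "\<dots> = 2 ^ CARD('d) * (\<Sum>j\<le>m. (2 ^ CARD('d)) ^ j)" by (simp add: sum_distrib_left)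
  also have "\<dots> < 2 ^ CARD('d) * (2 ^ CARD('d)) ^ Suc m"
    using geo[of "2 ^ CARD('d)" m] power_increasing[of 1 "CARD('d)" "2::nat"] by simp
  also have "\<dots> = 2 ^ ((m + 2) * CARD('d))" by (simp add: power_mult power_add mult.commute[of _ "CARD('d)"])
  finally show "card ?T < 2 ^ ((m + 2) * CARD('d))" .
qed

lemma bij_subset: "bij_betw \<iota> {p \<in> level_index CARD('d). Q (\<iota> p)} {t \<in> tensor_index J. Q t}"
proof (rule bij_betw_subset[OF bij])
  show "\<iota> ` {p \<in> level_index CARD('d). Q (\<iota> p)} = {t \<in> tensor_index J. Q t}"
    unfolding bij_betw_imp_surj_on[OF bij, symmetric] by auto
qed auto

lemma finite_level_set: "finite (level_set m)"
  using bij_betw_finite[OF bij_subset[of "\<lambda>t. tensor_resolution t \<le> m"]] finite_resolution(1)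
  by (simp add: level_set_def)

text \<open>Counting: otherwise monotonicity would put the whole level \<open>m + 2\<close>, which
  has \<open>2 ^ ((m + 2) * d)\<close> indices, at resolution at most \<open>m\<close>, and there
  are fewer such wavelets.\<close>

lemma level_le_resolution:
  assumes p: "p \<in> level_set m" shows "fst p \<le> m + 2"
proof (rule ccontr)
  assume "\<not> fst p \<le> m + 2"
  let ?A = "{m + 2} \<times> {1..2 ^ ((m + 2) * CARD('d))} :: (nat \<times> nat) set"
  have A: "?A \<subseteq> level_index CARD('d)" by (auto simp: level_index_def)
  have "?A \<subseteq> level_set m"
  proof
    fix q assume q: "q \<in> ?A"
    then have "tensor_resolution (\<iota> q) \<le> tensor_resolution (\<iota> p)"
      using A p \<open>\<not> fst p \<le> m + 2\<close> by (intro mono) (auto simp: level_set_def)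
    then show "q \<in> level_set m" using q A p by (auto simp: level_set_def)
  qed
  then have "card ?A \<le> card (level_set m)" by (intro card_mono finite_level_set)
  also have "card (level_set m) = card {t \<in> tensor_index J :: (nat \<times> ('d \<Rightarrow> bool) \<times> ('d \<Rightarrow> nat)) set. tensor_resolution t \<le> m}"
    unfolding level_set_def by (rule bij_betw_same_card[OF bij_subset[of "\<lambda>t. tensor_resolution t \<le> m"]])
  also have "\<dots> < 2 ^ ((m + 2) * CARD('d))" by (rule finite_resolution(2))
  finally show False by (simp add: card_cartesian_product)
qed

text \<open>Counting in the other direction: otherwise all pure wavelets of scale \<open>m\<close>
  would be numbered no later than the level of \<open>p\<close>, where there is not enough
  room.\<close>

lemma resolution_le_level:
  assumes p: "p \<in> level_index CARD('d)" shows "tensor_resolution (\<iota> p) \<le> fst p + J + 2"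
proof (rule ccontr)
  assume not: "\<not> tensor_resolution (\<iota> p) \<le> fst p + J + 2"
  \<comment> \<open>\<open>J\<close> is added so that scale \<open>m\<close> exists. Its wavelets
    have resolution \<open>m + 1\<close>, just below what is assumed of \<open>p\<close>.\<close>
  define m where "m = fst p + J + 1"
  let ?K = "{k :: 'd \<Rightarrow> nat. \<forall>i. k i < 2 ^ m}"
  let ?A = "(\<lambda>k. (m, \<lambda>_::'d. True, k)) ` ?K"
  have K: "?K = PiE (UNIV :: 'd set) (\<lambda>_. {..<2 ^ m})" by (auto simp: PiE_def)
  have cA: "card ?A = 2 ^ (m * CARD('d))"
    by (subst card_image) (auto simp: inj_on_def K card_PiE power_mult)
  have A: "?A \<subseteq> tensor_index J" by (auto simp: tensor_index_def m_def)
  let ?inv = "inv_into (level_index CARD('d)) \<iota>"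
  have "?inv ` ?A \<subseteq> {q \<in> level_index CARD('d). fst q \<le> fst p}"
  proof
    fix q assume "q \<in> ?inv ` ?A"
    then obtain k where k: "q = ?inv (m, \<lambda>_. True, k)" "(m, \<lambda>_. True, k) \<in> tensor_index J" using A by auto
    have q: "q \<in> level_index CARD('d)" "\<iota> q = (m, \<lambda>_. True, k)"
      using bij k by (auto simp: bij_betw_def inv_into_into f_inv_into_f)
    have "\<not> fst p < fst q"
      using mono[OF p q(1)] q(2) not by (auto simp: m_def)
    with q show "q \<in> {q \<in> level_index CARD('d). fst q \<le> fst p}" by simp
  qed
  then have "card (?inv ` ?A) \<le> card {q \<in> level_index CARD('d). fst q \<le> fst p}" by (intro card_mono finite_levels_upto)
  also have "\<dots> < 2 ^ ((fst p + 1) * CARD('d))" by (rule card_levels_upto) (simp add: Suc_le_eq)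
  also have "card (?inv ` ?A) = card ?A"
    using bij A by (intro card_image inj_on_inv_into) (auto simp: bij_betw_def)
  finally have "m * CARD('d) < (fst p + 1) * CARD('d)" using cA by simp
  then show False by (simp add: m_def)
qed

text \<open>The scale exceeds the level by a bounded amount only, which enters the constant.\<close>

lemma \<Psi>_bound:
  assumes p: "p \<in> level_index CARD('d)" and z: "z \<in> cbox 0 1"
  shows "\<bar>\<Psi> p z\<bar> \<le> (sqrt (2 ^ (J + 2)) * B) ^ CARD('d) * sqrt (2 ^ (fst p * CARD('d)))"
proof -
  obtain j e k where t: "\<iota> p = (j, e, k)" "(j, e, k) \<in> tensor_index J"
    "\<And>z. z \<in> cbox 0 1 \<Longrightarrow> \<Psi> p z = tensor_fun scal wav (j, e, k) z"
    using \<Psi>_tensor[OF p] by blast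
  have "j \<le> tensor_resolution (\<iota> p)" by (simp add: t(1))
  then have j: "j \<le> fst p + (J + 2)" using resolution_le_level[OF p] by simp
  have "\<bar>\<Psi> p z\<bar> \<le> (sqrt (2 ^ j) * B) ^ CARD('d)" using tensor_bound[OF t(2) z] t(3)[OF z] by simp
  also have "\<dots> \<le> (sqrt (2 ^ (fst p + (J + 2))) * B) ^ CARD('d)"
    using pos by (intro power_mono mult_right_mono real_sqrt_le_mono power_increasing j) auto
  also have "\<dots> = (sqrt (2 ^ (J + 2)) * B) ^ CARD('d) * sqrt (2 ^ (fst p * CARD('d)))"
    by (simp add: power_add real_sqrt_mult power_mult_distrib power_mult real_sqrt_power)
  finally show ?thesis .
qed

end

section \<open>Convergence of the partial sums\<close>

context tensor_wavelets
begin

definition coef :: "(real^'d \<Rightarrow> real) \<Rightarrow> nat \<times> nat \<Rightarrow> real" where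
  "coef f p = (LINT z:cbox 0 1|lborel. f z * \<Psi> p z)"

definition partial_series :: "(real^'d \<Rightarrow> real) \<Rightarrow> nat \<Rightarrow> real^'d \<Rightarrow> real" where
  "partial_series f m z = (\<Sum>p\<in>level_set m. coef f p * \<Psi> p z)"

lemma level_set_subset: "level_set m \<subseteq> level_index CARD('d)"
  by (auto simp: level_set_def)

lemma \<Psi>_orthonormal:
  assumes "p \<in> level_index CARD('d)" "q \<in> level_index CARD('d)"
  shows "(LINT z:cbox 0 1|lborel. \<Psi> p z * \<Psi> q z) = (if p = q then 1 else 0)"
proof -
  have "\<forall>(l, k)\<in>level_index CARD('d). \<forall>(l', k')\<in>level_index CARD('d).
        (LINT z:cbox 0 1|lborel. \<psi> l k z * \<psi> l' k' z) = (if (l, k) = (l', k') then 1 else 0)"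
    using ob unfolding cube_orthonormal_basis_def by (elim conjE)
  from this[unfolded case_prod_unfold] assms show ?thesis by (simp add: prod_eq_iff)
qed

text \<open>The coefficients \<open>b\<close> are free because the identity is applied to a single
  index, to the Fourier coefficients, and to the approximant supplied by completeness.\<close>

lemma residual_energy:
  fixes f :: "real^'d \<Rightarrow> real"
  assumes f: "continuous_on (cbox 0 1) f" and T: "finite T" "T \<subseteq> level_index CARD('d)"
  shows "(LINT z:cbox 0 1|lborel. (f z - (\<Sum>p\<in>T. b p * \<Psi> p z))\<^sup>2) =
    (LINT z:cbox 0 1|lborel. (f z)\<^sup>2) - (\<Sum>p\<in>T. 2 * b p * coef f p) + (\<Sum>p\<in>T. (b p)\<^sup>2)"
proof -
  have c\<Psi>: "p \<in> T \<Longrightarrow> continuous_on (cbox 0 1) (\<Psi> p)" for p using T \<Psi>_continuous by auto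
  have i1: "set_integrable lborel (cbox 0 1) (\<lambda>z. (f z)\<^sup>2)"
    by (intro cube_set_integrable continuous_on_power f)
  have i2: "p \<in> T \<Longrightarrow> set_integrable lborel (cbox 0 1) (\<lambda>z. f z * \<Psi> p z)" for p
    by (intro cube_set_integrable continuous_on_mult f c\<Psi>)
  have i3: "p \<in> T \<Longrightarrow> q \<in> T \<Longrightarrow> set_integrable lborel (cbox 0 1) (\<lambda>z. \<Psi> p z * \<Psi> q z)" for p q
    by (intro cube_set_integrable continuous_on_mult c\<Psi>)
  have i4: "p \<in> T \<Longrightarrow> set_integrable lborel (cbox 0 1) (\<lambda>z. \<Sum>q\<in>T. b q * (\<Psi> p z * \<Psi> q z))" for p
    by (intro cube_set_integrable continuous_on_sum continuous_on_mult c\<Psi> continuous_on_const)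
  have i5: "set_integrable lborel (cbox 0 1) (\<lambda>z. \<Sum>p\<in>T. (2 * b p) * (f z * \<Psi> p z))"
    by (intro cube_set_integrable continuous_on_sum continuous_on_mult c\<Psi> f continuous_on_const)
  have i6: "set_integrable lborel (cbox 0 1) (\<lambda>z. \<Sum>p\<in>T. b p * (\<Sum>q\<in>T. b q * (\<Psi> p z * \<Psi> q z)))"
    by (intro cube_set_integrable continuous_on_sum continuous_on_mult c\<Psi> continuous_on_const)
  have e: "(f z - (\<Sum>p\<in>T. b p * \<Psi> p z))\<^sup>2 =
      (f z)\<^sup>2 - (\<Sum>p\<in>T. (2 * b p) * (f z * \<Psi> p z)) + (\<Sum>p\<in>T. b p * (\<Sum>q\<in>T. b q * (\<Psi> p z * \<Psi> q z)))" for z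
  proof -
    have "(\<Sum>p\<in>T. b p * \<Psi> p z)\<^sup>2 = (\<Sum>p\<in>T. b p * (\<Sum>q\<in>T. b q * (\<Psi> p z * \<Psi> q z)))"
    proof -
      have "(\<Sum>p\<in>T. b p * \<Psi> p z)\<^sup>2 = (\<Sum>p\<in>T. \<Sum>q\<in>T. (b p * \<Psi> p z) * (b q * \<Psi> q z))"
        by (simp only: power2_eq_square sum_product)
      then show ?thesis by (simp add: sum_distrib_left mult_ac)
    qed
    moreover have "(\<Sum>p\<in>T. (2 * b p) * (f z * \<Psi> p z)) = 2 * f z * (\<Sum>p\<in>T. b p * \<Psi> p z)"
      unfolding sum_distrib_left by (simp add: mult_ac)
    ultimately show ?thesis by (simp add: power2_diff)
  qed
  have "(LINT z:cbox 0 1|lborel. (f z - (\<Sum>p\<in>T. b p * \<Psi> p z))\<^sup>2) =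
    (LINT z:cbox 0 1|lborel. (f z)\<^sup>2) - (LINT z:cbox 0 1|lborel. (\<Sum>p\<in>T. (2 * b p) * (f z * \<Psi> p z)))
     + (LINT z:cbox 0 1|lborel. (\<Sum>p\<in>T. b p * (\<Sum>q\<in>T. b q * (\<Psi> p z * \<Psi> q z))))"
    unfolding e by (simp only: set_integral_add(2)[OF set_integral_diff(1)[OF i1 i5] i6] set_integral_diff(2)[OF i1 i5])
  also have "(LINT z:cbox 0 1|lborel. (\<Sum>p\<in>T. (2 * b p) * (f z * \<Psi> p z))) = (\<Sum>p\<in>T. 2 * b p * coef f p)"
    unfolding coef_def by (rule set_integral_sum[OF i2])
  also have "(LINT z:cbox 0 1|lborel. (\<Sum>p\<in>T. b p * (\<Sum>q\<in>T. b q * (\<Psi> p z * \<Psi> q z)))) =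
      (\<Sum>p\<in>T. b p * (LINT z:cbox 0 1|lborel. (\<Sum>q\<in>T. b q * (\<Psi> p z * \<Psi> q z))))"
    by (rule set_integral_sum[OF i4])
  also have "\<dots> = (\<Sum>p\<in>T. b p * (\<Sum>q\<in>T. b q * (LINT z:cbox 0 1|lborel. \<Psi> p z * \<Psi> q z)))"
    by (intro sum.cong refl arg_cong2[where f="(*)"] set_integral_sum i3)
  also have "\<dots> = (\<Sum>p\<in>T. b p * (\<Sum>q\<in>T. if p = q then b q else 0))"
  proof (rule sum.cong[OF refl])
    fix p assume p: "p \<in> T"
    have "(\<Sum>q\<in>T. b q * (LINT z:cbox 0 1|lborel. \<Psi> p z * \<Psi> q z)) = (\<Sum>q\<in>T. if p = q then b q else 0)"
    proof (rule sum.cong[OF refl])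
      fix q assume "q \<in> T"
      with p T(2) show "b q * (LINT z:cbox 0 1|lborel. \<Psi> p z * \<Psi> q z) = (if p = q then b q else 0)"
        by (subst \<Psi>_orthonormal) (blast, blast, simp)
    qed
    then show "b p * (\<Sum>q\<in>T. b q * (LINT z:cbox 0 1|lborel. \<Psi> p z * \<Psi> q z)) = b p * (\<Sum>q\<in>T. if p = q then b q else 0)"
      by simp
  qed
  also have "\<dots> = (\<Sum>p\<in>T. (b p)\<^sup>2)"
    using T(1) by (intro sum.cong) (auto simp: power2_eq_square)
  finally show ?thesis .
qed

text \<open>Bessel's inequality for one index.\<close>

lemma coef_bound:
  fixes f :: "real^'d \<Rightarrow> real"
  assumes f: "continuous_on (cbox 0 1) f" and p: "p \<in> level_index CARD('d)"
  shows "\<bar>coef f p\<bar> \<le> sqrt (LINT z:cbox 0 1|lborel. (f z)\<^sup>2)"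
proof -
  have "0 \<le> (LINT z:cbox 0 1|lborel. (f z - (\<Sum>p\<in>{p}. coef f p * \<Psi> p z))\<^sup>2)"
    unfolding set_lebesgue_integral_def by (intro Bochner_Integration.integral_nonneg) auto
  also have "\<dots> = (LINT z:cbox 0 1|lborel. (f z)\<^sup>2) - (coef f p)\<^sup>2"
    using p by (subst residual_energy[OF f]) (auto simp: power2_eq_square)
  finally have "sqrt ((coef f p)\<^sup>2) \<le> sqrt (LINT z:cbox 0 1|lborel. (f z)\<^sup>2)"
    by (intro real_sqrt_le_mono) simp
  then show ?thesis by simp
qed

text \<open>With \<open>r = s + m\<close> the new terms have coefficients of order
  \<open>2 powr (- j * (r + d / 2))\<close>, while the absolute values of the wavelets of one scale
  sum to order \<open>2 powr (j * d / 2)\<close> at every point; \<open>2 powr (- j * r)\<close>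
  remains.\<close>

lemma partial_series_step:
  fixes f :: "real^'d \<Rightarrow> real"
  assumes f: "holder_smooth m s f" and s: "s \<ge> 0" and m: "m < N"
  shows "\<exists>K\<ge>0. \<forall>j\<ge>J. \<forall>z\<in>cbox 0 1.
    \<bar>partial_series f (Suc j) z - partial_series f j z\<bar> \<le> K * (2 powr - (s + real m)) ^ j"
proof -
  let ?tf = "tensor_fun scal wav :: nat \<times> ('d \<Rightarrow> bool) \<times> ('d \<Rightarrow> nat) \<Rightarrow> real^'d \<Rightarrow> real"
  let ?c = "\<lambda>t. LINT z:cbox 0 1|lborel. f z * ?tf t z"
  obtain H where H: "H \<ge> 0" "\<And>j e k. (j, e, k) \<in> tensor_index J \<Longrightarrow> \<exists>i. e i \<Longrightarrow>
    \<bar>?c (j, e, k)\<bar> \<le> H * (2 * real N / 2 ^ j) powr s * (2 * real N / 2 ^ j) ^ m * (4 * real N * B * sqrt (2 ^ j) / 2 ^ j) ^ CARD('d)"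
    using tensor_coefficient_bound[OF f s m] by blast
  define r where "r = s + real m"
  define K where "K = H * (2 * real N) powr r * (20 * (real N)\<^sup>2 * B\<^sup>2) ^ CARD('d) * real CARD('d \<Rightarrow> bool)"
  have K: "K \<ge> 0" using H(1) by (simp add: K_def)
  have "\<bar>partial_series f (Suc j) z - partial_series f j z\<bar> \<le> K * (2 powr - r) ^ j"
    if j: "J \<le> j" and z: "z \<in> cbox 0 1" for j z
  proof -
    let ?D = "{p \<in> level_index CARD('d). tensor_resolution (\<iota> p) = Suc j}"
    let ?E = "{t \<in> tensor_index J :: (nat \<times> ('d \<Rightarrow> bool) \<times> ('d \<Rightarrow> nat)) set. tensor_resolution t = Suc j}"
    let ?KK = "{k :: 'd \<Rightarrow> nat. \<forall>i. k i < 2 ^ j}"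
    let ?V = "(\<lambda>(e, k). (j, e, k)) ` ({e :: 'd \<Rightarrow> bool. \<exists>i. e i} \<times> ?KK)"
    define C1 where "C1 = H * (2 * real N / 2 ^ j) powr s * (2 * real N / 2 ^ j) ^ m * (4 * real N * B * sqrt (2 ^ j) / 2 ^ j) ^ CARD('d)"
    have C1: "C1 \<ge> 0" using H(1) pos by (simp add: C1_def)
    have KK: "?KK = PiE (UNIV :: 'd set) (\<lambda>_. {..<2 ^ j})" by (auto simp: PiE_def)
    have finK: "finite ?KK" unfolding KK by (intro finite_PiE) auto
    have split: "level_set (Suc j) = level_set j \<union> ?D" "level_set j \<inter> ?D = {}"
      by (auto simp: level_set_def)
    have finD: "finite ?D" using finite_level_set[of "Suc j"] split by simp
    have "partial_series f (Suc j) z - partial_series f j z = (\<Sum>p\<in>?D. coef f p * \<Psi> p z)"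
      unfolding partial_series_def split(1)
      by (subst sum.union_disjoint) (use split(2) finite_level_set finD in auto)
    also have "\<bar>\<dots>\<bar> \<le> (\<Sum>p\<in>?D. \<bar>coef f p * \<Psi> p z\<bar>)" by (rule sum_abs)
    also have "\<dots> = (\<Sum>p\<in>?D. \<bar>?c (\<iota> p) * ?tf (\<iota> p) z\<bar>)"
    proof (rule sum.cong[OF refl])
      fix p assume "p \<in> ?D"
      then have p: "p \<in> level_index CARD('d)" by simp
      have "coef f p = ?c (\<iota> p)"
        unfolding coef_def using eq[OF p] by (intro set_lebesgue_integral_cong) auto
      then show "\<bar>coef f p * \<Psi> p z\<bar> = \<bar>?c (\<iota> p) * ?tf (\<iota> p) z\<bar>" using eq[OF p z] by simp
    qed
    also have "\<dots> = (\<Sum>t\<in>?E. \<bar>?c t * ?tf t z\<bar>)"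
      by (rule sum.reindex_bij_betw[OF bij_subset])
    also have "\<dots> \<le> (\<Sum>t\<in>?V. \<bar>?c t * ?tf t z\<bar>)"
    proof (rule sum_mono2)
      show "finite ?V" using finK by (intro finite_imageI finite_cartesian_product) auto
      show "?E \<subseteq> ?V"
      proof
        fix t assume t: "t \<in> ?E"
        obtain j' e k where t': "t = (j', e, k)" by (metis prod_cases3)
        \<comment> \<open>A pure scaling index of resolution \<open>Suc j\<close> would have level
          \<open>Suc j > J\<close>, but this type exists at level \<open>J\<close> only.\<close>
        from t j have "j' = j" "\<exists>i. e i" "k \<in> ?KK"
          by (auto simp: t' tensor_index_def split: if_splits)
        then show "t \<in> ?V" by (intro image_eqI[of _ _ "(e, k)"]) (auto simp: t')
      qed
    qed auto
    also have "\<dots> \<le> (\<Sum>t\<in>?V. C1 * \<bar>?tf t z\<bar>)"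
    proof (rule sum_mono)
      fix t assume "t \<in> ?V"
      then obtain e k where t: "t = (j, e, k)" "\<exists>i. e i" "(j, e, k) \<in> tensor_index J"
        using j by (auto simp: tensor_index_def)
      show "\<bar>?c t * ?tf t z\<bar> \<le> C1 * \<bar>?tf t z\<bar>"
        using H(2)[OF t(3,2)] unfolding t(1) abs_mult C1_def by (intro mult_right_mono) auto
    qed
    also have "\<dots> = C1 * (\<Sum>e | \<exists>i. e i. \<Sum>k\<in>?KK. \<bar>?tf (j, e, k) z\<bar>)"
      by (subst sum.reindex) (auto simp: inj_on_def sum.cartesian_product sum_distrib_left case_prod_unfold simp del: tensor_fun.simps)
    also have "\<dots> \<le> C1 * (\<Sum>e\<in>(UNIV :: ('d \<Rightarrow> bool) set). (sqrt (2 ^ j) * (5 * real N * B)) ^ CARD('d))"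
      using tensor_sum_bound[OF j z] pos C1
      by (intro mult_left_mono order_trans[OF sum_mono sum_mono2]) auto
    also have "\<dots> = real CARD('d \<Rightarrow> bool) * (C1 * (sqrt (2 ^ j) * (5 * real N * B)) ^ CARD('d))" by simp
    also have "\<dots> = K * (2 powr - r) ^ j"
    proof -
      \<comment> \<open>Here the powers of \<open>2 ^ j\<close> from size and from localisation
        cancel.\<close>
      have a: "(4 * real N * B * sqrt (2 ^ j) / 2 ^ j) ^ CARD('d) * (sqrt (2 ^ j) * (5 * real N * B)) ^ CARD('d) =
        (20 * (real N)\<^sup>2 * B\<^sup>2) ^ CARD('d)"
      proof -
        have "(4 * x * y * u / t) * (u * (5 * x * y)) = 20 * x\<^sup>2 * y\<^sup>2" if "t = u * u" "t > 0" for x y u t :: real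
          using that by (cases "u = 0") (simp_all add: field_simps power2_eq_square)
        from this[of "2 ^ j" "sqrt (2 ^ j)"] show ?thesis
          unfolding power_mult_distrib[symmetric] by simp
      qed
      have "(2 * real N / 2 ^ j) powr s * (2 * real N / 2 ^ j) ^ m = (2 * real N / 2 ^ j) powr r"
        using pos by (simp add: r_def powr_add powr_realpow)
      also have "\<dots> = (2 * real N) powr r * (2 powr - r) ^ j"
      proof -
        have "2 * real N / 2 ^ j = 2 * real N * 2 powr (- real j)"
          by (simp add: powr_minus powr_realpow divide_inverse)
        then have "(2 * real N / 2 ^ j) powr r = (2 * real N) powr r * 2 powr (- real j * r)"
          by (simp add: powr_mult powr_powr)
        moreover have "(2 powr - r) ^ j = 2 powr (- r * real j)"
          by (simp add: powr_realpow[symmetric] powr_powr)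
        ultimately show ?thesis by (simp add: mult.commute)
      qed
      finally have b: "(2 * real N / 2 ^ j) powr s * (2 * real N / 2 ^ j) ^ m = (2 * real N) powr r * (2 powr - r) ^ j" .
      have "C1 * (sqrt (2 ^ j) * (5 * real N * B)) ^ CARD('d) =
         H * ((2 * real N / 2 ^ j) powr s * (2 * real N / 2 ^ j) ^ m) *
         ((4 * real N * B * sqrt (2 ^ j) / 2 ^ j) ^ CARD('d) * (sqrt (2 ^ j) * (5 * real N * B)) ^ CARD('d))"
        unfolding C1_def by (simp only: mult.assoc)
      then show ?thesis unfolding a b K_def by (simp add: mult_ac)
    qed
    finally show ?thesis .
  qed
  with K show ?thesis unfolding r_def by blast
qed

lemma partial_series_tail:
  fixes f :: "real^'d \<Rightarrow> real"
  assumes f: "holder_smooth m s f" and s: "s \<ge> 0" and m: "m < N" and r: "s + real m > 0"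
  shows "\<exists>K\<ge>0. \<forall>j\<ge>J. \<forall>z\<in>cbox 0 1. \<forall>i.
    \<bar>partial_series f (j + i) z - partial_series f j z\<bar> \<le> K * (2 powr - (s + real m)) ^ j"
proof -
  define q :: real where "q = 2 powr - (s + real m)"
  have q: "0 < q" "q < 1" unfolding q_def using r powr_less_mono[of "- (s + real m)" 0 2] by auto
  obtain K where K: "K \<ge> 0" "\<And>j z. j \<ge> J \<Longrightarrow> z \<in> cbox 0 1 \<Longrightarrow>
    \<bar>partial_series f (Suc j) z - partial_series f j z\<bar> \<le> K * q ^ j"
    using partial_series_step[OF f s m] unfolding q_def by blast
  have "\<bar>partial_series f (j + i) z - partial_series f j z\<bar> \<le> K / (1 - q) * q ^ j" if j: "j \<ge> J" and z: "z \<in> cbox 0 1" for j z i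
  proof -
    \<comment> \<open>The telescoping form \<open>q ^ j - q ^ (j + i)\<close> makes the induction
      close.\<close>
    have "\<bar>partial_series f (j + i) z - partial_series f j z\<bar> \<le> K / (1 - q) * (q ^ j - q ^ (j + i))"
    proof (induction i)
      case (Suc i)
      have "\<bar>partial_series f (j + Suc i) z - partial_series f j z\<bar> \<le>
        K * q ^ (j + i) + K / (1 - q) * (q ^ j - q ^ (j + i))"
        using K(2)[of "j + i" z] j z Suc by simp
      also have "K * q ^ (j + i) = K / (1 - q) * (q ^ (j + i) - q ^ (j + Suc i))"
        using q by (simp add: field_simps)
      finally show ?case by (simp add: algebra_simps)
    qed simp
    also have "\<dots> \<le> K / (1 - q) * q ^ j"
      using q K(1) by (intro mult_left_mono) auto
    finally show ?thesis .
  qed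
  moreover have "K / (1 - q) \<ge> 0" using q K(1) by simp
  ultimately show ?thesis unfolding q_def by blast
qed

lemma partial_series_continuous: "continuous_on (cbox 0 1) (partial_series f m)"
  unfolding partial_series_def[abs_def] using level_set_subset
  by (intro continuous_on_sum continuous_on_mult continuous_on_const \<Psi>_continuous) auto

text \<open>Fourier coefficients minimise the energy, so the partial sum is at least as good as the
  finite combination given by completeness as soon as all indices of the latter are
  included.\<close>

lemma partial_series_energy_small:
  fixes f :: "real^'d \<Rightarrow> real"
  assumes f: "continuous_on (cbox 0 1) f" and \<epsilon>: "\<epsilon> > 0"
  shows "\<exists>m0. \<forall>m\<ge>m0. (LINT z:cbox 0 1|lborel. (f z - partial_series f m z)\<^sup>2) < \<epsilon>"
proof -
  have fint: "set_integrable lborel (cbox 0 1) f" by (rule cube_set_integrable[OF f])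
  have f2int: "set_integrable lborel (cbox 0 1) (\<lambda>z. (f z)\<^sup>2)"
    by (intro cube_set_integrable continuous_on_power f)
  have meas: "set_borel_measurable lborel (cbox 0 1) f"
    using fint unfolding set_integrable_def set_borel_measurable_def by (rule borel_measurable_integrable)
  have complete: "\<forall>f. set_borel_measurable lborel (cbox 0 1) f \<longrightarrow>
          set_integrable lborel (cbox 0 1) (\<lambda>z. (f z)\<^sup>2) \<longrightarrow>
        (\<forall>\<epsilon>>0. \<exists>I c. finite I \<and> I \<subseteq> level_index CARD('d) \<and>
           (LINT z:cbox 0 1|lborel. (f z - (\<Sum>(l, k)\<in>I. c l k * \<psi> l k z))\<^sup>2) < \<epsilon>)"
    using ob unfolding cube_orthonormal_basis_def by (elim conjE)
  obtain I c where I: "finite I" "I \<subseteq> level_index CARD('d)"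
    "(LINT z:cbox 0 1|lborel. (f z - (\<Sum>(l, k)\<in>I. c l k * \<psi> l k z))\<^sup>2) < \<epsilon>"
    using complete[rule_format, OF meas f2int \<epsilon>] by (elim exE conjE) (rule that)
  obtain m0 where m0: "\<And>p. p \<in> I \<Longrightarrow> tensor_resolution (\<iota> p) \<le> m0"
    using I(1) by (metis finite_imageI finite_nat_set_iff_bounded_le imageI)
  have "(LINT z:cbox 0 1|lborel. (f z - partial_series f m z)\<^sup>2) < \<epsilon>" if m: "m0 \<le> m" for m
  proof -
    have IT: "I \<subseteq> level_set m" using I(2) m0 m by (fastforce simp: level_set_def)
    note fin = finite_level_set[of m] and sub = level_set_subset[of m]
    define b where "b p = (if p \<in> I then c (fst p) (snd p) else 0)" for p
    have "(LINT z:cbox 0 1|lborel. (f z - partial_series f m z)\<^sup>2) =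
      (LINT z:cbox 0 1|lborel. (f z)\<^sup>2) - (\<Sum>p\<in>level_set m. 2 * coef f p * coef f p) + (\<Sum>p\<in>level_set m. (coef f p)\<^sup>2)"
      unfolding partial_series_def by (rule residual_energy[OF f fin sub])
    also have "\<dots> \<le> (LINT z:cbox 0 1|lborel. (f z)\<^sup>2) - (\<Sum>p\<in>level_set m. 2 * b p * coef f p) + (\<Sum>p\<in>level_set m. (b p)\<^sup>2)"
    proof -
      have "- (2 * x * x) + x\<^sup>2 \<le> - (2 * y * x) + y\<^sup>2" for x y :: real
        using zero_le_power2[of "x - y"] by (simp add: power2_eq_square algebra_simps)
      then have "(\<Sum>p\<in>level_set m. - (2 * coef f p * coef f p) + (coef f p)\<^sup>2) \<le> (\<Sum>p\<in>level_set m. - (2 * b p * coef f p) + (b p)\<^sup>2)"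
        by (intro sum_mono)
      then show ?thesis by (simp add: sum_subtractf)
    qed
    also have "\<dots> = (LINT z:cbox 0 1|lborel. (f z - (\<Sum>p\<in>level_set m. b p * \<Psi> p z))\<^sup>2)"
      by (rule residual_energy[OF f fin sub, symmetric])
    also have "\<dots> = (LINT z:cbox 0 1|lborel. (f z - (\<Sum>(l, k)\<in>I. c l k * \<psi> l k z))\<^sup>2)"
    proof -
      have "(\<Sum>p\<in>level_set m. b p * \<Psi> p z) = (\<Sum>(l, k)\<in>I. c l k * \<psi> l k z)" for z
        unfolding b_def case_prod_unfold using IT fin by (intro sum.mono_neutral_cong_right) auto
      then show ?thesis by simp
    qed
    finally show ?thesis using I(3) by linarith
  qed
  then show ?thesis by blast
qed

lemma partial_series_uniform:
  fixes f :: "real^'d \<Rightarrow> real"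
  assumes f: "holder_smooth m s f" and s: "s \<ge> 0" and m: "m < N" and r: "s + real m > 0"
  shows "\<exists>K\<ge>0. \<forall>j\<ge>J. \<forall>z\<in>cbox 0 1. \<bar>f z - partial_series f j z\<bar> \<le> K * (2 powr - (s + real m)) ^ j"
proof -
  define q :: real where "q = 2 powr - (s + real m)"
  have q: "0 < q" "q < 1" unfolding q_def using r powr_less_mono[of "- (s + real m)" 0 2] by auto
  note cf = holder_smooth_continuous[OF f]
  obtain K where K: "K \<ge> 0" "\<And>j z i. j \<ge> J \<Longrightarrow> z \<in> cbox 0 1 \<Longrightarrow>
    \<bar>partial_series f (j + i) z - partial_series f j z\<bar> \<le> K * q ^ j"
    using partial_series_tail[OF f s m r] unfolding q_def by blast
  have q0: "(\<lambda>j. K * q ^ j) \<longlonglongrightarrow> 0"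
    using q by (intro tendsto_mult_right_zero LIMSEQ_realpow_zero) auto
  define g where "g z = lim (\<lambda>j. partial_series f j z)" for z
  have conv: "(\<lambda>j. partial_series f j z) \<longlonglongrightarrow> g z" if z: "z \<in> cbox 0 1" for z
  proof -
    have "Cauchy (\<lambda>j. partial_series f j z)"
      unfolding Cauchy_altdef2
    proof (intro allI impI)
      fix e :: real assume "e > 0"
      then have "\<forall>\<^sub>F j in sequentially. K * q ^ j < e" by (rule order_tendstoD(2)[OF q0])
      then obtain j where j: "j \<ge> J" "K * q ^ j < e"
        unfolding eventually_sequentially by (metis le_cases order_refl)
      have "dist (partial_series f n z) (partial_series f j z) < e" if "n \<ge> j" for n
        using K(2)[OF j(1) z, of "n - j"] j(2) that by (simp add: dist_real_def)
      then show "\<exists>j. \<forall>n\<ge>j. dist (partial_series f n z) (partial_series f j z) < e" by blast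
    qed
    then show ?thesis unfolding g_def by (simp add: Cauchy_convergent_iff convergent_LIMSEQ_iff)
  qed
  have bound: "\<bar>g z - partial_series f j z\<bar> \<le> K * q ^ j" if j: "j \<ge> J" and z: "z \<in> cbox 0 1" for j z
  proof (rule tendsto_upperbound)
    show "(\<lambda>i. \<bar>partial_series f i z - partial_series f j z\<bar>) \<longlonglongrightarrow> \<bar>g z - partial_series f j z\<bar>"
      by (intro tendsto_intros conv z)
    show "\<forall>\<^sub>F i in sequentially. \<bar>partial_series f i z - partial_series f j z\<bar> \<le> K * q ^ j"
      unfolding eventually_sequentially
    proof (intro exI allI impI)
      fix i assume "j \<le> i"
      then show "\<bar>partial_series f i z - partial_series f j z\<bar> \<le> K * q ^ j"
        using K(2)[OF j z, of "i - j"] by simp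
    qed
  qed simp
  have "uniform_limit (cbox 0 1) (partial_series f) g sequentially"
  proof (rule uniform_limitI)
    fix e :: real assume "e > 0"
    then have "\<forall>\<^sub>F j in sequentially. K * q ^ j < e" by (rule order_tendstoD(2)[OF q0])
    with eventually_ge_at_top[of J] show "\<forall>\<^sub>F j in sequentially. \<forall>z\<in>cbox 0 1. dist (partial_series f j z) (g z) < e"
    proof eventually_elim
      case (elim j)
      then show ?case using bound[of j] by (auto simp: dist_real_def abs_minus_commute intro: le_less_trans)
    qed
  qed
  then have cg: "continuous_on (cbox 0 1) g"
    by (rule uniform_limit_theorem[OF always_eventually[OF allI[OF partial_series_continuous]]]) simp
  let ?D = "\<lambda>z. (f z - g z)\<^sup>2"
  have cD: "continuous_on (cbox 0 1) ?D" by (intro continuous_on_power continuous_on_diff cf cg)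
  \<comment> \<open>A partial sum \<open>S\<close> links the two functions: \<open>f - S\<close> is
    small in energy, \<open>g - S\<close> uniformly, and
    \<open>2 * (e / 4) + e / 2 = e\<close>.\<close>
  have "(LINT z:cbox 0 1|lborel. ?D z) \<le> e" if e: "e > 0" for e
  proof -
    obtain m0 where m0: "\<And>m. m \<ge> m0 \<Longrightarrow> (LINT z:cbox 0 1|lborel. (f z - partial_series f m z)\<^sup>2) < e / 4"
      using partial_series_energy_small[OF cf, of "e / 4"] e by auto
    have "\<forall>\<^sub>F j in sequentially. K * q ^ j < sqrt (e / 4)" using e by (intro order_tendstoD(2)[OF q0]) auto
    then obtain j0 where j0: "\<And>j. j \<ge> j0 \<Longrightarrow> K * q ^ j < sqrt (e / 4)" unfolding eventually_sequentially by blast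
    define j where "j = max m0 (max j0 J)"
    have j: "j \<ge> m0" "j \<ge> j0" "j \<ge> J" by (auto simp: j_def)
    note cS = partial_series_continuous[of f j]
    have "(LINT z:cbox 0 1|lborel. ?D z) \<le> (LINT z:cbox 0 1|lborel. 2 * (f z - partial_series f j z)\<^sup>2 + e / 2)"
    proof (rule cube_integral_mono[OF cD])
      show "continuous_on (cbox 0 1) (\<lambda>z. 2 * (f z - partial_series f j z)\<^sup>2 + e / 2)"
        by (intro continuous_on_add continuous_on_mult continuous_on_const continuous_on_power continuous_on_diff cf cS)
      fix z :: "real^'d" assume z: "z \<in> cbox 0 1"
      have "\<bar>g z - partial_series f j z\<bar> \<le> sqrt (e / 4)" using bound[OF j(3) z] j0[OF j(2)] by linarith
      then have "(g z - partial_series f j z)\<^sup>2 \<le> e / 4"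
        using e by (metis abs_le_square_iff abs_of_nonneg divide_nonneg_nonneg less_imp_le real_sqrt_ge_zero real_sqrt_pow2 zero_le_numeral)
      moreover have sq: "(f z - g z)\<^sup>2 \<le> 2 * (f z - S)\<^sup>2 + 2 * (g z - S)\<^sup>2" for S
        using zero_le_power2[of "(f z - S) + (g z - S)"] by (simp add: power2_eq_square algebra_simps)
      ultimately show "(f z - g z)\<^sup>2 \<le> 2 * (f z - partial_series f j z)\<^sup>2 + e / 2"
        using sq[of "partial_series f j z"] by linarith
    qed
    also have "\<dots> = (LINT z:cbox 0 1|lborel. 2 * (f z - partial_series f j z)\<^sup>2) + (LINT z:(cbox 0 1 :: (real^'d) set)|lborel. e / 2)"
      by (intro set_integral_add(2) cube_set_integrable continuous_on_mult continuous_on_const continuous_on_power continuous_on_diff cf cS)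
    also have "\<dots> = 2 * (LINT z:cbox 0 1|lborel. (f z - partial_series f j z)\<^sup>2) + e / 2"
      by (simp only: set_integral_mult_right cube_integral_const)
    finally show ?thesis using m0[OF j(1)] by linarith
  qed
  then have "(LINT z:cbox 0 1|lborel. ?D z) \<le> 0" by (rule field_le_epsilon[where y=0, simplified])
  moreover have "(LINT z:cbox 0 1|lborel. ?D z) \<ge> 0"
    unfolding set_lebesgue_integral_def by (intro Bochner_Integration.integral_nonneg) auto
  ultimately have "integral (cbox 0 1) ?D = 0"
    using set_borel_integral_eq_integral(2)[OF cube_set_integrable[OF cD]] by simp
  \<comment> \<open>The cube has interior, so a nonnegative continuous function with integral 0
    vanishes on all of it, faces included.\<close>
  moreover have "box 0 (1 :: real^'d) \<noteq> {}" by (auto simp: interval_ne_empty_cart)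
  ultimately have "\<forall>z\<in>cbox 0 1. ?D z = 0" using integral_cbox_eq_0_iff[OF cD] by simp
  then have "f z = g z" if "z \<in> cbox 0 1" for z using that by simp
  with bound K(1) show ?thesis unfolding q_def by auto
qed

text \<open>Resolution \<open>j\<close> occupies levels up to \<open>j + 2\<close>. The two levels
  lost cost the factor \<open>1 / q\<^sup>2\<close>, absorbed in \<open>C\<close>; indices up to
  level \<open>L\<close> outside the partial sum receive the coefficient 0.\<close>

lemma series_approximation:
  fixes f :: "real^'d \<Rightarrow> real"
  assumes f: "holder_smooth m s f" and s: "s \<ge> 0" and m: "m < N" and r: "s + real m > 0"
  shows "\<exists>C\<ge>0. \<forall>L\<ge>J + 2. \<exists>c. (\<forall>p. \<bar>c p\<bar> \<le> C) \<and>
     (\<forall>z\<in>cbox 0 1. \<bar>f z - wavelet_series \<psi> (L, c) z\<bar> \<le> C * 2 powr (- (s + real m) * real L))"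
proof -
  define q :: real where "q = 2 powr - (s + real m)"
  have q: "0 < q" unfolding q_def by simp
  obtain K where K: "K \<ge> 0" "\<And>j z. j \<ge> J \<Longrightarrow> z \<in> cbox 0 1 \<Longrightarrow> \<bar>f z - partial_series f j z\<bar> \<le> K * q ^ j"
    using partial_series_uniform[OF f s m r] unfolding q_def by blast
  define E where "E = sqrt (LINT z:cbox 0 1|lborel. (f z)\<^sup>2)"
  have E: "E \<ge> 0" unfolding E_def set_lebesgue_integral_def by (intro real_sqrt_ge_zero Bochner_Integration.integral_nonneg) auto
  define C where "C = max E (K / q\<^sup>2)"
  have C: "C \<ge> 0" "E \<le> C" "K / q\<^sup>2 \<le> C" using E by (auto simp: C_def)
  have "\<exists>c. (\<forall>p. \<bar>c p\<bar> \<le> C) \<and> (\<forall>z\<in>cbox 0 1. \<bar>f z - wavelet_series \<psi> (L, c) z\<bar> \<le> C * q ^ L)"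
    if L: "L \<ge> J + 2" for L
  proof -
    define j where "j = L - 2"
    have j: "L = j + 2" "j \<ge> J" using L by (auto simp: j_def)
    define c where "c p = (if p \<in> level_set j then coef f p else 0)" for p
    have "\<bar>c p\<bar> \<le> C" for p
    proof (cases "p \<in> level_set j")
      case True
      then have "p \<in> level_index CARD('d)" using level_set_subset[of j] by (rule subsetD[rotated])
      from coef_bound[OF holder_smooth_continuous[OF f] this] C(2) True show ?thesis
        by (simp add: c_def E_def)
    qed (simp add: c_def C(1))
    moreover have "wavelet_series \<psi> (L, c) z = partial_series f j z" for z
      unfolding wavelet_series_sum partial_series_def
      using level_set_subset[of j] level_le_resolution[of _ j] finite_levels_upto[of "CARD('d)" L]
      by (intro sum.mono_neutral_cong_right) (auto simp: c_def j(1))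
    moreover have "\<bar>f z - partial_series f j z\<bar> \<le> C * q ^ L" if "z \<in> cbox 0 1" for z
    proof -
      have "K * q ^ j = (K / q\<^sup>2) * q ^ L" using q by (simp add: j(1) power_add power2_eq_square)
      also have "\<dots> \<le> C * q ^ L" using C q by (intro mult_right_mono) auto
      finally show ?thesis using K(2)[OF j(2) that] by linarith
    qed
    ultimately show ?thesis by (intro exI[of _ c] conjI allI ballI) (simp_all only:)
  qed
  moreover have "q ^ L = 2 powr (- (s + real m) * real L)" for L
    by (simp add: q_def powr_realpow[symmetric] powr_powr)
  ultimately show ?thesis using C(1) by auto
qed

end

text \<open>Interface to the statistical part. The coefficients are bounded uniformly in
  \<open>L\<close> because the Gaussian prior has to charge a neighbourhood of each of them by a
  comparable amount.\<close>

lemma wavelet_approximation: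
  fixes \<psi> :: "nat \<Rightarrow> nat \<Rightarrow> real^'d \<Rightarrow> real"
  assumes "daubechies_tensor_basis S \<psi>" and f: "f \<in> holder_space \<beta>" and \<beta>: "\<beta> > 0" and S: "S \<ge> nat \<lfloor>\<beta>\<rfloor> + 1"
  obtains C L0 where "C > 0"
    "\<And>l k. (l, k) \<in> level_index CARD('d) \<Longrightarrow> continuous_on (cbox 0 1) (\<psi> l k)"
    "\<And>l k z. (l, k) \<in> level_index CARD('d) \<Longrightarrow> z \<in> cbox 0 1 \<Longrightarrow> \<bar>\<psi> l k z\<bar> \<le> C * sqrt (2 ^ (l * CARD('d)))"
    "\<And>L. L \<ge> L0 \<Longrightarrow> \<exists>c. (\<forall>p. \<bar>c p\<bar> \<le> C) \<and>
        (\<forall>z\<in>cbox 0 1. \<bar>f z - wavelet_series \<psi> (L, c) z\<bar> \<le> C * 2 powr (- \<beta> * real L))"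
proof -
  from assms(1) obtain N h \<phi> \<phi>L \<psi>L \<phi>R \<psi>R J \<iota> where
    ob: "cube_orthonormal_basis \<psi>" and sc: "daubechies_scaling N h \<phi>" and SN: "S \<le> N" and
    L: "cdv_boundary N \<phi> (daubechies_wavelet N h \<phi>) \<phi>L \<psi>L" and
    R: "cdv_boundary N (\<lambda>x. \<phi> (1 - x)) (\<lambda>x. daubechies_wavelet N h \<phi> (1 - x)) \<phi>R \<psi>R" and
    J: "2 * N \<le> 2 ^ J" and bij: "bij_betw \<iota> (level_index CARD('d)) (tensor_index J)" and
    mono: "\<forall>p\<in>level_index CARD('d). \<forall>q\<in>level_index CARD('d).
           fst p < fst q \<longrightarrow> tensor_resolution (\<iota> p) \<le> tensor_resolution (\<iota> q)" and
    eq: "\<forall>(l, k)\<in>level_index CARD('d). \<forall>z\<in>cbox 0 1.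
           \<psi> l k z = tensor_fun (interval_fun N \<phi> \<phi>L \<phi>R) (interval_fun N (daubechies_wavelet N h \<phi>) \<psi>L \<psi>R) (\<iota> (l, k)) z"
    unfolding daubechies_tensor_basis_def Let_def by (elim conjE exE) (rule that)
  obtain B where fam: "interval_family N B \<phi> \<phi>L \<phi>R" "interval_family N B (daubechies_wavelet N h \<phi>) \<psi>L \<psi>R"
    "vanishing_moments N (daubechies_wavelet N h \<phi>) \<psi>L \<psi>R"
    using cdv_interval_families[OF sc refl L R] by blast
  interpret tensor_wavelets \<psi> N J B \<phi> "daubechies_wavelet N h \<phi>" \<phi>L \<phi>R \<psi>L \<psi>R \<iota>
  proof
    show "\<psi> (fst p) (snd p) z = tensor_fun (interval_fun N \<phi> \<phi>L \<phi>R) (interval_fun N (daubechies_wavelet N h \<phi>) \<psi>L \<psi>R) (\<iota> p) z"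
      if "p \<in> level_index CARD('d)" "z \<in> cbox 0 1" for p z
      using eq[rule_format, OF that(1)] that(2) by (simp only: case_prod_unfold prod.collapse)
  qed (rule ob fam(1) fam(2) fam(3) J bij mono[rule_format]; assumption)+
  define m where "m = nat \<lfloor>\<beta>\<rfloor>"
  define s where "s = \<beta> - of_int \<lfloor>\<beta>\<rfloor>"
  have sm: "s + real m = \<beta>" "s \<ge> 0" "m < N" using \<beta> S SN by (auto simp: s_def m_def)
  have "holder_smooth m s f" using f by (simp add: holder_space_def m_def s_def)
  from series_approximation[OF this sm(2,3)] sm(1) \<beta> obtain C1 where C1: "C1 \<ge> 0"
    "\<And>L. L \<ge> J + 2 \<Longrightarrow> \<exists>c. (\<forall>p. \<bar>c p\<bar> \<le> C1) \<and>
     (\<forall>z\<in>cbox 0 1. \<bar>f z - wavelet_series \<psi> (L, c) z\<bar> \<le> C1 * 2 powr (- \<beta> * real L))" by auto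
  define C2 where "C2 = (sqrt (2 ^ (J + 2)) * B) ^ CARD('d)"
  define C where "C = max 1 (max C1 C2)"
  show ?thesis
  proof (rule that[of C "J + 2"])
    show "C > 0" by (simp add: C_def)
    show "continuous_on (cbox 0 1) (\<psi> l k)" if "(l, k) \<in> level_index CARD('d)" for l k
      using \<Psi>_continuous[OF that] by simp
    show "\<bar>\<psi> l k z\<bar> \<le> C * sqrt (2 ^ (l * CARD('d)))" if "(l, k) \<in> level_index CARD('d)" "z \<in> cbox 0 1" for l k z
    proof -
      have "\<bar>\<psi> l k z\<bar> \<le> C2 * sqrt (2 ^ (l * CARD('d)))" using \<Psi>_bound[OF that] by (simp add: C2_def)
      also have "\<dots> \<le> C * sqrt (2 ^ (l * CARD('d)))" by (intro mult_right_mono) (auto simp: C_def)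
      finally show ?thesis .
    qed
    fix L assume "L \<ge> J + 2"
    from C1(2)[OF this] obtain c where c: "\<And>p. \<bar>c p\<bar> \<le> C1"
      "\<And>z. z \<in> cbox 0 1 \<Longrightarrow> \<bar>f z - wavelet_series \<psi> (L, c) z\<bar> \<le> C1 * 2 powr (- \<beta> * real L)" by blast
    have "C1 \<le> C" by (simp add: C_def)
    then have "C1 * 2 powr (- \<beta> * real L) \<le> C * 2 powr (- \<beta> * real L)" by (intro mult_right_mono) auto
    then show "\<exists>c. (\<forall>p. \<bar>c p\<bar> \<le> C) \<and>
        (\<forall>z\<in>cbox 0 1. \<bar>f z - wavelet_series \<psi> (L, c) z\<bar> \<le> C * 2 powr (- \<beta> * real L))"
      using c \<open>C1 \<le> C\<close> by (intro exI[of _ c]) (meson order_trans)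
  qed
qed

section \<open>Exponential moments of a Poisson process\<close>

lemma space_point_configs [simp]: "space point_configs = UNIV"
  by (simp add: point_configs_def space_measure_of_conv)

lemma point_count_measurable [measurable]:
  assumes "B \<in> sets borel"
  shows "point_count B \<in> measurable point_configs (count_space UNIV)"
  unfolding measurable_count_space_eq2_countable
proof (intro conjI ballI)
  fix k :: nat
  have "{N. point_count B N = k} \<in> sigma_sets UNIV {{N. point_count B N = k} | B k. B \<in> sets borel}"
    using assms by (intro sigma_sets.Basic) auto
  then show "point_count B -` {k} \<inter> space point_configs \<in> sets point_configs"
    by (simp add: point_configs_def vimage_def)
qed simp

lemma sum_mset_indicator: "(\<Sum>x\<in>#N. indicator B x :: real) = real (point_count B N)"
  by (induction N) (auto simp: point_count_def)

lemma sum_mset_indicator_ennreal: "(\<Sum>x\<in>#N. indicator B x :: ennreal) = of_nat (point_count B N)"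
  by (induction N) (auto simp: point_count_def)

lemma sum_mset_suminf:
  fixes g :: "nat \<Rightarrow> 'a \<Rightarrow> ennreal"
  shows "(\<Sum>x\<in>#N. \<Sum>i. g i x) = (\<Sum>i. \<Sum>x\<in>#N. g i x)"
  by (induction N) (auto simp: suminf_add[OF summableI summableI])

lemma sum_mset_tendsto:
  fixes g :: "'i \<Rightarrow> 'a \<Rightarrow> 'b :: topological_comm_monoid_add"
  shows "(\<And>x. x \<in># N \<Longrightarrow> ((\<lambda>i. g i x) \<longlongrightarrow> h x) F) \<Longrightarrow> ((\<lambda>i. \<Sum>x\<in>#N. g i x) \<longlongrightarrow> (\<Sum>x\<in>#N. h x)) F"
  by (induction N) (auto intro!: tendsto_add)

text \<open>Joint measurability in configuration and parameter is what Fubini's theorem will ask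
  for. Configurations carry the sigma-algebra of the counts, so rectangles are clear, and a Dynkin
  argument does the rest.\<close>

lemma sum_mset_indicator_measurable:
  assumes C: "C \<in> sets (borel \<Otimes>\<^sub>M Y)"
  shows "(\<lambda>(N, y). \<Sum>x\<in>#N. indicator C (x, y) :: ennreal) \<in> borel_measurable (point_configs \<Otimes>\<^sub>M Y)"
proof -
  let ?G = "{a \<times> b |a b. a \<in> sets borel \<and> b \<in> sets Y}"
  have C': "C \<in> sigma_sets (space borel \<times> space Y) ?G"
    using C by (simp only: sets_pair_measure)
  show ?thesis
    using Int_stable_pair_measure_generator pair_measure_closed C'
  proof (induct rule: sigma_sets_induct_disjoint)
    case (basic A)
    then obtain a b where A: "A = a \<times> b" and [measurable]: "a \<in> sets borel" "b \<in> sets Y" by auto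
    have "(\<Sum>x\<in>#N. indicator A (x, y)) = (of_nat (point_count a N) * indicator b y :: ennreal)" for N y
      by (simp add: A indicator_times sum_mset_indicator_ennreal flip: sum_mset_distrib_right)
    then show ?case by simp
  next
    case empty then show ?case by simp
  next
    case (compl A)
    have *: "(\<Sum>x\<in>#N. indicator (space borel \<times> space Y - A) (x, y)) =
      (of_nat (point_count UNIV N) - (\<Sum>x\<in>#N. indicator A (x, y)) :: ennreal)" if "y \<in> space Y" for N y
    proof -
      have "of_nat (point_count UNIV N) = (\<Sum>x\<in>#N. indicator (space borel \<times> space Y - A) (x, y)) + (\<Sum>x\<in>#N. indicator A (x, y) :: ennreal)"
        using that by (induction N) (auto simp: point_count_def indicator_def)
      \<comment> \<open>Finiteness of the configuration permits the subtraction of extended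
        values.\<close>
      moreover have "(\<Sum>x\<in>#N. indicator A (x, y) :: ennreal) < top"
        by (induction N) (auto simp: indicator_def)
      ultimately show ?thesis by (simp add: ennreal_add_diff_cancel_right less_top)
    qed
    have "(\<lambda>(N, y). of_nat (point_count UNIV N) - (\<Sum>x\<in>#N. indicator A (x, y)) :: ennreal) \<in> borel_measurable (point_configs \<Otimes>\<^sub>M Y)"
      using compl(2) by (simp add: case_prod_unfold)
    then show ?case
      by (subst measurable_cong) (use * in \<open>auto simp: space_pair_measure\<close>)
  next
    case (union A)
    have "(\<Sum>x\<in>#N. indicator (\<Union> (range A)) (x, y)) = (\<Sum>i. \<Sum>x\<in>#N. indicator (A i) (x, y) :: ennreal)" for N y
      unfolding suminf_indicator[OF union(1), symmetric] by (rule sum_mset_suminf)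
    then show ?case using union(3) by (simp add: case_prod_unfold)
  qed
qed

lemma sum_mset_measurable_ennreal:
  fixes u :: "'a::topological_space \<times> 'y \<Rightarrow> ennreal"
  assumes "u \<in> borel_measurable (borel \<Otimes>\<^sub>M Y)"
  shows "(\<lambda>(N, y). \<Sum>x\<in>#N. u (x, y)) \<in> borel_measurable (point_configs \<Otimes>\<^sub>M Y)"
  using assms
proof (induction u rule: borel_measurable_induct)
  case (cong f g)
  have "(\<Sum>x\<in>#N. f (x, y)) = (\<Sum>x\<in>#N. g (x, y))" if "y \<in> space Y" for N y
    using cong(3) that by (intro arg_cong[where f=sum_mset] image_mset_cong) (auto simp: space_pair_measure)
  then show ?case using cong(4) by (subst measurable_cong) (auto simp: space_pair_measure)
next
  case (set A) then show ?case by (rule sum_mset_indicator_measurable)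
next
  case (mult u c)
  then show ?case by (simp add: sum_mset_distrib_left[symmetric] case_prod_unfold)
next
  case (add u v)
  then show ?case by (simp add: sum_mset.distrib case_prod_unfold)
next
  case (seq U)
  show ?case
  proof (rule borel_measurable_LIMSEQ_order)
    show "(\<lambda>(N, y). \<Sum>x\<in>#N. U i (x, y)) \<in> borel_measurable (point_configs \<Otimes>\<^sub>M Y)" for i by (rule seq.IH)
    fix p :: "'a multiset \<times> 'y"
    have "(\<lambda>i. U i q) \<longlonglongrightarrow> (SUP i. U i) q" for q
      unfolding SUP_apply by (rule LIMSEQ_SUP) (use \<open>incseq U\<close> in \<open>simp add: incseq_def le_fun_def del: split_paired_All\<close>)
    then show "(\<lambda>i. (\<lambda>(N, y). \<Sum>x\<in>#N. U i (x, y)) p) \<longlonglongrightarrow> (\<lambda>(N, y). \<Sum>x\<in>#N. (SUP i. U i) (x, y)) p"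
      unfolding case_prod_unfold by (intro sum_mset_tendsto)
  qed
qed

lemma sum_mset_measurable:
  fixes g :: "'a::topological_space \<times> 'y \<Rightarrow> real"
  assumes [measurable]: "g \<in> borel_measurable (borel \<Otimes>\<^sub>M Y)"
  shows "(\<lambda>(N, y). \<Sum>x\<in>#N. g (x, y)) \<in> borel_measurable (point_configs \<Otimes>\<^sub>M Y)"
proof -
  have e: "(\<Sum>x\<in>#N. ennreal (h x)) = ennreal (\<Sum>x\<in>#N. h x) \<and> (\<Sum>x\<in>#N. h x) \<ge> 0" if "\<And>x. h x \<ge> 0" for h :: "'a \<Rightarrow> real" and N
    by (induction N) (auto simp: that ennreal_plus)
  have "(\<Sum>x\<in>#N. g (x, y)) = enn2real (\<Sum>x\<in>#N. ennreal (max 0 (g (x, y)))) - enn2real (\<Sum>x\<in>#N. ennreal (max 0 (- g (x, y))))" for N y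
  proof -
    have "(\<Sum>x\<in>#N. g (x, y)) = (\<Sum>x\<in>#N. max 0 (g (x, y))) - (\<Sum>x\<in>#N. max 0 (- g (x, y)))"
      by (induction N) auto
    then show ?thesis
      using e[of "\<lambda>x. max 0 (g (x, y))" N] e[of "\<lambda>x. max 0 (- g (x, y))" N] by simp
  qed
  moreover have "(\<lambda>(N, y). \<Sum>x\<in>#N. ennreal (max 0 (g (x, y)))) \<in> borel_measurable (point_configs \<Otimes>\<^sub>M Y)"
    using sum_mset_measurable_ennreal[of "\<lambda>p. ennreal (max 0 (g p))" Y] by simp
  moreover have "(\<lambda>(N, y). \<Sum>x\<in>#N. ennreal (max 0 (- g (x, y)))) \<in> borel_measurable (point_configs \<Otimes>\<^sub>M Y)"
    using sum_mset_measurable_ennreal[of "\<lambda>p. ennreal (max 0 (- g p))" Y] by simp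
  ultimately show ?thesis by (simp add: case_prod_unfold)
qed

text \<open>The parametrised version over a one-point parameter space.\<close>

lemma sum_mset_measurable_fixed:
  fixes g :: "'a::topological_space \<Rightarrow> real"
  assumes "g \<in> borel_measurable borel"
  shows "(\<lambda>N. \<Sum>x\<in>#N. g x) \<in> borel_measurable point_configs"
proof -
  have "(\<lambda>p. g (fst p)) \<in> borel_measurable (borel \<Otimes>\<^sub>M (count_space UNIV :: unit measure))"
    using assms by measurable
  from sum_mset_measurable[OF this] have "(\<lambda>(N, y). \<Sum>x\<in>#N. g x) \<in> borel_measurable (point_configs \<Otimes>\<^sub>M (count_space UNIV :: unit measure))"
    by simp
  from measurable_compose[OF _ this, of "\<lambda>N. (N, ())" point_configs] show ?thesis by simp
qed

section \<open>Laplace transforms of counts and of sums over the points\<close>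

locale poisson_setting =
  fixes A :: "'a::euclidean_space set" and lam :: "'a \<Rightarrow> real" and Q :: "'a multiset measure" and \<Lambda> :: real
  assumes pp: "poisson_process A lam Q"
    and A: "A \<in> sets borel" "emeasure lborel A < \<infinity>"
    and lam_meas [measurable]: "lam \<in> borel_measurable borel"
    and lam_nonneg: "\<And>x. lam x \<ge> 0" and lam_le: "\<And>x. lam x \<le> \<Lambda>"
begin

sublocale prob_space Q
  using pp unfolding poisson_process_def by blast

lemma sets_Q [measurable_cong]: "sets Q = sets point_configs"
  using pp unfolding poisson_process_def by blast

lemma set_integrable_bounded:
  assumes "g \<in> borel_measurable borel" "\<And>x. \<bar>g x\<bar> \<le> K"
  shows "set_integrable lborel A (g :: 'a \<Rightarrow> real)"
  unfolding set_integrable_def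
proof (rule Bochner_Integration.integrable_bound)
  show "integrable lborel (\<lambda>x. K * indicator A x)"
    using A by (intro integrable_mult_right) (auto simp: integrable_indicator_iff)
  show "(\<lambda>x. indicator A x *\<^sub>R g x) \<in> borel_measurable lborel" using A assms(1) by measurable
  show "AE x in lborel. norm (indicator A x *\<^sub>R g x) \<le> norm (K * indicator A x)"
    using assms(2) by (intro AE_I2) (auto simp: indicator_def intro: order_trans[OF _ abs_ge_self])
qed

lemma set_integrable_lam: "set_integrable lborel A lam"
  by (rule set_integrable_bounded[where K=\<Lambda>]) (use lam_nonneg lam_le in auto)

lemma set_integrable_lam_mult:
  assumes "g \<in> borel_measurable borel" "\<And>x. \<bar>g x\<bar> \<le> K"
  shows "set_integrable lborel A (\<lambda>x. g x * lam x)"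
proof (rule set_integrable_bounded[where K="K * \<Lambda>"])
  show "\<bar>g x * lam x\<bar> \<le> K * \<Lambda>" for x
    using assms(2)[of x] lam_nonneg[of x] lam_le[of x] by (auto simp: abs_mult intro!: mult_mono)
qed (use assms in measurable)

text \<open>Laplace transform of a Poisson variable, summed over the values of the count. The
  formula for the law of a count enters here; independence of counts enters in the next
  lemma.\<close>

lemma nn_integral_point_count:
  assumes B: "B \<in> sets borel"
  defines "m \<equiv> LINT x:A \<inter> B|lborel. lam x"
  shows "(\<integral>\<^sup>+N. ennreal (exp (c * real (point_count B N))) \<partial>Q) = ennreal (exp (m * (exp c - 1)))"
proof -
  have m: "m \<ge> 0" unfolding m_def set_lebesgue_integral_def
    using lam_nonneg by (intro Bochner_Integration.integral_nonneg) auto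
  have [measurable]: "point_count B \<in> measurable Q (count_space UNIV)" using B by measurable
  have "(\<integral>\<^sup>+N. ennreal (exp (c * real (point_count B N))) \<partial>Q) =
    (\<integral>\<^sup>+N. (\<Sum>k. ennreal (exp (c * real k)) * indicator {N. point_count B N = k} N) \<partial>Q)"
  proof (rule nn_integral_cong)
    fix N
    show "ennreal (exp (c * real (point_count B N))) = (\<Sum>k. ennreal (exp (c * real k)) * indicator {N. point_count B N = k} N)"
      by (subst suminf_finite[of "{point_count B N}"]) (auto simp: indicator_def)
  qed
  also have "\<dots> = (\<Sum>k. \<integral>\<^sup>+N. ennreal (exp (c * real k)) * indicator {N. point_count B N = k} N \<partial>Q)"
  proof (rule nn_integral_suminf)
    fix k
    have "{N \<in> space Q. point_count B N = k} \<in> sets Q" by measurable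
    then have [measurable]: "{N. point_count B N = k} \<in> sets Q" using sets_eq_imp_space_eq[OF sets_Q] by simp
    show "(\<lambda>N. ennreal (exp (c * real k)) * indicator {N. point_count B N = k} N) \<in> borel_measurable Q" by measurable
  qed
  also have "\<dots> = (\<Sum>k. ennreal (exp (c * real k) * (m ^ k / fact k * exp (- m))))"
  proof (rule suminf_cong)
    fix k
    have "{N \<in> space Q. point_count B N = k} \<in> sets Q" by measurable
    then have S: "{N. point_count B N = k} \<in> sets Q" using sets_eq_imp_space_eq[OF sets_Q] by simp
    have "measure Q {N. point_count B N = k} = m ^ k / fact k * exp (- m)"
      using pp B unfolding poisson_process_def m_def by (auto simp: Let_def)
    then have "emeasure Q {N. point_count B N = k} = ennreal (m ^ k / fact k * exp (- m))"
      by (simp add: emeasure_eq_measure)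
    then show "(\<integral>\<^sup>+N. ennreal (exp (c * real k)) * indicator {N. point_count B N = k} N \<partial>Q) =
        ennreal (exp (c * real k) * (m ^ k / fact k * exp (- m)))"
      using m S by (simp add: nn_integral_cmult ennreal_mult'[symmetric] mult_ac)
  qed
  also have "\<dots> = ennreal (exp (m * (exp c - 1)))"
  proof (rule suminf_ennreal_eq)
    show "0 \<le> exp (c * real k) * (m ^ k / fact k * exp (- m))" for k using m by simp
    have "(\<lambda>k. (m * exp c) ^ k /\<^sub>R fact k * exp (- m)) sums (exp (m * exp c) * exp (- m))"
      by (intro sums_mult2 exp_converges)
    then show "(\<lambda>k. exp (c * real k) * (m ^ k / fact k * exp (- m))) sums exp (m * (exp c - 1))"
      by (simp add: power_mult_distrib exp_of_nat_mult[symmetric] mult_ac divide_inverse exp_add[symmetric] algebra_simps)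
  qed
  finally show ?thesis .
qed

lemma exp_sum_simple:
  fixes c :: "nat \<Rightarrow> real" and B :: "nat \<Rightarrow> 'a set"
  assumes B: "\<And>i. i < r \<Longrightarrow> B i \<in> sets borel" and disj: "disjoint_family_on B {..<r}"
  shows "(\<integral>\<^sup>+N. ennreal (exp (\<Sum>i<r. c i * real (point_count (B i) N))) \<partial>Q) =
    ennreal (exp (\<Sum>i<r. (exp (c i) - 1) * (LINT x:A \<inter> B i|lborel. lam x)))"
proof -
  have "indep_vars (\<lambda>_. count_space UNIV) (\<lambda>i. point_count (B i)) {..<r}"
    using pp B disj unfolding poisson_process_def by blast
  then have ind: "indep_vars (\<lambda>_. borel) (\<lambda>i N. ennreal (exp (c i * real (point_count (B i) N)))) {..<r}"
    by (rule indep_vars_compose2[where Y="\<lambda>i k. ennreal (exp (c i * real k))"]) auto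
  have "(\<integral>\<^sup>+N. ennreal (exp (\<Sum>i<r. c i * real (point_count (B i) N))) \<partial>Q) =
    (\<integral>\<^sup>+N. (\<Prod>i<r. ennreal (exp (c i * real (point_count (B i) N)))) \<partial>Q)"
    by (simp add: exp_sum prod_ennreal)
  also have "\<dots> = (\<Prod>i<r. \<integral>\<^sup>+N. ennreal (exp (c i * real (point_count (B i) N))) \<partial>Q)"
    by (rule indep_vars_nn_integral[OF _ ind]) auto
  also have "\<dots> = (\<Prod>i<r. ennreal (exp ((LINT x:A \<inter> B i|lborel. lam x) * (exp (c i) - 1))))"
    using B by (intro prod.cong nn_integral_point_count) auto
  also have "\<dots> = ennreal (exp (\<Sum>i<r. (exp (c i) - 1) * (LINT x:A \<inter> B i|lborel. lam x)))"
    by (simp add: exp_sum prod_ennreal mult.commute)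
  finally show ?thesis .
qed

text \<open>Equality holds as well, but Fatou's lemma yields this direction at once and it suffices.\<close>

lemma exp_sum_le:
  fixes f :: "'a \<Rightarrow> real"
  assumes f [measurable]: "f \<in> borel_measurable borel" and K: "\<And>x. \<bar>f x\<bar> \<le> K"
  shows "(\<integral>\<^sup>+N. ennreal (exp (\<Sum>x\<in>#N. f x)) \<partial>Q) \<le> ennreal (exp (LINT x:A|lborel. (exp (f x) - 1) * lam x))"
proof -
  have K0: "K \<ge> 0" using K[of 0] by simp
  \<comment> \<open>Rounding down keeps \<open>fk k\<close> below \<open>f\<close>. Since
    \<open>exp\<close> is increasing, the right-hand side for \<open>fk k\<close> is at most the one
    for \<open>f\<close>, and a limit is taken on the left only.\<close>
  define fk where "fk k x = of_int \<lfloor>real (Suc k) * f x\<rfloor> / real (Suc k)" for k x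
  have fk_le: "fk k x \<le> f x" for k x
    unfolding fk_def by (simp add: pos_divide_le_eq mult.commute)
  have fk_ge: "f x - 1 / real (Suc k) \<le> fk k x" for k x
  proof -
    have "real (Suc k) * f x - 1 \<le> of_int \<lfloor>real (Suc k) * f x\<rfloor>" by linarith
    then have "(real (Suc k) * f x - 1) / real (Suc k) \<le> fk k x" unfolding fk_def by (intro divide_right_mono) auto
    then show ?thesis by (simp add: diff_divide_distrib)
  qed
  have fk_lim: "(\<lambda>k. fk k x) \<longlonglongrightarrow> f x" for x
  proof (rule tendsto_sandwich)
    show "(\<lambda>k. f x - 1 / real (Suc k)) \<longlonglongrightarrow> f x"
      using tendsto_diff[OF tendsto_const LIMSEQ_inverse_real_of_nat, of "f x"] by (simp add: divide_inverse)
  qed (use fk_le fk_ge in auto)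
  have fk_meas [measurable]: "fk k \<in> borel_measurable borel" for k unfolding fk_def by measurable
  have fk_bound: "\<bar>fk k x\<bar> \<le> K + 1" for k x
  proof -
    have "1 / real (Suc k) \<le> 1" by simp
    then show ?thesis using fk_le[of k x] fk_ge[of x k] K[of x] by linarith
  qed
  have step: "(\<integral>\<^sup>+N. ennreal (exp (\<Sum>x\<in>#N. fk k x)) \<partial>Q) \<le> ennreal (exp (LINT x:A|lborel. (exp (f x) - 1) * lam x))" for k
  proof -
    \<comment> \<open>The rounded function has finitely many values; its level sets
      \<open>B i\<close> are numbered by natural numbers through the shift by
      \<open>K'\<close>.\<close>
    define K' where "K' = nat \<lceil>real (Suc k) * (K + 1)\<rceil>"
    define r where "r = 2 * K' + 1"
    define B where "B i = {x. \<lfloor>real (Suc k) * f x\<rfloor> = int i - int K'}" for i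
    define c where "c i = (real i - real K') / real (Suc k)" for i
    have B: "B i \<in> sets borel" for i
    proof -
      have "{x \<in> space borel. \<lfloor>real (Suc k) * f x\<rfloor> = int i - int K'} \<in> sets borel" by measurable
      then show ?thesis by (simp add: B_def)
    qed
    have disj: "disjoint_family_on B {..<r}" by (auto simp: disjoint_family_on_def B_def)
    have part: "g (fk k x) = (\<Sum>i<r. g (c i) * indicator (B i) x)" for g :: "real \<Rightarrow> real" and x
    proof -
      define i where "i = nat (\<lfloor>real (Suc k) * f x\<rfloor> + int K')"
      have "\<bar>of_int \<lfloor>real (Suc k) * f x\<rfloor>\<bar> \<le> real (Suc k) * (K + 1)"
        using fk_bound[of k x] unfolding fk_def by (simp add: abs_divide pos_divide_le_eq mult.commute)
      then have b: "\<bar>\<lfloor>real (Suc k) * f x\<rfloor>\<bar> \<le> int K'" unfolding K'_def using K0 by linarith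
      have i: "i < r" "int i - int K' = \<lfloor>real (Suc k) * f x\<rfloor>" using b by (auto simp: i_def r_def)
      have "c i = fk k x"
      proof -
        have "real i - real K' = of_int (int i - int K')" by simp
        then show ?thesis unfolding c_def fk_def i(2)[symmetric] by simp
      qed
      moreover have "indicator (B i') x = (if i' = i then 1 else 0 :: real)" for i'
        using i(2) by (auto simp: B_def indicator_def)
      ultimately show ?thesis using i(1) by (simp add: if_distrib[of "\<lambda>z. _ * z"] cong: if_cong)
    qed
    have sumN: "(\<Sum>x\<in>#N. fk k x) = (\<Sum>i<r. c i * real (point_count (B i) N))" for N
    proof -
      have "(\<Sum>x\<in>#N. fk k x) = (\<Sum>x\<in>#N. \<Sum>i<r. c i * indicator (B i) x)" using part[of "\<lambda>x. x"] by simp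
      also have "\<dots> = (\<Sum>i<r. \<Sum>x\<in>#N. c i * indicator (B i) x)"
        by (induction N) (auto simp: sum.distrib)
      also have "\<dots> = (\<Sum>i<r. c i * real (point_count (B i) N))"
        by (simp add: sum_mset_indicator sum_mset_distrib_left[symmetric])
      finally show ?thesis .
    qed
    have "(\<Sum>i<r. (exp (c i) - 1) * (LINT x:A \<inter> B i|lborel. lam x)) =
      (\<Sum>i<r. (exp (c i) - 1) * (LINT x:A|lborel. indicator (B i) x * lam x))"
      by (simp add: set_lebesgue_integral_def indicator_inter_arith mult.assoc)
    also have "\<dots> = (LINT x:A|lborel. (\<Sum>i<r. (exp (c i) - 1) * (indicator (B i) x * lam x)))"
      using B by (subst set_integral_sum) (auto intro!: set_integrable_lam_mult[where K=1] simp: indicator_def)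
    also have "\<dots> = (LINT x:A|lborel. (exp (fk k x) - 1) * lam x)"
    proof -
      have "exp (fk k x) - 1 = (\<Sum>i<r. (exp (c i) - 1) * indicator (B i) x)" for x
        by (rule part[of "\<lambda>t. exp t - 1"])
      then show ?thesis by (simp only: sum_distrib_right mult.assoc)
    qed
    also have "\<dots> \<le> (LINT x:A|lborel. (exp (f x) - 1) * lam x)"
    proof (rule set_integral_mono)
      have bnd: "\<bar>exp t - 1\<bar> \<le> exp (K + 1) + 1" if "\<bar>t\<bar> \<le> K + 1" for t
      proof -
        have "exp t \<le> exp (K + 1)" "exp t > 0" using that by auto
        then show ?thesis by linarith
      qed
      show "set_integrable lborel A (\<lambda>x. (exp (fk k x) - 1) * lam x)"
        using bnd fk_bound by (intro set_integrable_lam_mult[where K="exp (K + 1) + 1"]) auto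
      have "\<bar>f x\<bar> \<le> K + 1" for x using K[of x] by linarith
      then show "set_integrable lborel A (\<lambda>x. (exp (f x) - 1) * lam x)"
        using bnd by (intro set_integrable_lam_mult[where K="exp (K + 1) + 1"]) auto
      show "(exp (fk k x) - 1) * lam x \<le> (exp (f x) - 1) * lam x" for x
        using fk_le lam_nonneg by (intro mult_right_mono) auto
    qed
    finally show ?thesis
      using exp_sum_simple[OF B disj, of c] by (simp add: sumN ennreal_leI)
  qed
  have "(\<integral>\<^sup>+N. ennreal (exp (\<Sum>x\<in>#N. f x)) \<partial>Q) = (\<integral>\<^sup>+N. liminf (\<lambda>k. ennreal (exp (\<Sum>x\<in>#N. fk k x))) \<partial>Q)"
  proof (rule nn_integral_cong)
    fix N
    have "(\<lambda>k. ennreal (exp (\<Sum>x\<in>#N. fk k x))) \<longlonglongrightarrow> ennreal (exp (\<Sum>x\<in>#N. f x))"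
      by (intro tendsto_ennrealI tendsto_exp sum_mset_tendsto fk_lim)
    then show "ennreal (exp (\<Sum>x\<in>#N. f x)) = liminf (\<lambda>k. ennreal (exp (\<Sum>x\<in>#N. fk k x)))"
      by (intro lim_imp_Liminf[symmetric]) auto
  qed
  also have "\<dots> \<le> liminf (\<lambda>k. \<integral>\<^sup>+N. ennreal (exp (\<Sum>x\<in>#N. fk k x)) \<partial>Q)"
  proof (rule nn_integral_liminf)
    fix k
    have "(\<lambda>N. \<Sum>x\<in>#N. fk k x) \<in> borel_measurable Q"
      using sum_mset_measurable_fixed[OF fk_meas] by (simp cong: measurable_cong_sets add: sets_Q)
    then show "(\<lambda>N. ennreal (exp (\<Sum>x\<in>#N. fk k x))) \<in> borel_measurable Q" by measurable
  qed
  also have "\<dots> \<le> liminf (\<lambda>k. ennreal (exp (LINT x:A|lborel. (exp (f x) - 1) * lam x)))"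
    by (intro Liminf_mono always_eventually allI step)
  finally show ?thesis by (simp add: Liminf_const)
qed

end

section \<open>Likelihood ratios and the posterior\<close>

lemma exp_minus_quadratic: "exp (- s) \<le> 1 - s + s\<^sup>2" if "0 \<le> s" for s :: real
proof -
  have "exp (- s) \<le> 1 / (1 + s)"
    using that exp_ge_add_one_self[of s] by (simp add: exp_minus field_simps)
  also have "\<dots> \<le> 1 - s + s\<^sup>2"
  proof -
    have "(1 - s + s\<^sup>2) * (1 + s) = 1 + s ^ 3" by (simp add: power2_eq_square power3_eq_cube algebra_simps)
    then show ?thesis using that by (simp add: pos_divide_le_eq)
  qed
  finally show ?thesis .
qed

locale posterior_setting = poisson_setting A lam Q \<Lambda> + prior: prob_space \<Theta>
  for A :: "'a::euclidean_space set" and lam :: "'a \<Rightarrow> real" and Q \<Lambda> and \<Theta> :: "'p measure" +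
  fixes F :: "'p \<Rightarrow> 'a \<Rightarrow> real" and c0 :: real
  assumes c0: "c0 > 0" and lam_ge: "\<And>x. c0 \<le> lam x"
    and F_measurable: "(\<lambda>(x, p). F p x) \<in> borel_measurable (borel \<Otimes>\<^sub>M \<Theta>)"
    and F_pos: "\<And>p x. p \<in> space \<Theta> \<Longrightarrow> F p x > 0"
    and F_bounded: "\<And>p. p \<in> space \<Theta> \<Longrightarrow> \<exists>K. \<forall>x. \<bar>ln (F p x)\<bar> \<le> K"
begin

text \<open>Density of the Poisson law with intensity \<open>F p\<close> on \<open>A\<close> with
  respect to the true one. It differs from the likelihood by a factor free of \<open>p\<close>,
  which cancels in the posterior.\<close>

definition ratio :: "'p \<Rightarrow> 'a multiset \<Rightarrow> real" where
  "ratio p N = exp ((\<Sum>x\<in>#N. ln (F p x / lam x)) - (LINT x:A|lborel. F p x - lam x))"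

lemma lam_pos: "lam x > 0" using lam_ge[of x] c0 by linarith

lemma F_measurable_x [measurable]: "p \<in> space \<Theta> \<Longrightarrow> F p \<in> borel_measurable borel"
  using measurable_compose[OF measurable_Pair2' F_measurable] by simp

lemma F_measurable_swap: "(\<lambda>(p, x). F p x) \<in> borel_measurable (\<Theta> \<Otimes>\<^sub>M borel)"
  using measurable_pair_swap[OF F_measurable] by simp

lemma space_Q [simp]: "space Q = UNIV"
  using sets_eq_imp_space_eq[OF sets_Q] by simp

lemma F_upper:
  assumes "p \<in> space \<Theta>" obtains K where "K > 0" "\<And>x. F p x \<le> K"
proof -
  obtain K where K: "\<And>x. \<bar>ln (F p x)\<bar> \<le> K" using F_bounded[OF assms] by blast
  have "F p x \<le> exp K" for x
    using K[of x] F_pos[OF assms, of x] by (metis abs_le_D1 exp_le_cancel_iff exp_ln)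
  then show ?thesis by (rule that[OF exp_gt_zero])
qed

lemma ln_ratio_bounded:
  assumes "p \<in> space \<Theta>" obtains K where "\<And>x. \<bar>ln (F p x / lam x)\<bar> \<le> K"
proof -
  obtain K where K: "\<And>x. \<bar>ln (F p x)\<bar> \<le> K" using F_bounded[OF assms] by blast
  have "\<bar>ln (F p x / lam x)\<bar> \<le> K + (\<bar>ln c0\<bar> + \<bar>ln \<Lambda>\<bar>)" for x
  proof -
    have "ln c0 \<le> ln (lam x)" "ln (lam x) \<le> ln \<Lambda>"
      using c0 lam_ge[of x] lam_le[of x] lam_pos[of x] by auto
    moreover have "ln (F p x / lam x) = ln (F p x) - ln (lam x)"
      using F_pos[OF assms, of x] lam_pos[of x] by (simp add: ln_div)
    ultimately show ?thesis using K[of x] by linarith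
  qed
  then show ?thesis by (rule that)
qed

lemma F_integrable: "p \<in> space \<Theta> \<Longrightarrow> set_integrable lborel A (F p)"
proof -
  assume p: "p \<in> space \<Theta>"
  obtain K where "K > 0" "\<And>x. F p x \<le> K" by (rule F_upper[OF p]) (rule that)
  then show ?thesis using p F_pos[OF p]
    by (intro set_integrable_bounded[where K=K]) (auto simp: less_imp_le)
qed

lemma F_integrable_indicator:
  assumes "p \<in> space \<Theta>" "S \<in> sets borel"
  shows "set_integrable lborel A (\<lambda>x. indicator S x * F p x)"
proof -
  obtain K where K: "K > 0" "\<And>x. F p x \<le> K" by (rule F_upper[OF assms(1)]) (rule that)
  show ?thesis
  proof (rule set_integrable_bounded[where K=K])
    show "(\<lambda>x. indicator S x * F p x) \<in> borel_measurable borel" using assms by measurable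
    show "\<bar>indicator S x * F p x\<bar> \<le> K" for x
      using K(1) K(2)[of x] F_pos[OF assms(1), of x] by (cases "x \<in> S") auto
  qed
qed

lemma ratio_measurable: "(\<lambda>(N, p). ratio p N) \<in> borel_measurable (Q \<Otimes>\<^sub>M \<Theta>)"
proof -
  have "(\<lambda>(x, p). ln (F p x / lam x)) \<in> borel_measurable (borel \<Otimes>\<^sub>M \<Theta>)"
    using F_measurable by (simp add: case_prod_unfold)
  from sum_mset_measurable[OF this]
  have 1: "(\<lambda>(N, p). \<Sum>x\<in>#N. ln (F p x / lam x)) \<in> borel_measurable (Q \<Otimes>\<^sub>M \<Theta>)"
    by (simp cong: measurable_cong_sets sets_pair_measure_cong add: sets_Q)
  have "(\<lambda>(p, x). indicator A x *\<^sub>R (F p x - lam x)) \<in> borel_measurable (\<Theta> \<Otimes>\<^sub>M lborel)"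
    using F_measurable_swap A(1) by (simp add: case_prod_unfold cong: measurable_cong_sets sets_pair_measure_cong)
  from lborel.borel_measurable_lebesgue_integral[OF this]
  have 2: "(\<lambda>p. LINT x:A|lborel. F p x - lam x) \<in> borel_measurable \<Theta>"
    by (simp add: set_lebesgue_integral_def)
  show ?thesis
    unfolding ratio_def case_prod_unfold
    by (intro measurable_compose[OF _ borel_measurable_exp] borel_measurable_diff
        1[unfolded case_prod_unfold] measurable_compose[OF measurable_snd 2])
qed

lemma ratio_measurable_N: "p \<in> space \<Theta> \<Longrightarrow> ratio p \<in> borel_measurable Q"
  using measurable_compose[OF measurable_Pair2' ratio_measurable] by simp

lemma ratio_measurable_p: "(\<lambda>p. ratio p N) \<in> borel_measurable \<Theta>"
  using measurable_compose[OF measurable_Pair1' ratio_measurable, of N] by simp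

lemma ratio_pos: "ratio p N > 0" by (simp add: ratio_def)

lemma sum_indicator_count: "(\<Sum>x\<in>#N. f x + s * indicator S x) = (\<Sum>x\<in>#N. f x) + s * real (point_count S N)"
  by (simp add: sum_mset.distrib sum_mset_indicator sum_mset_distrib_left[symmetric])

text \<open>Weighted by the ratio, the configuration behaves as one with intensity
  \<open>F p\<close>, so the right-hand side is the Laplace transform of the count of
  \<open>S\<close> under \<open>F p\<close>. The weight is absorbed into the summand
  \<open>f\<close>; no second Poisson process is constructed.\<close>

lemma tilted_expectation_le:
  assumes p: "p \<in> space \<Theta>" and S: "S \<in> sets borel"
  shows "(\<integral>\<^sup>+N. ennreal (exp (s * real (point_count S N)) * ratio p N) \<partial>Q) \<le>
    ennreal (exp ((exp s - 1) * (LINT x:A|lborel. indicator S x * F p x)))"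
proof -
  obtain K where K: "\<And>x. \<bar>ln (F p x / lam x)\<bar> \<le> K" by (rule ln_ratio_bounded[OF p]) (rule that)
  define f where "f x = ln (F p x / lam x) + s * indicator S x" for x
  have fm: "f \<in> borel_measurable borel" unfolding f_def using p S by measurable
  have fb: "\<bar>f x\<bar> \<le> K + \<bar>s\<bar>" for x
    using K[of x] unfolding f_def by (auto simp: indicator_def)
  define I where "I = (LINT x:A|lborel. F p x - lam x)"
  have "(\<integral>\<^sup>+N. ennreal (exp (s * real (point_count S N)) * ratio p N) \<partial>Q) =
    (\<integral>\<^sup>+N. ennreal (exp (- I)) * ennreal (exp (\<Sum>x\<in>#N. f x)) \<partial>Q)"
    unfolding ratio_def f_def sum_indicator_count I_def
    by (intro nn_integral_cong) (simp add: ennreal_mult'[symmetric] exp_add[symmetric] algebra_simps)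
  also have "\<dots> = ennreal (exp (- I)) * (\<integral>\<^sup>+N. ennreal (exp (\<Sum>x\<in>#N. f x)) \<partial>Q)"
    using sum_mset_measurable_fixed[OF fm] by (intro nn_integral_cmult) measurable
  also have "\<dots> \<le> ennreal (exp (- I)) * ennreal (exp (LINT x:A|lborel. (exp (f x) - 1) * lam x))"
    by (intro mult_left_mono exp_sum_le[OF fm fb]) auto
  also have "\<dots> = ennreal (exp (- I + (LINT x:A|lborel. (exp (f x) - 1) * lam x)))"
    by (simp add: ennreal_mult'[symmetric] exp_add[symmetric])
  also have "(LINT x:A|lborel. (exp (f x) - 1) * lam x) =
    (LINT x:A|lborel. (F p x - lam x) + (exp s - 1) * (indicator S x * F p x))"
  proof (rule arg_cong[where f="set_lebesgue_integral lborel A"], rule ext)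
    fix x
    have "exp (f x) = (F p x / lam x) * exp (s * indicator S x)"
      using F_pos[OF p] lam_pos by (simp add: f_def exp_add)
    then show "(exp (f x) - 1) * lam x = (F p x - lam x) + (exp s - 1) * (indicator S x * F p x)"
      using lam_pos[of x] by (auto simp: indicator_def field_simps)
  qed
  also have "\<dots> = I + (exp s - 1) * (LINT x:A|lborel. indicator S x * F p x)"
    unfolding I_def using F_integrable[OF p] set_integrable_lam F_integrable_indicator[OF p S]
    by (subst set_integral_add) auto
  finally show ?thesis by simp
qed

lemma expectation_ratio_le: "p \<in> space \<Theta> \<Longrightarrow> (\<integral>\<^sup>+N. ennreal (ratio p N) \<partial>Q) \<le> 1"
  using tilted_expectation_le[of p "{}" 0] by simp

text \<open>The integrand \<open>F - lam + (lam / F - 1) * lam\<close> collapses to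
  \<open>(lam - F)\<^sup>2 / F\<close>, a chi-square divergence.\<close>

lemma expectation_inverse_ratio_le:
  assumes p: "p \<in> space \<Theta>"
  shows "(\<integral>\<^sup>+N. ennreal (1 / ratio p N) \<partial>Q) \<le> ennreal (exp (LINT x:A|lborel. (lam x - F p x)\<^sup>2 / F p x))"
proof -
  obtain K where K: "\<And>x. \<bar>ln (F p x / lam x)\<bar> \<le> K" by (rule ln_ratio_bounded[OF p]) (rule that)
  define f where "f x = - ln (F p x / lam x)" for x
  have fm: "f \<in> borel_measurable borel" unfolding f_def using p by measurable
  have fb: "\<bar>f x\<bar> \<le> K" for x using K[of x] unfolding f_def by simp
  define I where "I = (LINT x:A|lborel. F p x - lam x)"
  have neg: "(\<Sum>x\<in>#N. f x) = - (\<Sum>x\<in>#N. ln (F p x / lam x))" for N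
    unfolding f_def by (induction N) auto
  have "(\<integral>\<^sup>+N. ennreal (1 / ratio p N) \<partial>Q) =
    (\<integral>\<^sup>+N. ennreal (exp I) * ennreal (exp (\<Sum>x\<in>#N. f x)) \<partial>Q)"
    unfolding ratio_def neg I_def
    by (intro nn_integral_cong) (simp add: ennreal_mult'[symmetric] exp_add[symmetric] exp_minus[symmetric] inverse_eq_divide[symmetric] algebra_simps)
  also have "\<dots> = ennreal (exp I) * (\<integral>\<^sup>+N. ennreal (exp (\<Sum>x\<in>#N. f x)) \<partial>Q)"
    using sum_mset_measurable_fixed[OF fm] by (intro nn_integral_cmult) measurable
  also have "\<dots> \<le> ennreal (exp I) * ennreal (exp (LINT x:A|lborel. (exp (f x) - 1) * lam x))"
    by (intro mult_left_mono exp_sum_le[OF fm fb]) auto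
  also have "\<dots> = ennreal (exp (I + (LINT x:A|lborel. (exp (f x) - 1) * lam x)))"
    by (simp add: ennreal_mult'[symmetric] exp_add[symmetric])
  also have "I + (LINT x:A|lborel. (exp (f x) - 1) * lam x) = (LINT x:A|lborel. (F p x - lam x) + (exp (f x) - 1) * lam x)"
  proof -
    have "\<bar>exp (f x) - 1\<bar> \<le> exp K + 1" for x
    proof -
      have "exp (f x) \<le> exp K" "exp (f x) > 0" using fb[of x] by auto
      then show ?thesis by linarith
    qed
    then have "set_integrable lborel A (\<lambda>x. (exp (f x) - 1) * lam x)"
      using fm by (intro set_integrable_lam_mult) auto
    then show ?thesis unfolding I_def using F_integrable[OF p] set_integrable_lam
      by (subst set_integral_add) auto
  qed
  also have "\<dots> = (LINT x:A|lborel. (lam x - F p x)\<^sup>2 / F p x)"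
  proof (rule arg_cong[where f="set_lebesgue_integral lborel A"], rule ext)
    fix x
    have "exp (f x) = lam x / F p x"
      using F_pos[OF p] lam_pos by (simp add: f_def exp_minus)
    then show "(F p x - lam x) + (exp (f x) - 1) * lam x = (lam x - F p x)\<^sup>2 / F p x"
      using F_pos[OF p, of x] by (simp add: field_simps power2_eq_square)
  qed
  finally show ?thesis .
qed

section \<open>Deviations of counts under the truth and under a far intensity\<close>

definition mass :: "'a set \<Rightarrow> real" where "mass S = (LINT x:A|lborel. indicator S x * lam x)"

lemma mass_alt: "(LINT x:A \<inter> S|lborel. lam x) = mass S"
  by (simp add: mass_def set_lebesgue_integral_def indicator_inter_arith mult.assoc)

lemma mass_nonneg: "mass S \<ge> 0"
  unfolding mass_def set_lebesgue_integral_def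
  using lam_nonneg by (intro Bochner_Integration.integral_nonneg) (auto simp: indicator_def)

text \<open>Chernoff's bound for both signs \<sigma>, with
  \<open>exp (\<sigma> * s) - 1 - \<sigma> * s <= s\<^sup>2\<close> for \<open>s\<close> in the unit
  interval. The parameter \<open>s\<close> stays free; it will be the rate.\<close>

lemma count_deviation:
  assumes S: "S \<in> sets borel" and m: "mass S \<le> m" and s: "0 \<le> s" "s \<le> 1"
  shows "emeasure Q {N. t < \<bar>real (point_count S N) - mass S\<bar>} \<le> ennreal (2 * exp (- s * t + s\<^sup>2 * m))"
proof -
  have [measurable]: "point_count S \<in> measurable Q (count_space UNIV)" using S by measurable
  have ev: "{N. t < \<sigma> * (real (point_count S N) - mass S)} \<in> sets Q" for \<sigma>
  proof -
    have "{N \<in> space Q. t < \<sigma> * (real (point_count S N) - mass S)} \<in> sets Q" by measurable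
    then show ?thesis by simp
  qed
  have one: "emeasure Q {N. t < \<sigma> * (real (point_count S N) - mass S)} \<le> ennreal (exp (- s * t + s\<^sup>2 * m))"
    if \<sigma>: "\<sigma> = 1 \<or> \<sigma> = -1" for \<sigma> :: real
  proof -
    have ex: "exp (\<sigma> * s) - 1 - \<sigma> * s \<le> s\<^sup>2"
      using \<sigma> s exp_bound[of s] exp_minus_quadratic[of s] by auto
    have "emeasure Q {N. t < \<sigma> * (real (point_count S N) - mass S)} =
      (\<integral>\<^sup>+N. indicator {N. t < \<sigma> * (real (point_count S N) - mass S)} N \<partial>Q)"
      by (rule nn_integral_indicator[OF ev, symmetric])
    also have "\<dots> \<le> (\<integral>\<^sup>+N. ennreal (exp (- s * t - \<sigma> * s * mass S)) * ennreal (exp (\<sigma> * s * real (point_count S N))) \<partial>Q)"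
    proof (rule nn_integral_mono)
      fix N
      show "indicator {N. t < \<sigma> * (real (point_count S N) - mass S)} N \<le>
          ennreal (exp (- s * t - \<sigma> * s * mass S)) * ennreal (exp (\<sigma> * s * real (point_count S N)))"
      proof (cases "t < \<sigma> * (real (point_count S N) - mass S)")
        case True
        then have "s * t \<le> s * (\<sigma> * (real (point_count S N) - mass S))" using s by (intro mult_left_mono) auto
        then have "1 \<le> exp (- s * t - \<sigma> * s * mass S) * exp (\<sigma> * s * real (point_count S N))"
          by (simp add: exp_add[symmetric] algebra_simps)
        then show ?thesis using True by (simp add: ennreal_mult'[symmetric] ennreal_leI flip: ennreal_1)
      qed simp
    qed
    also have "\<dots> = ennreal (exp (- s * t - \<sigma> * s * mass S)) * ennreal (exp (mass S * (exp (\<sigma> * s) - 1)))"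
      using nn_integral_point_count[OF S, of "\<sigma> * s"] by (subst nn_integral_cmult) (auto simp: mass_alt)
    also have "\<dots> = ennreal (exp (- s * t + mass S * (exp (\<sigma> * s) - 1 - \<sigma> * s)))"
      by (simp add: ennreal_mult'[symmetric] exp_add[symmetric] algebra_simps)
    also have "\<dots> \<le> ennreal (exp (- s * t + s\<^sup>2 * m))"
    proof -
      have "mass S * (exp (\<sigma> * s) - 1 - \<sigma> * s) \<le> mass S * s\<^sup>2"
        using mass_nonneg[of S] ex by (intro mult_left_mono)
      also have "\<dots> \<le> m * s\<^sup>2" using m by (intro mult_right_mono) auto
      finally show ?thesis by (intro ennreal_leI) (simp add: mult.commute)
    qed
    finally show ?thesis .
  qed
  have "{N. t < \<bar>real (point_count S N) - mass S\<bar>} \<subseteq>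
    {N. t < 1 * (real (point_count S N) - mass S)} \<union> {N. t < -1 * (real (point_count S N) - mass S)}" by auto
  then have "emeasure Q {N. t < \<bar>real (point_count S N) - mass S\<bar>} \<le>
     emeasure Q ({N. t < 1 * (real (point_count S N) - mass S)} \<union> {N. t < -1 * (real (point_count S N) - mass S)})"
    by (rule emeasure_mono) (intro sets.Un ev)
  also have "\<dots> \<le> emeasure Q {N. t < 1 * (real (point_count S N) - mass S)} + emeasure Q {N. t < -1 * (real (point_count S N) - mass S)}"
    by (rule emeasure_subadditive; rule ev)
  also have "\<dots> \<le> ennreal (exp (- s * t + s\<^sup>2 * m)) + ennreal (exp (- s * t + s\<^sup>2 * m))"
    by (intro add_mono one) auto
  finally show ?thesis by (simp flip: ennreal_plus)
qed

text \<open>On \<open>G\<close> the count is within \<open>t\<close> of its true mean, while its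
  mean under \<open>F p\<close> is at least \<open>4 * t\<close> away from that. The tilt points
  from the mean under \<open>F p\<close> towards the true one. If \<open>F p\<close> has more mass
  on \<open>S\<close>, half of the gain \<open>s * \<Delta>\<close> pays for
  \<open>s\<^sup>2 * \<Delta>\<close>, hence \<open>s <= 1 / 2\<close> and the factor 4.\<close>

lemma far_ratio_small:
  assumes p: "p \<in> space \<Theta>" and S: "S \<in> sets borel" and m: "mass S \<le> m" and s: "0 \<le> s" "s \<le> 1 / 2" and t: "t \<ge> 0"
    and far: "4 * t \<le> \<bar>(LINT x:A|lborel. indicator S x * F p x) - mass S\<bar>"
    and G: "\<And>N. N \<in> G \<Longrightarrow> \<bar>real (point_count S N) - mass S\<bar> \<le> t"
  shows "(\<integral>\<^sup>+N. indicator G N * ennreal (ratio p N) \<partial>Q) \<le> ennreal (exp (- s * t + s\<^sup>2 * m))"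
proof -
  define FS where "FS = (LINT x:A|lborel. indicator S x * F p x)"
  have FS0: "FS \<ge> 0" unfolding FS_def set_lebesgue_integral_def
    using F_pos[OF p] by (intro Bochner_Integration.integral_nonneg) (auto simp: indicator_def less_imp_le)
  have bound: "(\<integral>\<^sup>+N. indicator G N * ennreal (ratio p N) \<partial>Q) \<le>
    ennreal (exp (s * t - \<sigma> * s * mass S + FS * (exp (\<sigma> * s) - 1)))"
    if \<sigma>: "\<sigma> = 1 \<or> \<sigma> = -1" for \<sigma> :: real
  proof -
    have "(\<integral>\<^sup>+N. indicator G N * ennreal (ratio p N) \<partial>Q) \<le>
      (\<integral>\<^sup>+N. ennreal (exp (s * t - \<sigma> * s * mass S)) * ennreal (exp (\<sigma> * s * real (point_count S N)) * ratio p N) \<partial>Q)"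
    proof (rule nn_integral_mono)
      fix N
      show "indicator G N * ennreal (ratio p N) \<le>
          ennreal (exp (s * t - \<sigma> * s * mass S)) * ennreal (exp (\<sigma> * s * real (point_count S N)) * ratio p N)"
      proof (cases "N \<in> G")
        case True
        then have "- t \<le> \<sigma> * (real (point_count S N) - mass S)" using G[OF True] \<sigma> by auto
        then have "s * (- t) \<le> s * (\<sigma> * (real (point_count S N) - mass S))" using s by (intro mult_left_mono) auto
        then have "1 \<le> exp (s * t - \<sigma> * s * mass S) * exp (\<sigma> * s * real (point_count S N))"
          by (simp add: exp_add[symmetric] algebra_simps)
        then have "1 * ratio p N \<le> (exp (s * t - \<sigma> * s * mass S) * exp (\<sigma> * s * real (point_count S N))) * ratio p N"
          using ratio_pos[of p N] by (intro mult_right_mono) auto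
        then show ?thesis using True by (simp add: ennreal_mult'[symmetric] ennreal_leI mult.assoc)
      qed simp
    qed
    also have "\<dots> \<le> ennreal (exp (s * t - \<sigma> * s * mass S)) * ennreal (exp ((exp (\<sigma> * s) - 1) * FS))"
    proof (subst nn_integral_cmult)
      have [measurable]: "point_count S \<in> measurable Q (count_space UNIV)" using S by measurable
      note [measurable] = ratio_measurable_N[OF p]
      show "(\<lambda>N. ennreal (exp (\<sigma> * s * real (point_count S N)) * ratio p N)) \<in> borel_measurable Q" by measurable
    qed (use tilted_expectation_le[OF p S, of "\<sigma> * s"] in \<open>auto intro!: mult_left_mono simp: FS_def\<close>)
    also have "\<dots> = ennreal (exp (s * t - \<sigma> * s * mass S + FS * (exp (\<sigma> * s) - 1)))"
      by (simp add: ennreal_mult'[symmetric] exp_add[symmetric] mult.commute)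
    finally show ?thesis .
  qed
  have s2: "s\<^sup>2 * mass S \<le> s\<^sup>2 * m" using m by (intro mult_left_mono) auto
  show ?thesis
  proof (cases "FS \<ge> mass S")
    case True
    define \<Delta> where "\<Delta> = FS - mass S"
    have \<Delta>: "\<Delta> \<ge> 4 * t" using far True by (simp add: \<Delta>_def FS_def)
    have "s * t - (-1) * s * mass S + FS * (exp ((-1) * s) - 1) \<le> s * t + s * mass S + FS * (- s + s\<^sup>2)"
      using exp_minus_quadratic[OF s(1)] FS0 by (intro add_mono mult_left_mono) auto
    also have "\<dots> = s * t - s * \<Delta> + s\<^sup>2 * \<Delta> + s\<^sup>2 * mass S" by (simp add: \<Delta>_def algebra_simps)
    also have "\<dots> \<le> - s * t + s\<^sup>2 * m"
    proof -
      have "s * (s * \<Delta>) \<le> 1 / 2 * (s * \<Delta>)" using s t \<Delta> by (intro mult_right_mono mult_nonneg_nonneg) auto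
      moreover have "s * (4 * t) \<le> s * \<Delta>" using s \<Delta> by (intro mult_left_mono) auto
      ultimately have "s * t - s * \<Delta> + s\<^sup>2 * \<Delta> \<le> - s * t" by (simp add: power2_eq_square)
      with s2 show ?thesis by linarith
    qed
    finally show ?thesis using bound[of "-1"] by (meson ennreal_leI exp_le_cancel_iff order_trans)
  next
    case False
    define \<Delta> where "\<Delta> = mass S - FS"
    have \<Delta>: "\<Delta> \<ge> 4 * t" using far False by (simp add: \<Delta>_def FS_def)
    have "s * t - 1 * s * mass S + FS * (exp (1 * s) - 1) \<le> s * t - s * mass S + FS * (s + s\<^sup>2)"
      using exp_bound[of s] s FS0 by (intro add_mono mult_left_mono) auto
    also have "\<dots> = s * t - s * \<Delta> + s\<^sup>2 * FS" by (simp add: \<Delta>_def algebra_simps)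
    also have "\<dots> \<le> - s * t + s\<^sup>2 * m"
    proof -
      have "s * (4 * t) \<le> s * \<Delta>" "s * t \<ge> 0" using s t \<Delta> by (auto intro: mult_left_mono)
      moreover have "s\<^sup>2 * FS \<le> s\<^sup>2 * mass S" using False by (intro mult_left_mono) auto
      ultimately show ?thesis using s2 by linarith
    qed
    finally show ?thesis using bound[of 1] by (meson ennreal_leI exp_le_cancel_iff order_trans)
  qed
qed

end

section \<open>The posterior as a quotient of averaged ratios\<close>

context posterior_setting
begin

definition lik :: "'p \<Rightarrow> 'a multiset \<Rightarrow> real" where
  "lik p N = exp ((\<Sum>x\<in>#N. ln (F p x)) - (LINT x:A|lborel. F p x))"

definition post :: "'p set \<Rightarrow> 'a multiset \<Rightarrow> real" where
  "post E N = (LINT p|\<Theta>. indicator E p * lik p N) / (LINT p|\<Theta>. lik p N)"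

lemma lik_ratio:
  assumes "p \<in> space \<Theta>"
  shows "lik p N = exp ((\<Sum>x\<in>#N. ln (lam x)) - (LINT x:A|lborel. lam x)) * ratio p N"
proof -
  have "(\<Sum>x\<in>#N. ln (F p x)) = (\<Sum>x\<in>#N. ln (lam x)) + (\<Sum>x\<in>#N. ln (F p x / lam x))"
  proof -
    have "ln (F p x) = ln (lam x) + ln (F p x / lam x)" for x
      using F_pos[OF assms, of x] lam_pos[of x] by (simp add: ln_div)
    then show ?thesis by (simp add: sum_mset.distrib)
  qed
  moreover have "(LINT x:A|lborel. F p x) = (LINT x:A|lborel. lam x) + (LINT x:A|lborel. F p x - lam x)"
    using F_integrable[OF assms] set_integrable_lam by simp
  ultimately show ?thesis by (simp add: lik_def ratio_def exp_add[symmetric])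
qed

lemma post_eq_ratio:
  "post E N = (LINT p|\<Theta>. indicator E p * ratio p N) / (LINT p|\<Theta>. ratio p N)"
proof -
  let ?k = "exp ((\<Sum>x\<in>#N. ln (lam x)) - (LINT x:A|lborel. lam x))"
  have "(LINT p|\<Theta>. indicator E p * lik p N) = (LINT p|\<Theta>. ?k * (indicator E p * ratio p N))"
    by (intro Bochner_Integration.integral_cong) (simp_all add: lik_ratio)
  moreover have "(LINT p|\<Theta>. lik p N) = (LINT p|\<Theta>. ?k * ratio p N)"
    by (intro Bochner_Integration.integral_cong) (simp_all add: lik_ratio)
  ultimately show ?thesis by (simp add: post_def)
qed

lemma indicator_ratio_integrable:
  assumes "integrable \<Theta> (\<lambda>p. ratio p N)" "E \<in> sets \<Theta>"
  shows "integrable \<Theta> (\<lambda>p. indicator E p * ratio p N)"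
  using integrable_mult_indicator[OF assms(2,1)] by simp

lemma post_le_one:
  assumes E: "E \<in> sets \<Theta>" shows "post E N \<le> 1"
proof (cases "integrable \<Theta> (\<lambda>p. ratio p N)")
  case True
  have "(LINT p|\<Theta>. indicator E p * ratio p N) \<le> (LINT p|\<Theta>. ratio p N)"
    using True ratio_pos by (intro integral_mono indicator_ratio_integrable E) (auto simp: indicator_def less_imp_le)
  moreover have "0 \<le> (LINT p|\<Theta>. ratio p N)"
    using ratio_pos by (intro Bochner_Integration.integral_nonneg) (auto simp: less_imp_le)
  ultimately show ?thesis unfolding post_eq_ratio by (auto simp: divide_le_eq_1 not_less)
next
  \<comment> \<open>If the ratio is not integrable over the prior, the denominator is 0 by
    convention, and so is the quotient.\<close>
  case False
  then show ?thesis unfolding post_eq_ratio by (simp add: not_integrable_integral_eq)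
qed

text \<open>Passage from a quotient of Bochner integrals to extended integrals, in which the order
  of integration can be exchanged without integrability. A non-integrable ratio makes the posterior
  0 by convention.\<close>

lemma post_le_evidence:
  assumes E: "E \<in> sets \<Theta>" and D: "D > 0" "ennreal D \<le> (\<integral>\<^sup>+p. ennreal (ratio p N) \<partial>\<Theta>)"
  shows "ennreal (post E N) \<le> ennreal (1 / D) * (\<integral>\<^sup>+p. indicator E p * ennreal (ratio p N) \<partial>\<Theta>)"
proof (cases "integrable \<Theta> (\<lambda>p. ratio p N)")
  case True
  have den: "(\<integral>\<^sup>+p. ennreal (ratio p N) \<partial>\<Theta>) = ennreal (LINT p|\<Theta>. ratio p N)"
    using True ratio_pos by (intro nn_integral_eq_integral) (auto simp: less_imp_le)
  have num: "(\<integral>\<^sup>+p. indicator E p * ennreal (ratio p N) \<partial>\<Theta>) = ennreal (LINT p|\<Theta>. indicator E p * ratio p N)"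
  proof -
    have "(\<integral>\<^sup>+p. indicator E p * ennreal (ratio p N) \<partial>\<Theta>) = (\<integral>\<^sup>+p. ennreal (indicator E p * ratio p N) \<partial>\<Theta>)"
      by (intro nn_integral_cong) (auto simp: indicator_def)
    also have "\<dots> = ennreal (LINT p|\<Theta>. indicator E p * ratio p N)"
      using ratio_pos by (intro nn_integral_eq_integral indicator_ratio_integrable True E) (auto simp: indicator_def less_imp_le)
    finally show ?thesis .
  qed
  have num0: "(LINT p|\<Theta>. indicator E p * ratio p N) \<ge> 0"
    using ratio_pos by (intro Bochner_Integration.integral_nonneg) (auto simp: indicator_def less_imp_le)
  have "D \<le> (LINT p|\<Theta>. ratio p N)"
    using D unfolding den by (metis ennreal_le_iff2 not_less order.strict_trans2)
  then have "post E N \<le> (1 / D) * (LINT p|\<Theta>. indicator E p * ratio p N)"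
    unfolding post_eq_ratio using D(1) num0 by (simp add: divide_left_mono)
  then show ?thesis
    unfolding num using D(1) by (simp add: ennreal_mult'[symmetric] ennreal_leI)
next
  case False
  then show ?thesis unfolding post_eq_ratio by (simp add: not_integrable_integral_eq)
qed

text \<open>By the inequality of the means, R + a^2 / R is at least 2 a; this takes the place of Jensen's
  inequality in the lower bound for the evidence.\<close>

lemma evidence_lower_bound:
  assumes B: "B \<in> sets \<Theta>" and a: "a > 0"
    and J: "ennreal (a / prior.prob B) * (\<integral>\<^sup>+p. indicator B p * ennreal (1 / ratio p N) \<partial>\<Theta>) \<le> 1"
    and b: "prior.prob B > 0"
  shows "ennreal (a * prior.prob B) \<le> (\<integral>\<^sup>+p. ennreal (ratio p N) \<partial>\<Theta>)"
proof -
  let ?b = "prior.prob B"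
  note [measurable] = ratio_measurable_p B
  define X where "X = (\<integral>\<^sup>+p. indicator B p * ennreal (ratio p N) \<partial>\<Theta>)"
  define Y where "Y = (\<integral>\<^sup>+p. indicator B p * ennreal (1 / ratio p N) \<partial>\<Theta>)"
  \<comment> \<open>Integrated over \<open>B\<close> the inequality of the means reads
    \<open>2 * a * ?b <= X + a\<^sup>2 * Y\<close>, and the hypothesis on the average inverse ratio
    says \<open>a\<^sup>2 * Y <= a * ?b\<close>.\<close>
  have "ennreal (2 * a * ?b) = ennreal (2 * a) * emeasure \<Theta> B"
    using a by (simp add: prior.emeasure_eq_measure ennreal_mult')
  also have "\<dots> = (\<integral>\<^sup>+p. ennreal (2 * a) * indicator B p \<partial>\<Theta>)"
    by (simp add: nn_integral_cmult)
  also have "\<dots> \<le> (\<integral>\<^sup>+p. indicator B p * ennreal (ratio p N) + ennreal (a\<^sup>2) * (indicator B p * ennreal (1 / ratio p N)) \<partial>\<Theta>)"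
  proof (rule nn_integral_mono)
    fix p
    have r: "ratio p N > 0" by (rule ratio_pos)
    have "2 * a \<le> ratio p N + a\<^sup>2 * (1 / ratio p N)"
    proof -
      have "0 \<le> (ratio p N - a)\<^sup>2 / ratio p N" using r by simp
      also have "\<dots> = ratio p N + a\<^sup>2 * (1 / ratio p N) - 2 * a"
        using r by (simp add: power2_eq_square field_simps)
      finally show ?thesis by simp
    qed
    then have "ennreal (2 * a) \<le> ennreal (ratio p N + a\<^sup>2 * (1 / ratio p N))" by (rule ennreal_leI)
    also have "\<dots> = ennreal (ratio p N) + ennreal (a\<^sup>2) * ennreal (1 / ratio p N)"
      using r by (simp add: ennreal_plus ennreal_mult'[symmetric])
    finally show "ennreal (2 * a) * indicator B p \<le>
        indicator B p * ennreal (ratio p N) + ennreal (a\<^sup>2) * (indicator B p * ennreal (1 / ratio p N))"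
      by (auto simp: indicator_def)
  qed
  also have "\<dots> = X + ennreal (a\<^sup>2) * Y"
    unfolding X_def Y_def by (subst nn_integral_add) (auto simp: nn_integral_cmult)
  also have "ennreal (a\<^sup>2) * Y \<le> ennreal (a * ?b)"
  proof -
    have "ennreal (a\<^sup>2) * Y = ennreal (a * ?b) * (ennreal (a / ?b) * Y)"
      using a b by (simp add: mult.assoc[symmetric] ennreal_mult'[symmetric] power2_eq_square)
    also have "\<dots> \<le> ennreal (a * ?b) * 1" using J unfolding Y_def by (intro mult_left_mono) auto
    finally show ?thesis by simp
  qed
  finally have "ennreal (2 * a * ?b) \<le> X + ennreal (a * ?b)" by (simp add: add_left_mono)
  moreover have "ennreal (2 * a * ?b) = ennreal (a * ?b) + ennreal (a * ?b)"
    using a b by (simp flip: ennreal_plus)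
  ultimately have "ennreal (a * ?b) \<le> X" by (simp add: ennreal_add_left_cancel_le add.commute)
  also have "X \<le> (\<integral>\<^sup>+p. ennreal (ratio p N) \<partial>\<Theta>)"
    unfolding X_def by (intro nn_integral_mono) (auto simp: indicator_def)
  finally show ?thesis .
qed

text \<open>The three summands pay for: an average inverse ratio over \<open>B\<close> above
  \<open>1 / a\<close> (Markov); the deviation of some count (union of Chernoff bounds); the
  averaged ratio over \<open>E\<close> otherwise, divided by the lower bound of the evidence. In the
  last, parameters outside \<open>T\<close> cost their prior mass, because a ratio has mean at most
  1.\<close>

lemma expected_posterior_le:
  assumes E: "E \<in> sets \<Theta>" and B: "B \<in> sets \<Theta>" and T: "T \<in> sets \<Theta>"
    and b: "prior.prob B > 0" and a: "a > 0"
    and v: "\<And>p. p \<in> B \<Longrightarrow> (LINT x:A|lborel. (lam x - F p x)\<^sup>2 / F p x) \<le> v"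
    and \<SS>: "finite \<SS>" "\<And>S. S \<in> \<SS> \<Longrightarrow> S \<in> sets borel" "\<And>S. S \<in> \<SS> \<Longrightarrow> mass S \<le> m"
    and s: "0 \<le> s" "s \<le> 1 / 2" and t: "t \<ge> 0"
    and far: "\<And>p. p \<in> E \<Longrightarrow> p \<in> T \<Longrightarrow> \<exists>S\<in>\<SS>. 4 * t \<le> \<bar>(LINT x:A|lborel. indicator S x * F p x) - mass S\<bar>"
    and \<tau>: "prior.prob (space \<Theta> - T) \<le> \<tau>"
  shows "(\<integral>\<^sup>+N. ennreal (post E N) \<partial>Q) \<le> ennreal (a * exp v + real (card \<SS>) * (2 * exp (- s * t + s\<^sup>2 * m))
     + (\<tau> + exp (- s * t + s\<^sup>2 * m)) / (a * prior.prob B))"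
proof -
  interpret PS: pair_sigma_finite Q \<Theta> ..
  let ?b = "prior.prob B"
  define \<kappa> where "\<kappa> = exp (- s * t + s\<^sup>2 * m)"
  define dev where "dev S = {N. t < \<bar>real (point_count S N) - mass S\<bar>}" for S
  have devQ: "dev S \<in> sets Q" if "S \<in> \<SS>" for S
  proof -
    have [measurable]: "point_count S \<in> measurable Q (count_space UNIV)" using \<SS>(2)[OF that] by measurable
    have "{N \<in> space Q. t < \<bar>real (point_count S N) - mass S\<bar>} \<in> sets Q" by measurable
    then show ?thesis by (simp add: dev_def)
  qed
  define Bad where "Bad = (\<Union>S\<in>\<SS>. dev S)"
  define G where "G = space Q - Bad"
  have BadQ [measurable]: "Bad \<in> sets Q" unfolding Bad_def using \<SS>(1) devQ by auto
  then have GQ [measurable]: "G \<in> sets Q" unfolding G_def by (intro sets.compl_sets)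
  define J where "J N = (\<integral>\<^sup>+p. indicator B p * ennreal (1 / ratio p N) \<partial>\<Theta>)" for N
  define num where "num N = (\<integral>\<^sup>+p. indicator E p * (indicator G N * ennreal (ratio p N)) \<partial>\<Theta>)" for N
  note rm [measurable] = ratio_measurable[unfolded case_prod_unfold]
  note [measurable] = E B T
  have Jm [measurable]: "J \<in> borel_measurable Q" unfolding J_def[abs_def] by measurable
  have numm [measurable]: "num \<in> borel_measurable Q" unfolding num_def[abs_def] by measurable
  \<comment> \<open>No event of small evidence is formed: if the condition for the evidence bound or
    the counts fail, the first two terms add up to at least 1, and the posterior is at most
    1.\<close>
  have pointwise: "ennreal (post E N) \<le> ennreal (a / ?b) * J N + indicator Bad N + ennreal (1 / (a * ?b)) * num N" for N
  proof (cases "ennreal (a / ?b) * J N \<le> 1 \<and> N \<notin> Bad")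
    case True
    then have "ennreal (post E N) \<le> ennreal (1 / (a * ?b)) * (\<integral>\<^sup>+p. indicator E p * ennreal (ratio p N) \<partial>\<Theta>)"
      using a b by (intro post_le_evidence E evidence_lower_bound[OF B a]) (auto simp: J_def)
    also have "(\<integral>\<^sup>+p. indicator E p * ennreal (ratio p N) \<partial>\<Theta>) = num N"
      using True unfolding num_def G_def by simp
    finally show ?thesis by (rule order_trans) simp
  next
    case False
    have "ennreal (post E N) \<le> 1" using post_le_one[OF E] by simp
    also have "1 \<le> ennreal (a / ?b) * J N + indicator Bad N"
      using False by (cases "N \<in> Bad") (auto simp: indicator_def)
    finally show ?thesis by (rule order_trans) simp
  qed
  have intJ: "(\<integral>\<^sup>+N. J N \<partial>Q) \<le> ennreal (?b * exp v)"
  proof -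
    have "(\<integral>\<^sup>+N. J N \<partial>Q) = (\<integral>\<^sup>+p. \<integral>\<^sup>+N. indicator B p * ennreal (1 / ratio p N) \<partial>Q \<partial>\<Theta>)"
      unfolding J_def by (rule PS.Fubini'[symmetric]) measurable
    also have "\<dots> \<le> (\<integral>\<^sup>+p. ennreal (exp v) * indicator B p \<partial>\<Theta>)"
    proof (rule nn_integral_mono)
      fix p assume p: "p \<in> space \<Theta>"
      show "(\<integral>\<^sup>+N. indicator B p * ennreal (1 / ratio p N) \<partial>Q) \<le> ennreal (exp v) * indicator B p"
      proof (cases "p \<in> B")
        case True
        then show ?thesis
          using order_trans[OF expectation_inverse_ratio_le[OF p] ennreal_leI[of _ "exp v"]] v[OF True] by simp
      qed simp
    qed
    also have "\<dots> = ennreal (?b * exp v)"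
      by (simp add: nn_integral_cmult prior.emeasure_eq_measure ennreal_mult'[symmetric] mult.commute)
    finally show ?thesis .
  qed
  have Bad_le: "emeasure Q Bad \<le> ennreal (real (card \<SS>) * (2 * \<kappa>))"
  proof -
    have "emeasure Q Bad \<le> (\<Sum>S\<in>\<SS>. emeasure Q (dev S))"
      unfolding Bad_def using \<SS>(1) devQ by (intro emeasure_subadditive_finite) auto
    also have "\<dots> \<le> (\<Sum>S\<in>\<SS>. ennreal (2 * \<kappa>))"
      unfolding dev_def \<kappa>_def using s by (intro sum_mono count_deviation \<SS>) auto
    also have "\<dots> = ennreal (real (card \<SS>) * (2 * \<kappa>))"
      by (simp add: ennreal_of_nat_eq_real_of_nat ennreal_mult'[symmetric])
    finally show ?thesis .
  qed
  have intnum: "(\<integral>\<^sup>+N. num N \<partial>Q) \<le> ennreal (\<tau> + \<kappa>)"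
  proof -
    have "(\<integral>\<^sup>+N. num N \<partial>Q) = (\<integral>\<^sup>+p. \<integral>\<^sup>+N. indicator E p * (indicator G N * ennreal (ratio p N)) \<partial>Q \<partial>\<Theta>)"
      unfolding num_def by (rule PS.Fubini'[symmetric]) measurable
    also have "\<dots> \<le> (\<integral>\<^sup>+p. indicator (space \<Theta> - T) p + ennreal \<kappa> \<partial>\<Theta>)"
    proof (rule nn_integral_mono)
      fix p assume p: "p \<in> space \<Theta>"
      have sub: "(\<integral>\<^sup>+N. indicator E p * (indicator G N * ennreal (ratio p N)) \<partial>Q) \<le> (\<integral>\<^sup>+N. indicator G N * ennreal (ratio p N) \<partial>Q)"
        by (intro nn_integral_mono) (auto simp: indicator_def)
      show "(\<integral>\<^sup>+N. indicator E p * (indicator G N * ennreal (ratio p N)) \<partial>Q) \<le> indicator (space \<Theta> - T) p + ennreal \<kappa>"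
      proof (cases "p \<in> E \<and> p \<in> T")
        case True
        then obtain S where S: "S \<in> \<SS>" "4 * t \<le> \<bar>(LINT x:A|lborel. indicator S x * F p x) - mass S\<bar>"
          using far by blast
        have "\<bar>real (point_count S N) - mass S\<bar> \<le> t" if "N \<in> G" for N
          using that S(1) by (auto simp: G_def Bad_def dev_def not_less)
        then have "(\<integral>\<^sup>+N. indicator G N * ennreal (ratio p N) \<partial>Q) \<le> ennreal \<kappa>"
          unfolding \<kappa>_def using S \<SS> s t by (intro far_ratio_small[OF p]) auto
        with sub show ?thesis by (rule order_trans[THEN order_trans]) simp
      next
        case False
        show ?thesis
        proof (cases "p \<in> E")
          case True
          have "(\<integral>\<^sup>+N. indicator G N * ennreal (ratio p N) \<partial>Q) \<le> (\<integral>\<^sup>+N. ennreal (ratio p N) \<partial>Q)"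
            by (intro nn_integral_mono) (auto simp: indicator_def)
          also have "\<dots> \<le> 1" by (rule expectation_ratio_le[OF p])
          also have "1 \<le> indicator (space \<Theta> - T) p + ennreal \<kappa>" using True False p by simp
          finally show ?thesis using sub by (rule order_trans[rotated])
        qed simp
      qed
    qed
    also have "\<dots> = ennreal (prior.prob (space \<Theta> - T)) + ennreal \<kappa>"
      by (subst nn_integral_add) (auto simp: prior.emeasure_eq_measure prior.prob_space)
    also have "\<dots> = ennreal (prior.prob (space \<Theta> - T) + \<kappa>)" by (simp add: ennreal_plus \<kappa>_def)
    also have "\<dots> \<le> ennreal (\<tau> + \<kappa>)" using \<tau> by (intro ennreal_leI) auto
    finally show ?thesis .
  qed
  have \<tau>0: "\<tau> \<ge> 0" using \<tau> measure_nonneg order_trans by blast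
  have "(\<integral>\<^sup>+N. ennreal (post E N) \<partial>Q) \<le>
    (\<integral>\<^sup>+N. ennreal (a / ?b) * J N + indicator Bad N + ennreal (1 / (a * ?b)) * num N \<partial>Q)"
    by (intro nn_integral_mono pointwise)
  also have "\<dots> = ennreal (a / ?b) * (\<integral>\<^sup>+N. J N \<partial>Q) + emeasure Q Bad + ennreal (1 / (a * ?b)) * (\<integral>\<^sup>+N. num N \<partial>Q)"
    by (simp add: nn_integral_add nn_integral_cmult)
  also have "\<dots> \<le> ennreal (a / ?b) * ennreal (?b * exp v) + ennreal (real (card \<SS>) * (2 * \<kappa>)) + ennreal (1 / (a * ?b)) * ennreal (\<tau> + \<kappa>)"
    by (intro add_mono mult_left_mono intJ Bad_le intnum) auto
  also have "\<dots> = ennreal (a * exp v + real (card \<SS>) * (2 * \<kappa>) + (\<tau> + \<kappa>) / (a * ?b))"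
    using a b \<tau>0 by (simp add: ennreal_mult'[symmetric] ennreal_plus[symmetric] \<kappa>_def del: ennreal_plus)
  finally show ?thesis unfolding \<kappa>_def .
qed

end

section \<open>The hierarchical Gaussian prior\<close>

abbreviation "std_normal \<equiv> density lborel (\<lambda>t. ennreal (std_normal_density t))"

lemma prob_space_std_normal: "prob_space std_normal"
  by (rule prob_space_normal_density) simp

text \<open>Comparison with the normal density of variance 2: beyond \<open>G\<close>, half of the
  exponent \<open>t\<^sup>2 / 2\<close> is traded for \<open>exp (- G\<^sup>2 / 4)\<close>.\<close>

lemma std_normal_tail:
  "measure std_normal {t. G < \<bar>t\<bar>} \<le> sqrt 2 * exp (- G\<^sup>2 / 4)" if "G \<ge> 0"
proof -
  interpret prob_space std_normal by (rule prob_space_std_normal)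
  have "emeasure std_normal {t. G < \<bar>t\<bar>} = (\<integral>\<^sup>+t. ennreal (std_normal_density t) * indicator {t. G < \<bar>t\<bar>} t \<partial>lborel)"
    by (rule emeasure_density) auto
  also have "\<dots> \<le> (\<integral>\<^sup>+t. ennreal (sqrt 2 * exp (- G\<^sup>2 / 4)) * ennreal (normal_density 0 (sqrt 2) t) \<partial>lborel)"
  proof (rule nn_integral_mono)
    fix t :: real
    show "ennreal (std_normal_density t) * indicator {t. G < \<bar>t\<bar>} t \<le>
      ennreal (sqrt 2 * exp (- G\<^sup>2 / 4)) * ennreal (normal_density 0 (sqrt 2) t)"
    proof (cases "G < \<bar>t\<bar>")
      case True
      then have "G\<^sup>2 \<le> t\<^sup>2" using that by (metis abs_of_nonneg less_imp_le power2_abs power_mono)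
      then have "exp (- t\<^sup>2 / 2) \<le> exp (- G\<^sup>2 / 4) * exp (- t\<^sup>2 / 4)" by (simp add: exp_add[symmetric])
      moreover have "sqrt (2 * pi * 2) = sqrt 2 * sqrt (2 * pi)" by (simp add: real_sqrt_mult mult.commute)
      ultimately have "std_normal_density t \<le> (sqrt 2 * exp (- G\<^sup>2 / 4)) * normal_density 0 (sqrt 2) t"
        by (simp add: normal_density_def field_simps)
      then show ?thesis using True by (simp add: ennreal_mult'[symmetric] ennreal_leI)
    qed simp
  qed
  also have "\<dots> = ennreal (sqrt 2 * exp (- G\<^sup>2 / 4)) * (\<integral>\<^sup>+t. ennreal (normal_density 0 (sqrt 2) t) \<partial>lborel)"
    by (rule nn_integral_cmult) auto
  also have "(\<integral>\<^sup>+t. ennreal (normal_density 0 (sqrt 2) t) \<partial>lborel) = 1"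
    by (subst nn_integral_eq_integral) auto
  finally show ?thesis by (simp add: emeasure_eq_measure)
qed

text \<open>Length \<open>2 * \<delta>\<close> of the interval times the least density within
  distance \<open>C + 1\<close> of 0; uniform in the centre.\<close>

lemma std_normal_small_ball:
  assumes "\<bar>c\<bar> \<le> C" "0 < \<delta>" "\<delta> \<le> 1"
  shows "std_normal_density (C + 1) * \<delta> \<le> measure std_normal {t. \<bar>t - c\<bar> \<le> \<delta>}"
proof -
  interpret prob_space std_normal by (rule prob_space_std_normal)
  have I: "{t. \<bar>t - c\<bar> \<le> \<delta>} = {c - \<delta>..c + \<delta>}" by auto
  have "ennreal (std_normal_density (C + 1) * \<delta>) \<le> ennreal (std_normal_density (C + 1) * (2 * \<delta>))"
    using assms by (intro ennreal_leI mult_left_mono) auto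
  also have "\<dots> = (\<integral>\<^sup>+t. ennreal (std_normal_density (C + 1)) * indicator {c - \<delta>..c + \<delta>} t \<partial>lborel)"
    using assms by (simp add: nn_integral_cmult ennreal_mult)
  also have "\<dots> \<le> (\<integral>\<^sup>+t. ennreal (std_normal_density t) * indicator {c - \<delta>..c + \<delta>} t \<partial>lborel)"
  proof (rule nn_integral_mono)
    fix t :: real
    show "ennreal (std_normal_density (C + 1)) * indicator {c - \<delta>..c + \<delta>} t \<le> ennreal (std_normal_density t) * indicator {c - \<delta>..c + \<delta>} t"
    proof (cases "t \<in> {c - \<delta>..c + \<delta>}")
      case True
      then have "\<bar>t\<bar> \<le> C + 1" using assms by auto
      then have "t\<^sup>2 \<le> (C + 1)\<^sup>2" by (metis abs_ge_zero power2_abs power_mono)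
      then have "std_normal_density (C + 1) \<le> std_normal_density t"
        by (simp add: normal_density_def divide_right_mono)
      then show ?thesis using True by (simp add: ennreal_leI)
    qed simp
  qed
  also have "\<dots> = emeasure std_normal {t. \<bar>t - c\<bar> \<le> \<delta>}" unfolding I by (rule emeasure_density[symmetric]) auto
  finally show ?thesis by (simp add: emeasure_eq_measure)
qed

abbreviation "coeff_law \<equiv> Pi\<^sub>M (UNIV :: (nat \<times> nat) set) (\<lambda>_. std_normal)"

lemma product_prob_space_std_normal: "product_prob_space (\<lambda>_::nat \<times> nat. std_normal)"
  by (intro product_prob_space.intro product_sigma_finite.intro product_prob_space_axioms.intro
      prob_space_imp_sigma_finite prob_space_std_normal)

lemma coeff_law_rectangle:
  assumes "finite I" "\<And>p. p \<in> I \<Longrightarrow> X p \<in> sets borel"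
  shows "measure coeff_law {g. \<forall>p\<in>I. g p \<in> X p} = (\<Prod>p\<in>I. measure std_normal (X p))"
    "{g. \<forall>p\<in>I. g p \<in> X p} \<in> sets coeff_law"
proof -
  interpret product_prob_space "\<lambda>_::nat \<times> nat. std_normal" UNIV by (rule product_prob_space_std_normal)
  have eq: "emb UNIV I (Pi\<^sub>E I X) = {g. \<forall>p\<in>I. g p \<in> X p}"
    by (auto simp: prod_emb_def space_PiM PiE_def Pi_def)
  show "measure coeff_law {g. \<forall>p\<in>I. g p \<in> X p} = (\<Prod>p\<in>I. measure std_normal (X p))"
    using measure_PiM_emb[of I X] assms unfolding eq by simp
  show "{g. \<forall>p\<in>I. g p \<in> X p} \<in> sets coeff_law"
    unfolding eq[symmetric] using assms by (intro sets_PiM_I) auto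
qed

section \<open>The law of the truncation level and of the coefficients\<close>

context
  fixes d :: nat and C :: real
  assumes C: "C > 0"
begin

definition normalizer :: real where "normalizer = (\<Sum>l. level_weight d C l)"

lemma level_weight_nonneg: "level_weight d C l \<ge> 0" by (simp add: level_weight_def)

text \<open>Each further level adds at least \<open>C\<close> to the exponent, so the tail is
  dominated by a geometric series times the exponential at \<open>L\<close>.\<close>

lemma level_weight_decay: "level_weight d C (L + Suc i) \<le> exp (- C * 2 ^ (L * d) * real L) * exp (- C) ^ Suc i"
proof -
  have "(2::real) ^ (L * d) * real L + real (Suc i) \<le> 2 ^ (L * d) * real (L + Suc i)"
    using mult_right_mono[of 1 "(2::real) ^ (L * d)" "real (Suc i)"] by (simp add: algebra_simps)
  also have "\<dots> \<le> 2 ^ ((L + Suc i) * d) * real (L + Suc i)"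
    by (intro mult_right_mono power_increasing) auto
  finally have "C * (2 ^ (L * d) * real L + real (Suc i)) \<le> C * (2 ^ ((L + Suc i) * d) * real (L + Suc i))"
    using C by (intro mult_left_mono) auto
  then have "level_weight d C (L + Suc i) \<le> exp (- (C * (2 ^ (L * d) * real L + real (Suc i))))"
    by (simp add: level_weight_def mult.assoc)
  also have "\<dots> = exp (- C * 2 ^ (L * d) * real L) * exp (- C) ^ Suc i"
    unfolding exp_of_nat_mult[symmetric] exp_add[symmetric] by (simp add: algebra_simps)
  finally show ?thesis .
qed

lemma summable_level_weight: "summable (level_weight d C)"
proof -
  have "summable (\<lambda>i. exp (- C) ^ Suc i)"
    unfolding summable_Suc_iff using C by (intro summable_geometric) auto
  moreover have "norm (level_weight d C (Suc i)) \<le> exp (- C) ^ Suc i" for i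
    using level_weight_decay[of 0 i] level_weight_nonneg[of "Suc i"] by simp
  ultimately have "summable (\<lambda>i. level_weight d C (Suc i))"
    using summable_comparison_test'[where N=0 and f="\<lambda>i. level_weight d C (Suc i)"] by blast
  then show ?thesis by (simp add: summable_Suc_iff)
qed

lemma normalizer_pos: "normalizer > 0"
  unfolding normalizer_def
  by (rule suminf_pos2[OF summable_level_weight level_weight_nonneg, of 1]) (simp add: level_weight_def)

lemma level_prior_emeasure: "emeasure (level_prior d C) X = (\<Sum>l. ennreal (level_weight d C l / normalizer) * indicator X l)"
proof -
  have "emeasure (level_prior d C) X = (\<integral>\<^sup>+l. ennreal (level_weight d C l / normalizer) * indicator X l \<partial>count_space UNIV)"
    unfolding level_prior_def normalizer_def by (rule emeasure_density) auto
  then show ?thesis by (simp add: nn_integral_count_space_nat)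
qed

lemma sets_level_prior [simp]: "sets (level_prior d C) = UNIV"
  by (simp add: level_prior_def)

lemma space_level_prior [simp]: "space (level_prior d C) = UNIV"
  by (simp add: level_prior_def)

lemma prob_space_level_prior: "prob_space (level_prior d C)"
proof (rule prob_spaceI)
  have "(\<lambda>l. level_weight d C l / normalizer) sums (normalizer / normalizer)"
    unfolding normalizer_def by (intro sums_divide summable_sums summable_level_weight)
  then have "(\<Sum>l. ennreal (level_weight d C l / normalizer)) = ennreal 1"
    using normalizer_pos level_weight_nonneg by (intro suminf_ennreal_eq) auto
  then show "emeasure (level_prior d C) (space (level_prior d C)) = 1"
    by (simp add: level_prior_emeasure)
qed

lemma level_prior_singleton: "measure (level_prior d C) {l} = level_weight d C l / normalizer"
proof -
  interpret prob_space "level_prior d C" by (rule prob_space_level_prior)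
  have "emeasure (level_prior d C) {l} = ennreal (level_weight d C l / normalizer)"
    unfolding level_prior_emeasure by (subst suminf_finite[of "{l}"]) auto
  then show ?thesis using normalizer_pos level_weight_nonneg[of l] by (simp add: emeasure_eq_measure)
qed

definition tail_const :: real where "tail_const = (\<Sum>i. exp (- C) ^ Suc i) / normalizer"

lemma tail_const_nonneg: "tail_const \<ge> 0"
  unfolding tail_const_def using normalizer_pos C
  by (intro divide_nonneg_pos suminf_nonneg) (auto simp: summable_mult)

lemma level_prior_tail: "measure (level_prior d C) {L<..} \<le> tail_const * exp (- C * 2 ^ (L * d) * real L)"
proof -
  interpret prob_space "level_prior d C" by (rule prob_space_level_prior)
  let ?e = "exp (- C * 2 ^ (L * d) * real L)"
  have sg: "summable (\<lambda>i. exp (- C) ^ Suc i)"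
    unfolding summable_Suc_iff using C by (intro summable_geometric) auto
  have "emeasure (level_prior d C) {L<..} = (\<Sum>l. ennreal (level_weight d C l / normalizer) * indicator {L<..} l)"
    by (rule level_prior_emeasure)
  also have "\<dots> = (\<Sum>i. ennreal (level_weight d C (i + Suc L) / normalizer) * indicator {L<..} (i + Suc L))"
    by (subst suminf_offset[of _ "Suc L"]) auto
  also have "\<dots> \<le> (\<Sum>i. ennreal (?e / normalizer * exp (- C) ^ Suc i))"
  proof (intro suminf_le summableI)
    fix i
    have "level_weight d C (i + Suc L) / normalizer \<le> ?e / normalizer * exp (- C) ^ Suc i"
      using level_weight_decay[of L i] normalizer_pos by (simp add: add.commute divide_right_mono)
    then show "ennreal (level_weight d C (i + Suc L) / normalizer) * indicator {L<..} (i + Suc L) \<le> ennreal (?e / normalizer * exp (- C) ^ Suc i)"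
      by (simp add: ennreal_leI)
  qed
  also have "\<dots> = ennreal (?e / normalizer * (\<Sum>i. exp (- C) ^ Suc i))"
    using normalizer_pos by (intro suminf_ennreal_eq sums_mult summable_sums sg) auto
  also have "?e / normalizer * (\<Sum>i. exp (- C) ^ Suc i) = tail_const * ?e" by (simp add: tail_const_def)
  finally show ?thesis using tail_const_nonneg by (simp add: emeasure_eq_measure)
qed

lemma prob_space_prior_params: "prob_space (prior_params d C)"
proof -
  interpret L: prob_space "level_prior d C" by (rule prob_space_level_prior)
  interpret G: prob_space coeff_law
    by (intro prob_space_PiM prob_space_std_normal)
  interpret pair_prob_space "level_prior d C" coeff_law ..
  show ?thesis unfolding prior_params_def by (rule P.prob_space_axioms)
qed

lemma space_prior_params: "space (prior_params d C) = UNIV"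
  by (simp add: prior_params_def space_pair_measure space_PiM)

lemma prior_params_rectangle:
  assumes "Y \<in> sets coeff_law"
  shows "X \<times> Y \<in> sets (prior_params d C)"
    "measure (prior_params d C) (X \<times> Y) = measure (level_prior d C) X * measure coeff_law Y"
proof -
  interpret L: prob_space "level_prior d C" by (rule prob_space_level_prior)
  interpret G: prob_space coeff_law
    by (intro prob_space_PiM prob_space_std_normal)
  interpret pair_prob_space "level_prior d C" coeff_law ..
  show "X \<times> Y \<in> sets (prior_params d C)" using assms by (simp add: prior_params_def)
  show "measure (prior_params d C) (X \<times> Y) = measure (level_prior d C) X * measure coeff_law Y"
    using assms unfolding prior_params_def measure_def
    by (subst G.emeasure_pair_measure_Times) (auto simp: enn2real_mult)
qed

text \<open>A box in the coefficients at one fixed level: its mass is a product, and for small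
  \<delta> its series stay uniformly close to the one with coefficients \<open>c\<close>.\<close>

lemma prior_params_small_ball:
  assumes I: "finite I" and c: "\<And>p. \<bar>c p\<bar> \<le> K" and \<delta>: "0 < \<delta>" "\<delta> \<le> 1"
  shows "level_weight d C L / normalizer * (std_normal_density (K + 1) * \<delta>) ^ card I \<le>
      measure (prior_params d C) ({L} \<times> {g. \<forall>p\<in>I. \<bar>g p - c p\<bar> \<le> \<delta>})"
    "{L} \<times> {g. \<forall>p\<in>I. \<bar>g p - c p\<bar> \<le> \<delta>} \<in> sets (prior_params d C)"
proof -
  have eq: "{g. \<forall>p\<in>I. \<bar>g p - c p\<bar> \<le> \<delta>} = {g. \<forall>p\<in>I. g p \<in> {t. \<bar>t - c p\<bar> \<le> \<delta>}}" by simp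
  have bor: "{t. \<bar>t - c p\<bar> \<le> \<delta>} \<in> sets borel" for p
  proof -
    have "{t. \<bar>t - c p\<bar> \<le> \<delta>} = {c p - \<delta>..c p + \<delta>}" by auto
    then show ?thesis by simp
  qed
  note rect = coeff_law_rectangle[where X="\<lambda>p. {t. \<bar>t - c p\<bar> \<le> \<delta>}", OF I bor, folded eq]
  show "{L} \<times> {g. \<forall>p\<in>I. \<bar>g p - c p\<bar> \<le> \<delta>} \<in> sets (prior_params d C)"
    by (rule prior_params_rectangle(1)[OF rect(2)])
  have "(std_normal_density (K + 1) * \<delta>) ^ card I = (\<Prod>p\<in>I. std_normal_density (K + 1) * \<delta>)" by simp
  also have "\<dots> \<le> (\<Prod>p\<in>I. measure std_normal {t. \<bar>t - c p\<bar> \<le> \<delta>})"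
    using c \<delta> by (intro prod_mono conjI std_normal_small_ball mult_nonneg_nonneg) auto
  finally show "level_weight d C L / normalizer * (std_normal_density (K + 1) * \<delta>) ^ card I \<le>
      measure (prior_params d C) ({L} \<times> {g. \<forall>p\<in>I. \<bar>g p - c p\<bar> \<le> \<delta>})"
    using normalizer_pos level_weight_nonneg
    unfolding prior_params_rectangle(2)[OF rect(2)] level_prior_singleton rect(1)
    by (intro mult_left_mono) auto
qed

text \<open>The coefficients in \<open>I\<close> are bounded at every level up to \<open>L\<close>,
  even where the series is shorter, so the complement splits into one event for the level and one
  for each coefficient.\<close>

definition sieve :: "nat \<Rightarrow> (nat \<times> nat) set \<Rightarrow> real \<Rightarrow> (nat \<times> (nat \<times> nat \<Rightarrow> real)) set" where
  "sieve L I G = {..L} \<times> {g. \<forall>p\<in>I. \<bar>g p\<bar> \<le> G}"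

lemma prior_params_sieve:
  assumes I: "finite I" and G: "G \<ge> 0"
  shows "sieve L I G \<in> sets (prior_params d C)"
    "measure (prior_params d C) (space (prior_params d C) - sieve L I G) \<le>
       tail_const * exp (- C * 2 ^ (L * d) * real L) + real (card I) * (sqrt 2 * exp (- G\<^sup>2 / 4))"
proof -
  interpret P: prob_space "prior_params d C" by (rule prob_space_prior_params)
  interpret CL: prob_space coeff_law by (intro prob_space_PiM prob_space_std_normal)
  have eq: "{g. \<forall>p\<in>I. \<bar>g p\<bar> \<le> G} = {g. \<forall>p\<in>I. g p \<in> {t. \<bar>t\<bar> \<le> G}}" by simp
  have bor: "{t. \<bar>t\<bar> \<le> G} \<in> sets borel" by measurable
  have S: "{g. \<forall>p\<in>I. \<bar>g p\<bar> \<le> G} \<in> sets coeff_law"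
    unfolding eq by (rule coeff_law_rectangle(2)[where X="\<lambda>_. {t. \<bar>t\<bar> \<le> G}", OF I bor])
  then show "sieve L I G \<in> sets (prior_params d C)"
    unfolding sieve_def by (rule prior_params_rectangle(1))
  define Y where "Y p = {g :: nat \<times> nat \<Rightarrow> real. G < \<bar>g p\<bar>}" for p
  have bor': "{t. G < \<bar>t\<bar>} \<in> sets (borel :: real measure)" by measurable
  have Y: "Y p \<in> sets coeff_law" "measure coeff_law (Y p) = measure std_normal {t. G < \<bar>t\<bar>}" for p
    using coeff_law_rectangle[of "{p}" "\<lambda>_. {t. G < \<bar>t\<bar>}"] bor' by (simp_all add: Y_def)
  have sub: "space (prior_params d C) - sieve L I G \<subseteq> {L<..} \<times> UNIV \<union> (\<Union>p\<in>I. UNIV \<times> Y p)"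
    by (auto simp: sieve_def Y_def not_le)
  have UN: "UNIV \<in> sets coeff_law" using sets.top[of coeff_law] by (simp add: space_PiM)
  have m1: "{L<..} \<times> UNIV \<in> sets (prior_params d C)" by (rule prior_params_rectangle(1)[OF UN])
  have m2: "UNIV \<times> Y p \<in> sets (prior_params d C)" for p by (rule prior_params_rectangle(1)[OF Y(1)])
  have "measure (prior_params d C) (space (prior_params d C) - sieve L I G) \<le>
    measure (prior_params d C) ({L<..} \<times> UNIV \<union> (\<Union>p\<in>I. UNIV \<times> Y p))"
    using m1 m2 I by (intro P.finite_measure_mono sub) auto
  also have "\<dots> \<le> measure (prior_params d C) ({L<..} \<times> UNIV) + measure (prior_params d C) (\<Union>p\<in>I. UNIV \<times> Y p)"
    using m1 m2 I by (intro measure_Un_le) auto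
  also have "\<dots> \<le> measure (prior_params d C) ({L<..} \<times> UNIV) + (\<Sum>p\<in>I. measure (prior_params d C) (UNIV \<times> Y p))"
    using m2 I by (intro add_left_mono measure_UNION_le) auto
  also have "measure (prior_params d C) ({L<..} \<times> UNIV) \<le> tail_const * exp (- C * 2 ^ (L * d) * real L)"
    using prior_params_rectangle(2)[OF UN] level_prior_tail CL.prob_space by (simp add: space_PiM)
  also have "(\<Sum>p\<in>I. measure (prior_params d C) (UNIV \<times> Y p)) \<le> (\<Sum>p\<in>I. sqrt 2 * exp (- G\<^sup>2 / 4))"
    using prior_params_rectangle(2)[OF Y(1)] std_normal_tail[OF G] prob_space.prob_space[OF prob_space_level_prior]
    by (intro sum_mono) (simp add: Y(2))
  finally show "measure (prior_params d C) (space (prior_params d C) - sieve L I G) \<le>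
       tail_const * exp (- C * 2 ^ (L * d) * real L) + real (card I) * (sqrt 2 * exp (- G\<^sup>2 / 4))"
    by simp
qed

end

section \<open>Contraction along a single path of the covariates\<close>

lemma measurable_full_law:
  fixes f :: "'q \<Rightarrow> real"
  assumes "f \<circ> T \<in> borel_measurable M" shows "f \<in> borel_measurable (full_law M T)"
proof (rule measurableI)
  fix X assume "X \<in> sets (borel :: real measure)"
  with assms have "(f \<circ> T) -` X \<inter> space M \<in> sets M" by (rule measurable_sets)
  then show "f -` X \<inter> space (full_law M T) \<in> sets (full_law M T)"
    by (simp add: sets_full_law vimage_comp)
qed simp

lemma integral_full_law:
  fixes f :: "'q \<Rightarrow> real"
  assumes f: "f \<circ> T \<in> borel_measurable M"
  shows "(LINT q|full_law M T. f q) = (LINT p|M. f (T p))"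
proof -
  let ?S = "sigma UNIV {E. T -` E \<inter> space M \<in> sets M}"
  have setsS: "sets ?S = {E. T -` E \<inter> space M \<in> sets M}"
    using sets_full_law[of M T] by (simp add: full_law_def)
  have "T \<in> measurable M ?S"
    by (rule measurableI) (simp_all add: setsS space_measure_of_conv)
  moreover have "f \<in> borel_measurable ?S"
    using measurable_full_law[OF f] by (simp add: full_law_def)
  ultimately show ?thesis unfolding full_law_def by (rule integral_distr)
qed

section \<open>The wavelet prior seen along a path\<close>

locale wavelet_model =
  fixes \<psi> :: "nat \<Rightarrow> nat \<Rightarrow> real^'d \<Rightarrow> real" and \<eta> :: "real \<Rightarrow> real" and w0 :: "real^'d \<Rightarrow> real"
    and CL C Lip M0 :: real
  assumes CL: "CL > 0" and C: "C > 0" and Lip: "Lip > 0"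
    and \<eta>_mono: "strict_mono \<eta>" and \<eta>_pos: "\<And>x. \<eta> x > 0"
    and \<eta>_lip: "\<And>x y. \<bar>\<eta> x - \<eta> y\<bar> \<le> Lip * \<bar>x - y\<bar>"
    and w0_cont: "continuous_on (cbox 0 1) w0" and w0_bound: "\<And>z. z \<in> cbox 0 1 \<Longrightarrow> \<bar>w0 z\<bar> \<le> M0"
    and \<psi>_cont: "\<And>p. p \<in> level_index CARD('d) \<Longrightarrow> continuous_on (cbox 0 1) (\<psi> (fst p) (snd p))"
    and \<psi>_bound: "\<And>p z. p \<in> level_index CARD('d) \<Longrightarrow> z \<in> cbox 0 1 \<Longrightarrow>
       \<bar>\<psi> (fst p) (snd p) z\<bar> \<le> C * sqrt (2 ^ (fst p * CARD('d)))"
begin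

abbreviation "ws \<equiv> wavelet_series \<psi>"

lemma \<eta>_le: "\<eta> x \<le> \<eta> y \<longleftrightarrow> x \<le> y" using \<eta>_mono by (rule strict_mono_less_eq)

lemma \<eta>_measurable [measurable]: "\<eta> \<in> borel_measurable borel"
  by (rule borel_measurable_mono) (use \<eta>_le in \<open>simp add: mono_def\<close>)

lemma series_diff_le:
  assumes "z \<in> cbox 0 1" "\<And>p. p \<in> levels_upto CARD('d) L \<Longrightarrow> \<bar>g p - g' p\<bar> \<le> \<delta>"
  shows "\<bar>ws (L, g) z - ws (L, g') z\<bar> \<le> real (card (levels_upto CARD('d) L)) * (\<delta> * (C * sqrt (2 ^ (L * CARD('d)))))"
proof -
  have "\<bar>ws (L, g) z - ws (L, g') z\<bar> = \<bar>\<Sum>p\<in>levels_upto CARD('d) L. (g p - g' p) * \<psi> (fst p) (snd p) z\<bar>"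
    unfolding wavelet_series_sum by (simp add: sum_subtractf left_diff_distrib)
  also have "\<dots> \<le> (\<Sum>p\<in>levels_upto CARD('d) L. \<bar>g p - g' p\<bar> * \<bar>\<psi> (fst p) (snd p) z\<bar>)"
    by (rule order_trans[OF sum_abs]) (simp add: abs_mult)
  also have "\<dots> \<le> (\<Sum>p\<in>levels_upto CARD('d) L. \<delta> * (C * sqrt (2 ^ (L * CARD('d)))))"
  proof (rule sum_mono)
    fix p assume p: "p \<in> levels_upto CARD('d) L"
    have "\<bar>\<psi> (fst p) (snd p) z\<bar> \<le> C * sqrt (2 ^ (fst p * CARD('d)))" using p assms(1) by (intro \<psi>_bound) auto
    also have "\<dots> \<le> C * sqrt (2 ^ (L * CARD('d)))"
      using p C by (intro mult_left_mono real_sqrt_le_mono power_increasing mult_right_mono) auto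
    finally show "\<bar>g p - g' p\<bar> * \<bar>\<psi> (fst p) (snd p) z\<bar> \<le> \<delta> * (C * sqrt (2 ^ (L * CARD('d))))"
      using assms(2)[OF p] by (intro mult_mono) auto
  qed
  finally show ?thesis by simp
qed

text \<open>Bounds \<open>ln (F p x)\<close> over \<open>x\<close> for each parameter, as the
  exponential moments require; the bound may depend on \<open>p\<close>.\<close>

lemma series_bounded: "\<exists>M. \<forall>z\<in>cbox 0 1. \<bar>ws p z\<bar> \<le> M"
proof (cases p)
  case (Pair L g)
  define \<delta> where "\<delta> = (\<Sum>q\<in>levels_upto CARD('d) L. \<bar>g q\<bar>)"
  have "\<bar>g q - 0\<bar> \<le> \<delta>" if "q \<in> levels_upto CARD('d) L" for q
    unfolding \<delta>_def using that finite_levels_upto by (auto intro: member_le_sum)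
  then have "\<bar>ws (L, g) z - ws (L, \<lambda>_. 0) z\<bar> \<le> real (card (levels_upto CARD('d) L)) * (\<delta> * (C * sqrt (2 ^ (L * CARD('d)))))"
    if "z \<in> cbox 0 1" for z
    using that by (intro series_diff_le)
  moreover have "ws (L, \<lambda>_. 0) z = 0" for z by simp
  ultimately show ?thesis
    unfolding Pair by (intro exI ballI) (simp only: diff_zero)
qed

lemma series_measurable:
  assumes z: "z \<in> borel_measurable borel" "\<And>x. z x \<in> cbox 0 1"
  shows "(\<lambda>(x :: 'x::topological_space, p). ws p (z x)) \<in> borel_measurable (borel \<Otimes>\<^sub>M prior_params CARD('d) CL)"
proof -
  have psi: "(\<lambda>x. \<psi> (fst q) (snd q) (z x)) \<in> borel_measurable borel" if "q \<in> level_index CARD('d)" for q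
  proof -
    have "(\<lambda>y. indicator (cbox 0 1) y *\<^sub>R \<psi> (fst q) (snd q) y) \<in> borel_measurable borel"
      by (rule borel_measurable_continuous_on_indicator[OF _ \<psi>_cont[OF that]]) simp
    from measurable_compose[OF z(1) this] show ?thesis using z(2) by simp
  qed
  have coord: "(\<lambda>p. snd p q) \<in> borel_measurable (prior_params CARD('d) CL)" for q
    unfolding prior_params_def by measurable
  have lev: "fst \<in> measurable (prior_params CARD('d) CL) (count_space UNIV)"
  proof -
    have "fst \<in> measurable (prior_params CARD('d) CL) (level_prior CARD('d) CL)"
      unfolding prior_params_def by measurable
    also have "measurable (prior_params CARD('d) CL) (level_prior CARD('d) CL) = measurable (prior_params CARD('d) CL) (count_space UNIV)"
      by (rule measurable_cong_sets) (simp_all add: sets_level_prior[OF CL])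
    finally show ?thesis .
  qed
  have "(\<lambda>xp. \<Sum>q\<in>levels_upto CARD('d) (fst (snd xp)). snd (snd xp) q * \<psi> (fst q) (snd q) (z (fst xp))) \<in>
    borel_measurable (borel \<Otimes>\<^sub>M prior_params CARD('d) CL)"
  \<comment> \<open>The number of summands is itself part of the parameter; countably many levels
    reduce this to a fixed number.\<close>
  proof (rule measurable_compose_countable)
    show "(\<lambda>xp. fst (snd xp)) \<in> measurable (borel \<Otimes>\<^sub>M prior_params CARD('d) CL) (count_space UNIV)"
      by (rule measurable_compose[OF measurable_snd lev])
    show "(\<lambda>xp. \<Sum>q\<in>levels_upto CARD('d) L. snd (snd xp) q * \<psi> (fst q) (snd q) (z (fst xp))) \<in>
      borel_measurable (borel \<Otimes>\<^sub>M prior_params CARD('d) CL)" for L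
      by (intro borel_measurable_sum borel_measurable_times measurable_compose[OF measurable_snd coord]
          measurable_compose[OF measurable_fst psi]) auto
  qed
  moreover have "ws p y = (\<Sum>q\<in>levels_upto CARD('d) (fst p). snd p q * \<psi> (fst q) (snd q) y)" for p y
    by (cases p) (simp only: wavelet_series_sum fst_conv snd_conv)
  ultimately show ?thesis by (simp only: case_prod_unfold)
qed

end

locale wavelet_data = wavelet_model \<psi> \<eta> w0 CL C Lip M0
  for \<psi> :: "nat \<Rightarrow> nat \<Rightarrow> real^'d \<Rightarrow> real" and \<eta> w0 CL C Lip M0 +
  fixes z :: "real^'D \<Rightarrow> real^'d" and A :: "(real^'D) set" and Q
  assumes z: "z \<in> borel_measurable borel" "\<And>x. z x \<in> cbox 0 1"
    and A: "A \<in> sets borel" "emeasure lborel A < \<infinity>"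
    and pp: "poisson_process A (\<lambda>x. \<eta> (w0 (z x))) Q"

sublocale wavelet_data \<subseteq> posterior_setting A "\<lambda>x. \<eta> (w0 (z x))" Q "\<eta> M0" "prior_params CARD('d) CL"
  "\<lambda>p x. \<eta> (wavelet_series \<psi> p (z x))" "\<eta> (- M0)"
proof -
  interpret P: prob_space "prior_params CARD('d) CL" by (rule prob_space_prior_params[OF CL])
  have w0m: "(\<lambda>x. w0 (z x)) \<in> borel_measurable borel"
  proof -
    have "(\<lambda>y. indicator (cbox 0 1) y *\<^sub>R w0 y) \<in> borel_measurable borel"
      by (rule borel_measurable_continuous_on_indicator[OF _ w0_cont]) simp
    from measurable_compose[OF z(1) this] show ?thesis using z(2) by simp
  qed
  show "posterior_setting A (\<lambda>x. \<eta> (w0 (z x))) Q (\<eta> M0) (prior_params CARD('d) CL)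
    (\<lambda>p x. \<eta> (wavelet_series \<psi> p (z x))) (\<eta> (- M0))"
  proof (unfold_locales)
    show "poisson_process A (\<lambda>x. \<eta> (w0 (z x))) Q" by (rule pp)
    show "A \<in> sets borel" "emeasure lborel A < \<infinity>" by (rule A)+
    show "(\<lambda>x. \<eta> (w0 (z x))) \<in> borel_measurable borel" by (rule measurable_compose[OF w0m \<eta>_measurable])
    show "0 \<le> \<eta> (w0 (z x))" for x using \<eta>_pos[of "w0 (z x)"] by simp
    show "\<eta> (w0 (z x)) \<le> \<eta> M0" "\<eta> (- M0) \<le> \<eta> (w0 (z x))" for x
      using w0_bound[OF z(2)[of x]] by (simp_all add: \<eta>_le abs_le_iff)
    show "0 < \<eta> (- M0)" by (rule \<eta>_pos)
    show "0 < \<eta> (wavelet_series \<psi> p (z x))" for p x by (rule \<eta>_pos)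
    show "(\<lambda>(x, p). \<eta> (wavelet_series \<psi> p (z x))) \<in> borel_measurable (borel \<Otimes>\<^sub>M prior_params CARD('d) CL)"
      using measurable_compose[OF series_measurable[OF z] \<eta>_measurable] by (simp only: case_prod_unfold)
    show "\<exists>K. \<forall>x. \<bar>ln (\<eta> (wavelet_series \<psi> p (z x)))\<bar> \<le> K" for p
    proof -
      obtain M where M: "\<And>y. y \<in> cbox 0 1 \<Longrightarrow> \<bar>ws p y\<bar> \<le> M" using series_bounded[of p] by blast
      have "\<bar>ln (\<eta> (ws p (z x)))\<bar> \<le> \<bar>ln (\<eta> (- M))\<bar> + \<bar>ln (\<eta> M)\<bar>" for x
      proof -
        have "\<eta> (- M) \<le> \<eta> (ws p (z x))" "\<eta> (ws p (z x)) \<le> \<eta> M"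
          using M[OF z(2)[of x]] by (simp_all only: \<eta>_le abs_le_iff) linarith+
        then have "ln (\<eta> (- M)) \<le> ln (\<eta> (ws p (z x)))" "ln (\<eta> (ws p (z x))) \<le> ln (\<eta> M)"
          using \<eta>_pos by simp_all
        then show ?thesis by linarith
      qed
      then show ?thesis by blast
    qed
  qed
qed

section \<open>Test sets attached to the points of a net\<close>

context wavelet_data
begin

abbreviation "lam x \<equiv> \<eta> (w0 (z x))"
abbreviation "F p x \<equiv> \<eta> (ws p (z x))"

definition far_set :: "real \<Rightarrow> (nat \<times> (nat \<times> nat \<Rightarrow> real)) set" where
  "far_set X = {p. X < (LINT x:A|lborel. \<bar>F p x - lam x\<bar>)}"

lemma F_measurable_pair: "(\<lambda>(p, x). F p x) \<in> borel_measurable (prior_params CARD('d) CL \<Otimes>\<^sub>M borel)"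
  using F_measurable_swap .

lemma distance_measurable: "(\<lambda>p. LINT x:A|lborel. \<bar>F p x - lam x\<bar>) \<in> borel_measurable (prior_params CARD('d) CL)"
proof -
  have "(\<lambda>(p, x). indicator A x *\<^sub>R \<bar>F p x - lam x\<bar>) \<in> borel_measurable (prior_params CARD('d) CL \<Otimes>\<^sub>M lborel)"
    using F_measurable_pair A(1) lam_meas by (simp add: case_prod_unfold cong: measurable_cong_sets sets_pair_measure_cong)
  from lborel.borel_measurable_lebesgue_integral[OF this] show ?thesis
    by (simp add: set_lebesgue_integral_def)
qed

lemma far_set_sets: "far_set X \<in> sets (prior_params CARD('d) CL)"
proof -
  have "{p \<in> space (prior_params CARD('d) CL). X < (LINT x:A|lborel. \<bar>F p x - lam x\<bar>)} \<in> sets (prior_params CARD('d) CL)"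
    using distance_measurable by measurable
  then show ?thesis by (simp add: far_set_def space_prior_params[OF CL])
qed

text \<open>The prior lives on functions with the largest sigma-algebra that the parametrisation
  allows. Its integrals are pulled back to the parameters, where the event is measurable by
  Fubini.\<close>

lemma posterior_eq_post:
  "posterior (wavelet_prior \<eta> CL \<psi>) A N z {\<rho>. X < (LINT x:A|lborel. \<bar>\<rho> (z x) - lam x\<bar>)} = post (far_set X) N"
proof -
  let ?T = "\<lambda>p. \<eta> \<circ> ws p"
  let ?E = "{\<rho>. X < (LINT x:A|lborel. \<bar>\<rho> (z x) - lam x\<bar>)}"
  have lik: "likelihood A N z (?T p) = lik p N" for p
    by (simp add: likelihood_def lik_def)
  have lm: "(\<lambda>p. lik p N) \<in> borel_measurable (prior_params CARD('d) CL)"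
  proof -
    let ?k = "exp ((\<Sum>x\<in>#N. ln (lam x)) - (LINT x:A|lborel. lam x))"
    have "(\<lambda>p. ?k * ratio p N) \<in> borel_measurable (prior_params CARD('d) CL)" using ratio_measurable_p by measurable
    then show ?thesis by (rule measurable_cong[THEN iffD1, rotated]) (simp add: lik_ratio)
  qed
  have ind: "indicator ?E (?T p) = (indicator (far_set X) p :: real)" for p
    by (simp add: indicator_def far_set_def)
  have num: "(LINT \<rho>:?E|wavelet_prior \<eta> CL \<psi>. likelihood A N z \<rho>) = (LINT p|prior_params CARD('d) CL. indicator (far_set X) p * lik p N)"
    unfolding set_lebesgue_integral_def[of "wavelet_prior \<eta> CL \<psi>"] unfolding wavelet_prior_def
    by (subst integral_full_law) (use far_set_sets[of X] lm in \<open>simp_all add: comp_def[of _ ?T] ind lik\<close>)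
  have den: "(LINT \<rho>|wavelet_prior \<eta> CL \<psi>. likelihood A N z \<rho>) = (LINT p|prior_params CARD('d) CL. lik p N)"
    unfolding wavelet_prior_def
    by (subst integral_full_law) (use lm in \<open>simp_all add: comp_def[of _ ?T] lik\<close>)
  show ?thesis unfolding posterior_def num den post_def ..
qed

text \<open>The test sets belong to the net point \<open>q\<close> and not to \<open>p\<close>, so
  that finitely many of them serve the whole sieve.\<close>

definition above :: "(nat \<times> (nat \<times> nat \<Rightarrow> real)) \<Rightarrow> (real^'D) set" where "above q = {x. lam x < F q x}"
definition below :: "(nat \<times> (nat \<times> nat \<Rightarrow> real)) \<Rightarrow> (real^'D) set" where "below q = {x. F q x \<le> lam x}"

lemma above_below_sets: "above q \<in> sets borel" "below q \<in> sets borel"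
proof -
  have "F q \<in> borel_measurable borel" by (rule F_measurable_x) (simp add: space_prior_params[OF CL])
  then have "{x \<in> space borel. lam x < F q x} \<in> sets borel" "{x \<in> space borel. F q x \<le> lam x} \<in> sets borel"
    using lam_meas by measurable
  then show "above q \<in> sets borel" "below q \<in> sets borel" by (simp_all add: above_def below_def)
qed

text \<open>Where \<open>F q - lam\<close> has the wrong sign for \<open>F p - lam\<close>, the
  latter is at most \<open>r\<close> in absolute value, so passing to the signed difference costs at
  most \<open>2 * r\<close> per unit of volume. One of the two signed integrals carries half of what
  remains.\<close>

lemma far_witness:
  assumes r: "\<And>x. \<bar>F p x - F q x\<bar> \<le> r" and p: "p \<in> far_set X"
  shows "\<exists>S\<in>{above q, below q}. (X - 2 * r * measure lborel A) / 2 \<le> \<bar>(LINT x:A|lborel. indicator S x * F p x) - mass S\<bar>"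
proof -
  have sp: "p \<in> space (prior_params CARD('d) CL)" by (simp add: space_prior_params[OF CL])
  have intS: "set_integrable lborel A (\<lambda>x. indicator S x * (F p x - lam x))"
    "(LINT x:A|lborel. indicator S x * F p x) - mass S = (LINT x:A|lborel. indicator S x * (F p x - lam x))"
    if S: "S \<in> sets borel" for S
  proof -
    have i1: "set_integrable lborel A (\<lambda>x. indicator S x * F p x)" by (rule F_integrable_indicator[OF sp S])
    have i2: "set_integrable lborel A (\<lambda>x. indicator S x * lam x)"
      using S by (intro set_integrable_lam_mult[where K=1]) (auto simp: indicator_def)
    show "set_integrable lborel A (\<lambda>x. indicator S x * (F p x - lam x))"
      using set_integral_diff(1)[OF i1 i2] by (simp add: right_diff_distrib)
    show "(LINT x:A|lborel. indicator S x * F p x) - mass S = (LINT x:A|lborel. indicator S x * (F p x - lam x))"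
      using set_integral_diff(2)[OF i1 i2] by (simp add: right_diff_distrib mass_def)
  qed
  define a where "a = (LINT x:A|lborel. indicator (above q) x * (F p x - lam x))"
  define b where "b = (LINT x:A|lborel. indicator (below q) x * (F p x - lam x))"
  have fin: "set_integrable lborel A (\<lambda>x. 2 * r)" by (rule set_integrable_bounded[where K="\<bar>2 * r\<bar>"]) auto
  have "X < (LINT x:A|lborel. \<bar>F p x - lam x\<bar>)" using p by (simp add: far_set_def)
  also have "\<dots> \<le> (LINT x:A|lborel. indicator (above q) x * (F p x - lam x) - indicator (below q) x * (F p x - lam x) + 2 * r)"
  proof (rule set_integral_mono)
    show "set_integrable lborel A (\<lambda>x. \<bar>F p x - lam x\<bar>)"
      using F_integrable[OF sp] set_integrable_lam by (intro set_integrable_abs set_integral_diff(1))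
    show "set_integrable lborel A (\<lambda>x. indicator (above q) x * (F p x - lam x) - indicator (below q) x * (F p x - lam x) + 2 * r)"
      by (intro set_integral_add(1) set_integral_diff(1) intS(1) above_below_sets fin)
    fix x
    show "\<bar>F p x - lam x\<bar> \<le> indicator (above q) x * (F p x - lam x) - indicator (below q) x * (F p x - lam x) + 2 * r"
      using r[of x] by (cases "lam x < F q x") (auto simp: above_def below_def indicator_def abs_le_iff)
  qed
  also have "\<dots> = a - b + 2 * r * measure lborel A"
    unfolding a_def b_def
    by (subst set_integral_add(2)[OF set_integral_diff(1)[OF intS(1)[OF above_below_sets(1)] intS(1)[OF above_below_sets(2)]] fin],
        subst set_integral_diff(2)[OF intS(1)[OF above_below_sets(1)] intS(1)[OF above_below_sets(2)]])
       (use A in \<open>simp add: set_lebesgue_integral_def measure_def\<close>)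
  finally have "X - 2 * r * measure lborel A < \<bar>a\<bar> + \<bar>b\<bar>" by linarith
  moreover have "Y / 2 \<le> \<bar>a\<bar> \<or> Y / 2 \<le> \<bar>b\<bar>" if "Y < \<bar>a\<bar> + \<bar>b\<bar>" for Y using that by linarith
  ultimately have "(X - 2 * r * measure lborel A) / 2 \<le> \<bar>a\<bar> \<or> (X - 2 * r * measure lborel A) / 2 \<le> \<bar>b\<bar>" by blast
  then show ?thesis
    using intS(2)[OF above_below_sets(1), of q] intS(2)[OF above_below_sets(2), of q] by (auto simp: a_def b_def)
qed

end

section \<open>The posterior bound for a fixed window\<close>

context wavelet_data
begin

lemma mass_le: "S \<in> sets borel \<Longrightarrow> mass S \<le> \<eta> M0 * measure lborel A"
proof -
  assume S: "S \<in> sets borel"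
  have "mass S \<le> (LINT x:A|lborel. \<eta> M0)"
    unfolding mass_def
  proof (rule set_integral_mono)
    show "set_integrable lborel A (\<lambda>x. indicator S x * lam x)"
      using S by (intro set_integrable_lam_mult[where K=1]) (auto simp: indicator_def)
    show "set_integrable lborel A (\<lambda>x. \<eta> M0)" by (rule set_integrable_bounded[where K="\<bar>\<eta> M0\<bar>"]) auto
    show "indicator S x * lam x \<le> \<eta> M0" for x
      using lam_le[of x] \<eta>_pos[of M0] by (auto simp: indicator_def)
  qed
  also have "\<dots> = \<eta> M0 * measure lborel A"
    using A by (simp add: set_lebesgue_integral_def measure_def)
  finally show ?thesis .
qed

text \<open>Closeness in supremum norm keeps \<open>F p\<close> above half of the lower bound of the
  true intensity, which takes care of the denominator.\<close>

lemma divergence_le: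
  assumes close: "\<And>y. y \<in> cbox 0 1 \<Longrightarrow> \<bar>ws p y - w0 y\<bar> \<le> \<epsilon>" and \<epsilon>: "Lip * \<epsilon> \<le> \<eta> (- M0) / 2"
  shows "(LINT x:A|lborel. (lam x - F p x)\<^sup>2 / F p x) \<le> 2 * Lip\<^sup>2 * \<epsilon>\<^sup>2 / \<eta> (- M0) * measure lborel A"
proof -
  let ?k = "2 * Lip\<^sup>2 * \<epsilon>\<^sup>2 / \<eta> (- M0)"
  have k: "?k \<ge> 0" using \<eta>_pos[of "- M0"] by simp
  have pt: "(lam x - F p x)\<^sup>2 / F p x \<le> ?k" for x
  proof -
    have d: "\<bar>lam x - F p x\<bar> \<le> Lip * \<epsilon>"
      using \<eta>_lip[of "w0 (z x)" "ws p (z x)"] close[OF z(2)[of x]] Lip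
      by (smt (verit) abs_minus_commute mult_left_mono)
    have "F p x \<ge> \<eta> (- M0) / 2" using d \<epsilon> lam_ge[of x] by linarith
    moreover have "(lam x - F p x)\<^sup>2 \<le> (Lip * \<epsilon>)\<^sup>2" using d by (rule power2_le_iff_abs_le[THEN iffD2, rotated]) (use d in linarith)
    ultimately have "(lam x - F p x)\<^sup>2 / F p x \<le> (Lip * \<epsilon>)\<^sup>2 / (\<eta> (- M0) / 2)"
      using \<eta>_pos[of "- M0"] by (intro frac_le) auto
    then show ?thesis by (simp add: power_mult_distrib mult_ac)
  qed
  have meas: "(\<lambda>x. (lam x - F p x)\<^sup>2 / F p x) \<in> borel_measurable borel"
    using lam_meas F_measurable_x[of p] by (simp add: space_prior_params[OF CL])
  have "(LINT x:A|lborel. (lam x - F p x)\<^sup>2 / F p x) \<le> (LINT x:A|lborel. ?k)"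
  proof (rule set_integral_mono)
    show "set_integrable lborel A (\<lambda>x. (lam x - F p x)\<^sup>2 / F p x)"
      using pt meas \<eta>_pos by (intro set_integrable_bounded[where K="?k"]) (auto simp: abs_of_pos)
    show "set_integrable lborel A (\<lambda>x. ?k)" by (rule set_integrable_bounded[where K="?k"]) (use k in auto)
  qed (rule pt)
  also have "\<dots> = ?k * measure lborel A"
    using A by (simp add: set_lebesgue_integral_def measure_def)
  finally show ?thesis .
qed

text \<open>Coefficients are rounded down to multiples of \<open>h\<close>. Series of lower level
  are first padded with zeros, so that the net lives on the single level \<open>L\<close>.\<close>

lemma sieve_net:
  assumes p: "p \<in> sieve L (levels_upto CARD('d) L) G" and h: "h > 0" and R: "G / h + 1 \<le> real R"
  obtains f where "f \<in> PiE (levels_upto CARD('d) L) (\<lambda>_. {- int R..int R})"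
    "\<And>y. y \<in> cbox 0 1 \<Longrightarrow> \<bar>ws p y - ws (L, \<lambda>q. real_of_int (f q) * h) y\<bar> \<le>
       real (card (levels_upto CARD('d) L)) * (h * (C * sqrt (2 ^ (L * CARD('d)))))"
proof -
  obtain L' g where pLg: "p = (L', g)" by (cases p)
  have L': "L' \<le> L" and g: "\<And>q. q \<in> levels_upto CARD('d) L \<Longrightarrow> \<bar>g q\<bar> \<le> G"
    using p by (auto simp: sieve_def[OF CL] pLg)
  define g' where "g' q = (if fst q \<le> L' then g q else 0)" for q
  define f where "f = restrict (\<lambda>q. \<lfloor>g' q / h\<rfloor>) (levels_upto CARD('d) L)"
  have eq: "ws p y = ws (L, g') y" for y
    unfolding pLg wavelet_series_sum
    by (rule sum.mono_neutral_cong_left) (use L' finite_levels_upto in \<open>auto simp: g'_def\<close>)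
  have "f q \<in> {- int R..int R}" if q: "q \<in> levels_upto CARD('d) L" for q
  proof -
    have "\<bar>g' q\<bar> \<le> \<bar>g q\<bar>" by (simp add: g'_def)
    then have "\<bar>g' q\<bar> \<le> G" using g[OF q] by linarith
    then have "\<bar>g' q / h\<bar> \<le> G / h" using h by (simp add: abs_divide divide_right_mono)
    then have "\<bar>g' q / h\<bar> \<le> real R - 1" using R by linarith
    then have "- int R \<le> \<lfloor>g' q / h\<rfloor> \<and> \<lfloor>g' q / h\<rfloor> \<le> int R" by linarith
    then show ?thesis using q by (simp add: f_def)
  qed
  then have "f \<in> PiE (levels_upto CARD('d) L) (\<lambda>_. {- int R..int R})" by (auto simp: f_def)
  moreover have "\<bar>ws p y - ws (L, \<lambda>q. real_of_int (f q) * h) y\<bar> \<le>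
       real (card (levels_upto CARD('d) L)) * (h * (C * sqrt (2 ^ (L * CARD('d)))))" if y: "y \<in> cbox 0 1" for y
    unfolding eq
  proof (rule series_diff_le[OF y])
    fix q assume q: "q \<in> levels_upto CARD('d) L"
    have "\<bar>g' q / h - of_int \<lfloor>g' q / h\<rfloor>\<bar> \<le> 1" by linarith
    then have "\<bar>g' q / h - of_int \<lfloor>g' q / h\<rfloor>\<bar> * h \<le> 1 * h" using h by (intro mult_right_mono) auto
    also have "\<bar>g' q / h - of_int \<lfloor>g' q / h\<rfloor>\<bar> * h = \<bar>(g' q / h - of_int \<lfloor>g' q / h\<rfloor>) * h\<bar>"
      using h by (simp add: abs_mult)
    also have "(g' q / h - of_int \<lfloor>g' q / h\<rfloor>) * h = g' q - real_of_int (f q) * h"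
      using h q by (simp add: f_def left_diff_distrib)
    finally show "\<bar>g' q - real_of_int (f q) * h\<bar> \<le> h" by simp
  qed
  ultimately show ?thesis by (rule that)
qed

text \<open>The general bound with \<open>s = \<epsilon>\<close> and
  \<open>t = (K - 2) * \<epsilon> * n / 8\<close>: a net of radius \<epsilon> in the intensity
  leaves \<open>(K * \<epsilon> * n - 2 * \<epsilon> * n) / 2 = 4 * t\<close> for the witness.
  Numbers of coefficients are replaced by powers of two, and \<open>b\<close> bounds the prior mass
  of the ball from below.\<close>

lemma posterior_expectation_bound:
  fixes \<epsilon> K \<delta> h G a :: real and l L R :: nat and c :: "nat \<times> nat \<Rightarrow> real"
  defines "n \<equiv> measure lborel A"
  defines "D \<equiv> \<lambda>l. real (2 ^ ((l + 1) * CARD('d)))"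
  defines "\<kappa> \<equiv> exp (- \<epsilon> * ((K - 2) * \<epsilon> * n / 8) + \<epsilon>\<^sup>2 * (\<eta> M0 * n))"
  defines "\<tau> \<equiv> tail_const CARD('d) CL * exp (- CL * 2 ^ (L * CARD('d)) * real L) + D L * (sqrt 2 * exp (- G\<^sup>2 / 4))"
  defines "b \<equiv> level_weight CARD('d) CL l / normalizer CARD('d) CL * (std_normal_density (C + 1) * \<delta>) ^ 2 ^ ((l + 1) * CARD('d))"
  assumes \<epsilon>: "0 < \<epsilon>" "\<epsilon> \<le> 1 / 2" "Lip * \<epsilon> \<le> \<eta> (- M0) / 2" and K: "K \<ge> 2" and a: "a > 0" and l: "l \<ge> 1"
    and c: "\<And>p. \<bar>c p\<bar> \<le> C" "\<And>y. y \<in> cbox 0 1 \<Longrightarrow> \<bar>w0 y - ws (l, c) y\<bar> \<le> \<epsilon> / 2"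
    and \<delta>: "0 < \<delta>" "\<delta> \<le> 1" "D l * (\<delta> * (C * sqrt (2 ^ (l * CARD('d))))) \<le> \<epsilon> / 2"
    and h: "h > 0" "Lip * (D L * (h * (C * sqrt (2 ^ (L * CARD('d)))))) \<le> \<epsilon>" and G: "G \<ge> 0" and R: "G / h + 1 \<le> real R"
  shows "(\<integral>\<^sup>+N. ennreal (post (far_set (K * \<epsilon> * n)) N) \<partial>Q) \<le>
    ennreal (a * exp (2 * Lip\<^sup>2 * \<epsilon>\<^sup>2 / \<eta> (- M0) * n) + real (2 * (2 * R + 1) ^ 2 ^ ((L + 1) * CARD('d))) * (2 * \<kappa>) + (\<tau> + \<kappa>) / (a * b))"
proof -
  let ?I = "levels_upto CARD('d)"
  have card_nat: "card (?I l) \<le> 2 ^ ((l + 1) * CARD('d))" for l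
    by (rule less_imp_le[OF card_levels_upto]) (simp add: Suc_le_eq)
  have card_real: "real (card (?I l)) \<le> D l" for l
    unfolding D_def using card_nat by (simp only: of_nat_le_iff)
  have n0: "n \<ge> 0" by (simp add: n_def)
  define \<phi> where "\<phi> = std_normal_density (C + 1)"
  \<comment> \<open>The bound by 1 allows the number of coefficients in the exponent to be replaced
    by the larger power of two.\<close>
  have \<phi>: "\<phi> > 0" "\<phi> \<le> 1"
  proof -
    show "\<phi> > 0" unfolding \<phi>_def by (rule normal_density_pos) simp
    have "1 \<le> sqrt (2 * pi)" using pi_gt3 by (simp add: real_le_rsqrt)
    then have "exp (- (C + 1)\<^sup>2 / 2) / sqrt (2 * pi) \<le> 1 / 1" by (intro frac_le) auto
    then show "\<phi> \<le> 1" by (simp add: \<phi>_def normal_density_def)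
  qed
  define B where "B = {l} \<times> {g. \<forall>p\<in>?I l. \<bar>g p - c p\<bar> \<le> \<delta>}"
  have sb: "level_weight CARD('d) CL l / normalizer CARD('d) CL * (\<phi> * \<delta>) ^ card (?I l) \<le> prior.prob B"
      "B \<in> sets (prior_params CARD('d) CL)"
    unfolding B_def \<phi>_def by (rule prior_params_small_ball[OF CL finite_levels_upto c(1) \<delta>(1,2)])+
  have b_le: "b \<le> prior.prob B"
  proof (rule order_trans[OF _ sb(1)])
    have "(\<phi> * \<delta>) ^ 2 ^ ((l + 1) * CARD('d)) \<le> (\<phi> * \<delta>) ^ card (?I l)"
      using \<phi> \<delta> card_nat[of l] by (intro power_decreasing mult_le_one mult_nonneg_nonneg) auto
    then show "b \<le> level_weight CARD('d) CL l / normalizer CARD('d) CL * (\<phi> * \<delta>) ^ card (?I l)"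
      unfolding b_def \<phi>_def[symmetric] using normalizer_pos[OF CL] level_weight_nonneg[OF CL]
      by (intro mult_left_mono) (auto simp: less_imp_le)
  qed
  have b_pos: "b > 0"
    unfolding b_def using normalizer_pos[OF CL, of "CARD('d)"] \<phi>(1) \<delta>(1) l
    by (intro mult_pos_pos divide_pos_pos zero_less_power) (simp_all add: level_weight_def \<phi>_def)
  define T where "T = sieve L (?I L) G"
  have sv: "T \<in> sets (prior_params CARD('d) CL)"
    "prior.prob (space (prior_params CARD('d) CL) - T) \<le>
       tail_const CARD('d) CL * exp (- CL * 2 ^ (L * CARD('d)) * real L) + real (card (?I L)) * (sqrt 2 * exp (- G\<^sup>2 / 4))"
    unfolding T_def by (rule prior_params_sieve[OF CL finite_levels_upto G])+
  have \<tau>: "prior.prob (space (prior_params CARD('d) CL) - T) \<le> \<tau>"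
  proof -
    have "real (card (?I L)) * (sqrt 2 * exp (- G\<^sup>2 / 4)) \<le> D L * (sqrt 2 * exp (- G\<^sup>2 / 4))"
      by (rule mult_right_mono[OF card_real]) simp
    with sv(2) show ?thesis unfolding \<tau>_def by linarith
  qed
  define net where "net = PiE (?I L) (\<lambda>_. {- int R..int R})"
  define q where "q f = (L, \<lambda>p. real_of_int (f p) * h)" for f :: "nat \<times> nat \<Rightarrow> int"
  define \<SS> where "\<SS> = (\<lambda>f. above (q f)) ` net \<union> (\<lambda>f. below (q f)) ` net"
  have net: "finite net" "card net \<le> (2 * R + 1) ^ 2 ^ ((L + 1) * CARD('d))"
  proof -
    show "finite net" unfolding net_def by (intro finite_PiE finite_levels_upto) auto
    have "card net = (2 * R + 1) ^ card (?I L)"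
    proof -
      have "card {- int R..int R} = 2 * R + 1" by simp
      then show ?thesis unfolding net_def using finite_levels_upto by (simp only: card_PiE prod_constant)
    qed
    also have "\<dots> \<le> (2 * R + 1) ^ 2 ^ ((L + 1) * CARD('d))" by (intro power_increasing card_nat) auto
    finally show "card net \<le> (2 * R + 1) ^ 2 ^ ((L + 1) * CARD('d))" .
  qed
  have card\<SS>: "card \<SS> \<le> 2 * (2 * R + 1) ^ 2 ^ ((L + 1) * CARD('d))"
  proof -
    have "card \<SS> \<le> card ((\<lambda>f. above (q f)) ` net) + card ((\<lambda>f. below (q f)) ` net)"
      unfolding \<SS>_def by (rule card_Un_le)
    also have "\<dots> \<le> card net + card net" using net(1) by (intro add_mono card_image_le)
    finally show ?thesis using net(2) by linarith
  qed
  have far: "\<exists>S\<in>\<SS>. 4 * ((K - 2) * \<epsilon> * n / 8) \<le> \<bar>(LINT x:A|lborel. indicator S x * F p x) - mass S\<bar>"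
    if pf: "p \<in> far_set (K * \<epsilon> * n)" and pT: "p \<in> T" for p
  proof -
    obtain f where f: "f \<in> net"
      "\<And>y. y \<in> cbox 0 1 \<Longrightarrow> \<bar>ws p y - ws (q f) y\<bar> \<le> real (card (?I L)) * (h * (C * sqrt (2 ^ (L * CARD('d)))))"
      using sieve_net[OF pT[unfolded T_def] h(1) R] unfolding net_def q_def by blast
    have "\<bar>F p x - F (q f) x\<bar> \<le> \<epsilon>" for x
    proof -
      have "\<bar>F p x - F (q f) x\<bar> \<le> Lip * \<bar>ws p (z x) - ws (q f) (z x)\<bar>" by (rule \<eta>_lip)
      also have "\<dots> \<le> Lip * (real (card (?I L)) * (h * (C * sqrt (2 ^ (L * CARD('d))))))"
        using Lip by (intro mult_left_mono f(2) z(2)) auto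
      also have "\<dots> \<le> Lip * (D L * (h * (C * sqrt (2 ^ (L * CARD('d))))))"
        using Lip h(1) C by (intro mult_left_mono mult_right_mono card_real) auto
      finally show ?thesis using h(2) by linarith
    qed
    from far_witness[OF this pf] obtain S where S: "S \<in> {above (q f), below (q f)}"
      "(K * \<epsilon> * n - 2 * \<epsilon> * n) / 2 \<le> \<bar>(LINT x:A|lborel. indicator S x * F p x) - mass S\<bar>"
      unfolding n_def by blast
    have "4 * ((K - 2) * \<epsilon> * n / 8) = (K * \<epsilon> * n - 2 * \<epsilon> * n) / 2" by (simp add: field_simps)
    with S f(1) show ?thesis unfolding \<SS>_def by (intro bexI[of _ S]) auto
  qed
  have close: "(LINT x:A|lborel. (lam x - F p x)\<^sup>2 / F p x) \<le> 2 * Lip\<^sup>2 * \<epsilon>\<^sup>2 / \<eta> (- M0) * n" if pB: "p \<in> B" for p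
    unfolding n_def
  proof (rule divergence_le[OF _ \<epsilon>(3)])
    fix y :: "real^'d" assume y: "y \<in> cbox 0 1"
    obtain g where p: "p = (l, g)" "\<And>q. q \<in> ?I l \<Longrightarrow> \<bar>g q - c q\<bar> \<le> \<delta>" using pB by (auto simp: B_def)
    have "\<bar>ws (l, g) y - ws (l, c) y\<bar> \<le> real (card (?I l)) * (\<delta> * (C * sqrt (2 ^ (l * CARD('d)))))"
      by (rule series_diff_le[OF y p(2)])
    also have "\<dots> \<le> D l * (\<delta> * (C * sqrt (2 ^ (l * CARD('d)))))"
      using \<delta>(1) C by (intro mult_right_mono card_real) auto
    finally show "\<bar>ws p y - w0 y\<bar> \<le> \<epsilon>" using c(2)[OF y] \<delta>(3) unfolding p(1) by linarith
  qed
  have \<SS>_borel: "S \<in> sets borel" if "S \<in> \<SS>" for S using that above_below_sets by (auto simp: \<SS>_def q_def)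
  have pos: "prior.prob B > 0" using b_pos b_le by linarith
  have "(\<integral>\<^sup>+N. ennreal (post (far_set (K * \<epsilon> * n)) N) \<partial>Q) \<le>
    ennreal (a * exp (2 * Lip\<^sup>2 * \<epsilon>\<^sup>2 / \<eta> (- M0) * n) + real (card \<SS>) * (2 * \<kappa>) + (\<tau> + \<kappa>) / (a * prior.prob B))"
    unfolding \<kappa>_def
  proof (rule expected_posterior_le[where T=T])
    show "finite \<SS>" using net(1) by (simp add: \<SS>_def)
    show "mass S \<le> \<eta> M0 * n" if "S \<in> \<SS>" for S unfolding n_def by (rule mass_le[OF \<SS>_borel[OF that]])
    show "0 \<le> (K - 2) * \<epsilon> * n / 8" using K \<epsilon>(1) n0 by simp
  qed (use far_set_sets sb(2) sv(1) pos a close \<SS>_borel \<epsilon> far \<tau> in auto)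
  also have "\<dots> \<le> ennreal (a * exp (2 * Lip\<^sup>2 * \<epsilon>\<^sup>2 / \<eta> (- M0) * n) + real (2 * (2 * R + 1) ^ 2 ^ ((L + 1) * CARD('d))) * (2 * \<kappa>) + (\<tau> + \<kappa>) / (a * b))"
  proof (intro ennreal_leI add_mono order_refl mult_right_mono)
    show "real (card \<SS>) \<le> real (2 * (2 * R + 1) ^ 2 ^ ((L + 1) * CARD('d)))" using card\<SS> by (simp only: of_nat_le_iff)
    have "\<tau> \<ge> 0" using \<tau> measure_nonneg order_trans by blast
    then show "(\<tau> + \<kappa>) / (a * prior.prob B) \<le> (\<tau> + \<kappa>) / (a * b)"
      using a b_pos b_le by (intro divide_left_mono mult_left_mono mult_pos_pos) (auto simp: \<kappa>_def pos)
  qed (simp add: \<kappa>_def)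
  finally show ?thesis .
qed

end

section \<open>Choice of the levels and of the rate\<close>

text \<open>The least level that reaches \<open>x\<close> overshoots by at most the factor of one
  level.\<close>

lemma pow_between:
  fixes x :: real and d :: nat
  assumes "x \<ge> 1" "d \<ge> 1"
  obtains L :: nat where "x \<le> 2 ^ (L * d)" "2 ^ (L * d) \<le> 2 ^ d * x"
proof -
  have base: "(2::real) ^ (l * d) = (2 ^ d) ^ l" for l by (simp add: power_mult mult.commute)
  have "(2::real) ^ 1 \<le> 2 ^ d" using assms(2) by (intro power_increasing) auto
  then have "(1::real) < 2 ^ d" by simp
  then obtain l0 where "x < (2 ^ d) ^ l0" using real_arch_pow by blast
  then have ex: "\<exists>l. x \<le> 2 ^ (l * d)" unfolding base by (intro exI[of _ l0]) simp
  define L where "L = (LEAST l. x \<le> 2 ^ (l * d))"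
  have 1: "x \<le> 2 ^ (L * d)" unfolding L_def by (rule LeastI_ex[OF ex])
  have "2 ^ (L * d) \<le> 2 ^ d * x"
  proof (cases L)
    case 0
    have "1 * 1 \<le> 2 ^ d * x" using assms by (intro mult_mono) auto
    then show ?thesis using 0 by simp
  next
    case (Suc L')
    then have "\<not> x \<le> 2 ^ (L' * d)" unfolding L_def by (metis lessI not_less_Least)
    then show ?thesis unfolding Suc by (simp add: power_add)
  qed
  with 1 show ?thesis by (rule that)
qed

section \<open>Constants and the balance of exponents\<close>

locale rate_setup =
  fixes \<beta> CL C Lip c0 \<Lambda> Z tc \<phi> :: real and d L0 :: nat
  assumes \<beta>: "\<beta> > 0" and d: "d \<ge> 1" and pos: "CL > 0" "C > 0" "Lip > 0" "c0 > 0" "\<Lambda> > 0" "Z > 0" "\<phi> > 0" and tc: "tc \<ge> 0"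
begin

text \<open>With \<open>2 ^ l\<close> of order \<open>n powr \<alpha>\<close> the bias
  \<open>2 powr (- \<beta> * l)\<close> has the order of the rate without its logarithm. With
  \<open>X = n powr (\<alpha> * d)\<close>, the unit of all exponents will be
  \<open>T = n * \<epsilon>\<^sup>2 = X * (ln n)\<^sup>2\<close>.\<close>

definition "\<alpha> = 1 / (2 * \<beta> + real d)"
text \<open>The divergence on the ball is at most \<open>C2 * T\<close>.\<close>

definition "C2 = 2 * Lip\<^sup>2 / c0"
text \<open>Chosen so that \<open>2 ^ (L * d) >= Ks * X * ln n\<close> and
  \<open>L >= \<alpha> * ln n\<close> give the level prior beyond \<open>L\<close> the exponent
  \<open>(C2 + 4) * T\<close>.\<close>

definition "Ks = (C2 + 4) / (CL * \<alpha>)"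
text \<open>Collects the exponent of the prior mass of the ball: at most
  \<open>Kb * X * ln n\<close>, hence at most \<open>T\<close> once
  \<open>ln n >= Kb\<close>.\<close>

definition "Kb = CL * 2 ^ d * (2 * \<alpha> + 1) + \<bar>ln Z\<bar> + 4 ^ d * (\<bar>ln \<phi>\<bar> + 4)"
text \<open>Entropy of the net: at most \<open>4 ^ d * Ks * X * ln n\<close> coefficients with at
  most \<open>n ^ 6\<close> values each, so the logarithm of its size is at most
  \<open>C3 * T\<close>.\<close>

definition "C3 = 6 * 4 ^ d * Ks"
text \<open>Makes the Chernoff exponent \<open>((K - 2) / 8 - \<Lambda>) * T\<close> at least
  \<open>(C3 + C2 + 5) * T\<close>, enough to pay for the net and for the evidence.\<close>

definition "K0 = 2 + 8 * (\<Lambda> + C3 + C2 + 5)"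
definition "rate n = n powr (- \<beta> / (2 * \<beta> + real d)) * ln n"

lemma const_facts: "\<alpha> > 0" "\<alpha> \<le> 1" "\<alpha> * real d \<le> 1" "\<beta> * \<alpha> \<le> 1" "C2 \<ge> 0" "Ks > 0" "C3 \<ge> 0" "K0 \<ge> 2"
proof -
  have den: "2 * \<beta> + real d > 0" "real d \<ge> 1" using \<beta> d by auto
  show a: "\<alpha> > 0" using den by (simp add: \<alpha>_def)
  show "\<alpha> \<le> 1" "\<alpha> * real d \<le> 1" "\<beta> * \<alpha> \<le> 1" using den \<beta> by (simp_all add: \<alpha>_def divide_le_eq)
  show c2: "C2 \<ge> 0" using pos by (simp add: C2_def)
  show ks: "Ks > 0" using c2 a pos by (simp add: Ks_def)
  then show c3: "C3 \<ge> 0" by (simp add: C3_def)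
  show "K0 \<ge> 2" using c2 c3 pos by (simp add: K0_def)
qed

text \<open>Bookkeeping in multiples of \<open>T\<close>. The ball has mass at least
  \<open>exp (- T)\<close> and \<open>a = exp (- (C2 + 1) * T)\<close>, so the first term is
  \<open>exp (- T)\<close> and the evidence is at least \<open>exp (- (C2 + 2) * T)\<close>. The
  numerator is of order \<open>exp (- (C2 + 4) * T)\<close>, so \<open>exp (- 2 * T)\<close> is left
  of the quotient. Finally \<open>T >= ln n\<close> yields \<open>1 / n\<close>.\<close>

lemma rate_at:
  fixes n K :: real
  assumes n: "n \<ge> 3" and K: "K \<ge> K0"
    and big: "ln n \<ge> 1" "ln n \<ge> 2 * C" "ln n \<ge> 2 * 8 ^ d * C" "ln n \<ge> Kb" "ln n \<ge> C * Lip" "Ks * ln n \<ge> 1"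
    and \<epsilon>small: "rate n \<le> 1 / 2" "Lip * rate n \<le> c0 / 2"
    and L0: "2 ^ L0 \<le> n powr \<alpha>" and H4: "4 ^ d * Ks * ln n \<le> n"
    and H5: "n\<^sup>2 * (sqrt 2 * exp (- n\<^sup>2 / 4)) \<le> exp (- (C2 + 4) * n)"
  shows "\<exists>(l::nat) (L::nat) \<delta> h a. l \<ge> L0 \<and> l \<ge> 1 \<and> 0 < rate n \<and> a > 0 \<and>
     C * 2 powr (- \<beta> * real l) \<le> rate n / 2 \<and>
     0 < \<delta> \<and> \<delta> \<le> 1 \<and> real (2 ^ ((l + 1) * d)) * (\<delta> * (C * sqrt (2 ^ (l * d)))) \<le> rate n / 2 \<and>
     h > 0 \<and> Lip * (real (2 ^ ((L + 1) * d)) * (h * (C * sqrt (2 ^ (L * d))))) \<le> rate n \<and>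
     n / h + 1 \<le> n ^ 5 + 1 \<and>
     (\<forall>R :: nat. real R \<le> n ^ 5 + 2 \<longrightarrow>
       a * exp (2 * Lip\<^sup>2 * (rate n)\<^sup>2 / c0 * n) +
       real (2 * (2 * R + 1) ^ 2 ^ ((L + 1) * d)) * (2 * exp (- rate n * ((K - 2) * rate n * n / 8) + (rate n)\<^sup>2 * (\<Lambda> * n))) +
       ((tc * exp (- CL * 2 ^ (L * d) * real L) + real (2 ^ ((L + 1) * d)) * (sqrt 2 * exp (- n\<^sup>2 / 4))) +
         exp (- rate n * ((K - 2) * rate n * n / 8) + (rate n)\<^sup>2 * (\<Lambda> * n))) /
        (a * (exp (- CL * 2 ^ (l * d) * real l) / Z * (\<phi> * \<delta>) ^ 2 ^ ((l + 1) * d)))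
       \<le> (tc + 7) / n)"
proof -
  define \<epsilon> where "\<epsilon> = rate n"
  define \<mu> where "\<mu> = ln n"
  define X where "X = n powr (\<alpha> * real d)"
  define T where "T = X * \<mu>\<^sup>2"
  have n0: "n > 0" using n by simp
  have \<mu>: "\<mu> \<ge> 1" using big(1) by (simp add: \<mu>_def)
  have \<epsilon>_eq: "\<epsilon> = n powr (- (\<beta> * \<alpha>)) * \<mu>" by (simp add: \<epsilon>_def rate_def \<mu>_def \<alpha>_def)
  have X1: "X \<ge> 1" using n const_facts by (auto simp: X_def intro!: ge_one_powr_ge_zero)
  have Xn: "X \<le> n" using n const_facts powr_mono[of "\<alpha> * real d" 1 n] by (simp add: X_def)
  have \<epsilon>pos: "\<epsilon> > 0" using n0 \<mu> by (simp add: \<epsilon>_eq)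
  have \<epsilon>_ge: "\<mu> / n \<le> \<epsilon>"
  proof -
    have "n powr (- 1) \<le> n powr (- (\<beta> * \<alpha>))" using n const_facts by (intro powr_mono) auto
    then have "n powr (- 1) * \<mu> \<le> \<epsilon>" unfolding \<epsilon>_eq using \<mu> by (intro mult_right_mono) auto
    then show ?thesis using n0 by (simp add: powr_minus divide_inverse mult.commute)
  qed
  have T: "\<epsilon>\<^sup>2 * n = T"
  proof -
    have "\<epsilon>\<^sup>2 * n = (n powr (- (\<beta> * \<alpha>)) * n powr (- (\<beta> * \<alpha>)) * n powr 1) * \<mu>\<^sup>2"
      using n0 by (simp add: \<epsilon>_eq power2_eq_square)
    also have "n powr (- (\<beta> * \<alpha>)) * n powr (- (\<beta> * \<alpha>)) * n powr 1 = n powr (- (\<beta> * \<alpha>) + - (\<beta> * \<alpha>) + 1)"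
      by (simp only: powr_add)
    also have "- (\<beta> * \<alpha>) + - (\<beta> * \<alpha>) + 1 = \<alpha> * real d"
    proof -
      have "\<alpha> * (2 * \<beta> + real d) = 1" using \<beta> by (simp add: \<alpha>_def add_pos_nonneg less_imp_neq[symmetric])
      then show ?thesis by (simp add: algebra_simps)
    qed
    finally show ?thesis by (simp add: T_def X_def)
  qed
  \<comment> \<open>Lets a Gaussian tail that is below \<open>exp (- c * n)\<close> count as one
    below \<open>exp (- c * T)\<close>.\<close>
  have T_le_n: "T \<le> n"
  proof -
    have "\<epsilon>\<^sup>2 \<le> 1\<^sup>2" using \<epsilon>pos \<epsilon>small(1) by (intro power_mono) (auto simp: \<epsilon>_def)
    then have "\<epsilon>\<^sup>2 * n \<le> 1 * n" using n0 by (intro mult_right_mono) auto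
    then show ?thesis using T by simp
  qed
  have T_ge: "\<mu> \<le> T"
  proof -
    have "1 * \<mu> \<le> X * (\<mu> * \<mu>)" using X1 \<mu> mult_mono[of 1 X \<mu> "\<mu> * \<mu>"] by simp
    then show ?thesis by (simp add: T_def power2_eq_square)
  qed
  have XlT: "k * (X * \<mu>) \<le> T" if "k \<le> \<mu>" for k
  proof -
    have "k * (X * \<mu>) \<le> \<mu> * (X * \<mu>)" using that X1 \<mu> by (intro mult_right_mono) auto
    then show ?thesis by (simp add: T_def power2_eq_square mult_ac)
  qed
  \<comment> \<open>Dimension 1 is inserted here, since the bias sees \<open>2 ^ l\<close> and not
    \<open>2 ^ (l * d)\<close>.\<close>
  obtain l where l: "n powr \<alpha> \<le> 2 ^ (l * 1)" "2 ^ (l * 1) \<le> 2 ^ 1 * n powr \<alpha>"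
    using pow_between[of "n powr \<alpha>" 1] n const_facts by (metis ge_one_powr_ge_zero le_numeral_extra(4) less_imp_le one_le_numeral order_trans)
  then have l: "n powr \<alpha> \<le> 2 ^ l" "2 ^ l \<le> 2 * n powr \<alpha>" by simp_all
  have lL0: "l \<ge> L0"
  proof -
    have "(2::real) ^ L0 \<le> 2 ^ l" using L0 l(1) by linarith
    then show ?thesis by simp
  qed
  \<comment> \<open>Level 0 carries no prior mass.\<close>
  have l1: "l \<ge> 1"
  proof (rule ccontr)
    assume "\<not> 1 \<le> l"
    then have "l = 0" by simp
    with l(1) have "n powr \<alpha> \<le> 1" by simp
    moreover have "1 < n powr \<alpha>" using n const_facts(1) by (simp add: gr_one_powr)
    ultimately show False by simp
  qed
  have l_le: "real l \<le> (2 * \<alpha> + 1) * \<mu>"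
  proof -
    have "ln (2 ^ l) \<le> ln (2 * n powr \<alpha>)" using l(2) by (intro ln_mono) auto
    then have "real l * ln 2 \<le> ln 2 + \<alpha> * \<mu>" using n0 by (simp add: ln_realpow ln_mult ln_powr \<mu>_def)
    then have "real l * ln 2 \<le> (1 + 2 * \<alpha> * \<mu>) * ln 2"
    proof -
      have "1 / 2 \<le> ln (2::real)" using ln_le_minus_one[of "1 / 2 :: real"] by (simp add: ln_div)
      then have "(2 * \<alpha> * \<mu>) * (1 / 2) \<le> (2 * \<alpha> * \<mu>) * ln 2" using const_facts(1) \<mu> by (intro mult_left_mono) auto
      with \<open>real l * ln 2 \<le> ln 2 + \<alpha> * \<mu>\<close> show ?thesis by (simp add: algebra_simps)
    qed
    then have "real l \<le> 1 + 2 * \<alpha> * \<mu>" by simp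
    then show ?thesis using \<mu> by (simp add: algebra_simps)
  qed
  have pow_l: "(2::real) ^ (l * d) \<le> 2 ^ d * X"
  proof -
    have "(2::real) ^ (l * d) \<le> (2 * n powr \<alpha>) ^ d" unfolding power_mult using l(2) by (rule power_mono) simp
    also have "\<dots> = 2 ^ d * X" using n0 by (simp add: power_mult_distrib X_def powr_powr[symmetric] powr_realpow)
    finally show ?thesis .
  qed
  have D_l: "(2::real) ^ ((l + 1) * d) \<le> 4 ^ d * X"
  proof -
    have "(2::real) ^ ((l + 1) * d) = 2 ^ d * 2 ^ (l * d)" by (simp add: power_add)
    also have "\<dots> \<le> 2 ^ d * (2 ^ d * X)" using pow_l by (intro mult_left_mono) auto
    also have "\<dots> = 4 ^ d * X" by (simp flip: power_mult_distrib mult.assoc)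
    finally show ?thesis .
  qed
  \<comment> \<open>The number of coefficients and the size of the wavelets are each at most of
    order \<open>n\<close>, so the fourth power leaves \<open>1 / n\<^sup>2\<close>, below the rate.
    In the prior mass it costs only \<open>4 * ln n\<close> per coefficient.\<close>
  define \<delta> where "\<delta> = 1 / n ^ 4"
  have \<delta>: "0 < \<delta>" "\<delta> \<le> 1" using n by (auto simp: \<delta>_def divide_le_eq_1 one_le_power)
  have approx: "C * 2 powr (- \<beta> * real l) \<le> \<epsilon> / 2"
  proof -
    have "2 powr (- \<beta> * real l) = (2 ^ l) powr (- \<beta>)"
      by (simp add: powr_realpow[symmetric] powr_powr mult.commute)
    also have "\<dots> \<le> (n powr \<alpha>) powr (- \<beta>)" using l(1) \<beta> n0 by (intro powr_mono2') auto
    also have "\<dots> = n powr (- (\<beta> * \<alpha>))" by (simp add: powr_powr mult.commute)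
    finally have "C * 2 powr (- \<beta> * real l) \<le> C * n powr (- (\<beta> * \<alpha>))" using pos by (intro mult_left_mono) auto
    also have "\<dots> \<le> (\<mu> / 2) * n powr (- (\<beta> * \<alpha>))" using big(2) by (intro mult_right_mono) (auto simp: \<mu>_def)
    finally show ?thesis by (simp add: \<epsilon>_eq mult.commute)
  qed
  have dl: "real (2 ^ ((l + 1) * d)) * (\<delta> * (C * sqrt (2 ^ (l * d)))) \<le> \<epsilon> / 2"
  proof -
    have "sqrt (2 ^ (l * d)) \<le> 2 ^ (l * d)" by (intro real_le_lsqrt) (auto simp: power2_eq_square)
    have s: "sqrt (2 ^ (l * d)) \<le> 2 ^ d * n"
    proof (rule order_trans[OF order_trans[OF \<open>sqrt (2 ^ (l * d)) \<le> 2 ^ (l * d)\<close> pow_l]])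
      show "2 ^ d * X \<le> 2 ^ d * n" using Xn by (rule mult_left_mono) simp
    qed
    have D: "(2::real) ^ ((l + 1) * d) \<le> 4 ^ d * n"
    proof (rule order_trans[OF D_l])
      show "4 ^ d * X \<le> 4 ^ d * n" using Xn by (rule mult_left_mono) simp
    qed
    have "real (2 ^ ((l + 1) * d)) * (\<delta> * (C * sqrt (2 ^ (l * d)))) \<le> (4 ^ d * n) * (\<delta> * (C * (2 ^ d * n)))"
      using \<delta> pos s D n0 by (intro mult_mono mult_left_mono mult_nonneg_nonneg) auto
    also have "\<dots> = (8 ^ d * C) / n * (1 / n)"
      using n0 by (simp add: \<delta>_def eval_nat_numeral power_mult_distrib[symmetric] mult_ac field_simps)
    also have "\<dots> \<le> (8 ^ d * C) / n * 1" using n pos by (intro mult_left_mono) auto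
    also have "\<dots> \<le> (\<mu> / 2) / n" using big(3) n0 by (simp add: \<mu>_def divide_right_mono field_simps)
    finally show ?thesis using \<epsilon>_ge by simp
  qed
  have "Ks * X * \<mu> \<ge> 1"
  proof -
    have "1 * 1 \<le> X * (Ks * \<mu>)" using X1 big(6) by (intro mult_mono) (auto simp: \<mu>_def)
    then show ?thesis by (simp add: mult_ac)
  qed
  \<comment> \<open>Larger than \<open>2 ^ (l * d)\<close> by one logarithm; the second logarithm of
    \<open>T\<close> comes from the factor \<open>L\<close> in the exponent of the level
    prior.\<close>
  then obtain L where L: "Ks * X * \<mu> \<le> 2 ^ (L * d)" "2 ^ (L * d) \<le> 2 ^ d * (Ks * X * \<mu>)"
    using pow_between[OF _ d] by blast
  have D_L: "(2::real) ^ ((L + 1) * d) \<le> 4 ^ d * Ks * X * \<mu>"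
  proof -
    have "(2::real) ^ ((L + 1) * d) = 2 ^ d * 2 ^ (L * d)" by (simp add: power_add)
    also have "\<dots> \<le> 2 ^ d * (2 ^ d * (Ks * X * \<mu>))" using L(2) by (intro mult_left_mono) auto
    also have "\<dots> = 4 ^ d * Ks * X * \<mu>" by (simp flip: power_mult_distrib mult.assoc)
    finally show ?thesis .
  qed
  have D_L_n: "(2::real) ^ ((L + 1) * d) \<le> n\<^sup>2"
  proof -
    have "(4 ^ d * Ks * \<mu>) * X \<le> n * n" using H4 Xn X1 n0 by (intro mult_mono) (auto simp: \<mu>_def)
    then show ?thesis using D_L by (simp add: power2_eq_square mult_ac)
  qed
  have L_ge: "\<alpha> * \<mu> \<le> real L"
  proof -
    have "X * 1 \<le> X * (Ks * \<mu>)" using X1 big(6) by (intro mult_left_mono) (auto simp: \<mu>_def)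
    then have "X \<le> 2 ^ (L * d)" using L(1) by (simp add: mult_ac)
    then have "ln X \<le> ln (2 ^ (L * d))" using X1 by (intro ln_mono) auto
    then have "real d * (\<alpha> * \<mu>) \<le> real d * (real L * ln 2)"
      using n0 by (simp add: X_def ln_powr ln_realpow \<mu>_def mult_ac)
    then have "\<alpha> * \<mu> \<le> real L * ln 2" using d by simp
    also have "\<dots> \<le> real L * 1" using ln_2_less_1 by (intro mult_left_mono) auto
    finally show ?thesis by simp
  qed
  have lev: "(C2 + 4) * T \<le> CL * 2 ^ (L * d) * real L"
  proof -
    have "(C2 + 4) * T = CL * (Ks * X * \<mu>) * (\<alpha> * \<mu>)"
      using pos const_facts(1) by (simp add: Ks_def T_def power2_eq_square field_simps)
    also have "\<dots> \<le> CL * 2 ^ (L * d) * real L"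
      using L(1) L_ge pos const_facts X1 \<mu> by (intro mult_mono mult_left_mono mult_nonneg_nonneg) auto
    finally show ?thesis .
  qed
  \<comment> \<open>At most \<open>n\<^sup>2\<close> coefficients and wavelets of size at most
    \<open>C * n\<close> give a net radius of order \<open>1 / n\<close>. With coefficients up to
    \<open>n\<close> there are of order \<open>n ^ 5\<close> grid values.\<close>
  define h where "h = 1 / n ^ 4"
  have h: "h > 0" using n0 by (simp add: h_def)
  have net: "Lip * (real (2 ^ ((L + 1) * d)) * (h * (C * sqrt (2 ^ (L * d))))) \<le> \<epsilon>"
  proof -
    have "(2::real) ^ (L * d) \<le> 2 ^ ((L + 1) * d)" by (intro power_increasing) auto
    then have "(2::real) ^ (L * d) \<le> n\<^sup>2" using D_L_n by (rule order_trans)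
    then have "sqrt (2 ^ (L * d)) \<le> n" using n0 by (intro real_le_lsqrt) auto
    then have "Lip * (real (2 ^ ((L + 1) * d)) * (h * (C * sqrt (2 ^ (L * d))))) \<le> Lip * (n\<^sup>2 * (h * (C * n)))"
      using D_L_n h pos n0 by (intro mult_left_mono mult_mono mult_nonneg_nonneg) auto
    also have "\<dots> = (C * Lip) / n" using n0 by (simp add: h_def eval_nat_numeral field_simps)
    also have "\<dots> \<le> \<mu> / n" using big(5) n0 by (simp add: \<mu>_def divide_right_mono)
    finally show ?thesis using \<epsilon>_ge by simp
  qed
  \<comment> \<open>One \<open>T\<close> more than the divergence \<open>C2 * T\<close>, so that the
    Markov term is \<open>exp (- T)\<close>.\<close>
  define a where "a = exp (- (C2 + 1) * T)"
  define \<kappa> where "\<kappa> = exp (- \<epsilon> * ((K - 2) * \<epsilon> * n / 8) + \<epsilon>\<^sup>2 * (\<Lambda> * n))"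
  define b where "b = exp (- CL * 2 ^ (l * d) * real l) / Z * (\<phi> * \<delta>) ^ 2 ^ ((l + 1) * d)"
  define \<tau> where "\<tau> = tc * exp (- CL * 2 ^ (L * d) * real L) + real (2 ^ ((L + 1) * d)) * (sqrt 2 * exp (- n\<^sup>2 / 4))"
  have T0: "T \<ge> 0" using T_ge \<mu> by simp
  have \<kappa>: "\<kappa> \<le> exp (- (C3 + C2 + 5) * T)"
  proof -
    have "- \<epsilon> * ((K - 2) * \<epsilon> * n / 8) + \<epsilon>\<^sup>2 * (\<Lambda> * n) = (\<Lambda> - (K - 2) / 8) * (\<epsilon>\<^sup>2 * n)"
      by (simp add: power2_eq_square field_simps)
    also have "\<dots> \<le> - (C3 + C2 + 5) * T"
      unfolding T using K T0 by (intro mult_right_mono) (auto simp: K0_def field_simps)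
    finally show ?thesis by (simp add: \<kappa>_def)
  qed
  have b: "exp (- T) \<le> b"
  proof -
    let ?D = "(2::real) ^ ((l + 1) * d)"
    have Xl: "1 \<le> X * \<mu>" using X1 \<mu> mult_mono[of 1 X 1 \<mu>] by simp
    have "b = exp (- (CL * 2 ^ (l * d) * real l) - ln Z + ?D * (ln \<phi> - 4 * \<mu>))"
    proof -
      have "\<phi> * \<delta> = exp (ln \<phi> - 4 * \<mu>)"
        using pos n0 by (simp add: \<delta>_def exp_diff \<mu>_def exp_of_nat_mult[of 4 "ln n", simplified] divide_inverse)
      then have "(\<phi> * \<delta>) ^ 2 ^ ((l + 1) * d) = exp (?D * (ln \<phi> - 4 * \<mu>))"
        by (simp add: exp_of_nat_mult[symmetric])
      moreover have "1 / Z = exp (- ln Z)" using pos by (simp add: exp_minus divide_inverse)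
      ultimately show ?thesis unfolding b_def by (simp add: exp_add exp_diff exp_minus divide_inverse)
    qed
    moreover have "- T \<le> - (CL * 2 ^ (l * d) * real l) - ln Z + ?D * (ln \<phi> - 4 * \<mu>)"
    proof -
      have 1: "CL * 2 ^ (l * d) * real l \<le> CL * (2 ^ d * X) * ((2 * \<alpha> + 1) * \<mu>)"
        using pow_l l_le pos X1 by (intro mult_mono mult_left_mono mult_nonneg_nonneg) auto
      have 2: "ln Z \<le> \<bar>ln Z\<bar> * (X * \<mu>)" using mult_left_mono[OF Xl, of "\<bar>ln Z\<bar>"] by simp
      have "\<bar>ln \<phi>\<bar> * 1 \<le> \<bar>ln \<phi>\<bar> * \<mu>" using \<mu> by (intro mult_left_mono) auto
      then have "4 * \<mu> - ln \<phi> \<le> (\<bar>ln \<phi>\<bar> + 4) * \<mu>" by (simp add: algebra_simps)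
      then have "?D * (4 * \<mu> - ln \<phi>) \<le> ?D * ((\<bar>ln \<phi>\<bar> + 4) * \<mu>)" by (intro mult_left_mono) auto
      also have "\<dots> \<le> (4 ^ d * X) * ((\<bar>ln \<phi>\<bar> + 4) * \<mu>)" using D_l \<mu> by (intro mult_right_mono) auto
      finally have 3: "?D * (4 * \<mu> - ln \<phi>) \<le> (4 ^ d * X) * ((\<bar>ln \<phi>\<bar> + 4) * \<mu>)" .
      have "CL * 2 ^ (l * d) * real l + ln Z + ?D * (4 * \<mu> - ln \<phi>) \<le> Kb * (X * \<mu>)"
        using 1 2 3 by (simp add: Kb_def algebra_simps)
      also have "\<dots> \<le> T" using big(4) by (intro XlT) (simp add: \<mu>_def)
      finally show ?thesis by (simp add: algebra_simps)
    qed
    ultimately show ?thesis by simp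
  qed
  have \<tau>: "\<tau> \<le> (tc + 1) * exp (- (C2 + 4) * T)"
  proof -
    have "exp (- CL * 2 ^ (L * d) * real L) \<le> exp (- (C2 + 4) * T)"
      unfolding exp_le_cancel_iff mult_minus_left neg_le_iff_le by (rule lev)
    then have 1: "tc * exp (- CL * 2 ^ (L * d) * real L) \<le> tc * exp (- (C2 + 4) * T)" using tc by (rule mult_left_mono)
    have "real (2 ^ ((L + 1) * d)) * (sqrt 2 * exp (- n\<^sup>2 / 4)) \<le> n\<^sup>2 * (sqrt 2 * exp (- n\<^sup>2 / 4))"
      using D_L_n by (intro mult_right_mono) auto
    also have "\<dots> \<le> exp (- (C2 + 4) * n)" by (rule H5)
    also have "\<dots> \<le> exp (- (C2 + 4) * T)"
      using T_le_n const_facts(5) mult_left_mono[of T n "C2 + 4"] by simp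
    finally show ?thesis using 1 by (simp add: \<tau>_def algebra_simps)
  qed
  have eT: "exp (- T) \<le> 1 / n"
  proof -
    have "exp (- T) \<le> exp (- \<mu>)" using T_ge by simp
    also have "\<dots> = 1 / n" using n0 by (simp add: \<mu>_def exp_minus divide_inverse)
    finally show ?thesis .
  qed
  have t1: "a * exp (2 * Lip\<^sup>2 * \<epsilon>\<^sup>2 / c0 * n) = exp (- T)"
  proof -
    have "2 * Lip\<^sup>2 * \<epsilon>\<^sup>2 / c0 * n = C2 * T" by (simp add: C2_def T[symmetric])
    then show ?thesis by (simp add: a_def exp_add[symmetric] algebra_simps)
  qed
  have t2: "real (2 * (2 * R + 1) ^ 2 ^ ((L + 1) * d)) * (2 * \<kappa>) \<le> 4 * exp (- T)" if R: "real R \<le> n ^ 5 + 2" for R :: nat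
  proof -
    have "2 * real R + 1 \<le> n ^ 6"
    proof -
      have "3 ^ 5 \<le> n ^ 5" using n by (intro power_mono) auto
      then have "2 * real R + 1 \<le> 3 * n ^ 5" using R by simp
      also have "\<dots> \<le> n * n ^ 5" using n by (intro mult_right_mono) auto
      finally show ?thesis by (simp add: eval_nat_numeral)
    qed
    then have "(2 * real R + 1) ^ 2 ^ ((L + 1) * d) \<le> (n ^ 6) ^ 2 ^ ((L + 1) * d)" by (intro power_mono) auto
    also have "\<dots> = exp (real (2 ^ ((L + 1) * d)) * (6 * \<mu>))"
    proof -
      have "n ^ 6 = exp (6 * \<mu>)" using n0 exp_of_nat_mult[of 6 "ln n"] by (simp add: \<mu>_def)
      then show ?thesis by (simp only: exp_of_nat_mult)
    qed
    also have "\<dots> \<le> exp (C3 * T)"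
    proof -
      have "real (2 ^ ((L + 1) * d)) * (6 * \<mu>) \<le> (4 ^ d * Ks * X * \<mu>) * (6 * \<mu>)" using D_L \<mu> by (intro mult_right_mono) auto
      also have "\<dots> = C3 * T" by (simp add: C3_def T_def power2_eq_square mult_ac)
      finally show ?thesis by simp
    qed
    finally have "real (2 * (2 * R + 1) ^ 2 ^ ((L + 1) * d)) * (2 * \<kappa>) \<le> (2 * exp (C3 * T)) * (2 * exp (- (C3 + C2 + 5) * T))"
      using \<kappa> by (intro mult_mono mult_left_mono) (auto simp: \<kappa>_def add.commute)
    also have "\<dots> = 4 * exp (- (C2 + 5) * T)" by (simp add: exp_add[symmetric] algebra_simps)
    also have "\<dots> \<le> 4 * exp (- T)"
    proof -
      have "1 * T \<le> (C2 + 5) * T" using T0 const_facts(5) by (intro mult_right_mono) auto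
      then have "- (C2 + 5) * T \<le> - T" unfolding mult_minus_left neg_le_iff_le by simp
      then show ?thesis unfolding mult_le_cancel_left exp_le_cancel_iff by simp
    qed
    finally show ?thesis .
  qed
  have t3: "(\<tau> + \<kappa>) / (a * b) \<le> (tc + 2) * exp (- T)"
  proof -
    have "- (C3 + C2 + 5) * T \<le> - (C2 + 4) * T" using T0 const_facts(7) by (intro mult_right_mono) auto
    then have "\<kappa> \<le> exp (- (C2 + 4) * T)" using \<kappa> by (meson exp_le_cancel_iff order_trans)
    then have num: "\<tau> + \<kappa> \<le> (tc + 2) * exp (- (C2 + 4) * T)" using \<tau> by (simp add: algebra_simps)
    have den: "exp (- (C2 + 2) * T) \<le> a * b"
    proof -
      have "exp (- (C2 + 2) * T) = a * exp (- T)" by (simp add: a_def exp_add[symmetric] algebra_simps)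
      also have "\<dots> \<le> a * b" using b by (intro mult_left_mono) (auto simp: a_def)
      finally show ?thesis .
    qed
    have "(\<tau> + \<kappa>) / (a * b) \<le> ((tc + 2) * exp (- (C2 + 4) * T)) / exp (- (C2 + 2) * T)"
      using num den tc by (intro frac_le) auto
    also have "\<dots> = (tc + 2) * exp (- 2 * T)"
      by (simp add: divide_inverse exp_minus[symmetric] exp_add[symmetric] mult.assoc) (simp add: algebra_simps)
    also have "\<dots> \<le> (tc + 2) * exp (- T)" using T0 tc by (intro mult_left_mono) auto
    finally show ?thesis .
  qed
  have final: "a * exp (2 * Lip\<^sup>2 * \<epsilon>\<^sup>2 / c0 * n) + real (2 * (2 * R + 1) ^ 2 ^ ((L + 1) * d)) * (2 * \<kappa>) + (\<tau> + \<kappa>) / (a * b) \<le> (tc + 7) / n"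
    if R: "real R \<le> n ^ 5 + 2" for R :: nat
  proof -
    have "a * exp (2 * Lip\<^sup>2 * \<epsilon>\<^sup>2 / c0 * n) + real (2 * (2 * R + 1) ^ 2 ^ ((L + 1) * d)) * (2 * \<kappa>) + (\<tau> + \<kappa>) / (a * b)
      \<le> exp (- T) + 4 * exp (- T) + (tc + 2) * exp (- T)" using t1 t2[OF R] t3 by linarith
    also have "\<dots> = (tc + 7) * exp (- T)" by (simp add: algebra_simps)
    also have "\<dots> \<le> (tc + 7) * (1 / n)" using eT tc by (intro mult_left_mono) auto
    finally show ?thesis by simp
  qed
  have hn: "n / h + 1 \<le> n ^ 5 + 1" using n0 by (simp add: h_def eval_nat_numeral)
  have a0: "a > 0" by (simp add: a_def)
  show ?thesis
    unfolding \<epsilon>_def[symmetric]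
    by (intro exI[of _ l] exI[of _ L] exI[of _ \<delta>] exI[of _ h] exI[of _ a] conjI allI impI lL0 l1 \<epsilon>pos a0 approx \<delta> dl h net hn
        final[unfolded \<kappa>_def \<tau>_def b_def])
qed

lemma rate_eventually:
  "\<exists>n0. \<forall>n\<ge>n0. n \<ge> (3::real) \<and> ln n \<ge> 1 \<and> ln n \<ge> 2 * C \<and> ln n \<ge> 2 * 8 ^ d * C \<and> ln n \<ge> Kb \<and> ln n \<ge> C * Lip \<and> Ks * ln n \<ge> 1 \<and>
     rate n \<le> 1 / 2 \<and> Lip * rate n \<le> c0 / 2 \<and> 2 ^ L0 \<le> n powr \<alpha> \<and> 4 ^ d * Ks * ln n \<le> n \<and>
     n\<^sup>2 * (sqrt 2 * exp (- n\<^sup>2 / 4)) \<le> exp (- (C2 + 4) * n)"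
proof -
  have ln_big: "eventually (\<lambda>n. k \<le> ln n) at_top" for k :: real
    using ln_at_top by (simp add: filterlim_at_top)
  have ge3: "eventually (\<lambda>n. (3::real) \<le> n) at_top" by (rule eventually_ge_at_top)
  have ks: "eventually (\<lambda>n. 1 \<le> Ks * ln n) at_top"
    using ln_big[of "1 / Ks"] by eventually_elim (use const_facts(6) in \<open>simp add: field_simps\<close>)
  have "\<beta> / (2 * \<beta> + real d) > 0" using \<beta> by (intro divide_pos_pos) auto
  then have rate0: "(rate \<longlongrightarrow> 0) at_top"
    unfolding rate_def minus_divide_left[symmetric] by real_asymp
  have r1: "eventually (\<lambda>n. rate n < 1 / 2) at_top" by (rule order_tendstoD(2)[OF rate0]) simp
  have r2: "eventually (\<lambda>n. rate n < c0 / 2 / Lip) at_top"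
    by (rule order_tendstoD(2)[OF rate0]) (use pos in simp)
  have "filterlim (\<lambda>n. n powr \<alpha>) at_top at_top" using const_facts(1) by real_asymp
  then have p: "eventually (\<lambda>n. 2 ^ L0 \<le> n powr \<alpha>) at_top" by (simp add: filterlim_at_top)
  have lin: "eventually (\<lambda>n. k * ln n \<le> n) at_top" for k :: real
  proof -
    have "((\<lambda>n::real. k * (ln n / n)) \<longlongrightarrow> k * 0) at_top" by (intro tendsto_mult tendsto_const) real_asymp
    then have "eventually (\<lambda>n. k * (ln n / n) < 1) at_top" by (rule order_tendstoD(2)) simp
    then show ?thesis using ge3 by eventually_elim (simp add: field_simps)
  qed
  have gauss: "eventually (\<lambda>n. n\<^sup>2 * (sqrt 2 * exp (- n\<^sup>2 / 4)) \<le> exp (- k * n)) at_top" for k :: real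
  proof -
    have "((\<lambda>n::real. sqrt 2 * (n\<^sup>2 * exp (- n))) \<longlongrightarrow> sqrt 2 * 0) at_top"
      by (intro tendsto_mult tendsto_const) real_asymp
    then have "eventually (\<lambda>n. sqrt 2 * (n\<^sup>2 * exp (- n)) < 1) at_top" by (rule order_tendstoD(2)) simp
    moreover have "eventually (\<lambda>n. 4 * (k + 1) \<le> n) at_top" by (rule eventually_ge_at_top)
    ultimately show ?thesis using ge3
    proof eventually_elim
      case (elim n)
      have "4 * (k + 1) * n \<le> n * n" using elim by (intro mult_right_mono) auto
      then have "- n\<^sup>2 / 4 \<le> - n + (- k * n)" by (simp add: power2_eq_square algebra_simps)
      then have "exp (- n\<^sup>2 / 4) \<le> exp (- n) * exp (- k * n)" by (simp add: exp_add[symmetric])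
      then have "(sqrt 2 * n\<^sup>2) * exp (- n\<^sup>2 / 4) \<le> (sqrt 2 * n\<^sup>2) * (exp (- n) * exp (- k * n))"
        by (intro mult_left_mono) auto
      also have "\<dots> = (sqrt 2 * (n\<^sup>2 * exp (- n))) * exp (- k * n)" by simp
      also have "\<dots> \<le> 1 * exp (- k * n)" using elim by (intro mult_right_mono) auto
      finally show ?case by (simp add: mult_ac)
    qed
  qed
  have "eventually (\<lambda>n. n \<ge> (3::real) \<and> ln n \<ge> 1 \<and> ln n \<ge> 2 * C \<and> ln n \<ge> 2 * 8 ^ d * C \<and> ln n \<ge> Kb \<and> ln n \<ge> C * Lip \<and> Ks * ln n \<ge> 1 \<and>
     rate n \<le> 1 / 2 \<and> Lip * rate n \<le> c0 / 2 \<and> 2 ^ L0 \<le> n powr \<alpha> \<and> 4 ^ d * Ks * ln n \<le> n \<and>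
     n\<^sup>2 * (sqrt 2 * exp (- n\<^sup>2 / 4)) \<le> exp (- (C2 + 4) * n)) at_top"
    using ge3 ln_big[of 1] ln_big[of "2 * C"] ln_big[of "2 * 8 ^ d * C"] ln_big[of Kb] ln_big[of "C * Lip"] ks r1 r2 p
      lin[of "4 ^ d * Ks"] gauss[of "C2 + 4"]
    by eventually_elim (use pos in \<open>auto simp: field_simps\<close>)
  then show ?thesis by (simp add: eventually_at_top_linorder)
qed

end

section \<open>Averaging over the data\<close>

text \<open>\<open>K0\<close>, \<open>n0\<close> and \<open>B\<close> are fixed before the path, the
  window and the Poisson law, so that the bound can be integrated over the paths.\<close>

lemma (in wavelet_model) posterior_rate:
  fixes \<beta> :: real
  assumes \<beta>: "\<beta> > 0"
    and approx: "\<And>L. L \<ge> L0 \<Longrightarrow> \<exists>c. (\<forall>p. \<bar>c p\<bar> \<le> C) \<and>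
        (\<forall>y\<in>cbox 0 1. \<bar>w0 y - wavelet_series \<psi> (L, c) y\<bar> \<le> C * 2 powr (- \<beta> * real L))"
  obtains K0 n0 B where "K0 > 0" "B \<ge> 0"
    "\<And>K (z :: real^'D \<Rightarrow> real^'d) A Q. K \<ge> K0 \<Longrightarrow> wavelet_data \<psi> \<eta> w0 CL C Lip M0 z A Q \<Longrightarrow> n0 \<le> measure lborel A \<Longrightarrow>
      (\<integral>\<^sup>+N. ennreal (posterior (wavelet_prior \<eta> CL \<psi>) A N z
          {\<rho>. K * (measure lborel A powr (- \<beta> / (2 * \<beta> + real CARD('d))) * ln (measure lborel A)) * measure lborel A
              < (LINT x:A|lborel. \<bar>\<rho> (z x) - \<eta> (w0 (z x))\<bar>)}) \<partial>Q)
      \<le> ennreal (B / measure lborel A)"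
proof -
  let ?tc = "tail_const CARD('d) CL"
  have \<phi>: "std_normal_density (C + 1) > 0" by (rule normal_density_pos) simp
  interpret r: rate_setup \<beta> CL C Lip "\<eta> (- M0)" "\<eta> M0" "normalizer CARD('d) CL" ?tc "std_normal_density (C + 1)" "CARD('d)" L0
    by unfold_locales (use \<beta> CL C Lip \<eta>_pos normalizer_pos[OF CL] tail_const_nonneg[OF CL] \<phi> in \<open>simp_all add: Suc_le_eq\<close>)
  obtain n0 where n0: "\<forall>n\<ge>n0. n \<ge> (3::real) \<and> ln n \<ge> 1 \<and> ln n \<ge> 2 * C \<and> ln n \<ge> 2 * 8 ^ CARD('d) * C \<and> ln n \<ge> r.Kb \<and>
     ln n \<ge> C * Lip \<and> r.Ks * ln n \<ge> 1 \<and> r.rate n \<le> 1 / 2 \<and> Lip * r.rate n \<le> \<eta> (- M0) / 2 \<and> 2 ^ L0 \<le> n powr r.\<alpha> \<and>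
     4 ^ CARD('d) * r.Ks * ln n \<le> n \<and> n\<^sup>2 * (sqrt 2 * exp (- n\<^sup>2 / 4)) \<le> exp (- (r.C2 + 4) * n)"
    using r.rate_eventually by (elim exE) (rule that)
  show thesis
  proof (rule that[of r.K0 "?tc + 7" n0])
    show "r.K0 > 0" using r.const_facts(8) by linarith
    show "?tc + 7 \<ge> 0" using tail_const_nonneg[OF CL, of "CARD('d)"] by linarith
    fix K A Q and z :: "real^'D \<Rightarrow> real^'d"
    assume K: "K \<ge> r.K0" and data: "wavelet_data \<psi> \<eta> w0 CL C Lip M0 z A Q" and nA: "n0 \<le> measure lborel A"
    interpret wavelet_data \<psi> \<eta> w0 CL C Lip M0 z A Q by (rule data)
    define n where "n = measure lborel A"
    note nn = n0[rule_format, OF nA, folded n_def]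
    have n3: "n \<ge> 3" using nn by (elim conjE)
    have sm: "r.rate n \<le> 1 / 2" using nn by (elim conjE)
    have sm2: "Lip * r.rate n \<le> \<eta> (- M0) / 2" using nn by (elim conjE)
    have K2: "K \<ge> 2" using K r.const_facts(8) by linarith
    \<comment> \<open>An integer between \<open>n ^ 5 + 1\<close>, demanded by the net, and
      \<open>n ^ 5 + 2\<close>, allowed by the bound on its size.\<close>
    define R where "R = nat \<lceil>n ^ 5 + 1\<rceil>"
    have n5: "n ^ 5 + 1 \<ge> 0" using n3 by simp
    have R1: "n ^ 5 + 1 \<le> real R" unfolding R_def by (rule real_nat_ceiling_ge)
    have R2: "real R \<le> n ^ 5 + 2" unfolding R_def using n5 by linarith
    have "(\<integral>\<^sup>+N. ennreal (post (far_set (K * r.rate n * n)) N) \<partial>Q) \<le> ennreal ((?tc + 7) / n)"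
      using r.rate_at[of n K] nn K
    proof (elim conjE impE exE meta_impE)
      fix l L :: nat and \<delta> h a :: real
      assume l: "l \<ge> L0" "l \<ge> 1" and pos: "0 < r.rate n" "a > 0"
        and ap: "C * 2 powr (- \<beta> * real l) \<le> r.rate n / 2"
        and \<delta>: "0 < \<delta>" "\<delta> \<le> 1" "real (2 ^ ((l + 1) * CARD('d))) * (\<delta> * (C * sqrt (2 ^ (l * CARD('d))))) \<le> r.rate n / 2"
        and h: "h > 0" "Lip * (real (2 ^ ((L + 1) * CARD('d))) * (h * (C * sqrt (2 ^ (L * CARD('d)))))) \<le> r.rate n" "n / h + 1 \<le> n ^ 5 + 1"
        and fin: "\<forall>R :: nat. real R \<le> n ^ 5 + 2 \<longrightarrow>
       a * exp (2 * Lip\<^sup>2 * (r.rate n)\<^sup>2 / \<eta> (- M0) * n) +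
       real (2 * (2 * R + 1) ^ 2 ^ ((L + 1) * CARD('d))) * (2 * exp (- r.rate n * ((K - 2) * r.rate n * n / 8) + (r.rate n)\<^sup>2 * (\<eta> M0 * n))) +
       ((?tc * exp (- CL * 2 ^ (L * CARD('d)) * real L) + real (2 ^ ((L + 1) * CARD('d))) * (sqrt 2 * exp (- n\<^sup>2 / 4))) +
         exp (- r.rate n * ((K - 2) * r.rate n * n / 8) + (r.rate n)\<^sup>2 * (\<eta> M0 * n))) /
        (a * (exp (- CL * 2 ^ (l * CARD('d)) * real l) / normalizer CARD('d) CL * (std_normal_density (C + 1) * \<delta>) ^ 2 ^ ((l + 1) * CARD('d))))
       \<le> (?tc + 7) / n"
      obtain c where c: "\<forall>p. \<bar>c p\<bar> \<le> C"
        "\<forall>y\<in>cbox 0 1. \<bar>w0 y - wavelet_series \<psi> (l, c) y\<bar> \<le> C * 2 powr (- \<beta> * real l)"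
        using approx[OF l(1)] by (elim exE conjE) (rule that)
      have lw: "level_weight CARD('d) CL l = exp (- CL * 2 ^ (l * CARD('d)) * real l)" using l(2) by (simp add: level_weight_def)
      have "n \<ge> 0" using n3 by simp
      have c': "\<bar>w0 y - ws (l, c) y\<bar> \<le> r.rate n / 2" if "y \<in> cbox 0 1" for y
        using c(2)[rule_format, OF that] ap by linarith
      \<comment> \<open>The coefficient bound of the sieve is \<open>G = n\<close>: the tails
        \<open>exp (- n\<^sup>2 / 4)\<close> are then negligible, and the net stays polynomial in
        \<open>n\<close> per coefficient.\<close>
      note bound = posterior_expectation_bound[where \<epsilon>="r.rate n" and K=K and a=a and l=l and c=c and \<delta>=\<delta>
          and h=h and L=L and G=n and R=R, folded n_def]
      show ?thesis
      proof (rule order_trans[OF bound ennreal_leI[OF fin[rule_format, OF R2, folded lw]]])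
        show "\<bar>c p\<bar> \<le> C" for p using c(1) by (rule spec)
        show "\<bar>w0 y - ws (l, c) y\<bar> \<le> r.rate n / 2" if "y \<in> cbox 0 1" for y by (rule c'[OF that])
        show "n / h + 1 \<le> real R" using h(3) R1 by linarith
      qed (fact pos sm sm2 K2 l \<delta> h \<open>n \<ge> 0\<close>)+
    qed
    then show "(\<integral>\<^sup>+N. ennreal (posterior (wavelet_prior \<eta> CL \<psi>) A N z
          {\<rho>. K * (measure lborel A powr (- \<beta> / (2 * \<beta> + real CARD('d))) * ln (measure lborel A)) * measure lborel A
              < (LINT x:A|lborel. \<bar>\<rho> (z x) - \<eta> (w0 (z x))\<bar>)}) \<partial>Q)
      \<le> ennreal ((?tc + 7) / measure lborel A)"
      unfolding posterior_eq_post r.rate_def n_def .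
  qed
qed

text \<open>The data law is integrated path by path. Measurability of \<open>f\<close> comes with
  integrability; without integrability the integral is 0 by convention, and the bound holds because
  \<open>B >= 0\<close>.\<close>

lemma bind_pair_integral_le:
  fixes f :: "'a \<times> 'w \<Rightarrow> real"
  assumes M: "prob_space M" and K: "K \<in> measurable M (prob_algebra N)"
    and f: "\<And>x. f x \<ge> 0" and B: "B \<ge> 0" and le: "\<And>\<omega>. \<omega> \<in> space M \<Longrightarrow> (\<integral>\<^sup>+y. ennreal (f (y, \<omega>)) \<partial>K \<omega>) \<le> ennreal B"
  shows "(LINT x|bind M (\<lambda>\<omega>. distr (K \<omega>) (N \<Otimes>\<^sub>M M) (\<lambda>y. (y, \<omega>))). f x) \<le> B"
proof (cases "integrable (bind M (\<lambda>\<omega>. distr (K \<omega>) (N \<Otimes>\<^sub>M M) (\<lambda>y. (y, \<omega>)))) f")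
  case True
  let ?k = "\<lambda>\<omega>. distr (K \<omega>) (N \<Otimes>\<^sub>M M) (\<lambda>y. (y, \<omega>))"
  interpret M: prob_space M by (rule M)
  have k: "?k \<in> measurable M (subprob_algebra (N \<Otimes>\<^sub>M M))"
    by (rule measurable_distr2[where M=N]) (use measurable_prob_algebraD[OF K] in measurable)
  have sets: "sets (bind M ?k) = sets (N \<Otimes>\<^sub>M M)" by (rule sets_bind) (simp_all add: M.not_empty)
  have fm: "f \<in> borel_measurable (N \<Otimes>\<^sub>M M)"
    using borel_measurable_integrable[OF True] unfolding measurable_cong_sets[OF sets refl] .
  have "ennreal (LINT x|bind M ?k. f x) = (\<integral>\<^sup>+x. ennreal (f x) \<partial>bind M ?k)"
    by (rule nn_integral_eq_integral[symmetric, OF True]) (simp add: f)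
  also have "\<dots> = (\<integral>\<^sup>+\<omega>. \<integral>\<^sup>+x. ennreal (f x) \<partial>?k \<omega> \<partial>M)"
    by (rule nn_integral_bind[OF _ k]) (use fm in measurable)
  also have "\<dots> \<le> (\<integral>\<^sup>+\<omega>. ennreal B \<partial>M)"
  proof (rule nn_integral_mono)
    fix \<omega> assume \<omega>: "\<omega> \<in> space M"
    have sK: "sets (K \<omega>) = sets N" using measurable_space[OF K \<omega>] by (simp add: space_prob_algebra)
    have "(\<lambda>y. (y, \<omega>)) \<in> measurable (K \<omega>) (N \<Otimes>\<^sub>M M)"
      unfolding measurable_cong_sets[OF sK refl] by (rule measurable_Pair2'[OF \<omega>])
    then have "(\<integral>\<^sup>+x. ennreal (f x) \<partial>?k \<omega>) = (\<integral>\<^sup>+y. ennreal (f (y, \<omega>)) \<partial>K \<omega>)"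
      by (rule nn_integral_distr) (use fm in measurable)
    then show "(\<integral>\<^sup>+x. ennreal (f x) \<partial>?k \<omega>) \<le> ennreal B" using le[OF \<omega>] by simp
  qed
  also have "\<dots> = ennreal B" by (simp add: M.emeasure_space_1)
  finally show ?thesis using B by (simp add: ennreal_le_iff)
qed (simp add: not_integrable_integral_eq B)

lemma posterior_nonneg: "posterior Q A N z E \<ge> 0"
  unfolding posterior_def set_lebesgue_integral_def likelihood_def
  by (intro divide_nonneg_nonneg Bochner_Integration.integral_nonneg scaleR_nonneg_nonneg) auto

theorem proposition3p7:
  fixes \<beta> :: real
  assumes "\<beta> > 0"
  shows "\<exists>S\<^sub>0 :: nat. \<forall>S\<ge>S\<^sub>0.
    \<forall>(\<psi> :: nat \<Rightarrow> nat \<Rightarrow> real^'d \<Rightarrow> real) (\<eta> :: real \<Rightarrow> real) (w\<^sub>0 :: real^'d \<Rightarrow> real) (C\<^sub>L :: real)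
     (M :: 'w measure) (Z :: 'w \<Rightarrow> real^'D \<Rightarrow> real^'d) (\<nu> :: (real^'d) measure)
     (W :: nat \<Rightarrow> (real^'D) set) (P :: nat \<Rightarrow> ((real^'D) multiset \<times> 'w) measure).
      daubechies_tensor_basis S \<psi> \<longrightarrow>
      link_function \<eta> \<longrightarrow>
      w\<^sub>0 \<in> holder_space \<beta> \<longrightarrow>
      C\<^sub>L > 0 \<longrightarrow>
      stationary_field M Z \<nu> \<longrightarrow>
      observation_windows W \<longrightarrow>
      (\<forall>n\<ge>1. data_law M Z (W n) (\<eta> \<circ> w\<^sub>0) (P n)) \<longrightarrow>
      (let prior = wavelet_prior \<eta> C\<^sub>L \<psi>;
           \<epsilon> = (\<lambda>n. real n powr (- \<beta> / (2 * \<beta> + real CARD('d))) * ln (real n))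
       in \<exists>K\<^sub>0>0. \<forall>K\<ge>K\<^sub>0.
         (\<lambda>n. LINT (N, \<omega>)|P n.
            posterior prior (W n) N (Z \<omega>)
              {\<rho>. (1 / real n) * (LINT x:W n|lborel.
                     \<bar>intensity \<rho> (Z \<omega>) x - intensity (\<eta> \<circ> w\<^sub>0) (Z \<omega>) x\<bar>) > K * \<epsilon> n})
         \<longlonglongrightarrow> 0)"
\<comment> \<open>Regularity above the integer part of \<beta> makes the number of vanishing moments
  exceed the degree of the Taylor polynomials.\<close>
proof (rule exI[of _ "nat \<lfloor>\<beta>\<rfloor> + 1"], intro allI impI)
  fix S and \<psi> :: "nat \<Rightarrow> nat \<Rightarrow> real^'d \<Rightarrow> real" and \<eta> :: "real \<Rightarrow> real" and w0 :: "real^'d \<Rightarrow> real" and CL :: real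
    and M :: "'w measure" and Z :: "'w \<Rightarrow> real^'D \<Rightarrow> real^'d" and \<nu> :: "(real^'d) measure"
    and W :: "nat \<Rightarrow> (real^'D) set" and P :: "nat \<Rightarrow> ((real^'D) multiset \<times> 'w) measure"
  assume S: "nat \<lfloor>\<beta>\<rfloor> + 1 \<le> S" and basis: "daubechies_tensor_basis S \<psi>" and link: "link_function \<eta>"
    and w0: "w0 \<in> holder_space \<beta>" and CL: "CL > 0" and field: "stationary_field M Z \<nu>"
    and windows: "observation_windows W" and law: "\<forall>n\<ge>1. data_law M Z (W n) (\<eta> \<circ> w0) (P n)"
  obtain C L0 where wa: "C > 0"
    "\<And>l k. (l, k) \<in> level_index CARD('d) \<Longrightarrow> continuous_on (cbox 0 1) (\<psi> l k)"
    "\<And>l k z. (l, k) \<in> level_index CARD('d) \<Longrightarrow> z \<in> cbox 0 1 \<Longrightarrow> \<bar>\<psi> l k z\<bar> \<le> C * sqrt (2 ^ (l * CARD('d)))"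
    "\<And>L. L \<ge> L0 \<Longrightarrow> \<exists>c. (\<forall>p. \<bar>c p\<bar> \<le> C) \<and>
        (\<forall>z\<in>cbox 0 1. \<bar>w0 z - wavelet_series \<psi> (L, c) z\<bar> \<le> C * 2 powr (- \<beta> * real L))"
    by (rule wavelet_approximation[OF basis w0 assms S]) (rule that)
  have w0c: "continuous_on (cbox 0 1) w0"
    using w0 unfolding holder_space_def mem_Collect_eq by (rule holder_smooth_continuous)
  have "bounded (w0 ` cbox 0 1)" by (intro compact_imp_bounded compact_continuous_image w0c compact_cbox)
  then obtain M0 where "\<forall>x\<in>w0 ` cbox 0 1. norm x \<le> M0" unfolding bounded_iff by (elim exE) (rule that)
  then have M0: "\<bar>w0 z\<bar> \<le> M0" if "z \<in> cbox 0 1" for z using that by simp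
  have mono: "strict_mono \<eta>" using link unfolding link_function_def by (elim conjE)
  have bij: "bij_betw \<eta> UNIV {0<..}" using link unfolding link_function_def by (elim conjE)
  have \<eta>_pos: "\<eta> x > 0" for x using bij_betwE[OF bij] by simp
  obtain B where B: "B-lipschitz_on UNIV \<eta>" using link unfolding link_function_def by (elim conjE exE) (rule that)
  \<comment> \<open>The maximum makes the constant positive, since the threshold for
    \<open>n\<close> divides by it.\<close>
  define Lip where "Lip = max B 1"
  have Lip: "Lip > 0" by (simp add: Lip_def)
  have lip: "\<bar>\<eta> x - \<eta> y\<bar> \<le> Lip * \<bar>x - y\<bar>" for x y
  proof -
    have "\<bar>\<eta> x - \<eta> y\<bar> \<le> B * \<bar>x - y\<bar>" using lipschitz_onD[OF B, of x y] by (simp add: dist_real_def)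
    also have "\<dots> \<le> Lip * \<bar>x - y\<bar>" by (intro mult_right_mono) (auto simp: Lip_def)
    finally show ?thesis .
  qed
  interpret wavelet_model \<psi> \<eta> w0 CL C Lip M0
  proof
    show "continuous_on (cbox 0 1) (\<psi> (fst p) (snd p))" if "p \<in> level_index CARD('d)" for p
      using that by (intro wa(2)) simp
    show "\<bar>\<psi> (fst p) (snd p) y\<bar> \<le> C * sqrt (2 ^ (fst p * CARD('d)))" if "p \<in> level_index CARD('d)" "y \<in> cbox 0 1" for p y
      using that by (intro wa(3)) simp_all
  qed (fact CL wa(1) Lip mono \<eta>_pos lip w0c M0)+
  define \<epsilon> where "\<epsilon> n = n powr (- \<beta> / (2 * \<beta> + real CARD('d))) * ln n" for n
  obtain K0 n0 B' where K0: "K0 > 0" "B' \<ge> 0" and bound: "\<And>K (z :: real^'D \<Rightarrow> real^'d) A Q. K \<ge> K0 \<Longrightarrow>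
      wavelet_data \<psi> \<eta> w0 CL C Lip M0 z A Q \<Longrightarrow> n0 \<le> measure lborel A \<Longrightarrow>
      (\<integral>\<^sup>+N. ennreal (posterior (wavelet_prior \<eta> CL \<psi>) A N z
          {\<rho>. K * \<epsilon> (measure lborel A) * measure lborel A < (LINT x:A|lborel. \<bar>\<rho> (z x) - \<eta> (w0 (z x))\<bar>)}) \<partial>Q)
      \<le> ennreal (B' / measure lborel A)"
  proof (rule posterior_rate[where ?'D='D and ?L0.0=L0, OF assms])
    show "\<exists>c. (\<forall>p. \<bar>c p\<bar> \<le> C) \<and>
        (\<forall>z\<in>cbox 0 1. \<bar>w0 z - wavelet_series \<psi> (L, c) z\<bar> \<le> C * 2 powr (- \<beta> * real L))" if "L \<ge> L0" for L
      by (rule wa(4)[OF that])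
  next
    fix K0 n0 B
    assume pos: "K0 > 0" "B \<ge> 0" and le: "\<And>K (z :: real^'D \<Rightarrow> real^'d) A Q. K \<ge> K0 \<Longrightarrow>
      wavelet_data \<psi> \<eta> w0 CL C Lip M0 z A Q \<Longrightarrow> n0 \<le> measure lborel A \<Longrightarrow>
      (\<integral>\<^sup>+N. ennreal (posterior (wavelet_prior \<eta> CL \<psi>) A N z
          {\<rho>. K * (measure lborel A powr (- \<beta> / (2 * \<beta> + real CARD('d))) * ln (measure lborel A)) * measure lborel A
              < (LINT x:A|lborel. \<bar>\<rho> (z x) - \<eta> (w0 (z x))\<bar>)}) \<partial>Q)
      \<le> ennreal (B / measure lborel A)"
    show ?thesis by (rule that[OF pos le[folded \<epsilon>_def]])
  qed
  have prob: "prob_space M" using field unfolding stationary_field_def by (elim conjE)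
  have Z: "(\<lambda>(\<omega>, x). Z \<omega> x) \<in> borel_measurable (M \<Otimes>\<^sub>M borel)"
    using field unfolding stationary_field_def by (elim conjE)
  have Z_cube: "\<forall>\<omega>\<in>space M. \<forall>x. Z \<omega> x \<in> cbox 0 1"
    using field unfolding stationary_field_def by (elim conjE)
  show "let prior = wavelet_prior \<eta> CL \<psi>;
           \<epsilon> = (\<lambda>n. real n powr (- \<beta> / (2 * \<beta> + real CARD('d))) * ln (real n))
       in \<exists>K\<^sub>0>0. \<forall>K\<ge>K\<^sub>0.
         (\<lambda>n. LINT (N, \<omega>)|P n.
            posterior prior (W n) N (Z \<omega>)
              {\<rho>. (1 / real n) * (LINT x:W n|lborel.
                     \<bar>intensity \<rho> (Z \<omega>) x - intensity (\<eta> \<circ> w0) (Z \<omega>) x\<bar>) > K * \<epsilon> n})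
         \<longlonglongrightarrow> 0"
    unfolding Let_def \<epsilon>_def[symmetric]
  proof (rule exI[of _ K0], intro conjI allI impI K0)
    fix K assume K: "K \<ge> K0"
    define E where "E n \<omega> = {\<rho>. (1 / real n) * (LINT x:W n|lborel.
                     \<bar>intensity \<rho> (Z \<omega>) x - intensity (\<eta> \<circ> w0) (Z \<omega>) x\<bar>) > K * \<epsilon> (real n)}" for n \<omega>
    define f where "f n = (\<lambda>(N, \<omega>). posterior (wavelet_prior \<eta> CL \<psi>) (W n) N (Z \<omega>) (E n \<omega>))" for n
    have f0: "f n x \<ge> 0" for n x by (simp add: f_def posterior_nonneg split: prod.split)
    have le: "(LINT x|P n. f n x) \<le> B' / real n" if n: "n \<ge> 1" "real n \<ge> n0" for n
    proof -
      from law n(1) obtain Q where Q: "Q \<in> measurable M (prob_algebra point_configs)"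
        "\<forall>\<omega>\<in>space M. poisson_process (W n) (intensity (\<eta> \<circ> w0) (Z \<omega>)) (Q \<omega>)"
        "P n = bind M (\<lambda>\<omega>. distr (Q \<omega>) (point_configs \<Otimes>\<^sub>M M) (\<lambda>N. (N, \<omega>)))"
        unfolding data_law_def by (elim allE[of _ n] impE bexE conjE) (assumption | rule that)+
      have Wn: "compact (W n)" "measure lborel (W n) = real n"
        using windows n(1) unfolding observation_windows_def by auto
      show ?thesis
        unfolding Q(3)
      proof (rule bind_pair_integral_le[OF prob Q(1) f0])
        show "0 \<le> B' / real n" using K0(2) by simp
        fix \<omega> assume \<omega>: "\<omega> \<in> space M"
        have "wavelet_data \<psi> \<eta> w0 CL C Lip M0 (Z \<omega>) (W n) (Q \<omega>)"
        proof (intro wavelet_data.intro wavelet_data_axioms.intro)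
          show "wavelet_model \<psi> \<eta> w0 CL C Lip M0" by unfold_locales
          show "Z \<omega> \<in> borel_measurable borel" using measurable_Pair2[OF Z \<omega>] by simp
          show "Z \<omega> x \<in> cbox 0 1" for x using Z_cube \<omega> by simp
          show "W n \<in> sets borel" using Wn(1) by (rule borel_compact)
          show "emeasure lborel (W n) < \<infinity>" using compact_imp_bounded[OF Wn(1)] by (rule emeasure_bounded_finite)
          have "intensity (\<eta> \<circ> w0) (Z \<omega>) = (\<lambda>x. \<eta> (w0 (Z \<omega> x)))" by (simp add: fun_eq_iff intensity_def)
          from Q(2)[rule_format, OF \<omega>, unfolded this]
          show "poisson_process (W n) (\<lambda>x. \<eta> (w0 (Z \<omega> x))) (Q \<omega>)" .
        qed
        from bound[OF K this, unfolded Wn(2), OF n(2)]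
        have "(\<integral>\<^sup>+N. ennreal (posterior (wavelet_prior \<eta> CL \<psi>) (W n) N (Z \<omega>)
            {\<rho>. K * \<epsilon> (real n) * real n < (LINT x:W n|lborel. \<bar>\<rho> (Z \<omega> x) - \<eta> (w0 (Z \<omega> x))\<bar>)}) \<partial>Q \<omega>) \<le> ennreal (B' / real n)" .
        \<comment> \<open>Multiplication by \<open>n\<close>, the volume of the window, turns the
          averaged distance into the plain one.\<close>
        moreover have "{\<rho>. K * \<epsilon> (real n) * real n < (LINT x:W n|lborel. \<bar>\<rho> (Z \<omega> x) - \<eta> (w0 (Z \<omega> x))\<bar>)} = E n \<omega>"
          using n(1) unfolding E_def intensity_def o_def by (intro Collect_cong) (simp add: field_simps)
        ultimately show "(\<integral>\<^sup>+N. ennreal (f n (N, \<omega>)) \<partial>Q \<omega>) \<le> ennreal (B' / real n)" unfolding f_def by simp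
      qed
    qed
    have "(\<lambda>n. LINT x|P n. f n x) \<longlonglongrightarrow> 0"
    proof (rule tendsto_sandwich)
      show "eventually (\<lambda>n. 0 \<le> (LINT x|P n. f n x)) sequentially"
        by (intro always_eventually allI Bochner_Integration.integral_nonneg f0)
      have "eventually (\<lambda>n. n0 \<le> real n) sequentially"
        using filterlim_real_sequentially by (simp add: filterlim_at_top)
      then show "eventually (\<lambda>n. (LINT x|P n. f n x) \<le> B' / real n) sequentially"
        using eventually_ge_at_top[of 1] by eventually_elim (rule le)
      show "(\<lambda>n. B' / real n) \<longlonglongrightarrow> 0" by (rule lim_const_over_n)
    qed simp
    then show "(\<lambda>n. LINT (N, \<omega>)|P n. posterior (wavelet_prior \<eta> CL \<psi>) (W n) N (Z \<omega>)
              {\<rho>. (1 / real n) * (LINT x:W n|lborel.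
                     \<bar>intensity \<rho> (Z \<omega>) x - intensity (\<eta> \<circ> w0) (Z \<omega>) x\<bar>) > K * \<epsilon> (real n)})
         \<longlonglongrightarrow> 0" unfolding f_def E_def .
  qed
qed

end
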